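(* Let $n\ge 2$ and let $\mathfrak{q}=\mathfrak{q}(n)$ be the queer Lie superalgebra. Suppose $A$ is a finitely generated commutative unital associative $\mathbb{C}$-algebra and $\Gamma$ is a finite abelian group acting on $A$ and on $\mathfrak{q}$ by automorphisms. Suppose furthermore that the induced action of $\Gamma$ on $\operatorname{MaxSpec}(A)$ is free. Then the map $$\mathcal{E}(\mathfrak{q},A)^\Gamma\to\mathcal{R}(\mathfrak{q},A)^\Gamma,\qquad \Psi\mapsto\widehat{\operatorname{ev}}{}^\Gamma_\Psi,$$ is a bijection, where $\mathcal{R}(\mathfrak{q},A)^\Gamma$ is the set of isomorphism classes of irreducible finite-dimensional representations of $(\mathfrak{q}\otimes A)^\Gamma$.
   Context: Everything is over $\mathbb{C}$. Modules (representations) of a Lie superalgebra are $\mathbb{Z}_2$-graded, submodules are graded, and irreducible means nonzero with no proper nonzero graded submodule. A homomorphism of modules is a linear map $f$ with $f(xm)=xf(m)$ for all $x,m$; homomorphisms and isomorphisms are not required to be homogeneous. Queer Lie superalgebra: let $\hat{\mathfrak{q}}(n)$ be the Lie superalgebra of block matrices $\begin{pmatrix}a&b\\ b&a\end{pmatrix}$ with $a,b$ complex $(n+1)\times(n+1)$ matrices; the even part is given by $b=0$, the odd part by $a=0$, and the bracket on homogeneous elements is $[x,y]=xy-(-1)^{|x||y|}yx$. Its derived subalgebra $\tilde{\mathfrak{q}}(n)$ consists of those matrices with $\operatorname{tr} b=0$, and $\mathfrak{q}(n)=\tilde{\mathfrak{q}}(n)/\mathbb{C}I_{2n+2}$. The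 Lie superalgebra $\mathfrak{q}\otimes A$ has grading $(\mathfrak{q}\otimes A)_j=\mathfrak{q}_j\otimes A$ and bracket $[x_1\otimes f_1,x_2\otimes f_2]=[x_1,x_2]\otimes f_1f_2$. The group $\Gamma$ acts diagonally on $\mathfrak{q}\otimes A$, and $(\mathfrak{q}\otimes A)^\Gamma$ is the subalgebra of fixed points. $\operatorname{MaxSpec}(A)$ is the set of maximal ideals of $A$. Irreducible product: for Lie superalgebras $\mathfrak{g}^1,\mathfrak{g}^2$ and irreducible finite-dimensional $\mathfrak{g}^i$-modules $V^i$, let $\operatorname{End}_{\mathfrak{g}^i}(V^i)_{\bar 1}$ be the space of odd linear endomorphisms of $V^i$ that supercommute with the action of $\mathfrak{g}^i$; it is either $0$ or $\mathbb{C}\varphi_i$ with $\varphi_i^2=-\operatorname{id}$. The $\mathfrak{g}^1\oplus\mathfrak{g}^2$-module $V^1\otimes V^2$ (with the usual sign rule) is irreducible unless both of these spaces are nonzero, in which case $V^1\otimes V^2\cong\widehat V\oplus\widehat V$, where $\widehat V=\{v\in V^1\otimes V^2: (\sqrt{-1}\,\varphi_1\otimes\varphi_2)v=v\}$ is an irreducible submodule. Define $V^1\widehat\otimes V^2$ to be $V^1\otimes V^2$ if this is irreducible and $\widehat V$ otherwise, and inductively $V^1\widehat\otimes\cdots\widehat\otimes V^k=(V^1\widehat\otimes\cdots\widehat\otimes V^{k-1})\widehat\otimes V^k$, a $\mathfrak{g}^1\oplus\cdots\oplus\mathfrak{g}^k$-module; similarly write $\rho_1\widehat\otimes\cdots\widehat\otimes\rho_k$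 for the corresponding representations. Evaluation: for pairwise distinct maximal ideals $\mathsf{m}_1,\dots,\mathsf{m}_k$ of $A$, let $\operatorname{ev}_{\mathsf{m}_1,\dots,\mathsf{m}_k}:\mathfrak{q}\otimes A\to\bigoplus_{i=1}^k(\mathfrak{q}\otimes A/\mathsf{m}_i)$ be the canonical map; here $A/\mathsf{m}_i\cong\mathbb{C}$, so $\mathfrak{q}\otimes A/\mathsf{m}_i\cong\mathfrak{q}$. For irreducible finite-dimensional representations $\rho_i$ of $\mathfrak{q}\otimes A/\mathsf{m}_i$, let $\widehat{\operatorname{ev}}_{\mathsf{m}_1,\dots,\mathsf{m}_k}(\rho_1,\dots,\rho_k)=(\rho_1\widehat\otimes\cdots\widehat\otimes\rho_k)\circ\operatorname{ev}_{\mathsf{m}_1,\dots,\mathsf{m}_k}$, and let $\widehat{\operatorname{ev}}{}^\Gamma_{\mathsf{m}_1,\dots,\mathsf{m}_k}(\rho_1,\dots,\rho_k)$ be its restriction to $(\mathfrak{q}\otimes A)^\Gamma$. Up to isomorphism these depend only on the isomorphism classes of the $\rho_i$. Let $\mathcal{R}(\mathfrak{q})$ be the set of isomorphism classes of irreducible finite-dimensional representations of $\mathfrak{q}$, with $\Gamma$-action $\gamma[\rho]=[\rho\circ\gamma^{-1}]$, and let $0\in\mathcal{R}(\mathfrak{q})$ denote the class of the trivial one-dimensional representation. $\mathcal{E}(\mathfrak{q},A)$ is the set of functions $\Psi:\operatorname{MaxSpec}(A)\to\mathcal{R}(\mathfrak{q})$ with finite support $\operatorname{Supp}(\Psi)=\{\mathsf{m}:\Psi(\mathsf{m})\ne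 0\}$, and $\mathcal{E}(\mathfrak{q},A)^\Gamma$ is the subset of $\Gamma$-equivariant functions. For $\Psi\in\mathcal{E}(\mathfrak{q},A)^\Gamma$, choose $\{\mathsf{m}_1,\dots,\mathsf{m}_k\}$ containing exactly one element from each $\Gamma$-orbit in $\operatorname{Supp}(\Psi)$ and let $\widehat{\operatorname{ev}}{}^\Gamma_\Psi$ be the isomorphism class of $\widehat{\operatorname{ev}}{}^\Gamma_{\mathsf{m}_1,\dots,\mathsf{m}_k}(\Psi(\mathsf{m}_1),\dots,\Psi(\mathsf{m}_k))$ (this is independent of the choice); if $\Psi=0$, $\widehat{\operatorname{ev}}{}^\Gamma_\Psi$ is the class of the trivial one-dimensional representation of $(\mathfrak{q}\otimes A)^\Gamma$. *)

theory Defs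
  imports
    "HOL-Analysis.Determinants"
    "HOL-Algebra.Ideal"
    "HOL-Library.Function_Algebras"
    "HOL-Library.FuncSet"
    "HOL-Library.Poly_Mapping"
    "HOL-Library.Z2"
begin

section \<open>Complex vector spaces and algebras\<close>

class scaleC =
  fixes scaleC :: "complex \<Rightarrow> 'a \<Rightarrow> 'a"  (infixr \<open>*\<^sub>C\<close> 75)

class complex_vector = scaleC + ab_group_add +
  assumes scaleC_add_right: "a *\<^sub>C (x + y) = a *\<^sub>C x + a *\<^sub>C y"
    and scaleC_add_left: "(a + b) *\<^sub>C x = a *\<^sub>C x + b *\<^sub>C x"
    and scaleC_scaleC: "a *\<^sub>C b *\<^sub>C x = (a * b) *\<^sub>C x"
    and scaleC_one: "1 *\<^sub>C x = x"

global_interpretation complex_vector: vector_space "scaleC :: complex \<Rightarrow> 'a \<Rightarrow> 'a::complex_vector"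
  defines csubspace = complex_vector.subspace
    and cspan = complex_vector.span
  by unfold_locales (simp_all add: scaleC_add_right scaleC_add_left scaleC_scaleC scaleC_one)

global_interpretation complex_vector: vector_space_pair
  "scaleC :: complex \<Rightarrow> 'a \<Rightarrow> 'a::complex_vector" "scaleC :: complex \<Rightarrow> 'b \<Rightarrow> 'b::complex_vector"
  by unfold_locales

abbreviation clinear :: "('a::complex_vector \<Rightarrow> 'b::complex_vector) \<Rightarrow> bool"
  where "clinear \<equiv> Vector_Spaces.linear scaleC scaleC"

definition linear_on :: "'a::complex_vector set \<Rightarrow> ('a \<Rightarrow> 'b::complex_vector) \<Rightarrow> bool" where
  "linear_on V f \<longleftrightarrow>
     (\<forall>x\<in>V. \<forall>y\<in>V. f (x + y) = f x + f y) \<and> (\<forall>c. \<forall>x\<in>V. f (c *\<^sub>C x) = c *\<^sub>C f x)"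

definition bilinear_on ::
  "'a::complex_vector set \<Rightarrow> 'b::complex_vector set \<Rightarrow> ('a \<Rightarrow> 'b \<Rightarrow> 'c::complex_vector) \<Rightarrow> bool" where
  "bilinear_on V W B \<longleftrightarrow> (\<forall>w\<in>W. linear_on V (\<lambda>v. B v w)) \<and> (\<forall>v\<in>V. linear_on W (B v))"

definition finite_dimensional :: "'a::complex_vector set \<Rightarrow> bool" where
  "finite_dimensional V \<longleftrightarrow> (\<exists>B. finite B \<and> V \<subseteq> cspan B)"

lemma linear_on_UNIV: "linear_on UNIV f \<longleftrightarrow> clinear f"
  unfolding linear_on_def Vector_Spaces.linear_iff
  by (auto intro: complex_vector.vector_space_axioms)

text \<open>The sort of \<^typ>\<open>'a\<close> includes \<^class>\<open>comm_monoid_mult\<close> rather than \<^class>\<open>comm_ring_1\<close>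
  because the latter assumes \<open>0 \<noteq> 1\<close>; the zero algebra is allowed.\<close>

class comm_unital_complex_algebra = complex_vector + comm_ring + comm_monoid_mult +
  assumes scaleC_mult_left: "(c *\<^sub>C x) * y = c *\<^sub>C (x * y)"

definition csubalgebra :: "'a::comm_unital_complex_algebra set \<Rightarrow> bool" where
  "csubalgebra B \<longleftrightarrow> csubspace B \<and> 1 \<in> B \<and> (\<forall>x\<in>B. \<forall>y\<in>B. x * y \<in> B)"

definition finitely_generated_algebra :: "'a::comm_unital_complex_algebra itself \<Rightarrow> bool" where
  "finitely_generated_algebra _ \<longleftrightarrow>
     (\<exists>S::'a set. finite S \<and> (\<forall>B. csubalgebra B \<and> S \<subseteq> B \<longrightarrow> B = UNIV))"

definition algebra_automorphism :: "('a::comm_unital_complex_algebra \<Rightarrow> 'a) \<Rightarrow> bool" where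
  "algebra_automorphism f \<longleftrightarrow>
     clinear f \<and> bij f \<and> (\<forall>x y. f (x * y) = f x * f y) \<and> f 1 = 1"

definition ring_of_algebra :: "'a::comm_unital_complex_algebra ring" where
  "ring_of_algebra =
     \<lparr>carrier = UNIV, monoid.mult = (*), one = 1, ring.zero = 0, add = (+)\<rparr>"

definition MaxSpec :: "'a::comm_unital_complex_algebra set set" where
  "MaxSpec = {m. maximalideal m ring_of_algebra}"

text \<open>The composite \<open>A \<longrightarrow> A/m \<cong> \<complex>\<close>: for \<open>A\<close> finitely generated and \<open>m\<close> maximal, the class of
  \<open>f\<close> modulo \<open>m\<close> is the class of exactly one scalar.\<close>

definition eval_at :: "'a::comm_unital_complex_algebra set \<Rightarrow> 'a \<Rightarrow> complex" where
  "eval_at m f = (THE c. f - c *\<^sub>C 1 \<in> m)"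

instantiation complex :: comm_unital_complex_algebra
begin
definition scaleC_complex :: "complex \<Rightarrow> complex \<Rightarrow> complex" where "scaleC_complex = (*)"
instance by standard (simp_all add: scaleC_complex_def algebra_simps)
end

instantiation "fun" :: (type, complex_vector) complex_vector
begin
definition scaleC_fun :: "complex \<Rightarrow> ('a \<Rightarrow> 'b) \<Rightarrow> 'a \<Rightarrow> 'b" where
  "scaleC_fun c f = (\<lambda>x. c *\<^sub>C f x)"
instance
  by standard (simp_all add: scaleC_fun_def fun_eq_iff scaleC_add_right scaleC_add_left
      scaleC_scaleC scaleC_one)
end

instantiation prod :: (complex_vector, complex_vector) complex_vector
begin
definition scaleC_prod :: "complex \<Rightarrow> 'a \<times> 'b \<Rightarrow> 'a \<times> 'b" where
  "scaleC_prod c p = (c *\<^sub>C fst p, c *\<^sub>C snd p)"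
instance
  by standard (simp_all add: scaleC_prod_def prod_eq_iff scaleC_add_right scaleC_add_left
      scaleC_scaleC scaleC_one)
end

instantiation vec :: (complex_vector, finite) complex_vector
begin
definition scaleC_vec :: "complex \<Rightarrow> 'a ^ 'b \<Rightarrow> 'a ^ 'b" where
  "scaleC_vec c v = (\<chi> i. c *\<^sub>C v $ i)"
instance
  by standard (simp_all add: scaleC_vec_def vec_eq_iff scaleC_add_right scaleC_add_left
      scaleC_scaleC scaleC_one)
end

instantiation poly_mapping :: (type, complex_vector) complex_vector
begin
lift_definition scaleC_poly_mapping :: "complex \<Rightarrow> ('a \<Rightarrow>\<^sub>0 'b) \<Rightarrow> 'a \<Rightarrow>\<^sub>0 'b"
  is "\<lambda>c p k. c *\<^sub>C p k"
  by (erule rev_finite_subset) (auto simp: complex_vector.scale_zero_right)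

instance
  by standard (transfer; simp add: fun_eq_iff scaleC_add_right scaleC_add_left scaleC_scaleC
      scaleC_one)+
end

lemma lookup_scaleC:
  "Poly_Mapping.lookup (c *\<^sub>C p) k = c *\<^sub>C Poly_Mapping.lookup p k"
  by (simp add: scaleC_poly_mapping.rep_eq)


section \<open>Tensor products\<close>

text \<open>The quotient of the free vector space on \<open>V \<times> W\<close> by the bilinearity relations.\<close>

abbreviation free_gen :: "'v \<Rightarrow> 'w \<Rightarrow> ('v \<times> 'w) \<Rightarrow>\<^sub>0 complex" where
  "free_gen v w \<equiv> Poly_Mapping.single (v, w) 1"

definition tensor_relations ::
  "(('v::complex_vector \<times> 'w::complex_vector) \<Rightarrow>\<^sub>0 complex) set" where
  "tensor_relations = cspan
     ({free_gen (v + v') w - free_gen v w - free_gen v' w | v v' w. True} \<union>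
      {free_gen v (w + w') - free_gen v w - free_gen v w' | v w w'. True} \<union>
      {free_gen (c *\<^sub>C v) w - c *\<^sub>C free_gen v w | c v w. True} \<union>
      {free_gen v (c *\<^sub>C w) - c *\<^sub>C free_gen v w | c v w. True})"

lemma tensor_relations_closed:
  "0 \<in> tensor_relations"
  "p \<in> tensor_relations \<Longrightarrow> q \<in> tensor_relations \<Longrightarrow> p + q \<in> tensor_relations"
  "p \<in> tensor_relations \<Longrightarrow> q \<in> tensor_relations \<Longrightarrow> p - q \<in> tensor_relations"
  "p \<in> tensor_relations \<Longrightarrow> - p \<in> tensor_relations"
  "p \<in> tensor_relations \<Longrightarrow> c *\<^sub>C p \<in> tensor_relations"
  unfolding tensor_relations_def
  by (auto intro: complex_vector.span_zero complex_vector.span_add complex_vector.span_diff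
      complex_vector.span_neg complex_vector.span_scale)

definition tensor_rel ::
  "(('v::complex_vector \<times> 'w::complex_vector) \<Rightarrow>\<^sub>0 complex) \<Rightarrow> (('v \<times> 'w) \<Rightarrow>\<^sub>0 complex) \<Rightarrow> bool" where
  "tensor_rel p q \<longleftrightarrow> p - q \<in> tensor_relations"

quotient_type (overloaded) ('v, 'w) tensor = "('v::complex_vector \<times> 'w::complex_vector) \<Rightarrow>\<^sub>0 complex" / tensor_rel
proof (rule equivpI)
  show "reflp tensor_rel"
    by (simp add: reflp_def tensor_rel_def tensor_relations_closed)
  show "symp tensor_rel"
    unfolding symp_def tensor_rel_def using tensor_relations_closed(4) by fastforce
  show "transp tensor_rel"
    unfolding transp_def tensor_rel_def using tensor_relations_closed(2) by fastforce
qed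

instantiation tensor :: (complex_vector, complex_vector) complex_vector
begin

lift_definition zero_tensor :: "('a, 'b) tensor" is 0 .

lift_definition plus_tensor :: "('a, 'b) tensor \<Rightarrow> ('a, 'b) tensor \<Rightarrow> ('a, 'b) tensor" is "(+)"
  unfolding tensor_rel_def by (drule (1) tensor_relations_closed(2)) (simp add: algebra_simps)

lift_definition uminus_tensor :: "('a, 'b) tensor \<Rightarrow> ('a, 'b) tensor" is uminus
  unfolding tensor_rel_def by (drule tensor_relations_closed(4)) (simp add: algebra_simps)

lift_definition minus_tensor :: "('a, 'b) tensor \<Rightarrow> ('a, 'b) tensor \<Rightarrow> ('a, 'b) tensor" is "(-)"
  unfolding tensor_rel_def
  by (drule (1) tensor_relations_closed(3)) (simp add: algebra_simps)

lift_definition scaleC_tensor :: "complex \<Rightarrow> ('a, 'b) tensor \<Rightarrow> ('a, 'b) tensor" is scaleC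
  unfolding tensor_rel_def
  by (simp add: tensor_relations_closed(5) complex_vector.scale_right_diff_distrib[symmetric])

instance
proof
  fix a b :: complex and x y z :: "('a, 'b) tensor"
  have eq: "p = q \<Longrightarrow> tensor_rel p q" for p q :: "('a \<times> 'b) \<Rightarrow>\<^sub>0 complex"
    by (simp add: tensor_rel_def tensor_relations_closed)
  show "x + y + z = x + (y + z)" by transfer (simp add: eq add.assoc)
  show "x + y = y + x" by transfer (simp add: eq add.commute)
  show "0 + x = x" by transfer (simp add: eq)
  show "- x + x = 0" by transfer (simp add: eq)
  show "x - y = x + - y" by transfer (simp add: eq)
  show "a *\<^sub>C (x + y) = a *\<^sub>C x + a *\<^sub>C y" by transfer (simp add: eq scaleC_add_right)
  show "(a + b) *\<^sub>C x = a *\<^sub>C x + b *\<^sub>C x" by transfer (simp add: eq scaleC_add_left)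
  show "a *\<^sub>C b *\<^sub>C x = (a * b) *\<^sub>C x" by transfer (simp add: eq scaleC_scaleC)
  show "1 *\<^sub>C x = x" by transfer (simp add: eq scaleC_one)
qed

end

lift_definition tens :: "'v::complex_vector \<Rightarrow> 'w::complex_vector \<Rightarrow> ('v, 'w) tensor"
    (infixl \<open>\<otimes>\<^sub>C\<close> 72)
  is free_gen .

lemma tens_bilinear:
  "(v + v') \<otimes>\<^sub>C w = v \<otimes>\<^sub>C w + v' \<otimes>\<^sub>C w"
  "v \<otimes>\<^sub>C (w + w') = v \<otimes>\<^sub>C w + v \<otimes>\<^sub>C w'"
  "(c *\<^sub>C v) \<otimes>\<^sub>C w = c *\<^sub>C (v \<otimes>\<^sub>C w)"
  "v \<otimes>\<^sub>C (c *\<^sub>C w) = c *\<^sub>C (v \<otimes>\<^sub>C w)"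
proof -
  have *: "p - (q + r) = p - q - r" for p q r :: "('a \<times> 'b) \<Rightarrow>\<^sub>0 complex"
    by (simp add: diff_diff_eq)
  show "(v + v') \<otimes>\<^sub>C w = v \<otimes>\<^sub>C w + v' \<otimes>\<^sub>C w" "v \<otimes>\<^sub>C (w + w') = v \<otimes>\<^sub>C w + v \<otimes>\<^sub>C w'"
    "(c *\<^sub>C v) \<otimes>\<^sub>C w = c *\<^sub>C (v \<otimes>\<^sub>C w)" "v \<otimes>\<^sub>C (c *\<^sub>C w) = c *\<^sub>C (v \<otimes>\<^sub>C w)"
    by (transfer, unfold tensor_rel_def tensor_relations_def *,
        rule complex_vector.span_base, blast)+
qed

text \<open>For subspaces \<open>V\<close> and \<open>W\<close>, the canonical map from \<open>V \<otimes> W\<close> to the tensor product of the ambient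
  spaces is injective, so \<open>V \<otimes> W\<close> is identified with the span of the \<open>v \<otimes> w\<close>.  The linear map on it
  induced by a bilinear map \<open>B\<close> is (the restriction of) \<open>tensor_lift V W B\<close>.\<close>

definition tensor_lift ::
  "'v::complex_vector set \<Rightarrow> 'w::complex_vector set \<Rightarrow> ('v \<Rightarrow> 'w \<Rightarrow> 'z::complex_vector) \<Rightarrow>
   ('v, 'w) tensor \<Rightarrow> 'z" where
  "tensor_lift V W B = (SOME L. clinear L \<and> (\<forall>v\<in>V. \<forall>w\<in>W. L (v \<otimes>\<^sub>C w) = B v w))"

lemma tensor_lift_exists:
  assumes V: "csubspace V" and W: "csubspace W" and B: "bilinear_on V W B"
  shows "\<exists>L. clinear L \<and> (\<forall>v\<in>V. \<forall>w\<in>W. L (v \<otimes>\<^sub>C w) = B v w)"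
proof -
  have "clinear (id :: 'a \<Rightarrow> 'a)" "clinear (id :: 'b \<Rightarrow> 'b)"
    by (simp_all add: linear_on_UNIV[symmetric] linear_on_def)
  from complex_vector.linear_exists_left_inverse_on[OF this(1) V]
    complex_vector.linear_exists_left_inverse_on[OF this(2) W]
  obtain p q where p: "range p \<subseteq> V" "clinear p" "\<And>v. v \<in> V \<Longrightarrow> p v = v"
    and q: "range q \<subseteq> W" "clinear q" "\<And>w. w \<in> W \<Longrightarrow> q w = w"
    by auto
  define C where "C = (\<lambda>k. B (p (fst k)) (q (snd k)))"
  define F where "F = (\<lambda>r. \<Sum>k\<in>Poly_Mapping.keys r. Poly_Mapping.lookup r k *\<^sub>C C k)"
  have F_eq: "F r = (\<Sum>k\<in>S. Poly_Mapping.lookup r k *\<^sub>C C k)"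
    if "finite S" "Poly_Mapping.keys r \<subseteq> S" for r S
    unfolding F_def
    by (rule sum.mono_neutral_left) (use that in \<open>auto simp: in_keys_iff complex_vector.scale_zero_left\<close>)
  have F_add: "F (r + s) = F r + F s" for r s
  proof -
    let ?S = "Poly_Mapping.keys r \<union> Poly_Mapping.keys s"
    have "Poly_Mapping.keys (r + s) \<subseteq> ?S" by (rule Poly_Mapping.keys_add)
    then show ?thesis
      by (simp add: F_eq[of ?S] lookup_add scaleC_add_left sum.distrib)
  qed
  have F_scale: "F (c *\<^sub>C r) = c *\<^sub>C F r" for c r
  proof -
    have "Poly_Mapping.keys (c *\<^sub>C r) \<subseteq> Poly_Mapping.keys r"
      by (auto simp: in_keys_iff lookup_scaleC complex_vector.scale_zero_right)
    then show ?thesis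
      by (simp add: F_eq[of "Poly_Mapping.keys r"] lookup_scaleC complex_vector.scale_sum_right
          scaleC_scaleC scaleC_complex_def)
  qed
  have F_lin: "clinear F"
    by (simp add: linear_on_UNIV[symmetric] linear_on_def F_add F_scale)
  have F_gen: "F (free_gen v w) = B (p v) (q w)" for v w
    by (simp add: F_def C_def scaleC_one)
  have F_diff: "F (r - s) = F r - F s" for r s
    using F_lin by (rule complex_vector.linear_diff)
  have pq: "p v \<in> V" "q w \<in> W" for v w
    using p(1) q(1) by auto
  have F_rel: "F r = 0" if "r \<in> tensor_relations" for r
    using that unfolding tensor_relations_def
  proof (induction rule: complex_vector.span_induct_alt)
    case base
    show ?case by (simp add: F_def)
  next
    case (step c r s)
    have "F r = 0"
      using step(1) p q pq B
      by (auto simp: F_diff F_scale F_gen bilinear_on_def linear_on_def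
          complex_vector.linear_add complex_vector.linear_scale)
    then show ?case
      by (simp add: F_add F_scale step complex_vector.scale_zero_right)
  qed
  have "tensor_rel r s \<Longrightarrow> F r = F s" for r s
    using F_rel[of "r - s"] by (simp add: F_diff tensor_rel_def)
  moreover define L where "L = (\<lambda>t. F (rep_tensor t))"
  moreover have "tensor_rel (rep_tensor (abs_tensor r)) r" for r
    by (rule Quotient3_rep_abs[OF Quotient3_tensor])
      (simp add: tensor_rel_def tensor_relations_closed)
  ultimately have L: "L (abs_tensor r) = F r" for r
    unfolding L_def by blast
  have ex: "\<exists>r. t = abs_tensor r" for t :: "('a, 'b) tensor"
    by (induct t rule: tensor.abs_induct) blast
  have "L (t + u) = L t + L u" for t u
    using ex[of t] ex[of u] by (auto simp: L F_add plus_tensor.abs_eq)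
  moreover have "L (c *\<^sub>C t) = c *\<^sub>C L t" for t c
    using ex[of t] by (auto simp: L F_scale scaleC_tensor.abs_eq)
  ultimately have "clinear L"
    by (simp add: linear_on_UNIV[symmetric] linear_on_def)
  moreover have "L (v \<otimes>\<^sub>C w) = B v w" if "v \<in> V" "w \<in> W" for v w
    using that p q by (simp add: tens.abs_eq L F_gen)
  ultimately show ?thesis by blast
qed

lemma tensor_lift_tens:
  assumes "csubspace V" "csubspace W" "bilinear_on V W B" "v \<in> V" "w \<in> W"
  shows "tensor_lift V W B (v \<otimes>\<^sub>C w) = B v w"
  using someI_ex[OF tensor_lift_exists[OF assms(1-3)]] assms(4,5)
  unfolding tensor_lift_def by blast


section \<open>Lie superalgebras\<close>

text \<open>Parities are elements of the two-element field \<^typ>\<open>bit\<close>.  The underlying space of a graded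
  space \<open>V\<close> is the (direct) sum of its even part \<open>V 0\<close> and its odd part \<open>V 1\<close>.\<close>

definition total :: "(bit \<Rightarrow> 'v::complex_vector set) \<Rightarrow> 'v set" where
  "total V = {u + v | u v. u \<in> V 0 \<and> v \<in> V 1}"

definition graded_space :: "(bit \<Rightarrow> 'v::complex_vector set) \<Rightarrow> bool" where
  "graded_space V \<longleftrightarrow> csubspace (V 0) \<and> csubspace (V 1) \<and> V 0 \<inter> V 1 = {0}"

definition component :: "(bit \<Rightarrow> 'v::complex_vector set) \<Rightarrow> bit \<Rightarrow> 'v \<Rightarrow> 'v" where
  "component V i v = (THE u. u \<in> V i \<and> v - u \<in> V (i + 1))"

definition koszul :: "bit \<Rightarrow> bit \<Rightarrow> complex" where
  "koszul i j = (if i = 1 \<and> j = 1 then - 1 else 1)"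

record 'g superalgebra =
  grade :: "bit \<Rightarrow> 'g set"
  bracket :: "'g \<Rightarrow> 'g \<Rightarrow> 'g"

abbreviation underlying :: "'g::complex_vector superalgebra \<Rightarrow> 'g set" where
  "underlying G \<equiv> total (grade G)"

definition lie_superalgebra :: "'g::complex_vector superalgebra \<Rightarrow> bool" where
  "lie_superalgebra G \<longleftrightarrow>
     graded_space (grade G) \<and>
     bilinear_on (underlying G) (underlying G) (bracket G) \<and>
     (\<forall>i j. \<forall>x\<in>grade G i. \<forall>y\<in>grade G j. bracket G x y \<in> grade G (i + j)) \<and>
     (\<forall>i j. \<forall>x\<in>grade G i. \<forall>y\<in>grade G j.
        bracket G x y = - (koszul i j *\<^sub>C bracket G y x)) \<and>
     (\<forall>i j k. \<forall>x\<in>grade G i. \<forall>y\<in>grade G j. \<forall>z\<in>grade G k.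
        bracket G x (bracket G y z) =
          bracket G (bracket G x y) z + koszul i j *\<^sub>C bracket G y (bracket G x z))"

definition superalgebra_automorphism :: "'g::complex_vector superalgebra \<Rightarrow> ('g \<Rightarrow> 'g) \<Rightarrow> bool" where
  "superalgebra_automorphism G f \<longleftrightarrow>
     linear_on (underlying G) f \<and> bij_betw f (underlying G) (underlying G) \<and>
     (\<forall>i. f ` grade G i = grade G i) \<and>
     (\<forall>x\<in>underlying G. \<forall>y\<in>underlying G. f (bracket G x y) = bracket G (f x) (f y))"

definition direct_sum ::
  "'g::complex_vector superalgebra \<Rightarrow> 'h::complex_vector superalgebra \<Rightarrow> ('g \<times> 'h) superalgebra" where
  "direct_sum G H =
     \<lparr>grade = (\<lambda>i. grade G i \<times> grade H i),
      bracket = (\<lambda>x y. (bracket G (fst x) (fst y), bracket H (snd x) (snd y)))\<rparr>"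

text \<open>The direct sum of \<open>k\<close> copies of \<open>G\<close>, with elements \<open>(x 0, \<dots>, x (k - 1))\<close> padded by zeros.\<close>

definition direct_power :: "nat \<Rightarrow> 'g::complex_vector superalgebra \<Rightarrow> (nat \<Rightarrow> 'g) superalgebra" where
  "direct_power k G =
     \<lparr>grade = (\<lambda>p. {x. \<forall>i. if i < k then x i \<in> grade G p else x i = 0}),
      bracket = (\<lambda>x y i. if i < k then bracket G (x i) (y i) else 0)\<rparr>"


section \<open>The queer Lie superalgebra\<close>

definition block ::
  "complex ^ 'n ^ 'n \<Rightarrow> complex ^ 'n ^ 'n \<Rightarrow> complex ^ ('n::finite + 'n) ^ ('n + 'n)" where
  "block a b = (\<chi> i j. case (i, j) of
       (Inl i', Inl j') \<Rightarrow> a $ i' $ j' | (Inl i', Inr j') \<Rightarrow> b $ i' $ j'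
     | (Inr i', Inl j') \<Rightarrow> b $ i' $ j' | (Inr i', Inr j') \<Rightarrow> a $ i' $ j')"

definition qhat_grade :: "bit \<Rightarrow> (complex ^ ('n::finite + 'n) ^ ('n + 'n)) set" where
  "qhat_grade i = (if i = 0 then range (\<lambda>a. block a 0) else range (\<lambda>b. block 0 b))"

text \<open>The superbracket, extended bilinearly from homogeneous elements.\<close>

definition qhat_bracket ::
  "complex ^ ('n::finite + 'n) ^ ('n + 'n) \<Rightarrow> complex ^ ('n + 'n) ^ ('n + 'n) \<Rightarrow>
   complex ^ ('n + 'n) ^ ('n + 'n)" where
  "qhat_bracket X Y = (\<Sum>i\<in>{0, 1}. \<Sum>j\<in>{0, 1}.
     component qhat_grade i X ** component qhat_grade j Y
     - koszul i j *\<^sub>C (component qhat_grade j Y ** component qhat_grade i X))"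

definition qtilde :: "(complex ^ ('n::finite + 'n) ^ ('n + 'n)) set" where
  "qtilde = {block a b | a b. trace b = 0}"

definition qtilde_rel ::
  "complex ^ ('n::finite + 'n) ^ ('n + 'n) \<Rightarrow> complex ^ ('n + 'n) ^ ('n + 'n) \<Rightarrow> bool" where
  "qtilde_rel X Y \<longleftrightarrow> X \<in> qtilde \<and> Y \<in> qtilde \<and> (\<exists>c. X - Y = c *\<^sub>C mat 1)"

lemma block_eq_iff: "block a b = block a' b' \<longleftrightarrow> a = a' \<and> b = b'"
proof
  assume *: "block a b = block a' b'"
  have "block a b $ Inl i $ Inl j = block a' b' $ Inl i $ Inl j"
    "block a b $ Inl i $ Inr j = block a' b' $ Inl i $ Inr j" for i j
    by (simp_all add: *)
  then show "a = a' \<and> b = b'" by (simp add: block_def vec_eq_iff)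
qed simp

lemma block_arith:
  "block a b + block a' b' = block (a + a') (b + b')"
  "block a b - block a' b' = block (a - a') (b - b')"
  "- block a b = block (- a) (- b)"
  "c *\<^sub>C block a b = block (c *\<^sub>C a) (c *\<^sub>C b)"
  "block 0 0 = 0"
  "mat 1 = block (mat 1) 0"
  by (auto simp: block_def vec_eq_iff scaleC_vec_def mat_def split: sum.split)

lemma block_mult:
  "block a b ** block a' b' = block (a ** a' + b ** b') (a ** b' + b ** a')"
proof -
  have "(\<Sum>k\<in>UNIV. f k) = (\<Sum>k\<in>UNIV. f (Inl k)) + (\<Sum>k\<in>UNIV. f (Inr k))"
    for f :: "'a::finite + 'a \<Rightarrow> complex"
    by (simp add: UNIV_Plus_UNIV[symmetric] sum.Plus del: UNIV_Plus_UNIV)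
  then show ?thesis
    by (auto simp: block_def vec_eq_iff matrix_matrix_mult_def add.commute split: sum.split)
qed

lemma component_block:
  "component qhat_grade 0 (block a b) = block a 0"
  "component qhat_grade 1 (block a b) = block 0 b"
  unfolding component_def qhat_grade_def
  by (rule the_equality; auto simp: block_arith block_eq_iff)+

lemma matrix_mult_zero: "(a :: complex ^ 'n ^ 'n) ** 0 = 0" "0 ** (a :: complex ^ 'n ^ 'n) = 0"
  by (simp_all add: matrix_matrix_mult_def vec_eq_iff)

lemma qhat_bracket_block:
  "qhat_bracket (block a b) (block a' b') =
     block (a ** a' - a' ** a + (b ** b' + b' ** b)) (a ** b' - b' ** a + (b ** a' - a' ** b))"
  by (simp add: qhat_bracket_def component_block koszul_def block_mult block_arith block_eq_iff
      matrix_mult_zero scaleC_one complex_vector.scale_minus_left)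

lemma matrix_mult_ring:
  fixes a b c :: "complex ^ 'n ^ 'n"
  shows "a ** (b + c) = a ** b + a ** c" "(a + b) ** c = a ** c + b ** c"
    "a ** (b - c) = a ** b - a ** c" "(a - b) ** c = a ** c - b ** c"
    "a ** (- b) = - (a ** b)" "(- a) ** b = - (a ** b)"
    "a ** (k *\<^sub>C b) = k *\<^sub>C (a ** b)" "(k *\<^sub>C a) ** b = k *\<^sub>C (a ** b)"
    "a ** b ** c = a ** (b ** c)"
  by (simp_all add: matrix_mul_assoc)
    (simp_all add: matrix_matrix_mult_def vec_eq_iff scaleC_vec_def scaleC_complex_def
      sum.distrib sum_subtractf sum_negf sum_distrib_left ring_distribs mult.assoc mult.left_commute)

lemma trace_arith:
  fixes a b :: "complex ^ 'n ^ 'n"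
  shows "trace (- a) = - trace a" "trace (k *\<^sub>C a) = k * trace a" "trace (0 :: complex ^ 'n ^ 'n) = 0"
  by (simp_all add: trace_def sum_negf scaleC_vec_def scaleC_complex_def sum_distrib_left)

lemma qtilde_block: "block a b \<in> qtilde \<longleftrightarrow> trace b = 0"
  by (auto simp: qtilde_def block_eq_iff)

lemma qtilde_cases:
  assumes "X \<in> qtilde"
  obtains a b where "X = block a b" "trace b = 0"
  using assms by (auto simp: qtilde_def)

lemma qtilde_closed:
  "0 \<in> qtilde"
  "X \<in> qtilde \<Longrightarrow> Y \<in> qtilde \<Longrightarrow> X + Y \<in> qtilde"
  "X \<in> qtilde \<Longrightarrow> Y \<in> qtilde \<Longrightarrow> X - Y \<in> qtilde"
  "X \<in> qtilde \<Longrightarrow> - X \<in> qtilde"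
  "X \<in> qtilde \<Longrightarrow> c *\<^sub>C X \<in> qtilde"
  "X \<in> qtilde \<Longrightarrow> Y \<in> qtilde \<Longrightarrow> qhat_bracket X Y \<in> qtilde"
proof -
  show "0 \<in> qtilde"
    using qtilde_block[of 0 0] by (simp add: block_arith trace_arith)
  show "X \<in> qtilde \<Longrightarrow> Y \<in> qtilde \<Longrightarrow> X + Y \<in> qtilde"
    "X \<in> qtilde \<Longrightarrow> Y \<in> qtilde \<Longrightarrow> X - Y \<in> qtilde"
    "X \<in> qtilde \<Longrightarrow> - X \<in> qtilde"
    "X \<in> qtilde \<Longrightarrow> c *\<^sub>C X \<in> qtilde"
    by (elim qtilde_cases; simp add: qtilde_block block_arith trace_add trace_sub trace_arith)+
  show "X \<in> qtilde \<Longrightarrow> Y \<in> qtilde \<Longrightarrow> qhat_bracket X Y \<in> qtilde"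
    by (elim qtilde_cases; simp add: qtilde_block qhat_bracket_block trace_add trace_sub)
      (metis add.right_neutral diff_self trace_mul_sym)
qed

lemma qtilde_rel_block:
  "qtilde_rel (block a b) (block a' b') \<longleftrightarrow>
     trace b = 0 \<and> b' = b \<and> (\<exists>c. a - a' = c *\<^sub>C mat 1)"
  by (auto simp: qtilde_rel_def qtilde_block block_arith block_eq_iff complex_vector.scale_zero_right)

quotient_type 'n queer = "complex ^ ('n::finite + 'n) ^ ('n + 'n)" / partial: qtilde_rel
proof (rule part_equivpI)
  show "\<exists>X. qtilde_rel X X"
    by (rule exI[of _ "block 0 0"])
      (auto simp: qtilde_rel_block trace_arith intro: exI[of _ 0] complex_vector.scale_zero_left)
  show "symp qtilde_rel"
  proof (rule sympI)
    fix X Y assume "qtilde_rel X Y"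
    then obtain c where "X \<in> qtilde" "Y \<in> qtilde" "X - Y = c *\<^sub>C mat 1"
      unfolding qtilde_rel_def by blast
    moreover from this have "Y - X = (- c) *\<^sub>C mat 1"
      using minus_diff_eq[of X Y] by (simp only: complex_vector.scale_minus_left)
    ultimately show "qtilde_rel Y X" unfolding qtilde_rel_def by blast
  qed
  show "transp qtilde_rel"
  proof (rule transpI)
    fix X Y Z assume "qtilde_rel X Y" "qtilde_rel Y Z"
    then obtain c d where "X \<in> qtilde" "Z \<in> qtilde" "X - Y = c *\<^sub>C mat 1" "Y - Z = d *\<^sub>C mat 1"
      unfolding qtilde_rel_def by blast
    moreover have "X - Z = (X - Y) + (Y - Z)" by simp
    ultimately have "X \<in> qtilde" "Z \<in> qtilde" "X - Z = (c + d) *\<^sub>C mat 1"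
      by (simp_all only: scaleC_add_left)
    then show "qtilde_rel X Z" unfolding qtilde_rel_def by blast
  qed
qed

lemma qtilde_relI: "X \<in> qtilde \<Longrightarrow> Y \<in> qtilde \<Longrightarrow> X - Y = c *\<^sub>C mat 1 \<Longrightarrow> qtilde_rel X Y"
  by (auto simp: qtilde_rel_def)

lemma qtilde_relE:
  assumes "qtilde_rel X Y"
  obtains c where "X \<in> qtilde" "Y \<in> qtilde" "X - Y = c *\<^sub>C mat 1"
  using assms by (auto simp: qtilde_rel_def)

lemma qtilde_rel_refl: "X \<in> qtilde \<Longrightarrow> qtilde_rel X X"
  by (rule qtilde_relI[of _ _ 0]) (simp_all add: complex_vector.scale_zero_left)

instantiation queer :: (finite) complex_vector
begin

lift_definition zero_queer :: "'a queer" is 0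
  by (rule qtilde_rel_refl) (rule qtilde_closed)

lift_definition plus_queer :: "'a queer \<Rightarrow> 'a queer \<Rightarrow> 'a queer" is "(+)"
proof -
  fix X X' Y Y' :: "complex ^ ('a + 'a) ^ ('a + 'a)"
  assume "qtilde_rel X X'" "qtilde_rel Y Y'"
  then obtain c d where "X \<in> qtilde" "X' \<in> qtilde" "X - X' = c *\<^sub>C mat 1"
    "Y \<in> qtilde" "Y' \<in> qtilde" "Y - Y' = d *\<^sub>C mat 1"
    by (auto elim!: qtilde_relE)
  then show "qtilde_rel (X + Y) (X' + Y')"
    by (intro qtilde_relI[of _ _ "c + d"] qtilde_closed)
      (simp_all add: scaleC_add_left add_diff_add)
qed

lift_definition uminus_queer :: "'a queer \<Rightarrow> 'a queer" is uminus
proof -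
  fix X X' :: "complex ^ ('a + 'a) ^ ('a + 'a)"
  assume "qtilde_rel X X'"
  then obtain c where "X \<in> qtilde" "X' \<in> qtilde" "X - X' = c *\<^sub>C mat 1"
    by (auto elim!: qtilde_relE)
  moreover have "- X - - X' = - (X - X')" by simp
  ultimately show "qtilde_rel (- X) (- X')"
    by (intro qtilde_relI[of _ _ "- c"] qtilde_closed)
      (simp_all only: complex_vector.scale_minus_left)
qed

lift_definition minus_queer :: "'a queer \<Rightarrow> 'a queer \<Rightarrow> 'a queer" is "(-)"
proof -
  fix X X' Y Y' :: "complex ^ ('a + 'a) ^ ('a + 'a)"
  assume "qtilde_rel X X'" "qtilde_rel Y Y'"
  then obtain c d where *: "X \<in> qtilde" "X' \<in> qtilde" "X - X' = c *\<^sub>C mat 1"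
    "Y \<in> qtilde" "Y' \<in> qtilde" "Y - Y' = d *\<^sub>C mat 1"
    by (auto elim!: qtilde_relE)
  have "(X - Y) - (X' - Y') = (X - X') - (Y - Y')" by simp
  with * show "qtilde_rel (X - Y) (X' - Y')"
    by (intro qtilde_relI[of _ _ "c - d"] qtilde_closed)
      (simp_all add: complex_vector.scale_left_diff_distrib)
qed

lift_definition scaleC_queer :: "complex \<Rightarrow> 'a queer \<Rightarrow> 'a queer" is scaleC
proof -
  fix k and X X' :: "complex ^ ('a + 'a) ^ ('a + 'a)"
  assume "qtilde_rel X X'"
  then obtain c where "X \<in> qtilde" "X' \<in> qtilde" "X - X' = c *\<^sub>C mat 1"
    by (auto elim!: qtilde_relE)
  then show "qtilde_rel (k *\<^sub>C X) (k *\<^sub>C X')"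
    by (intro qtilde_relI[of _ _ "k * c"] qtilde_closed)
      (simp_all add: scaleC_scaleC flip: complex_vector.scale_right_diff_distrib)
qed

instance
proof
  fix a b :: complex and x y z :: "'a queer"
  have eq: "qtilde_rel X Y" if "qtilde_rel X X" "X = Y" for X Y :: "complex ^ ('a + 'a) ^ ('a + 'a)"
    using that by simp
  have D: "X \<in> qtilde" if "qtilde_rel X X" for X :: "complex ^ ('a + 'a) ^ ('a + 'a)"
    using that by (simp add: qtilde_rel_def)
  note R = eq[OF qtilde_rel_refl] qtilde_closed
  show "x + y + z = x + (y + z)" by transfer (auto dest!: D intro!: R simp: add.assoc)
  show "x + y = y + x" by transfer (auto dest!: D intro!: R simp: add.commute)
  show "0 + x = x" by transfer (auto dest!: D intro!: R)
  show "- x + x = 0" by transfer (auto dest!: D intro!: R)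
  show "x - y = x + - y" by transfer (auto dest!: D intro!: R)
  show "a *\<^sub>C (x + y) = a *\<^sub>C x + a *\<^sub>C y" by transfer (auto dest!: D intro!: R simp: scaleC_add_right)
  show "(a + b) *\<^sub>C x = a *\<^sub>C x + b *\<^sub>C x" by transfer (auto dest!: D intro!: R simp: scaleC_add_left)
  show "a *\<^sub>C b *\<^sub>C x = (a * b) *\<^sub>C x" by transfer (auto dest!: D intro!: R simp: scaleC_scaleC)
  show "1 *\<^sub>C x = x" by transfer (auto dest!: D intro!: R simp: scaleC_one)
qed

end

lift_definition queer_bracket :: "'n::finite queer \<Rightarrow> 'n queer \<Rightarrow> 'n queer" is qhat_bracket
proof -
  fix X X' Y Y' :: "complex ^ ('n + 'n) ^ ('n + 'n)"
  assume XY: "qtilde_rel X X'" "qtilde_rel Y Y'"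
  then have Q: "X \<in> qtilde" "X' \<in> qtilde" "Y \<in> qtilde" "Y' \<in> qtilde"
    by (auto simp: qtilde_rel_def)
  then obtain a b a' b' p q p' q' where
    eqs: "X = block a b" "X' = block a' b'" "Y = block p q" "Y' = block p' q'"
    by (auto elim!: qtilde_cases)
  with XY obtain c d where "b' = b" "q' = q" and cd: "a - a' = c *\<^sub>C mat 1" "p - p' = d *\<^sub>C mat 1"
    by (auto simp: qtilde_rel_block)
  moreover have "a = a' + c *\<^sub>C mat 1" "p = p' + d *\<^sub>C mat 1"
    using cd by (simp_all add: algebra_simps)
  ultimately have "qhat_bracket X Y = qhat_bracket X' Y'"
    unfolding eqs
    by (simp add: qhat_bracket_block block_eq_iff matrix_mult_ring scaleC_add_right scaleC_scaleC
        mult.commute)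
  then show "qtilde_rel (qhat_bracket X Y) (qhat_bracket X' Y')"
    by (simp add: qtilde_rel_refl qtilde_closed Q)
qed

definition queer_algebra :: "'n::finite queer superalgebra" where
  "queer_algebra =
     \<lparr>grade = (\<lambda>i. abs_queer ` (qtilde \<inter> qhat_grade i)), bracket = queer_bracket\<rparr>"

lemma abs_queer_block:
  assumes "trace b = 0" "trace b' = 0"
  shows "abs_queer (block a b) = abs_queer (block a' b') \<longleftrightarrow> b = b' \<and> (\<exists>c. a - a' = c *\<^sub>C mat 1)"
    and "abs_queer (block a b) + abs_queer (block a' b') = abs_queer (block (a + a') (b + b'))"
    and "abs_queer (block a b) - abs_queer (block a' b') = abs_queer (block (a - a') (b - b'))"
    and "queer_bracket (abs_queer (block a b)) (abs_queer (block a' b')) =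
      abs_queer (block (a ** a' - a' ** a + (b ** b' + b' ** b)) (a ** b' - b' ** a + (b ** a' - a' ** b)))"
  using Quotient3_rel[OF Quotient3_queer, of "block a b" "block a' b'"] assms
    qtilde_rel_block[of a b a b] qtilde_rel_block[of a' b' a' b']
  by (auto simp: qtilde_rel_refl qtilde_block qtilde_rel_block plus_queer.abs_eq minus_queer.abs_eq queer_bracket.abs_eq block_arith qhat_bracket_block)

lemma abs_queer_block':
  assumes "trace b = 0"
  shows "- abs_queer (block a b) = abs_queer (block (- a) (- b))"
    and "c *\<^sub>C abs_queer (block a b) = abs_queer (block (c *\<^sub>C a) (c *\<^sub>C b))"
  using assms
  by (auto simp: qtilde_rel_refl qtilde_block uminus_queer.abs_eq scaleC_queer.abs_eq block_arith)

lemma trace_commutators: "trace (u ** v - v ** u + (u' ** v' - v' ** u')) = 0"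
  "trace (u ** v - v ** u) = 0" "trace (- (u ** v) + v ** u) = 0"
  for u v u' v' :: "complex ^ 'n ^ 'n"
  by (simp_all add: trace_add trace_sub trace_arith trace_mul_sym[of u v] trace_mul_sym[of u' v'])

lemma queer_cases:
  obtains a b where "x = abs_queer (block a b)" "trace b = 0"
proof -
  have "qtilde_rel (rep_queer x) (rep_queer x) \<and> x = abs_queer (rep_queer x)"
    by (simp add: Quotient3_abs_rep[OF Quotient3_queer] Quotient3_rep_reflp[OF Quotient3_queer])
  then show ?thesis
    using that unfolding qtilde_rel_def by (metis qtilde_cases)
qed

lemma queer_grade:
  "grade queer_algebra i =
     (if i = 0 then {abs_queer (block a 0) | a. True} else {abs_queer (block 0 b) | b. trace b = 0})"
  by (cases i) (auto simp: queer_algebra_def qhat_grade_def qtilde_block trace_arith)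

lemma underlying_queer: "underlying queer_algebra = (UNIV :: 'n::finite queer set)"
proof -
  have "x \<in> underlying queer_algebra" for x :: "'n queer"
  proof -
    obtain a b where x: "x = abs_queer (block a b)" and b: "trace b = 0"
      by (rule queer_cases)
    have "x = abs_queer (block a 0) + abs_queer (block 0 b)"
      by (simp add: x b abs_queer_block trace_arith)
    with b show ?thesis
      unfolding total_def queer_grade by auto
  qed
  then show ?thesis by auto
qed

lemma lie_superalgebra_queer: "lie_superalgebra (queer_algebra :: 'n::finite queer superalgebra)"
proof -
  have bit: "(\<forall>i. P i) \<longleftrightarrow> P 0 \<and> P 1" for P :: "bit \<Rightarrow> bool"
    by (metis bit_not_one_iff)
  have zero: "(0 :: 'n queer) = abs_queer (block 0 0)"
    by (simp add: zero_queer_def block_arith)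
  have br: "bracket queer_algebra = queer_bracket"
    by (simp add: queer_algebra_def)
  have "csubspace (grade queer_algebra i :: 'n queer set)" for i
  proof (cases "i = 0")
    case True
    show ?thesis
      unfolding complex_vector.subspace_def queer_grade zero
      by (auto simp: True abs_queer_block(2-) abs_queer_block' trace_arith complex_vector.scale_zero_right)
  next
    case False
    show ?thesis
      unfolding complex_vector.subspace_def queer_grade zero
      by (auto simp: False abs_queer_block(2-) abs_queer_block' trace_arith trace_add complex_vector.scale_zero_right)
  qed
  moreover have "grade queer_algebra 0 \<inter> grade queer_algebra 1 = {0 :: 'n queer}"
    unfolding queer_grade
    by (auto simp: zero abs_queer_block trace_arith)
  ultimately have "graded_space (grade queer_algebra :: bit \<Rightarrow> 'n queer set)"
    unfolding graded_space_def by blast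
  moreover have "bilinear_on UNIV UNIV (queer_bracket :: 'n queer \<Rightarrow> _)"
    unfolding bilinear_on_def linear_on_def
  proof (intro ballI conjI allI)
    fix x y z :: "'n queer" and c
    obtain a b where x: "x = abs_queer (block a b)" "trace b = 0" by (rule queer_cases)
    obtain a' b' where y: "y = abs_queer (block a' b')" "trace b' = 0" by (rule queer_cases)
    obtain p q where z: "z = abs_queer (block p q)" "trace q = 0" by (rule queer_cases)
    note S = abs_queer_block(2-) abs_queer_block' trace_commutators trace_add[of b b'] trace_arith x y z
    have eqI: "u = u' \<Longrightarrow> v = v' \<Longrightarrow> abs_queer (block u v) = abs_queer (block u' v')"
      for u u' v v' :: "complex ^ 'n ^ 'n" by simp
    show "queer_bracket (x + y) z = queer_bracket x z + queer_bracket y z"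
      "queer_bracket z (x + y) = queer_bracket z x + queer_bracket z y"
      "queer_bracket (c *\<^sub>C x) z = c *\<^sub>C queer_bracket x z"
      "queer_bracket z (c *\<^sub>C x) = c *\<^sub>C queer_bracket z x"
      by (simp_all add: S)
        (rule eqI; simp add: matrix_mult_ring algebra_simps scaleC_add_right
          complex_vector.scale_right_diff_distrib)+
  qed
  moreover have "queer_bracket x y \<in> grade queer_algebra (i + j)"
    if "x \<in> grade queer_algebra i" "y \<in> grade queer_algebra j" for x y :: "'n queer" and i j
  proof -
    have intro: "abs_queer (block a b) \<in> grade queer_algebra i"
      if "trace b = 0" "if i = 0 then b = 0 else a = 0" for a b :: "complex ^ 'n ^ 'n" and i
      using that by (cases "i = 0") (auto simp: queer_grade)
    have elim: "\<exists>a b. x = abs_queer (block a b) \<and> trace b = 0 \<and> (if i = 0 then b = 0 else a = 0)"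
      if "x \<in> grade queer_algebra i" for x :: "'n queer" and i
      using that by (cases "i = 0") (auto simp: queer_grade trace_arith)
    from elim[OF that(1)] obtain a b where x: "x = abs_queer (block a b)" "trace b = 0"
      "if i = 0 then b = 0 else a = 0" by blast
    from elim[OF that(2)] obtain a' b' where y: "y = abs_queer (block a' b')" "trace b' = 0"
      "if j = 0 then b' = 0 else a' = 0" by blast
    show ?thesis
      unfolding x(1) y(1) abs_queer_block(4)[OF x(2) y(2)]
      using x(3) y(3)
      by (intro intro trace_commutators(1); cases i; cases j) (simp_all add: matrix_mult_zero)
  qed
  moreover have "\<forall>i j. \<forall>x\<in>grade queer_algebra i. \<forall>y\<in>grade queer_algebra j.
      queer_bracket x y = (- (koszul i j *\<^sub>C queer_bracket y x) :: 'n queer)"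
    unfolding bit queer_grade
    by (auto simp: abs_queer_block(2-) abs_queer_block' matrix_mult_zero trace_arith
        trace_commutators koszul_def scaleC_one complex_vector.scale_minus_left add.commute)
  moreover have "\<forall>i j k. \<forall>x\<in>grade queer_algebra i. \<forall>y\<in>grade queer_algebra j.
      \<forall>z\<in>grade queer_algebra k. queer_bracket x (queer_bracket y z) =
        (queer_bracket (queer_bracket x y) z + koszul i j *\<^sub>C queer_bracket y (queer_bracket x z)
          :: 'n queer)"
    unfolding bit queer_grade
    by (auto simp: abs_queer_block(2-) abs_queer_block' matrix_mult_zero trace_arith
        trace_commutators koszul_def scaleC_one complex_vector.scale_minus_left)
      (auto simp: matrix_mult_ring algebra_simps)
  ultimately show ?thesis
    unfolding lie_superalgebra_def underlying_queer br by blast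
qed


section \<open>Supermodules\<close>

record ('g, 'v) supermodule =
  mgrade :: "bit \<Rightarrow> 'v set"
  act :: "'g \<Rightarrow> 'v \<Rightarrow> 'v"

abbreviation space :: "('g, 'v::complex_vector) supermodule \<Rightarrow> 'v set" where
  "space M \<equiv> total (mgrade M)"

definition is_supermodule ::
  "'g::complex_vector superalgebra \<Rightarrow> ('g, 'v::complex_vector) supermodule \<Rightarrow> bool" where
  "is_supermodule G M \<longleftrightarrow>
     graded_space (mgrade M) \<and>
     bilinear_on (underlying G) (space M) (act M) \<and>
     (\<forall>i j. \<forall>x\<in>grade G i. \<forall>v\<in>mgrade M j. act M x v \<in> mgrade M (i + j)) \<and>
     (\<forall>i j. \<forall>x\<in>grade G i. \<forall>y\<in>grade G j. \<forall>v\<in>space M.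
        act M (bracket G x y) v =
          act M x (act M y v) - koszul i j *\<^sub>C act M y (act M x v))"

definition graded_submodule ::
  "'g::complex_vector superalgebra \<Rightarrow> ('g, 'v::complex_vector) supermodule \<Rightarrow> 'v set \<Rightarrow> bool" where
  "graded_submodule G M W \<longleftrightarrow>
     csubspace W \<and> W = total (\<lambda>i. W \<inter> mgrade M i) \<and>
     (\<forall>x\<in>underlying G. \<forall>w\<in>W. act M x w \<in> W)"

definition irreducible_supermodule ::
  "'g::complex_vector superalgebra \<Rightarrow> ('g, 'v::complex_vector) supermodule \<Rightarrow> bool" where
  "irreducible_supermodule G M \<longleftrightarrow>
     is_supermodule G M \<and> space M \<noteq> {0} \<and>
     (\<forall>W. graded_submodule G M W \<longrightarrow> W = {0} \<or> W = space M)"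

text \<open>Isomorphisms need not be homogeneous.\<close>

definition module_iso ::
  "'g::complex_vector superalgebra \<Rightarrow> ('g, 'v::complex_vector) supermodule \<Rightarrow>
   ('g, 'w::complex_vector) supermodule \<Rightarrow> bool" where
  "module_iso G M N \<longleftrightarrow>
     (\<exists>f. linear_on (space M) f \<and> bij_betw f (space M) (space N) \<and>
        (\<forall>x\<in>underlying G. \<forall>v\<in>space M. f (act M x v) = act N x (f v)))"

definition pullback :: "('h \<Rightarrow> 'g) \<Rightarrow> ('g, 'v) supermodule \<Rightarrow> ('h, 'v) supermodule" where
  "pullback h M = \<lparr>mgrade = mgrade M, act = (\<lambda>x. act M (h x))\<rparr>"

text \<open>Every finite-dimensional supermodule is isomorphic to one whose underlying space is a
  finite-dimensional subspace of \<^typ>\<open>nat \<Rightarrow> complex\<close>, so isomorphism classes are represented by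
  sets of such supermodules.\<close>

type_synonym 'g coord_module = "('g, nat \<Rightarrow> complex) supermodule"

definition irreps :: "'g::complex_vector superalgebra \<Rightarrow> 'g coord_module set" where
  "irreps G = {M. irreducible_supermodule G M \<and> finite_dimensional (space M)}"

definition irrep_classes :: "'g::complex_vector superalgebra \<Rightarrow> 'g coord_module set set" where
  "irrep_classes G = irreps G // {(M, N). M \<in> irreps G \<and> N \<in> irreps G \<and> module_iso G M N}"

definition trivial_module :: "'g coord_module" where
  "trivial_module =
     \<lparr>mgrade = (\<lambda>i. if i = 0 then cspan {\<lambda>m. if m = 0 then 1 else 0} else {0}),
      act = (\<lambda>x v. 0)\<rparr>"

definition trivial_class :: "'g::complex_vector superalgebra \<Rightarrow> 'g coord_module set" where
  "trivial_class G = {N \<in> irreps G. module_iso G trivial_module N}"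


section \<open>Irreducible products\<close>

definition tensor_grade ::
  "(bit \<Rightarrow> 'v::complex_vector set) \<Rightarrow> (bit \<Rightarrow> 'w::complex_vector set) \<Rightarrow> bit \<Rightarrow> ('v, 'w) tensor set"
  where
  "tensor_grade V W k = cspan {v \<otimes>\<^sub>C w | v w i j. v \<in> V i \<and> w \<in> W j \<and> i + j = k}"

text \<open>\<open>(x, y) (v \<otimes> w) = x v \<otimes> w + (-1)\<^bsup>|y||v|\<^esup> v \<otimes> y w\<close>\<close>

definition tensor_module ::
  "'h::complex_vector superalgebra \<Rightarrow> ('g::complex_vector, 'v::complex_vector) supermodule \<Rightarrow>
   ('h, 'w::complex_vector) supermodule \<Rightarrow> ('g \<times> 'h, ('v, 'w) tensor) supermodule" where
  "tensor_module H M N =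
     \<lparr>mgrade = tensor_grade (mgrade M) (mgrade N),
      act = (\<lambda>(x, y). tensor_lift (space M) (space N) (\<lambda>v w.
        act M x v \<otimes>\<^sub>C w +
        (\<Sum>i\<in>{0, 1}. \<Sum>j\<in>{0, 1}. koszul j i *\<^sub>C
           (component (mgrade M) i v \<otimes>\<^sub>C act N (component (grade H) j y) w))))\<rparr>"

text \<open>The odd endomorphisms that supercommute with the action (only their values on the module
  matter).\<close>

definition odd_endomorphisms ::
  "'g::complex_vector superalgebra \<Rightarrow> ('g, 'v::complex_vector) supermodule \<Rightarrow> ('v \<Rightarrow> 'v) set" where
  "odd_endomorphisms G M =
     {\<phi>. linear_on (space M) \<phi> \<and>
         (\<forall>i. \<phi> ` mgrade M i \<subseteq> mgrade M (i + 1)) \<and>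
         (\<forall>j. \<forall>x\<in>grade G j. \<forall>v\<in>space M. \<phi> (act M x v) = koszul 1 j *\<^sub>C act M x (\<phi> v))}"

definition odd_generator ::
  "'g::complex_vector superalgebra \<Rightarrow> ('g, 'v::complex_vector) supermodule \<Rightarrow> 'v \<Rightarrow> 'v" where
  "odd_generator G M =
     (SOME \<phi>. \<phi> \<in> odd_endomorphisms G M \<and> (\<forall>v\<in>space M. \<phi> (\<phi> v) = - v))"

text \<open>\<open>(\<phi> \<otimes> \<psi>) (v \<otimes> w) = (-1)\<^bsup>|v|\<^esup> \<phi> v \<otimes> \<psi> w\<close> for odd \<open>\<phi>\<close>, \<open>\<psi>\<close>\<close>

definition odd_tensor ::
  "(bit \<Rightarrow> 'v::complex_vector set) \<Rightarrow> (bit \<Rightarrow> 'w::complex_vector set) \<Rightarrow>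
   ('v \<Rightarrow> 'v) \<Rightarrow> ('w \<Rightarrow> 'w) \<Rightarrow> ('v, 'w) tensor \<Rightarrow> ('v, 'w) tensor" where
  "odd_tensor V W \<phi> \<psi> = tensor_lift (total V) (total W) (\<lambda>v w.
     \<Sum>i\<in>{0, 1}. koszul 1 i *\<^sub>C (\<phi> (component V i v) \<otimes>\<^sub>C \<psi> w))"

text \<open>When the tensor product is irreducible it is the irreducible product; otherwise both modules
  have nonzero odd endomorphisms and the irreducible product is the fixed space of
  \<open>\<i> \<phi> \<otimes> \<psi>\<close>.\<close>

definition irreducible_product ::
  "'g::complex_vector superalgebra \<Rightarrow> 'h::complex_vector superalgebra \<Rightarrow>
   ('g, 'v::complex_vector) supermodule \<Rightarrow> ('h, 'w::complex_vector) supermodule \<Rightarrow>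
   ('g \<times> 'h, ('v, 'w) tensor) supermodule" where
  "irreducible_product G H M N =
     (let T = tensor_module H M N;
          P = odd_tensor (mgrade M) (mgrade N) (odd_generator G M) (odd_generator H N)
      in if irreducible_supermodule (direct_sum G H) T then T
         else T\<lparr>mgrade := (\<lambda>k. {u \<in> mgrade T k. \<i> *\<^sub>C P u = u})\<rparr>)"

text \<open>Transport of structure along a linear embedding into \<^typ>\<open>nat \<Rightarrow> complex\<close>, which exists for
  finite-dimensional modules.\<close>

definition coordinatize :: "('g, 'v::complex_vector) supermodule \<Rightarrow> 'g coord_module" where
  "coordinatize M =
     (let f = (SOME f. linear_on (space M) f \<and> inj_on f (space M))
      in \<lparr>mgrade = (\<lambda>i. f ` mgrade M i),
          act = (\<lambda>x v. f (act M x (inv_into (space M) f v)))\<rparr>)"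

text \<open>The irreducible product of \<open>\<rho> 0, \<dots>, \<rho> (k - 1)\<close> as a module for the direct sum of \<open>k\<close> copies
  of \<open>G\<close>; the empty product is the trivial module.\<close>

fun iterated_product ::
  "'g::complex_vector superalgebra \<Rightarrow> (nat \<Rightarrow> 'g coord_module) \<Rightarrow> nat \<Rightarrow> (nat \<Rightarrow> 'g) coord_module"
  where
  "iterated_product G \<rho> 0 = trivial_module"
| "iterated_product G \<rho> (Suc 0) = pullback (\<lambda>x. x 0) (\<rho> 0)"
| "iterated_product G \<rho> (Suc (Suc k)) =
     pullback (\<lambda>x. ((\<lambda>i. if i < Suc k then x i else 0), x (Suc k)))
       (coordinatize
         (irreducible_product (direct_power (Suc k) G) G (iterated_product G \<rho> (Suc k)) (\<rho> (Suc k))))"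


section \<open>Equivariant map superalgebras\<close>

definition current_superalgebra ::
  "'g::complex_vector superalgebra \<Rightarrow> ('g, 'a::comm_unital_complex_algebra) tensor superalgebra" where
  "current_superalgebra G =
     \<lparr>grade = (\<lambda>i. cspan {x \<otimes>\<^sub>C f | x f. x \<in> grade G i}),
      bracket = (\<lambda>t u. tensor_lift (underlying G) UNIV (\<lambda>x f.
        tensor_lift (underlying G) UNIV (\<lambda>y g. bracket G x y \<otimes>\<^sub>C (f * g)) u) t)\<rparr>"

lemma csubspace_total: "graded_space V \<Longrightarrow> csubspace (total V)"
  unfolding graded_space_def total_def by (blast intro: complex_vector.subspace_sums)

lemma current_bracket_tens:
  assumes G: "lie_superalgebra G" and x: "x \<in> underlying G" and y: "y \<in> underlying G"
  shows "bracket (current_superalgebra G) (x \<otimes>\<^sub>C f) (y \<otimes>\<^sub>C g) = bracket G x y \<otimes>\<^sub>C (f * g)"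
proof -
  let ?U = "underlying G"
  have sub: "csubspace ?U" and bil: "bilinear_on ?U ?U (bracket G)"
    using G unfolding lie_superalgebra_def by (auto intro: csubspace_total)
  have mult_right: "h * (c *\<^sub>C k) = c *\<^sub>C (h * k)" for c and h k :: 'b
    by (metis mult.commute scaleC_mult_left)
  have "tensor_lift ?U UNIV (\<lambda>y g. bracket G x y \<otimes>\<^sub>C (f * g)) (y \<otimes>\<^sub>C g) = bracket G x y \<otimes>\<^sub>C (f * g)"
    if "x \<in> ?U" for x f
    by (rule tensor_lift_tens[OF sub complex_vector.subspace_UNIV])
      (use that y bil in \<open>auto simp: bilinear_on_def linear_on_def tens_bilinear distrib_left
        mult_right\<close>)
  moreover from this have "tensor_lift ?U UNIV (\<lambda>x f. tensor_lift ?U UNIV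
        (\<lambda>y g. bracket G x y \<otimes>\<^sub>C (f * g)) (y \<otimes>\<^sub>C g)) (x \<otimes>\<^sub>C f) =
      tensor_lift ?U UNIV (\<lambda>y g. bracket G x y \<otimes>\<^sub>C (f * g)) (y \<otimes>\<^sub>C g)"
    by (intro tensor_lift_tens[OF sub complex_vector.subspace_UNIV])
      (use x y bil sub in \<open>auto simp: bilinear_on_def linear_on_def tens_bilinear distrib_right
        scaleC_mult_left complex_vector.subspace_def\<close>)
  ultimately show ?thesis
    using x by (simp add: current_superalgebra_def)
qed

text \<open>An action of the additively written group \<^typ>\<open>'t\<close> by maps satisfying \<open>P\<close>.\<close>

definition acts_by :: "(('x \<Rightarrow> 'x) \<Rightarrow> bool) \<Rightarrow> ('t::ab_group_add \<Rightarrow> 'x \<Rightarrow> 'x) \<Rightarrow> bool" where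
  "acts_by P \<alpha> \<longleftrightarrow>
     (\<forall>s. P (\<alpha> s)) \<and> \<alpha> 0 = id \<and> (\<forall>s t. \<alpha> (s + t) = \<alpha> s \<circ> \<alpha> t)"

definition diagonal_action ::
  "'g::complex_vector superalgebra \<Rightarrow> ('t \<Rightarrow> 'g \<Rightarrow> 'g) \<Rightarrow>
   ('t \<Rightarrow> 'a::comm_unital_complex_algebra \<Rightarrow> 'a) \<Rightarrow> 't \<Rightarrow> ('g, 'a) tensor \<Rightarrow> ('g, 'a) tensor" where
  "diagonal_action G \<alpha> \<beta> s = tensor_lift (underlying G) UNIV (\<lambda>x f. \<alpha> s x \<otimes>\<^sub>C \<beta> s f)"

definition equivariant_map_superalgebra ::
  "'g::complex_vector superalgebra \<Rightarrow> ('t \<Rightarrow> 'g \<Rightarrow> 'g) \<Rightarrow>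
   ('t \<Rightarrow> 'a::comm_unital_complex_algebra \<Rightarrow> 'a) \<Rightarrow> ('g, 'a) tensor superalgebra" where
  "equivariant_map_superalgebra G \<alpha> \<beta> =
     \<lparr>grade = (\<lambda>i. {t \<in> grade (current_superalgebra G) i. \<forall>s. diagonal_action G \<alpha> \<beta> s t = t}),
      bracket = bracket (current_superalgebra G)\<rparr>"

text \<open>The evaluation map \<open>G \<otimes> A \<longrightarrow> \<Oplus>\<^sub>i (G \<otimes> A/m\<^sub>i) \<cong> \<Oplus>\<^sub>i G\<close>.\<close>

definition evaluation ::
  "'g::complex_vector superalgebra \<Rightarrow> 'a::comm_unital_complex_algebra set list \<Rightarrow>
   ('g, 'a) tensor \<Rightarrow> nat \<Rightarrow> 'g" where
  "evaluation G ms t = (\<lambda>i. if i < length ms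
     then tensor_lift (underlying G) UNIV (\<lambda>x f. eval_at (ms ! i) f *\<^sub>C x) t else 0)"

definition evaluation_module ::
  "'g::complex_vector superalgebra \<Rightarrow> 'a::comm_unital_complex_algebra set list \<Rightarrow>
   (nat \<Rightarrow> 'g coord_module) \<Rightarrow> ('g, 'a) tensor coord_module" where
  "evaluation_module G ms \<rho> = pullback (evaluation G ms) (iterated_product G \<rho> (length ms))"

definition class_action ::
  "'g::complex_vector superalgebra \<Rightarrow> ('t::ab_group_add \<Rightarrow> 'g \<Rightarrow> 'g) \<Rightarrow> 't \<Rightarrow>
   'g coord_module set \<Rightarrow> 'g coord_module set" where
  "class_action G \<alpha> s X = {N \<in> irreps G. \<exists>M\<in>X. module_iso G (pullback (\<alpha> (- s)) M) N}"

definition support ::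
  "'g::complex_vector superalgebra \<Rightarrow>
   ('a::comm_unital_complex_algebra set \<Rightarrow> 'g coord_module set) \<Rightarrow> 'a set set" where
  "support G \<Psi> = {m \<in> MaxSpec. \<Psi> m \<noteq> trivial_class G}"

definition finite_support_functions ::
  "'g::complex_vector superalgebra \<Rightarrow>
   ('a::comm_unital_complex_algebra set \<Rightarrow> 'g coord_module set) set" where
  "finite_support_functions G = {\<Psi> \<in> MaxSpec \<rightarrow>\<^sub>E irrep_classes G. finite (support G \<Psi>)}"

definition equivariant_functions ::
  "'g::complex_vector superalgebra \<Rightarrow> ('t::ab_group_add \<Rightarrow> 'g \<Rightarrow> 'g) \<Rightarrow>
   ('t \<Rightarrow> 'a::comm_unital_complex_algebra \<Rightarrow> 'a) \<Rightarrow>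
   ('a set \<Rightarrow> 'g coord_module set) set" where
  "equivariant_functions G \<alpha> \<beta> =
     {\<Psi> \<in> finite_support_functions G.
        \<forall>s. \<forall>m\<in>MaxSpec. \<Psi> (\<beta> s ` m) = class_action G \<alpha> s (\<Psi> m)}"

definition orbit_representatives :: "('t \<Rightarrow> 'a \<Rightarrow> 'a) \<Rightarrow> 'a set set \<Rightarrow> 'a set list \<Rightarrow> bool" where
  "orbit_representatives \<beta> S ms \<longleftrightarrow>
     distinct ms \<and> set ms \<subseteq> S \<and> (\<forall>m\<in>S. \<exists>!m'. m' \<in> set ms \<and> (\<exists>s. m' = \<beta> s ` m))"

text \<open>All modules isomorphic to the evaluation module for some choice of (ordered) orbit
  representatives and of modules in the classes \<open>\<Psi> m\<^sub>i\<close>.  Since the isomorphism class of the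
  evaluation module does not depend on these choices, this set is that isomorphism class.\<close>

definition evaluation_class ::
  "'g::complex_vector superalgebra \<Rightarrow> ('t::ab_group_add \<Rightarrow> 'g \<Rightarrow> 'g) \<Rightarrow>
   ('t \<Rightarrow> 'a::comm_unital_complex_algebra \<Rightarrow> 'a) \<Rightarrow>
   ('a set \<Rightarrow> 'g coord_module set) \<Rightarrow> ('g, 'a) tensor coord_module set" where
  "evaluation_class G \<alpha> \<beta> \<Psi> =
     {N \<in> irreps (equivariant_map_superalgebra G \<alpha> \<beta>).
        \<exists>ms \<rho>. orbit_representatives \<beta> (support G \<Psi>) ms \<and>
          (\<forall>i<length ms. \<rho> i \<in> \<Psi> (ms ! i)) \<and>
          module_iso (equivariant_map_superalgebra G \<alpha> \<beta>) (evaluation_module G ms \<rho>) N}"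

end

theory Submission
  imports Defs "HOL-Computational_Algebra.Fundamental_Theorem_Algebra" "HOL-Analysis.Continuum_Not_Denumerable"
begin

text \<open>
  Both sides of the bijection are described by local data.  Let \<open>L\<close> be a finite-dimensional Lie superalgebra
  with \<open>L\<^sub>0 = [L\<^sub>0, L\<^sub>0]\<close> and \<open>L\<^sub>1 = [L\<^sub>0, L\<^sub>1]\<close>, such as the queer one, and write \<open>Tr (x \<otimes> a)\<close> for the sum of the translates of \<open>x \<otimes> a\<close> under the group; these elements
  span the fixed points.  A module \<open>\<rho>\<close> for \<open>L\<close> is said to occur in a module \<open>V\<close> at a maximal ideal \<open>m\<close> if some
  nonzero linear map from \<open>\<rho>\<close> to \<open>V\<close> turns \<open>a(m) x\<close> into \<open>Tr (x \<otimes> a)\<close> for all functions \<open>a\<close> that vanish at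
  finitely many other points.  The theorem follows from three facts: in an irreducible \<open>V\<close> exactly one irreducible
  class occurs at each point, it is trivial outside a finite set and equivariant along orbits
  (\<open>matching_function\<close>); the evaluation module of a function \<open>\<Psi>\<close> realises \<open>\<Psi>\<close>
  (\<open>evaluation_matches\<close>); and \<open>V\<close> is determined by what occurs in it (\<open>matches_evaluation\<close>).

  The geometric input is that the annihilator of \<open>V\<close> in the coordinate algebra is a semiprime ideal of finite
  codimension, hence the ideal of a finite invariant set of points.  Finite codimension uses that the action on the
  spectrum is free: there are \<open>a\<^sub>i\<close>, \<open>b\<^sub>i\<close> such that the sum of the \<open>a\<^sub>i s(b\<^sub>i)\<close> is \<open>1\<close> for \<open>s = 0\<close> and \<open>0\<close> otherwise
  (\<open>Galois_coordinates\<close>), which writes \<open>Tr ([x, y] \<otimes> c d)\<close> as a sum of brackets.  Semiprimeness holds because an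
  invariant ideal of square zero modulo the annihilator acts by supercommuting operators whose even part has
  vanishing eigenvalues, so that their common kernel is a nonzero submodule (\<open>square_zero_ideal\<close>).  Therefore \<open>V\<close> is a
  module over a finite direct power of \<open>L\<close>, one copy for each orbit.

  For direct powers the theory of irreducible products applies: the tensor product of two irreducible modules is
  irreducible unless both have odd endomorphisms, in which case it is the sum of two isomorphic halves, and in both
  cases an irreducible module over a direct sum is determined by the modules that occur for the two summands
  (\<open>iterated_product_irreducible\<close>, \<open>iterated_product_unique\<close>).
\<close>

section \<open>Linear algebra on subspaces\<close>

notation scaleC (infixr "*C" 75) and tens (infixl "**C" 72)

text \<open>Short names for facts about complex vector spaces.\<close>

lemmas cv_independent_span_bound = complex_vector.independent_span_bound
  and cv_linear_0 = complex_vector.linear_0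
  and cv_linear_add = complex_vector.linear_add
  and cv_linear_diff = complex_vector.linear_diff
  and cv_linear_neg = complex_vector.linear_neg
  and cv_linear_scale = complex_vector.linear_scale
  and cv_linear_preimage = complex_vector.linear_subspace_linear_preimage
  and cv_linear_sum = complex_vector.linear_sum
  and cv_scale_right_diff_distrib = complex_vector.scale_right_diff_distrib
  and cv_scale_sum_right = complex_vector.scale_sum_right
  and cv_span_add = complex_vector.span_add
  and cv_span_base = complex_vector.span_base
  and cv_span_minimal = complex_vector.span_minimal
  and cv_span_mono = complex_vector.span_mono
  and cv_span_scale = complex_vector.span_scale
  and cv_span_singleton = complex_vector.span_singleton
  and cv_span_sum = complex_vector.span_sum
  and cv_span_zero = complex_vector.span_zero
  and cv_subspace_0 = complex_vector.subspace_0
  and cv_subspace_UNIV = complex_vector.subspace_UNIV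
  and cv_subspace_add = complex_vector.subspace_add
  and cv_subspace_def = complex_vector.subspace_def
  and cv_subspace_diff = complex_vector.subspace_diff
  and cv_subspace_neg = complex_vector.subspace_neg
  and cv_subspace_scale = complex_vector.subspace_scale
  and cv_subspace_single_0 = complex_vector.subspace_single_0
  and cv_subspace_sum = complex_vector.subspace_sum



lemmas csub_intros = cv_subspace_0 cv_subspace_add
 cv_subspace_diff cv_subspace_neg cv_subspace_scale

lemma lin_on_add: "linear_on V f ==> x : V ==> y : V ==> f (x + y) = f x + f y"
 and lin_on_scale: "linear_on V f ==> x : V ==> f (c *C x) = c *C f x"
 by (auto simp: linear_on_def)

lemma lin_on_0: "linear_on V f ==> csubspace V ==> f 0 = 0"
 using lin_on_scale[of V f 0 0] by (simp add: csub_intros)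

lemma lin_on_neg: "linear_on V f ==> x : V ==> f (- x) = - f x"
 using lin_on_scale[of V f x "-1"] by (simp add: complex_vector.scale_minus_left scaleC_one)

lemma lin_on_diff:
 assumes "linear_on V f" "csubspace V" "x : V" "y : V"
 shows "f (x - y) = f x - f y"
 using lin_on_add[OF assms(1), of x "- y"] lin_on_neg[OF assms(1), of y] assms
 by (simp add: csub_intros)

lemma lin_on_sum:
 assumes "linear_on V f" "csubspace V" "!!i. i : I ==> x i : V"
 shows "f (\<Sum>i\<in>I. x i) = (\<Sum>i\<in>I. f (x i))"
 using assms(3)
 by (induction I rule: infinite_finite_induct)
  (simp_all add: lin_on_0[OF assms(1,2)] lin_on_add[OF assms(1)]
   cv_subspace_sum[OF assms(2)])

lemma lin_on_subset: "linear_on V f ==> W \<subseteq> V ==> linear_on W f"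
 unfolding linear_on_def by blast

lemma clinear_linear_on: "clinear f ==> linear_on V f"
 using linear_on_UNIV lin_on_subset by blast

lemma lin_on_cong: "(!!x. x : V ==> f x = g x) ==> csubspace V ==> linear_on V f \<longleftrightarrow> linear_on V g"
 by (simp add: linear_on_def csub_intros)

lemma lin_on_compose:
 "linear_on V f ==> (!!x. x : V ==> f x : W) ==> linear_on W g ==> linear_on V (%x. g (f x))"
 by (simp add: linear_on_def)

lemma lin_on_arith:
 "linear_on V f ==> linear_on V g ==> linear_on V (%x. f x + g x)"
 "linear_on V f ==> linear_on V g ==> linear_on V (%x. f x - g x)"
 "linear_on V f ==> linear_on V (%x. - f x)"
 "linear_on V f ==> linear_on V (%x. c *C f x)"
 "linear_on V (%x. x)"
 "linear_on V (%x. 0)"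
 by (simp_all add: linear_on_def scaleC_add_right scaleC_scaleC mult.commute
   cv_scale_right_diff_distrib)

lemma csubspace_image:
 assumes "linear_on V f" "csubspace W" "W \<subseteq> V"
 shows "csubspace (f ` W)"
proof -
 have f: "linear_on W f" by (rule lin_on_subset) fact+
 show ?thesis
  unfolding cv_subspace_def
 proof (safe)
  show "0 : f ` W"
   using lin_on_0[OF f assms(2)] csub_intros(1)[OF assms(2)] by (metis imageI)
  show "f x + f y : f ` W" if "x : W" "y : W" for x y
   using lin_on_add[OF f that] csub_intros(2)[OF assms(2) that] by (metis imageI)
  show "c *C f x : f ` W" if "x : W" for x c
   using lin_on_scale[OF f that] csub_intros(5)[OF assms(2) that] by (metis imageI)
 qed
qed

lemma csubspace_preimage:
 assumes "linear_on V f" "csubspace V" "csubspace W"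
 shows "csubspace {v : V. f v : W}"
 using assms unfolding cv_subspace_def
 by (auto simp: lin_on_add lin_on_scale lin_on_0[OF assms(1,2)])

lemma csubspace_kernel:
 assumes "linear_on V f" "csubspace V"
 shows "csubspace {v : V. f v = 0}"
 using csubspace_preimage[OF assms, of "{0}"] by simp

lemma lin_on_inj_on:
 assumes "linear_on V f" "csubspace V" "!!x. x : V ==> f x = 0 ==> x = 0"
 shows "inj_on f V"
proof (rule inj_onI)
 fix x y assume "x : V" "y : V" "f x = f y"
 then have "f (x - y) = 0" "x - y : V"
  using assms(1,2) by (simp_all add: lin_on_diff csub_intros)
 then show "x = y" using assms(3)[of "x - y"] by simp
qed

lemma finite_dimensional_subset: "finite_dimensional V ==> W \<subseteq> V ==> finite_dimensional W"
 unfolding finite_dimensional_def by blast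

lemma finite_dimensional_basis:
 assumes "finite_dimensional V" "csubspace V"
 obtains B where "finite B" "B \<subseteq> V" "complex_vector.independent B" "cspan B = V"
proof -
 obtain C where C: "finite C" "V \<subseteq> cspan C" using assms(1) finite_dimensional_def by blast
 obtain B where B: "B \<subseteq> V" "complex_vector.independent B" "V \<subseteq> cspan B"
  using complex_vector.maximal_independent_subset by blast
 have "finite B"
  using cv_independent_span_bound[OF C(1) B(2)] B(1) C(2) by blast
 moreover have "cspan B = V"
  using B assms(2) by (intro complex_vector.span_subspace)
 ultimately show ?thesis using B(1,2) that by blast
qed

lemma finite_dimensional_image:
 assumes "finite_dimensional V" "csubspace V" "linear_on V f"
 shows "finite_dimensional (f ` V)"
proof -
 obtain B where B: "finite B" "B \<subseteq> V" "complex_vector.independent B" "cspan B = V"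
  by (rule finite_dimensional_basis[OF assms(1,2)])
 have "cspan B \<subseteq> {v : V. f v : cspan (f ` B)}"
  using B(2) csubspace_preimage[OF assms(3,2)]
  by (intro cv_span_minimal) (auto intro: cv_span_base)
 then have "f ` V \<subseteq> cspan (f ` B)" unfolding B(4) by blast
 with B(1) show ?thesis unfolding finite_dimensional_def by blast
qed

lemma dependent_family:
 assumes B: "finite B" and I: "finite I" "card B < card I" and y: "!!i. i : I ==> y i : cspan B"
 shows "EX c. (EX i:I. c i ~= 0) & (\<Sum>i\<in>I. c i *C y i) = 0"
proof (cases "inj_on y I")
 case False
 then obtain i j where ij: "i : I" "j : I" "i ~= j" "y i = y j" by (auto simp: inj_on_def)
 define c :: "'b => complex" where "c = (%k. if k = i then 1 else if k = j then -1 else 0)"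
 have "(\<Sum>k\<in>I. c k *C y k) = (\<Sum>k\<in>{i,j}. c k *C y k)"
  using I ij by (intro sum.mono_neutral_right) (auto simp: c_def)
 also have "\<dots> = 0" using ij by (simp add: c_def scaleC_one complex_vector.scale_minus_left)
 finally show ?thesis using ij by (intro exI[of _ c]) (auto simp: c_def)
next
 case True
 have "complex_vector.dependent (y ` I)"
 proof (rule ccontr)
  assume "\<not> complex_vector.dependent (y ` I)"
  from cv_independent_span_bound[OF B this] y have "card (y ` I) \<le> card B" by auto
  with I card_image[OF True] show False by simp
 qed
 with complex_vector.dependent_finite[of "y ` I"] I
 obtain u where u: "EX v:y ` I. u v ~= 0" "(\<Sum>v\<in>y ` I. u v *C v) = 0" by blast
 then show ?thesis
  by (intro exI[of _ "%i. u (y i)"]) (auto simp: sum.reindex[OF True])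
qed

lemma strict_subspace_dim:
 assumes "finite_dimensional V" "csubspace W" "csubspace U" "U \<subseteq> V" "W \<subset> U"
 shows "complex_vector.dim W < complex_vector.dim U"
proof -
 have fd: "finite_dimensional U" "finite_dimensional W"
  using assms finite_dimensional_subset by (meson psubset_imp_subset)+
 obtain B where B: "finite B" "B \<subseteq> W" "complex_vector.independent B" "cspan B = W"
  by (rule finite_dimensional_basis[OF fd(2) assms(2)])
 obtain C where C: "B \<subseteq> C" "C \<subseteq> U" "complex_vector.independent C" "U \<subseteq> cspan C"
  using complex_vector.maximal_independent_subset_extend[of B U] B assms(5) by blast
 obtain D where "finite D" "U \<subseteq> cspan D" using fd(1) finite_dimensional_def by blast
 then have "finite C"
  using cv_independent_span_bound[of D C] C by blast
 moreover have "B ~= C" using B C assms(5) by auto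
 ultimately have "card B < card C" using C(1) by (intro psubset_card_mono) auto
 moreover have "complex_vector.dim W = card B" "complex_vector.dim U = card C"
  using complex_vector.basis_card_eq_dim[OF B(2) _ B(3)] B(4)
   complex_vector.basis_card_eq_dim[OF C(2,4,3)] by simp_all
 ultimately show ?thesis by simp
qed

lemma minimal_subspace:
 assumes "finite_dimensional V" "F ~= {}" "!!W. W : F ==> csubspace W & W \<subseteq> V"
 obtains W where "W : F" "!!U. U : F ==> U \<subseteq> W ==> U = W"
proof -
 obtain W where W: "W : F" "!!U. U : F ==> complex_vector.dim W \<le> complex_vector.dim U"
  using exists_least_iff[of "%n. EX W:F. complex_vector.dim W = n"] assms(2)
  by (metis all_not_in_conv leI)
 show ?thesis
 proof (rule that[OF W(1)])
  fix U assume "U : F" "U \<subseteq> W"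
  then show "U = W"
   using strict_subspace_dim[OF assms(1), of U W] W assms(3) by (metis leD psubsetI)
 qed
qed

section \<open>Polynomials in an operator\<close>

definition poly_op :: "('v::complex_vector => 'v) => complex poly => 'v => 'v" where
 "poly_op f p v = fold_coeffs (%a w. a *C v + f w) p 0"

definition finite_codim :: "'v::complex_vector set => 'v set => bool" where
 "finite_codim V S \<longleftrightarrow> (EX B. finite B & (ALL x:V. EX y:cspan B. x - y : S))"

context
 fixes f :: "'v::complex_vector => 'v" and V and v
 assumes f: "linear_on V f" "csubspace V" "!!x. x : V ==> f x : V" and v: "v : V"
begin

lemma poly_op_0: "poly_op f 0 v = 0"
 by (simp add: poly_op_def)

lemma poly_op_pCons: "poly_op f (pCons a p) v = a *C v + f (poly_op f p v)"
 by (cases "a = 0 & p = 0") (auto simp: poly_op_def lin_on_0[OF f(1,2)])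

lemma poly_op_in: "poly_op f p v : V"
 by (induction p) (auto simp: poly_op_0 poly_op_pCons intro!: csub_intros f v)

lemma poly_op_add: "poly_op f (p + q) v = poly_op f p v + poly_op f q v"
 by (induction p q rule: poly_induct2)
  (simp_all add: poly_op_0 poly_op_pCons lin_on_add[OF f(1)] poly_op_in scaleC_add_left algebra_simps)

lemma poly_op_smult: "poly_op f (smult c p) v = c *C poly_op f p v"
 by (induction p)
  (simp_all add: poly_op_0 poly_op_pCons lin_on_scale[OF f(1)] poly_op_in scaleC_add_right scaleC_scaleC)

lemma poly_op_sum: "poly_op f (\<Sum>i\<in>I. p i) v = (\<Sum>i\<in>I. poly_op f (p i) v)"
 by (induction I rule: infinite_finite_induct) (simp_all add: poly_op_0 poly_op_add)

lemma poly_op_monom: "poly_op f (monom c i) v = c *C (f ^^ i) v"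
proof (induction i)
 case 0
 then show ?case by (simp add: monom_0 poly_op_pCons poly_op_0 lin_on_0[OF f(1,2)])
next
 case (Suc i)
 have "(f ^^ i) v : V" by (induction i) (use f v in auto)
 with Suc show ?case by (simp add: monom_Suc poly_op_pCons lin_on_scale[OF f(1)])
qed

lemma poly_op_linear_factor:
 "poly_op f ([:- z, 1:] * q) v = f (poly_op f q v) - z *C poly_op f q v"
proof -
 have "[:- z, 1:] * q = pCons 0 q + smult (- z) q" by simp
 then show ?thesis
  by (simp only: poly_op_add poly_op_smult poly_op_pCons) simp
qed

text \<open>A polynomial that sends \<open>v\<close> into \<open>S\<close> splits into linear factors; the first factor that
  enters \<open>S\<close> yields an eigenvector modulo \<open>S\<close>.\<close>

lemma eigenvector_of_annihilator:
 assumes S: "csubspace S" "v ~: S" and "p ~= 0" "poly_op f p v : S"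
 obtains z q where "poly_op f q v ~: S" "f (poly_op f q v) - z *C poly_op f q v : S"
proof -
 have "EX z q. poly_op f q v ~: S & f (poly_op f q v) - z *C poly_op f q v : S"
  using assms(3,4)
 proof (induction "degree p" arbitrary: p rule: less_induct)
  case less
  show ?case
  proof (cases "degree p = 0")
   case True
   then obtain a where p: "p = [:a:]" by (meson degree_eq_zeroE)
   with less have "a *C v : S" "a ~= 0"
    by (auto simp: poly_op_pCons poly_op_0 lin_on_0[OF f(1,2)])
   from cv_subspace_scale[OF S(1) this(1)]
   have "inverse a *C a *C v : S" .
   moreover have "inverse a *C a *C v = v"
    using \<open>a ~= 0\<close> by (simp add: scaleC_scaleC scaleC_one)
   ultimately show ?thesis using S by simp
  next
   case False
   then obtain z where "poly p z = 0"
    using fundamental_theorem_of_algebra[of p] constant_degree[of p] by auto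
   then obtain q where q: "p = [:- z, 1:] * q" by (metis poly_eq_0_iff_dvd dvdE)
   with less.prems have "q ~= 0" by auto
   then have "degree q < degree p" unfolding q by (subst degree_mult_eq) auto
   show ?thesis
   proof (cases "poly_op f q v : S")
    case True
    then show ?thesis using less.hyps[OF \<open>degree q < degree p\<close> \<open>q ~= 0\<close>] by blast
   next
    case False
    then show ?thesis using less.prems(2) unfolding q poly_op_linear_factor by blast
   qed
  qed
 qed
 then show ?thesis using that by blast
qed

lemma finite_codim_annihilator:
 assumes "finite_codim V S" "csubspace S"
 obtains p where "p ~= 0" "poly_op f p v : S"
proof -
 obtain B where B: "finite B" "!!x. x : V ==> EX y:cspan B. x - y : S"
  using assms(1) finite_codim_def by metis
 have iter: "(f ^^ i) v : V" for i by (induction i) (use f v in auto)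
 then have "ALL i. EX y. y : cspan B & (f ^^ i) v - y : S"
  using B(2) by blast
 from choice[OF this] obtain y where y: "!!i. y i : cspan B" "!!i. (f ^^ i) v - y i : S"
  by blast
 define I where "I = {..card B}"
 have I: "finite I" "card B < card I" by (auto simp: I_def)
 obtain c where c: "EX i:I. c i ~= 0" "(\<Sum>i\<in>I. c i *C y i) = 0"
  using dependent_family[OF B(1) I, of y] y(1) by blast
 define p where "p = (\<Sum>i\<in>I. monom (c i) i)"
 have "coeff p i = c i" if "i : I" for i
  using that I by (simp add: p_def coeff_sum)
 with c(1) have "p ~= 0" by auto
 moreover have "poly_op f p v = (\<Sum>i\<in>I. c i *C ((f ^^ i) v - y i))"
  using c(2) by (simp add: p_def poly_op_sum poly_op_monom sum_subtractf
    cv_scale_right_diff_distrib)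
 then have "poly_op f p v : S"
  using y(2) assms(2) by (simp add: cv_subspace_sum cv_subspace_scale)
 ultimately show ?thesis using that by blast
qed

end

lemma finite_codim_0: "finite_dimensional V ==> finite_codim V {0}"
 unfolding finite_dimensional_def finite_codim_def by force

lemma exists_eigenvector:
 assumes "linear_on V f" "csubspace V" "!!x. x : V ==> f x : V" "finite_dimensional V" "V ~= {0}"
 obtains c v where "v : V" "v ~= 0" "f v = c *C v"
proof -
 obtain v where v: "v : V" "v ~= 0" using assms(2,5) cv_subspace_0 by blast
 obtain p where p: "p ~= 0" "poly_op f p v : {0}"
  by (rule finite_codim_annihilator[OF assms(1-3) v(1) finite_codim_0[OF assms(4)]
    cv_subspace_single_0])
 have "v ~: {0}" using v by simp
 then obtain q z where "poly_op f q v ~: {0}" "f (poly_op f q v) - z *C poly_op f q v : {0}"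
  using eigenvector_of_annihilator[OF assms(1-3) v(1) cv_subspace_single_0 _ p] by blast
 then show ?thesis
  using poly_op_in[OF assms(1-3) v(1)] by (intro that[of "poly_op f q v" z]) auto
qed

section \<open>Irreducible families of operators\<close>

definition operators :: "'i set => ('i => 'v::complex_vector => 'v) => 'v set => bool" where
 "operators I a V \<longleftrightarrow> csubspace V & (ALL i:I. linear_on V (a i) & a i ` V \<subseteq> V)"

definition stable :: "'i set => ('i => 'v::complex_vector => 'v) => 'v set => bool" where
 "stable I a W \<longleftrightarrow> csubspace W & (ALL i:I. a i ` W \<subseteq> W)"

definition irreducible_family :: "'i set => ('i => 'v::complex_vector => 'v) => 'v set => bool" where
 "irreducible_family I a V \<longleftrightarrow>
   operators I a V & V ~= {0} & (ALL W. W \<subseteq> V & stable I a W --> W = {0} \<or> W = V)"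

definition intertwines ::
 "'i set => ('i => 'v::complex_vector => 'v) => 'v set => ('i => 'w::complex_vector => 'w) => 'w set =>
  ('v => 'w) => bool" where
 "intertwines I a V b W f \<longleftrightarrow>
   linear_on V f & f ` V \<subseteq> W & (ALL i:I. ALL v:V. f (a i v) = b i (f v))"

lemma operators_stable: "operators I a V ==> stable I a V"
 by (simp add: operators_def stable_def)

lemma operators_subset: "operators I a V ==> W \<subseteq> V ==> stable I a W ==> operators I a W"
 by (auto simp: operators_def stable_def intro: lin_on_subset)

lemma irr_famD:
 assumes "irreducible_family I a V"
 shows "operators I a V" "csubspace V" "V ~= {0}"
  "!!W. W \<subseteq> V ==> stable I a W ==> W ~= {0} ==> W = V"
 using assms unfolding irreducible_family_def operators_def by blast+

lemma exists_irreducible_subspace: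
 assumes "operators I a V" "finite_dimensional V" "V ~= {0}"
 obtains W where "W \<subseteq> V" "irreducible_family I a W"
proof -
 define F where "F = {W. W \<subseteq> V & stable I a W & W ~= {0}}"
 have "V : F" using assms operators_stable by (auto simp: F_def)
 then have "F ~= {}" by blast
 moreover have "!!W. W : F ==> csubspace W & W \<subseteq> V" by (simp add: F_def stable_def)
 ultimately obtain W where W: "W : F" "!!U. U : F ==> U \<subseteq> W ==> U = W"
  using minimal_subspace[OF assms(2), of F] by metis
 show ?thesis
 proof (rule that[of W])
  show "W \<subseteq> V" using W by (simp add: F_def)
  show "irreducible_family I a W"
   unfolding irreducible_family_def
  proof (intro conjI allI impI)
   show "operators I a W" using W operators_subset[OF assms(1)] by (simp add: F_def)
   show "W ~= {0}" using W by (simp add: F_def)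
   show "U = {0} \<or> U = W" if "U \<subseteq> W & stable I a U" for U
    using that W by (auto simp: F_def)
  qed
 qed
qed

lemma stable_kernel:
 assumes "intertwines I a V b W f" "operators I a V" "operators I b W"
 shows "stable I a {v : V. f v = 0}"
 unfolding stable_def
proof (intro conjI ballI)
 show "csubspace {v : V. f v = 0}"
  using assms by (auto simp: intertwines_def operators_def intro: csubspace_kernel)
 fix i assume "i : I"
 then have "b i 0 = 0" using assms(3) lin_on_0[of W "b i"] by (simp add: operators_def)
 with \<open>i : I\<close> show "a i ` {v : V. f v = 0} \<subseteq> {v : V. f v = 0}"
  using assms(1,2) by (auto simp: intertwines_def operators_def)
qed

lemma stable_image:
 assumes "intertwines I a V b W f" "operators I a V"
 shows "stable I b (f ` V)"
 using assms by (force simp: stable_def intertwines_def operators_def intro: csubspace_image)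

lemma Schur_inj:
 assumes "intertwines I a V b W f" "irreducible_family I a V" "operators I b W"
  and "v : V" "f v ~= 0"
 shows "inj_on f V"
proof -
 have "{v : V. f v = 0} = {0}"
  using irr_famD(4)[OF assms(2), of "{v : V. f v = 0}"] assms
   stable_kernel[OF assms(1) irr_famD(1)[OF assms(2)] assms(3)] by fastforce
 then show ?thesis
  using assms irr_famD(2)[OF assms(2)] by (intro lin_on_inj_on) (auto simp: intertwines_def)
qed

lemma Schur_bij:
 assumes "intertwines I a V b W f" "irreducible_family I a V" "irreducible_family I b W"
  and "v : V" "f v ~= 0"
 shows "bij_betw f V W"
proof -
 have "f ` V = W"
  using irr_famD(4)[OF assms(3), of "f ` V"] assms(1,4,5)
   stable_image[OF assms(1) irr_famD(1)[OF assms(2)]] by (auto simp: intertwines_def)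
 with Schur_inj[OF assms(1,2) irr_famD(1)[OF assms(3)] assms(4,5)]
 show ?thesis by (simp add: bij_betw_def)
qed

lemma Schur_scalar:
 assumes "intertwines I a V a V f" "irreducible_family I a V" "finite_dimensional V"
 obtains c where "!!v. v : V ==> f v = c *C v"
proof -
 note V = irr_famD[OF assms(2)]
 have f: "linear_on V f" "!!x. x : V ==> f x : V" using assms by (auto simp: intertwines_def)
 obtain c v where cv: "v : V" "v ~= 0" "f v = c *C v"
  using exists_eigenvector[OF f(1) V(2) f(2) assms(3) V(3)] by blast
 define g where "g = (%v. f v - c *C v)"
 have "intertwines I a V a V g"
  unfolding intertwines_def
 proof (intro conjI ballI)
  show lin: "linear_on V g" unfolding g_def by (intro lin_on_arith f)
  show "g ` V \<subseteq> V" using f V(2) by (auto simp: g_def intro!: csub_intros)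
  fix i v assume iv: "i : I" "v : V"
  have "linear_on V (a i)" using V(1) iv by (auto simp: operators_def)
  then have "a i (f v - c *C v) = a i (f v) - c *C a i v"
   using iv V(2) f by (simp add: lin_on_diff lin_on_scale csub_intros)
  then show "g (a i v) = a i (g v)"
   using assms(1) iv by (simp add: g_def intertwines_def)
 qed
 have "g u = 0" if "u : V" for u
 proof (rule ccontr)
  assume "g u ~= 0"
  from Schur_inj[OF \<open>intertwines I a V a V g\<close> assms(2) V(1) that this]
  have "inj_on g V" .
  moreover have "g v = g 0" "0 : V" using cv V(2) lin_on_0[OF f(1) V(2)] by (auto simp: g_def csub_intros)
  ultimately show False using cv by (auto dest: inj_onD)
 qed
 then show ?thesis by (intro that[of c]) (simp add: g_def)
qed

section \<open>Gradings and the parity operator\<close>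

lemma all_bit: "(ALL i::bit. P i) \<longleftrightarrow> P 0 & P 1"
 by (metis bit_not_one_iff)

lemma koszul_simps [simp]: "koszul 0 j = 1" "koszul i 0 = 1" "koszul 1 1 = -1"
 by (auto simp: koszul_def)

lemma koszul_square [simp]: "koszul i j * koszul i j = 1"
 by (simp add: koszul_def)

lemma koszul_mult: "koszul 1 i * koszul 1 j = koszul 1 (i + j)"
 by (cases i; cases j) simp_all

definition parity_map :: "(bit => 'v::complex_vector set) => 'v => 'v" where
 "parity_map V v = component V 0 v - component V 1 v"

lemma totalI: "u : V 0 ==> w : V 1 ==> u + w : total V"
 by (auto simp: total_def)

context
 fixes V :: "bit => 'v::complex_vector set"
 assumes V: "graded_space V"
begin

lemma graded_subspace: "csubspace (V i)"
 using V by (cases i) (auto simp: graded_space_def)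

lemma graded_total: "csubspace (total V)"
 by (rule csubspace_total[OF V])

lemma in_total: "v : V i ==> v : total V"
 using totalI[of v V 0] totalI[of 0 V v] csub_intros(1)[OF graded_subspace]
 by (cases i) simp_all

lemma grades_disjoint: "u : V 0 ==> u : V 1 ==> u = 0"
 using V by (auto simp: graded_space_def)

lemma component_sum:
 assumes "u : V 0" "w : V 1"
 shows "component V 0 (u + w) = u" "component V 1 (u + w) = w"
proof -
 have uniq: "u' = u" if "u' : V 0" "u + w - u' : V 1" for u'
 proof -
  have "u - u' : V 1"
   using cv_subspace_diff[OF graded_subspace that(2) assms(2)] by simp
  then show ?thesis
   using grades_disjoint[of "u - u'"] assms that cv_subspace_diff[OF graded_subspace] by auto
 qed
 have uniq': "w' = w" if "w' : V 1" "u + w - w' : V 0" for w'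
 proof -
  have "w - w' : V 0"
   using cv_subspace_diff[OF graded_subspace that(2) assms(1)] by simp
  then show ?thesis
   using grades_disjoint[of "w - w'"] assms that cv_subspace_diff[OF graded_subspace] by auto
 qed
 show "component V 0 (u + w) = u"
  unfolding component_def by (rule the_equality) (use assms uniq in auto)
 show "component V 1 (u + w) = w"
  unfolding component_def by (rule the_equality) (use assms uniq' in auto)
qed

lemma total_cases:
 assumes "v : total V"
 obtains u w where "u : V 0" "w : V 1" "v = u + w"
 using assms by (auto simp: total_def)

lemma component_homogeneous: "v : V j ==> component V i v = (if i = j then v else 0)"
 using component_sum[of v 0] component_sum[of 0 v] csub_intros(1)[OF graded_subspace]
 by (cases i; cases j) simp_all

lemma component_in: "v : total V ==> component V i v : V i"
 by (cases i) (auto elim!: total_cases simp: component_sum)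

lemma component_add: "v : total V ==> component V 0 v + component V 1 v = v"
 by (auto elim!: total_cases simp: component_sum)

lemma lin_on_component: "linear_on (total V) (component V i)"
 unfolding linear_on_def
proof (intro conjI allI ballI)
 fix x y assume "x : total V" "y : total V"
 then obtain u w u' w' where *: "u : V 0" "w : V 1" "x = u + w" "u' : V 0" "w' : V 1" "y = u' + w'"
  by (metis total_cases)
 then have eq: "x + y = (u + u') + (w + w')" by simp
 have "u + u' : V 0" "w + w' : V 1" using * graded_subspace by (auto intro: csub_intros)
 then show "component V i (x + y) = component V i x + component V i y"
  unfolding eq unfolding *(3,6) using *(1,2,4,5) by (cases i) (simp_all add: component_sum)
next
 fix c x assume "x : total V"
 then obtain u w where *: "u : V 0" "w : V 1" "x = u + w" by (rule total_cases)
 then have "c *C x = c *C u + c *C w" by (simp add: scaleC_add_right)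
 moreover have "c *C u : V 0" "c *C w : V 1" using * graded_subspace by (auto intro: csub_intros)
 ultimately show "component V i (c *C x) = c *C component V i x"
  using * by (cases i) (simp_all add: component_sum)
qed

lemma parity_sum: "u : V 0 ==> w : V 1 ==> parity_map V (u + w) = u - w"
 by (simp add: parity_map_def component_sum)

lemma lin_on_parity: "linear_on (total V) (parity_map V)"
 unfolding parity_map_def by (intro lin_on_arith lin_on_component)

lemma parity_in: "v : total V ==> parity_map V v : total V"
 unfolding parity_map_def
 by (intro cv_subspace_diff graded_total in_total[OF component_in])

lemma parity_parity: "v : total V ==> parity_map V (parity_map V v) = v"
proof (elim total_cases)
 fix u w assume "u : V 0" "w : V 1" "v = u + w"
 moreover from this have "- w : V 1" using graded_subspace by (auto intro: csub_intros)
 ultimately show ?thesis using parity_sum[of u "- w"] by (simp add: parity_sum)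
qed

lemma parity_homogeneous: "v : V i ==> parity_map V v = koszul 1 i *C v"
 using parity_sum[of v 0] parity_sum[of 0 v] csub_intros(1)[OF graded_subspace]
 by (cases i) (simp_all add: scaleC_one)

lemma component_parity: "v : total V ==> component V i v = (1/2) *C (v + koszul 1 i *C parity_map V v)"
proof (elim total_cases)
 fix u w assume uw: "u : V 0" "w : V 1" "v = u + w"
 have "x + x = 2 *C x" for x :: 'v
  by (metis one_add_one scaleC_add_left scaleC_one)
 then have half: "(1/2) *C (x + x) = x" for x :: 'v
  by (simp add: scaleC_scaleC scaleC_one)
 show ?thesis
  using uw half by (cases i) (simp_all add: component_sum parity_sum scaleC_one)
qed

lemma grade_iff_parity: "v : V i \<longleftrightarrow> v : total V & parity_map V v = koszul 1 i *C v"
proof safe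
 assume v: "v : total V" "parity_map V v = koszul 1 i *C v"
 have "v + v = 2 *C v"
  by (metis one_add_one scaleC_add_left scaleC_one)
 then have "component V i v = v"
  unfolding component_parity[OF v(1)] v(2) by (simp add: scaleC_scaleC scaleC_one)
 with component_in[OF v(1)] show "v : V i" by metis
qed (auto simp: parity_homogeneous in_total)

end

lemma parity_of_homogeneous_map:
 assumes "graded_space V" "graded_space W" "linear_on (total V) f"
  and "!!j. f ` V j \<subseteq> W (i + j)" and "v : total V"
 shows "parity_map W (f v) = koszul 1 i *C f (parity_map V v)"
proof -
 obtain u w where v: "u : V 0" "w : V 1" "v = u + w"
  using assms(5) by (auto simp: total_def)
 have fuw: "f u : W (i + 0)" "f w : W (i + 1)" using assms(4) v by blast+
 have uw: "u : total V" "w : total V" using v in_total[OF assms(1)] by blast+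
 have fv: "f (u + w) = f u + f w" "f (u - w) = f u - f w"
  using lin_on_add[OF assms(3) uw] lin_on_diff[OF assms(3) graded_total[OF assms(1)] uw] by auto
 have "parity_map W (f u + f w) = parity_map W (f u) + parity_map W (f w)"
  using lin_on_add[OF lin_on_parity[OF assms(2)]] fuw in_total[OF assms(2)] by blast
 also have "\<dots> = koszul 1 i *C (f u - f w)"
  unfolding parity_homogeneous[OF assms(2) fuw(1)] parity_homogeneous[OF assms(2) fuw(2)]
  by (cases i) (simp_all add: scaleC_one)
 finally show ?thesis
  using v fv by (simp add: parity_sum[OF assms(1)])
qed

lemma homogeneous_map_of_parity:
 assumes "graded_space V" "graded_space W" "!!v. v : total V ==> f v : total W"
  and "linear_on (total V) f"
  and "!!v. v : total V ==> parity_map W (f v) = koszul 1 i *C f (parity_map V v)"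
 shows "f ` V j \<subseteq> W (i + j)"
proof safe
 fix v assume v: "v : V j"
 then have vt: "v : total V" by (rule in_total[OF assms(1)])
 have "parity_map W (f v) = koszul 1 (i + j) *C f v"
  using assms(5)[OF vt] lin_on_scale[OF assms(4) vt]
  by (simp add: parity_homogeneous[OF assms(1) v] scaleC_scaleC koszul_mult)
 then show "f v : W (i + j)"
  using grade_iff_parity[OF assms(2)] assms(3)[OF vt] by blast
qed

lemma graded_part:
 assumes V: "graded_space V" and W: "csubspace W" "W \<subseteq> total V" "parity_map V ` W \<subseteq> W"
 shows "graded_space (%i. W \<inter> V i)" "total (%i. W \<inter> V i) = W"
  "!!v i. v : W ==> component (%i. W \<inter> V i) i v = component V i v"
  "!!v. v : W ==> parity_map (%i. W \<inter> V i) v = parity_map V v"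
proof -
 show g: "graded_space (%i. W \<inter> V i)"
  using V W(1) unfolding graded_space_def
  by (auto intro: complex_vector.subspace_inter csub_intros)
 have comp: "component V i v : W \<inter> V i" if "v : W" for i v
 proof -
  have "v : total V" using that W by blast
  moreover have "(1/2) *C (v + koszul 1 i *C parity_map V v) : W"
   using that W by (intro csub_intros(5) csub_intros(2) W(1)) auto
  ultimately show ?thesis using component_in[OF V] component_parity[OF V] by auto
 qed
 then have dec: "v = component V 0 v + component V 1 v" if "v : W" for v
  using that W(2) component_add[OF V] by (metis subsetD)
 show "total (%i. W \<inter> V i) = W"
 proof
  show "total (%i. W \<inter> V i) \<subseteq> W" using W(1) by (auto simp: total_def intro: csub_intros)
  show "W \<subseteq> total (%i. W \<inter> V i)"
   using comp dec unfolding total_def by blast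
 qed
 show c: "component (%i. W \<inter> V i) i v = component V i v" if "v : W" for v i
  using component_sum[OF g, of "component V 0 v" "component V 1 v"] comp[OF that] dec[OF that]
  by (cases i) auto
 show "parity_map (%i. W \<inter> V i) v = parity_map V v" if "v : W" for v
  using c[OF that] by (simp add: parity_map_def)
qed

lemma parity_stable_of_total:
 assumes V: "graded_space V" and W: "csubspace W" "W = total (%i. W \<inter> V i)"
 shows "W \<subseteq> total V" "parity_map V ` W \<subseteq> W"
proof -
 have *: "EX u w. v = u + w & u : W \<inter> V 0 & w : W \<inter> V 1" if "v : W" for v
  using that W(2) unfolding total_def by blast
 then show "W \<subseteq> total V" unfolding total_def by blast
 show "parity_map V ` W \<subseteq> W"
 proof safe
  fix v assume "v : W"
  with * obtain u w where "v = u + w" "u : W \<inter> V 0" "w : W \<inter> V 1" by blast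
  then show "parity_map V v : W" using W(1) by (auto simp: parity_sum[OF V] intro: csub_intros)
 qed
qed

section \<open>Supermodules as families of operators\<close>

definition indices :: "'g superalgebra => 'g option set" where
 "indices G = insert None (Some ` (grade G 0 \<union> grade G 1))"

definition ops :: "('g, 'v::complex_vector) supermodule => 'g option => 'v => 'v" where
 "ops M i = (case i of None => parity_map (mgrade M) | Some x => act M x)"

lemma ops_simps [simp]: "ops M None = parity_map (mgrade M)" "ops M (Some x) = act M x"
 by (simp_all add: ops_def)

lemma ball_indices: "(ALL i:indices G. P i) \<longleftrightarrow> P None & (ALL j. ALL x:grade G j. P (Some x))"
 by (auto simp: indices_def all_bit)

lemma smodD:
 assumes "is_supermodule G M"
 shows "graded_space (mgrade M)" "csubspace (space M)"
  "!!v. v : space M ==> linear_on (underlying G) (%x. act M x v)"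
  "!!x. x : underlying G ==> linear_on (space M) (act M x)"
  "!!i j x v. x : grade G i ==> v : mgrade M j ==> act M x v : mgrade M (i + j)"
  "!!i j x y v. x : grade G i ==> y : grade G j ==> v : space M ==>
    act M (bracket G x y) v = act M x (act M y v) - koszul i j *C act M y (act M x v)"
 using assms unfolding is_supermodule_def bilinear_on_def by (auto intro: csubspace_total)

lemma act_in_homogeneous:
 assumes M: "is_supermodule G M" and G: "graded_space (grade G)" and x: "x : grade G i" and v: "v : space M"
 shows "act M x v : space M"
proof -
 obtain u w where uw: "u : mgrade M 0" "w : mgrade M 1" "v = u + w"
  by (rule total_cases[OF smodD(1)[OF M] v])
 note t = in_total[OF smodD(1)[OF M]]
 have "act M x v = act M x u + act M x w"
  using lin_on_add[OF smodD(4)[OF M in_total[OF G x]]] uw t by blast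
 then show ?thesis
  using smodD(5)[OF M x] uw t csub_intros(2)[OF smodD(2)[OF M]] by metis
qed

lemma act_decompose:
 assumes M: "is_supermodule G M" and G: "graded_space (grade G)" and x: "x : underlying G" and v: "v : space M"
 shows "act M x v = act M (component (grade G) 0 x) v + act M (component (grade G) 1 x) v"
 using lin_on_add[OF smodD(3)[OF M v] in_total[OF G component_in[OF G x]] in_total[OF G component_in[OF G x]]]
  component_add[OF G x] by metis

lemma act_in:
 assumes M: "is_supermodule G M" and G: "graded_space (grade G)" and x: "x : underlying G" and v: "v : space M"
 shows "act M x v : space M"
 unfolding act_decompose[OF assms]
 by (intro csub_intros(2) smodD(2)[OF M] act_in_homogeneous[OF M G component_in[OF G x] v])

lemma act_parity:
 assumes M: "is_supermodule G M" and G: "graded_space (grade G)" and x: "x : grade G i" and v: "v : space M"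
 shows "parity_map (mgrade M) (act M x v) = koszul 1 i *C act M x (parity_map (mgrade M) v)"
 using parity_of_homogeneous_map[OF smodD(1)[OF M] smodD(1)[OF M]
   smodD(4)[OF M in_total[OF G x]] _ v]
  smodD(5)[OF M x] by blast

lemma supermodule_operators:
 assumes "is_supermodule G M" "graded_space (grade G)"
 shows "operators (indices G) (ops M) (space M)"
 unfolding operators_def ball_indices
 using smodD[OF assms(1)] assms
 by (auto simp: lin_on_parity parity_in in_total act_in_homogeneous)

lemma graded_submodule_iff:
 assumes M: "is_supermodule G M" and G: "graded_space (grade G)"
 shows "graded_submodule G M W \<longleftrightarrow> W \<subseteq> space M & stable (indices G) (ops M) W"
proof
 assume *: "graded_submodule G M W"
 then show "W \<subseteq> space M & stable (indices G) (ops M) W"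
  using parity_stable_of_total[OF smodD(1)[OF M], of W] in_total[OF G]
  unfolding graded_submodule_def stable_def ball_indices by (simp add: image_subset_iff)
next
 assume *: "W \<subseteq> space M & stable (indices G) (ops M) W"
 then have W: "csubspace W" "W \<subseteq> space M" "parity_map (mgrade M) ` W \<subseteq> W"
  "!!j x. x : grade G j ==> act M x ` W \<subseteq> W"
  unfolding stable_def ball_indices by auto
 have "act M x w : W" if "x : underlying G" "w : W" for x w
 proof -
  have "w : space M" using that W by blast
  moreover have "act M (component (grade G) i x) w : W" for i
   using W(4)[OF component_in[OF G that(1)]] that(2) by blast
  ultimately show ?thesis
   using act_decompose[OF M G that(1)] csub_intros(2)[OF W(1)] by metis
 qed
 then show "graded_submodule G M W"
  unfolding graded_submodule_def using W graded_part(2)[OF smodD(1)[OF M] W(1-3)] by auto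
qed

lemma irreducible_iff:
 assumes G: "graded_space (grade G)"
 shows "irreducible_supermodule G M \<longleftrightarrow>
  is_supermodule G M & irreducible_family (indices G) (ops M) (space M)"
 using supermodule_operators[OF _ G, of M] graded_submodule_iff[OF _ G, of M]
 unfolding irreducible_supermodule_def irreducible_family_def by blast

definition restrict :: "('g, 'v::complex_vector) supermodule => 'v set => ('g, 'v) supermodule" where
 "restrict M W = M\<lparr>mgrade := (%i. W \<inter> mgrade M i)\<rparr>"

lemma restrict:
 assumes M: "is_supermodule G M" and G: "graded_space (grade G)"
  and W: "W \<subseteq> space M" "stable (indices G) (ops M) W"
 shows "space (restrict M W) = W" "is_supermodule G (restrict M W)"
  "act (restrict M W) = act M"
  "!!v. v : W ==> parity_map (mgrade (restrict M W)) v = parity_map (mgrade M) v"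
proof -
 have W': "csubspace W" "W \<subseteq> space M" "parity_map (mgrade M) ` W \<subseteq> W"
  "!!j x. x : grade G j ==> act M x ` W \<subseteq> W"
  using W unfolding stable_def ball_indices by auto
 note g = graded_part[OF smodD(1)[OF M] W'(1-3)]
 show s: "space (restrict M W) = W" using g(2) by (simp add: restrict_def)
 show a: "act (restrict M W) = act M" by (simp add: restrict_def)
 show "!!v. v : W ==> parity_map (mgrade (restrict M W)) v = parity_map (mgrade M) v"
  using g(4) by (simp add: restrict_def)
 show "is_supermodule G (restrict M W)"
  unfolding is_supermodule_def s a bilinear_on_def
 proof (intro conjI ballI allI)
  show "graded_space (mgrade (restrict M W))" using g(1) by (simp add: restrict_def)
  show "linear_on (underlying G) (%v. act M v w)" if "w : W" for w
   using smodD(3)[OF M] that W by blast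
  show "linear_on W (act M x)" if "x : underlying G" for x
   using lin_on_subset[OF smodD(4)[OF M that] W(1)] .
  show "act M x v : mgrade (restrict M W) (i + j)"
   if "x : grade G i" "v : mgrade (restrict M W) j" for i j x v
   using that W'(4)[OF that(1)] smodD(5)[OF M that(1)] by (auto simp: restrict_def)
  show "act M (bracket G x y) v = act M x (act M y v) - koszul i j *C act M y (act M x v)"
   if "x : grade G i" "y : grade G j" "v : W" for i j x y v
   using smodD(6)[OF M that(1,2)] that W by blast
 qed
qed

lemma stable_cong:
 "(!!i w. i : I ==> w : W ==> a i w = b i w) ==> stable I a W \<longleftrightarrow> stable I b W"
 unfolding stable_def by (simp add: image_subset_iff)

lemma restrict_irreducible:
 assumes M: "is_supermodule G M" and G: "graded_space (grade G)"
  and W: "W \<subseteq> space M" "irreducible_family (indices G) (ops M) W"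
 shows "irreducible_supermodule G (restrict M W)"
proof -
 have st: "stable (indices G) (ops M) W"
  using operators_stable irr_famD(1)[OF W(2)] by blast
 note R = restrict[OF M G W(1) st]
 have "stable (indices G) (ops (restrict M W)) U \<longleftrightarrow> stable (indices G) (ops M) U" if "U \<subseteq> W" for U
  by (rule stable_cong) (use that R in \<open>auto simp: ops_def split: option.split\<close>)
 then have "irreducible_family (indices G) (ops (restrict M W)) W"
  using W(2) supermodule_operators[OF R(2) G]
  unfolding irreducible_family_def R(1) by blast
 then show ?thesis using R unfolding irreducible_iff[OF G] by simp
qed

section \<open>Homomorphisms that need not be homogeneous\<close>

definition mhom_on ::
 "'g::complex_vector superalgebra => ('g, 'v::complex_vector) supermodule =>
  ('g, 'w::complex_vector) supermodule => ('v => 'w) => bool" where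
 "mhom_on G M N f \<longleftrightarrow> linear_on (space M) f & f ` space M \<subseteq> space N &
   (ALL x:underlying G. ALL v:space M. f (act M x v) = act N x (f v))"

definition occurs ::
 "'g::complex_vector superalgebra => ('g, 'v::complex_vector) supermodule =>
  ('g, 'w::complex_vector) supermodule => bool" where
 "occurs G M N \<longleftrightarrow> (EX f. mhom_on G M N f & (EX v:space M. f v ~= 0))"

lemma mhomD:
 assumes "mhom_on G M N f"
 shows "linear_on (space M) f" "!!v. v : space M ==> f v : space N"
  "!!x v. x : underlying G ==> v : space M ==> f (act M x v) = act N x (f v)"
 using assms unfolding mhom_on_def by auto

lemma module_hom_compose:
 "mhom_on G M N f ==> mhom_on G N P g ==> mhom_on G M P (%v. g (f v))"
 unfolding mhom_on_def by (auto intro: lin_on_compose simp: image_subset_iff)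

lemma module_hom_onI:
 assumes M: "is_supermodule G M" and N: "is_supermodule G N" and G: "graded_space (grade G)"
  and f: "linear_on (space M) f" "!!v. v : space M ==> f v : space N"
  and comm: "!!i x v. x : grade G i ==> v : space M ==> f (act M x v) = act N x (f v)"
 shows "mhom_on G M N f"
 unfolding mhom_on_def
proof (intro conjI ballI)
 show "linear_on (space M) f" by fact
 show "f ` space M \<subseteq> space N" using f(2) by blast
 fix x v assume x: "x : underlying G" and v: "v : space M"
 note c = component_in[OF G x]
 have "f (act M x v) = f (act M (component (grade G) 0 x) v) + f (act M (component (grade G) 1 x) v)"
  unfolding act_decompose[OF M G x v]
  by (intro lin_on_add[OF f(1)] act_in_homogeneous[OF M G c v])
 also have "\<dots> = act N x (f v)"
  unfolding act_decompose[OF N G x f(2)[OF v]] comm[OF c v] ..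
 finally show "f (act M x v) = act N x (f v)" .
qed

lemma module_hom_even:
 assumes M: "is_supermodule G M" and N: "is_supermodule G N" and G: "graded_space (grade G)"
 shows "intertwines (indices G) (ops M) (space M) (ops N) (space N) f \<longleftrightarrow>
  mhom_on G M N f & (ALL v:space M. f (parity_map (mgrade M) v) = parity_map (mgrade N) (f v))"
  (is "?L \<longleftrightarrow> ?R")
proof
 assume ?L
 then show ?R
  using module_hom_onI[OF M N G, of f] unfolding intertwines_def ball_indices by auto
next
 assume ?R
 then show ?L
  using in_total[OF G] unfolding intertwines_def ball_indices mhom_on_def by auto
qed

lemma module_iso_iff: "module_iso G M N \<longleftrightarrow> (EX f. mhom_on G M N f & bij_betw f (space M) (space N))"
 unfolding module_iso_def mhom_on_def by (auto simp: bij_betw_def)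

text \<open>The even and the odd part of a homomorphism \<open>f\<close> are again homomorphisms; a nonzero one of the two
  is injective by Schur's lemma.\<close>

lemma homogeneous_hom_from_irreducible:
 assumes M: "irreducible_supermodule G M" and N: "is_supermodule G N" and G: "graded_space (grade G)"
  and "occurs G M N"
 obtains g k where "mhom_on G M N g" "inj_on g (space M)"
  "irreducible_supermodule G N --> bij_betw g (space M) (space N)"
  "!!v. v : space M ==> parity_map (mgrade N) (g v) = koszul 1 k *C g (parity_map (mgrade M) v)"
proof -
 obtain f v where f: "mhom_on G M N f" and v: "v : space M" "f v ~= 0"
  using assms(4) unfolding occurs_def by blast
 have M': "is_supermodule G M" "irreducible_family (indices G) (ops M) (space M)"
  using M irreducible_iff[OF G] by blast+
 let ?s = "parity_map (mgrade M)" and ?t = "parity_map (mgrade N)"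
 note gM = smodD(1)[OF M'(1)] and gN = smodD(1)[OF N]
 note fD = mhomD[OF f]
 define h where "h = (%k v. f v + koszul 1 k *C ?t (f (?s v)))"
 have lin: "linear_on (space M) (h k)" for k
  unfolding h_def using fD lin_on_parity[OF gM] lin_on_parity[OF gN] parity_in[OF gM]
  by (intro lin_on_arith lin_on_compose[where f = "%v. f (?s v)" and g = ?t and W = "space N"]
    lin_on_compose[where f = ?s and g = f and W = "space M"]) auto
 have into: "h k v : space N" if "v : space M" for k v
  unfolding h_def using that fD parity_in[OF gM] parity_in[OF gN] smodD(2)[OF N]
  by (intro csub_intros) auto
 have par: "?t (h k v) = koszul 1 k *C h k (?s v)" if "v : space M" for k v
 proof -
  have "?t (h k v) = ?t (f v) + koszul 1 k *C ?t (?t (f (?s v)))"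
   unfolding h_def using that fD parity_in[OF gM] parity_in[OF gN] smodD(2)[OF N]
   by (simp add: lin_on_add[OF lin_on_parity[OF gN]] lin_on_scale[OF lin_on_parity[OF gN]]
    csub_intros)
  then show ?thesis
   using that fD parity_in[OF gM]
   by (simp add: h_def parity_parity[OF gN] parity_parity[OF gM] scaleC_add_right scaleC_scaleC)
 qed
 have comm: "h k (act M x v) = act N x (h k v)" if x: "x : grade G i" and v: "v : space M" for i k x v
 proof -
  have xu: "x : underlying G" by (rule in_total[OF G x])
  have "?t (f (?s (act M x v))) = act N x (?t (f (?s v)))"
  proof -
   have "f (?s (act M x v)) = koszul 1 i *C act N x (f (?s v))"
    unfolding act_parity[OF M'(1) G x v] using fD xu v
    by (simp add: lin_on_scale act_in_homogeneous[OF M'(1) G x] parity_in[OF gM])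
   then have "?t (f (?s (act M x v))) = koszul 1 i *C ?t (act N x (f (?s v)))"
    using v fD by (simp add: lin_on_scale[OF lin_on_parity[OF gN]] act_in_homogeneous[OF N G x] parity_in[OF gM])
   also have "\<dots> = act N x (?t (f (?s v)))"
    using act_parity[OF N G x, of "f (?s v)"] v fD parity_in[OF gM] by (simp add: scaleC_scaleC scaleC_one)
   finally show ?thesis .
  qed
  then show ?thesis
   using v fD xu parity_in[OF gM] parity_in[OF gN] smodD(2)[OF N]
   by (simp add: h_def lin_on_add[OF smodD(4)[OF N xu]] lin_on_scale[OF smodD(4)[OF N xu]] csub_intros)
 qed
 have hom: "mhom_on G M N (h k)" for k
  by (rule module_hom_onI[OF M'(1) N G lin into comm])
 have "h 0 v + h 1 v = f v + f v" by (simp add: h_def scaleC_one)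
 moreover have "f v + f v ~= 0"
 proof -
  have "f v + f v = 2 *C f v" by (metis one_add_one scaleC_add_left scaleC_one)
  with v show ?thesis by simp
 qed
 ultimately obtain k where k: "h k v ~= 0" by (metis add_0)
 define b where "b = (%i w. case i of None => koszul 1 k *C ?t w | Some x => act N x w)"
 have int: "intertwines (indices G) (ops M) (space M) b (space N) (h k)"
  unfolding intertwines_def ball_indices
 proof (intro conjI ballI allI)
  show "linear_on (space M) (h k)" "h k ` space M \<subseteq> space N" using lin into by blast+
  show "h k (ops M None v) = b None (h k v)" if "v : space M" for v
   by (simp add: b_def par[OF that] scaleC_scaleC scaleC_one)
  show "h k (ops M (Some x) v) = b (Some x) (h k v)" if "x : grade G j" "v : space M" for j x v
   by (simp add: b_def comm[OF that])
 qed
 have st: "stable (indices G) b W \<longleftrightarrow> stable (indices G) (ops N) W" for W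
 proof (cases "csubspace W")
  case True
  then have "(%w. koszul 1 k *C ?t w) ` W \<subseteq> W \<longleftrightarrow> ?t ` W \<subseteq> W"
   using cv_subspace_neg[OF True]
   by (cases k) (auto simp: scaleC_one image_subset_iff, metis minus_minus)
  then show ?thesis unfolding stable_def ball_indices by (simp add: b_def)
 qed (simp add: stable_def)
 have opN: "operators (indices G) b (space N)"
  using supermodule_operators[OF N G] st[of "space N"] operators_stable
  unfolding operators_def stable_def ball_indices
  by (auto simp: b_def intro!: lin_on_arith)
 show ?thesis
 proof (rule that[OF hom _ _ par])
  show "inj_on (h k) (space M)"
   by (rule Schur_inj[OF int M'(2) opN v(1) k])
  show "irreducible_supermodule G N --> bij_betw (h k) (space M) (space N)"
  proof
   assume "irreducible_supermodule G N"
   then have "irreducible_family (indices G) b (space N)"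
    using opN st unfolding irreducible_iff[OF G] irreducible_family_def by blast
   from Schur_bij[OF int M'(2) this v(1) k]
   show "bij_betw (h k) (space M) (space N)" .
  qed
 qed
qed

lemma nonzero_hom_from_irreducible:
 assumes "irreducible_supermodule G M" "is_supermodule G N" "graded_space (grade G)" "occurs G M N"
 obtains g where "mhom_on G M N g" "inj_on g (space M)"
  "irreducible_supermodule G N --> bij_betw g (space M) (space N)"
 using homogeneous_hom_from_irreducible[OF assms] by metis

lemma irreducible_nonzero:
 assumes "irreducible_supermodule G M"
 obtains v where "v : space M" "v ~= 0"
proof -
 have "space M ~= {0}" "0 : space M"
  using assms smodD(2)[of G M] cv_subspace_0
  unfolding irreducible_supermodule_def by blast+
 then show ?thesis using that by blast
qed

lemma irr_smod: "irreducible_supermodule G M ==> is_supermodule G M"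
 by (simp add: irreducible_supermodule_def)

lemma module_iso_imp_occurs:
 assumes "module_iso G M N" "irreducible_supermodule G M"
 shows "occurs G M N"
proof -
 obtain f where f: "mhom_on G M N f" "bij_betw f (space M) (space N)"
  using assms(1) module_iso_iff by blast
 obtain v where v: "v : space M" "v ~= 0" by (rule irreducible_nonzero[OF assms(2)])
 note sub = smodD(2)[OF irr_smod[OF assms(2)]]
 have "inj_on f (space M)" using f(2) by (simp add: bij_betw_def)
 then have "f v ~= 0"
  using inj_onD[of f "space M" v 0] v lin_on_0[OF mhomD(1)[OF f(1)] sub]
   cv_subspace_0[OF sub] by auto
 with f v show ?thesis unfolding occurs_def by blast
qed

lemma occurs_iff_iso:
 assumes "irreducible_supermodule G M" "irreducible_supermodule G N" "graded_space (grade G)"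
 shows "occurs G M N \<longleftrightarrow> module_iso G M N"
proof
 assume o: "occurs G M N"
 obtain g where "mhom_on G M N g" "inj_on g (space M)"
  "irreducible_supermodule G N --> bij_betw g (space M) (space N)"
  by (rule nonzero_hom_from_irreducible[OF assms(1) irr_smod[OF assms(2)] assms(3) o])
 with assms(2) show "module_iso G M N" unfolding module_iso_iff by blast
qed (rule module_iso_imp_occurs[OF _ assms(1)])

lemma occurs_trans_injective:
 assumes "occurs G M N" "mhom_on G N P g" "!!v. v : space N ==> v ~= 0 ==> g v ~= 0"
 shows "occurs G M P"
proof -
 obtain f v where "mhom_on G M N f" "v : space M" "f v ~= 0"
  using assms(1) unfolding occurs_def by blast
 then show ?thesis
  using module_hom_compose[OF _ assms(2), of M f] assms(3) mhomD(2)[of G M N f v]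
  unfolding occurs_def by blast
qed

lemma inj_on_nonzero:
 assumes "inj_on g V" "linear_on V g" "csubspace V" "v : V" "v ~= 0"
 shows "g v ~= 0"
 using inj_onD[OF assms(1), of v 0] assms(4,5) lin_on_0[OF assms(2,3)]
  cv_subspace_0[OF assms(3)] by auto

lemma occurs_trans:
 assumes "occurs G M N" "irreducible_supermodule G N" "is_supermodule G P" "graded_space (grade G)" "occurs G N P"
 shows "occurs G M P"
proof -
 obtain g where g: "mhom_on G N P g" "inj_on g (space N)"
  "irreducible_supermodule G P --> bij_betw g (space N) (space P)"
  by (rule nonzero_hom_from_irreducible[OF assms(2-5)])
 show ?thesis
  by (rule occurs_trans_injective[OF assms(1) g(1)])
   (use inj_on_nonzero[OF g(2) mhomD(1)[OF g(1)] smodD(2)[OF irr_smod[OF assms(2)]]] in blast)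
qed

lemma module_iso_refl: "module_iso G M M"
 unfolding module_iso_def
 by (rule exI[of _ "%v. v"]) (simp add: lin_on_arith(5) bij_betw_def)

lemma lin_on_inv_into:
 assumes "linear_on V f" "csubspace V" "bij_betw f V W"
 shows "linear_on W (inv_into V f)"
proof -
 have *: "inv_into V f w : V" "f (inv_into V f w) = w" if "w : W" for w
  using assms(3) that by (auto simp: bij_betw_def inv_into_into f_inv_into_f)
 have inv: "inv_into V f (f v) = v" if "v : V" for v
  using assms(3) that by (simp add: bij_betw_def)
 show ?thesis
  unfolding linear_on_def
 proof (intro conjI ballI allI)
  fix x y assume xy: "x : W" "y : W"
  have "inv_into V f (f (inv_into V f x + inv_into V f y)) = inv_into V f x + inv_into V f y"
   using * xy assms(2) by (intro inv csub_intros) auto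
  then show "inv_into V f (x + y) = inv_into V f x + inv_into V f y"
   using * xy by (simp add: lin_on_add[OF assms(1)])
 next
  fix c x assume x: "x : W"
  have "inv_into V f (f (c *C inv_into V f x)) = c *C inv_into V f x"
   using * x assms(2) by (intro inv csub_intros) auto
  then show "inv_into V f (c *C x) = c *C inv_into V f x"
   using * x by (simp add: lin_on_scale[OF assms(1)])
 qed
qed

lemma module_iso_sym:
 assumes "module_iso G M N" "is_supermodule G M" "graded_space (grade G)"
 shows "module_iso G N M"
proof -
 obtain f where f: "mhom_on G M N f" "bij_betw f (space M) (space N)"
  using assms(1) module_iso_iff by blast
 let ?g = "inv_into (space M) f"
 have g: "bij_betw ?g (space N) (space M)" by (rule bij_betw_inv_into[OF f(2)])
 have *: "?g w : space M" "f (?g w) = w" if "w : space N" for w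
  using f(2) that by (auto simp: bij_betw_def inv_into_into f_inv_into_f)
 have "?g (act N x v) = act M x (?g v)" if "x : underlying G" "v : space N" for x v
 proof -
  have "act M x (?g v) : space M" using act_in[OF assms(2,3) that(1)] * that by blast
  then have "?g (f (act M x (?g v))) = act M x (?g v)"
   using f(2) by (simp add: bij_betw_def)
  then show ?thesis using mhomD(3)[OF f(1) that(1)] * that by simp
 qed
 then show ?thesis
  unfolding module_iso_def
  using g lin_on_inv_into[OF mhomD(1)[OF f(1)] smodD(2)[OF assms(2)] f(2)] by blast
qed

lemma module_iso_trans:
 assumes "module_iso G M N" "module_iso G N P"
 shows "module_iso G M P"
proof -
 obtain f where f: "mhom_on G M N f" "bij_betw f (space M) (space N)"
  using assms(1) module_iso_iff by blast
 obtain g where g: "mhom_on G N P g" "bij_betw g (space N) (space P)"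
  using assms(2) module_iso_iff by blast
 have "bij_betw (%v. g (f v)) (space M) (space P)"
  using bij_betw_trans[OF f(2) g(2)] by (simp add: comp_def)
 with module_hom_compose[OF f(1) g(1)] show ?thesis unfolding module_iso_iff by blast
qed

lemma exists_irreducible_submodule:
 assumes M: "is_supermodule G M" and G: "graded_space (grade G)"
  and "finite_dimensional (space M)" "space M ~= {0}"
 obtains W where "W \<subseteq> space M" "irreducible_supermodule G (restrict M W)"
  "space (restrict M W) = W" "mhom_on G (restrict M W) M (%v. v)"
proof -
 obtain W where W: "W \<subseteq> space M" "irreducible_family (indices G) (ops M) W"
  by (rule exists_irreducible_subspace[OF supermodule_operators[OF M G] assms(3,4)])
 have st: "stable (indices G) (ops M) W"
  using operators_stable irr_famD(1)[OF W(2)] by blast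
 note R = restrict[OF M G W(1) st]
 have "mhom_on G (restrict M W) M (%v. v)"
  unfolding mhom_on_def R(1,3) using W(1) lin_on_arith(5) by auto
 with W R restrict_irreducible[OF M G W] show ?thesis by (intro that[of W])
qed

section \<open>Tensor products of operators\<close>

definition tensor_space :: "'v::complex_vector set => 'w::complex_vector set => ('v, 'w) tensor set" where
 "tensor_space V W = cspan {v **C w | v w. v : V & w : W}"

definition tensor_map ::
 "'v::complex_vector set => 'w::complex_vector set => ('v => 'x::complex_vector) =>
  ('w => 'y::complex_vector) => ('v, 'w) tensor => ('x, 'y) tensor" where
 "tensor_map V W f g = tensor_lift V W (%v w. f v **C g w)"

lemma tensor_zero [simp]: "0 **C w = 0" "v **C 0 = 0"
 using tens_bilinear(3)[of 0 v w] tens_bilinear(4)[of v 0 w] tens_bilinear(3)[of 0 0 w] tens_bilinear(4)[of v 0 0] by simp_all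

lemma tensor_neg: "(- v) **C w = - (v **C w)" "v **C (- w) = - (v **C w)"
 using tens_bilinear(3)[of "-1" v w] tens_bilinear(4)[of v "-1" w] by (simp_all add: scaleC_one)

lemma tensor_diff: "(v - v') **C w = v **C w - v' **C w" "v **C (w - w') = v **C w - v **C w'"
 using tens_bilinear(1)[of v "- v'" w] tens_bilinear(2)[of v w "- w'"] by (simp_all add: tensor_neg)

lemma tensor_sum_right: "v **C (\<Sum>i\<in>I. w i) = (\<Sum>i\<in>I. v **C w i)"
 by (induction I rule: infinite_finite_induct) (simp_all add: tens_bilinear)

lemma tensor_sum_left: "(\<Sum>i\<in>I. v i) **C w = (\<Sum>i\<in>I. v i **C w)"
 by (induction I rule: infinite_finite_induct) (simp_all add: tens_bilinear)

lemma bilinear_tensor: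
 "linear_on V f ==> linear_on W g ==> bilinear_on V W (%v w. f v **C g w)"
 by (auto simp: bilinear_on_def linear_on_def tens_bilinear)

lemma clinear_tensor_lift:
 assumes "csubspace V" "csubspace W" "bilinear_on V W B"
 shows "clinear (tensor_lift V W B)"
 using someI_ex[OF tensor_lift_exists[OF assms]] unfolding tensor_lift_def by blast

lemma cs_tensor_space: "csubspace (tensor_space V W)"
 by (simp add: tensor_space_def)

lemma tensor_in_space: "v : V ==> w : W ==> v **C w : tensor_space V W"
 unfolding tensor_space_def by (rule cv_span_base) blast

lemma tensor_space_subset:
 assumes "csubspace U" "!!v w. v : V ==> w : W ==> v **C w : U"
 shows "tensor_space V W \<subseteq> U"
 unfolding tensor_space_def using assms by (intro cv_span_minimal) auto

lemma tensor_space_UNIV: "tensor_space UNIV UNIV = UNIV"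
proof -
 have "t : tensor_space UNIV UNIV" for t :: "('a, 'b) tensor"
 proof (induct t rule: tensor.abs_induct)
  fix p :: "('a \<times> 'b) \<Rightarrow>\<^sub>0 complex"
  have *: "abs_tensor (Poly_Mapping.single k c) : (tensor_space UNIV UNIV :: ('a, 'b) tensor set)" for k c
  proof -
   obtain v w where k: "k = (v, w)" by (cases k)
   have "Poly_Mapping.single k c = c *C Poly_Mapping.single k 1"
    by (rule poly_mapping_eqI) (simp add: lookup_scaleC lookup_single scaleC_complex_def when_def)
   then have "abs_tensor (Poly_Mapping.single k c) = c *C (v **C w)"
    by (simp add: scaleC_tensor.abs_eq tens.abs_eq k)
   then show ?thesis
    by (simp add: cv_subspace_scale cs_tensor_space tensor_in_space)
  qed
  show "abs_tensor p : tensor_space UNIV UNIV"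
  proof (induction p rule: update_induct)
   case const
   show ?case
    using cv_subspace_0[OF cs_tensor_space] by (simp add: zero_tensor.abs_eq[symmetric])
  next
   case (update f a b)
   have "Poly_Mapping.update a b f = f + Poly_Mapping.single a b"
    using update by (intro poly_mapping_eqI) (auto simp: lookup_update lookup_add lookup_single in_keys_iff when_def)
   then show ?case
    using update * by (simp add: plus_tensor.abs_eq[symmetric] cv_subspace_add cs_tensor_space)
  qed
 qed
 then show ?thesis by blast
qed

lemma tensor_linear_maps_into:
 assumes "linear_on (tensor_space V W) L" "csubspace U"
  and "!!v w. v : V ==> w : W ==> L (v **C w) : U" and "t : tensor_space V W"
 shows "L t : U"
 using tensor_space_subset[OF csubspace_preimage[OF assms(1) cs_tensor_space assms(2)], of V W]
  assms(3,4) tensor_in_space by blast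

lemma tensor_linear_ext:
 assumes "linear_on (tensor_space V W) L" "linear_on (tensor_space V W) L'"
  and "!!v w. v : V ==> w : W ==> L (v **C w) = L' (v **C w)" and "t : tensor_space V W"
 shows "L t = L' t"
 using tensor_linear_maps_into[OF lin_on_arith(2)[OF assms(1,2)] cv_subspace_single_0, of t]
  assms(3,4) by simp

lemma finite_dimensional_tensor:
 assumes "finite_dimensional V" "csubspace V" "finite_dimensional W" "csubspace W"
 shows "finite_dimensional (tensor_space V W)"
proof -
 obtain B where B: "finite B" "B \<subseteq> V" "complex_vector.independent B" "cspan B = V"
  by (rule finite_dimensional_basis[OF assms(1,2)])
 obtain C where C: "finite C" "C \<subseteq> W" "complex_vector.independent C" "cspan C = W"
  by (rule finite_dimensional_basis[OF assms(3,4)])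
 let ?S = "cspan ((%(b, c). b **C c) ` (B \<times> C))"
 have 1: "b **C w : ?S" if "b : B" "w : W" for b w
 proof -
  have "csubspace {w. b **C w : ?S}"
   by (auto simp: cv_subspace_def tens_bilinear intro: cv_span_add cv_span_scale cv_span_zero)
  moreover have "C \<subseteq> {w. b **C w : ?S}" using that by (auto intro!: cv_span_base)
  ultimately have "cspan C \<subseteq> {w. b **C w : ?S}" by (intro cv_span_minimal)
  with that C show ?thesis by blast
 qed
 have "v **C w : ?S" if "v : V" "w : W" for v w
 proof -
  have "csubspace {v. v **C w : ?S}"
   by (auto simp: cv_subspace_def tens_bilinear intro: cv_span_add cv_span_scale cv_span_zero)
  moreover have "B \<subseteq> {v. v **C w : ?S}" using 1 that by blast
  ultimately have "cspan B \<subseteq> {v. v **C w : ?S}" by (intro cv_span_minimal)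
  with that B show ?thesis by blast
 qed
 then have "tensor_space V W \<subseteq> ?S" by (intro tensor_space_subset) auto
 moreover have "finite ((%(b, c). b **C c) ` (B \<times> C))" using B C by simp
 ultimately show ?thesis unfolding finite_dimensional_def by blast
qed

lemma
 assumes "csubspace V" "csubspace W" "linear_on V f" "linear_on W g"
 shows clinear_tensor_map: "clinear (tensor_map V W f g)"
  and tensor_map_tens: "v : V ==> w : W ==> tensor_map V W f g (v **C w) = f v **C g w"
 unfolding tensor_map_def
 using clinear_tensor_lift[OF assms(1,2) bilinear_tensor[OF assms(3,4)]]
  tensor_lift_tens[OF assms(1,2) bilinear_tensor[OF assms(3,4)]] by auto

lemma tensor_map_in:
 assumes "csubspace V" "csubspace W" "linear_on V f" "linear_on W g"
  and "!!v. v : V ==> f v : V'" "!!w. w : W ==> g w : W'" "t : tensor_space V W"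
 shows "tensor_map V W f g t : tensor_space V' W'"
 by (rule tensor_linear_maps_into[OF clinear_linear_on[OF clinear_tensor_map[OF assms(1-4)]] cs_tensor_space _ assms(7)])
  (simp add: tensor_map_tens[OF assms(1-4)] tensor_in_space assms(5,6))

subsection \<open>Slices\<close>

text \<open>A functional on one factor gives a map from the tensor product to the other factor; these maps
  separate points, and they commute with all operators that act on the other factor only.\<close>

definition slice_left :: "('w::complex_vector => complex) => ('v::complex_vector, 'w) tensor => 'v" where
 "slice_left \<theta> = tensor_lift UNIV UNIV (%v w. \<theta> w *C v)"

definition slice_right :: "('v::complex_vector => complex) => ('v, 'w::complex_vector) tensor => 'w" where
 "slice_right \<theta> = tensor_lift UNIV UNIV (%v w. \<theta> v *C w)"

lemma clinear_iff: "clinear f \<longleftrightarrow> (ALL x y. f (x + y) = f x + f y) & (ALL c x. f (c *C x) = c *C f x)"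
 by (simp add: linear_on_UNIV[symmetric] linear_on_def)

lemma
 assumes "clinear \<theta>"
 shows clinear_slice_left: "clinear (slice_left \<theta>)" and slice_left_tens [simp]: "slice_left \<theta> (v **C w) = \<theta> w *C v"
  and clinear_slice_right: "clinear (slice_right \<theta>)" and slice_right_tens [simp]: "slice_right \<theta> (w **C v) = \<theta> w *C v"
proof -
 have b: "bilinear_on UNIV UNIV (%v w. \<theta> w *C v)" "bilinear_on UNIV UNIV (%v w. \<theta> v *C w)"
  using assms unfolding clinear_iff bilinear_on_def linear_on_def
  by (auto simp: scaleC_add_right scaleC_add_left scaleC_scaleC scaleC_complex_def mult.commute)
 note U = cv_subspace_UNIV
 show "clinear (slice_left \<theta>)" "clinear (slice_right \<theta>)"
  unfolding slice_left_def slice_right_def using clinear_tensor_lift[OF U U] b by blast+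
 show "slice_left \<theta> (v **C w) = \<theta> w *C v" "slice_right \<theta> (w **C v) = \<theta> w *C v"
  unfolding slice_left_def slice_right_def
  using tensor_lift_tens[OF U U b(1)] tensor_lift_tens[OF U U b(2)] by auto
qed

lemma dual_basis:
 assumes "finite_dimensional W" "csubspace W"
 obtains B \<theta> where "finite B" "B \<subseteq> W" "!!b. clinear (\<theta> b :: 'w => complex)"
  "!!w. w : W ==> (w :: 'w::complex_vector) = (\<Sum>b\<in>B. \<theta> b w *C b)"
proof -
 obtain B where B: "finite B" "B \<subseteq> W" "complex_vector.independent B" "cspan B = W"
  by (rule finite_dimensional_basis[OF assms])
 define C where "C = complex_vector.extend_basis B"
 have C: "complex_vector.independent C" "cspan C = UNIV" "B \<subseteq> C"
  unfolding C_def using complex_vector.independent_extend_basis[OF B(3)]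
   complex_vector.span_extend_basis[OF B(3)] complex_vector.extend_basis_superset[OF B(3)] by auto
 define \<theta> where "\<theta> = (%b w. complex_vector.representation C w b)"
 show ?thesis
 proof (rule that[OF B(1,2), of \<theta>])
  show "clinear (\<theta> b)" for b
   using C(2) unfolding clinear_iff \<theta>_def
   by (simp add: complex_vector.representation_add[OF C(1)] complex_vector.representation_scale[OF C(1)] scaleC_complex_def)
  fix w assume "w : W"
  then have w: "w : cspan B" using B by simp
  have "complex_vector.representation C w = complex_vector.representation B w"
   using complex_vector.representation_extend[OF C(1) w C(3)] .
  then show "w = (\<Sum>b\<in>B. \<theta> b w *C b)"
   using complex_vector.sum_representation_eq[OF B(3) w B(1)] by (simp add: \<theta>_def)
 qed
qed

lemma slices_left_expand:
 assumes "finite B" "!!b. clinear (\<theta> b)" "!!w. w : W ==> w = (\<Sum>b\<in>B. \<theta> b w *C b)"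
  and t: "t : tensor_space V W"
 shows "t = (\<Sum>b\<in>B. slice_left (\<theta> b) t **C b)"
proof (rule tensor_linear_ext[OF _ _ _ t])
 show "linear_on (tensor_space V W) (%t. \<Sum>b\<in>B. slice_left (\<theta> b) t **C b)"
  unfolding linear_on_def
  by (simp add: cv_linear_add[OF clinear_slice_left[OF assms(2)]]
    cv_linear_scale[OF clinear_slice_left[OF assms(2)]]
    tens_bilinear sum.distrib cv_scale_sum_right)
 fix v w assume "v : V" "w : W"
 then have "v **C (\<Sum>b\<in>B. \<theta> b w *C b) = v **C w" using assms(3)[of w] by simp
 then have "(\<Sum>b\<in>B. \<theta> b w *C (v **C b)) = v **C w"
  by (simp add: tensor_sum_right tens_bilinear)
 then show "v **C w = (\<Sum>b\<in>B. slice_left (\<theta> b) (v **C w) **C b)"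
  by (simp add: assms(2) tens_bilinear)
qed (rule lin_on_arith)

lemma slices_right_expand:
 assumes "finite B" "!!b. clinear (\<theta> b)" "!!v. v : V ==> v = (\<Sum>b\<in>B. \<theta> b v *C b)"
  and t: "t : tensor_space V W"
 shows "t = (\<Sum>b\<in>B. b **C slice_right (\<theta> b) t)"
proof (rule tensor_linear_ext[OF _ _ _ t])
 show "linear_on (tensor_space V W) (%t. \<Sum>b\<in>B. b **C slice_right (\<theta> b) t)"
  unfolding linear_on_def
  by (simp add: cv_linear_add[OF clinear_slice_right[OF assms(2)]]
    cv_linear_scale[OF clinear_slice_right[OF assms(2)]]
    tens_bilinear sum.distrib cv_scale_sum_right)
 fix v w assume "v : V" "w : W"
 then have "(\<Sum>b\<in>B. \<theta> b v *C b) **C w = v **C w" using assms(3)[of v] by simp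
 then have "(\<Sum>b\<in>B. \<theta> b v *C (b **C w)) = v **C w"
  by (simp add: tensor_sum_left tens_bilinear)
 then show "v **C w = (\<Sum>b\<in>B. b **C slice_right (\<theta> b) (v **C w))"
  by (simp add: assms(2) tens_bilinear)
qed (rule lin_on_arith)

lemma slice_left_separates:
 assumes "finite_dimensional W" "csubspace W" "t : tensor_space V W" "t ~= 0"
 obtains \<theta> where "clinear \<theta>" "slice_left \<theta> t ~= 0"
proof -
 obtain B \<theta> where B: "finite B" "B \<subseteq> W" "!!b. clinear (\<theta> b)" "!!w. w : W ==> w = (\<Sum>b\<in>B. \<theta> b w *C b)"
  using dual_basis[OF assms(1,2)] by blast
 have "t = (\<Sum>b\<in>B. slice_left (\<theta> b) t **C b)"
  by (rule slices_left_expand[OF B(1,3,4) assms(3)])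
 have "EX b:B. slice_left (\<theta> b) t ~= 0"
 proof (rule ccontr)
  assume "\<not> ?thesis"
  with \<open>t = _\<close> have "t = 0" by simp
  with assms(4) show False ..
 qed
 then show ?thesis using B(3) that by blast
qed

lemma slice_right_separates:
 assumes "finite_dimensional V" "csubspace V" "t : tensor_space V W" "t ~= 0"
 obtains \<theta> where "clinear \<theta>" "slice_right \<theta> t ~= 0"
proof -
 obtain B \<theta> where B: "finite B" "B \<subseteq> V" "!!b. clinear (\<theta> b)" "!!w. w : V ==> w = (\<Sum>b\<in>B. \<theta> b w *C b)"
  using dual_basis[OF assms(1,2)] by blast
 have "t = (\<Sum>b\<in>B. b **C slice_right (\<theta> b) t)"
  by (rule slices_right_expand[OF B(1,3,4) assms(3)])
 have "EX b:B. slice_right (\<theta> b) t ~= 0"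
 proof (rule ccontr)
  assume "\<not> ?thesis"
  with \<open>t = _\<close> have "t = 0" by simp
  with assms(4) show False ..
 qed
 then show ?thesis using B(3) that by blast
qed

lemma slice_left_in:
 assumes "clinear \<theta>" "csubspace V" "t : tensor_space V W"
 shows "slice_left \<theta> t : V"
 by (rule tensor_linear_maps_into[OF clinear_linear_on[OF clinear_slice_left[OF assms(1)]] assms(2) _ assms(3)])
  (simp add: assms cv_subspace_scale)

lemma slice_right_in:
 assumes "clinear \<theta>" "csubspace W" "t : tensor_space V W"
 shows "slice_right \<theta> t : W"
 by (rule tensor_linear_maps_into[OF clinear_linear_on[OF clinear_slice_right[OF assms(1)]] assms(2) _ assms(3)])
  (simp add: assms cv_subspace_scale)

text \<open>Irreducibility of the tensor product under both families of operators: an irreducible subspace \<open>X\<close>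
  for the operators on the first factor consists of pure tensors \<open>v \<otimes> n\<close> with \<open>n\<close> fixed, since
  by Schur's lemma all slices of \<open>X\<close> are proportional.\<close>

lemma tensor_irreducible:
 fixes V :: "'v::complex_vector set" and W :: "'w::complex_vector set"
 assumes V: "irreducible_family I a V" "finite_dimensional V"
  and W: "irreducible_family J b W" "finite_dimensional W"
  and U: "csubspace U" "U \<subseteq> tensor_space V W" "U ~= {0}"
  and aU: "!!i t. i : I ==> t : U ==> tensor_map V W (a i) (%w. w) t : U"
  and bU: "!!j t. j : J ==> t : U ==> tensor_map V W (%v. v) (b j) t : U"
 shows "U = tensor_space V W"
proof -
 have sV: "csubspace V" and sW: "csubspace W" using irr_famD(2) V W by blast+
 have a: "linear_on V (a i)" "!!v. v : V ==> a i v : V" if "i : I" for i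
  using irr_famD(1)[OF V(1)] that unfolding operators_def by auto
 have b: "linear_on W (b i)" "!!v. v : W ==> b i v : W" if "i : J" for i
  using irr_famD(1)[OF W(1)] that unfolding operators_def by auto
 note id = lin_on_arith(5)
 define A where "A = (%i. tensor_map V W (a i) (%w. w))"
 have Alin: "clinear (A i)" if "i : I" for i
  unfolding A_def by (rule clinear_tensor_map[OF sV sW a(1)[OF that] id])
 have A_tens: "A i (v **C w) = a i v **C w" if "i : I" "v : V" "w : W" for i v w
  unfolding A_def using tensor_map_tens[OF sV sW a(1)[OF that(1)] id] that by blast
 have opU: "operators I A U"
  unfolding operators_def using U Alin aU by (auto simp: A_def intro: clinear_linear_on)
 have fdU: "finite_dimensional U"
  using finite_dimensional_tensor[OF V(2) sV W(2) sW] U(2) by (rule finite_dimensional_subset)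
 obtain X where X: "X \<subseteq> U" "irreducible_family I A X"
  by (rule exists_irreducible_subspace[OF opU fdU U(3)])
 have sX: "csubspace X" using X(2) by (rule irr_famD)
 have XT: "X \<subseteq> tensor_space V W" using X(1) U(2) by blast
 have AX: "A i t : X" if "i : I" "t : X" for i t
  using irr_famD(1)[OF X(2)] that unfolding operators_def by blast
 have slice: "intertwines I A X a V (slice_left \<theta>)" if \<theta>: "clinear \<theta>" for \<theta>
  unfolding intertwines_def
 proof (intro conjI ballI)
  show "linear_on X (slice_left \<theta>)" by (rule clinear_linear_on[OF clinear_slice_left[OF \<theta>]])
  show "slice_left \<theta> ` X \<subseteq> V" using slice_left_in[OF \<theta> sV] XT by blast
  fix i t assume i: "i : I" and t: "t : X"
  note lS = clinear_linear_on[OF clinear_slice_left[OF \<theta>]]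
  show "slice_left \<theta> (A i t) = a i (slice_left \<theta> t)"
  proof (rule tensor_linear_ext[of V W])
   show "linear_on (tensor_space V W) (%t. slice_left \<theta> (A i t))"
    by (rule lin_on_compose[of _ "A i" UNIV, OF clinear_linear_on[OF Alin[OF i]] _ lS]) simp
   show "linear_on (tensor_space V W) (%t. a i (slice_left \<theta> t))"
    by (rule lin_on_compose[of _ "slice_left \<theta>" V, OF lS slice_left_in[OF \<theta> sV] a(1)[OF i]])
   show "t : tensor_space V W" using t XT by blast
  qed (simp add: A_tens[OF i] \<theta> lin_on_scale[OF a(1)[OF i]])
 qed
 obtain t0 where t0: "t0 : X" "t0 ~= 0"
  using irr_famD(3)[OF X(2)] cv_subspace_0[OF sX] by blast
 obtain B \<theta> where B: "finite B" "B \<subseteq> W" "!!b. clinear (\<theta> b)" "!!w. w : W ==> w = (\<Sum>b\<in>B. \<theta> b w *C b)"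
  using dual_basis[OF W(2) sW] by blast
 have expand: "t = (\<Sum>b\<in>B. slice_left (\<theta> b) t **C b)" if "t : X" for t
  by (rule slices_left_expand[where V = V, OF B(1,3,4)]) (use that XT in blast)+
 have "EX b0:B. slice_left (\<theta> b0) t0 ~= 0"
 proof (rule ccontr)
  assume "\<not> ?thesis"
  then have "(\<Sum>b\<in>B. slice_left (\<theta> b) t0 **C b) = 0" by simp
  with expand[OF t0(1)] t0(2) show False by simp
 qed
 then obtain b0 where b0: "slice_left (\<theta> b0) t0 ~= 0" by blast
 define S :: "('v, 'w) tensor => 'v" where "S = slice_left (\<theta> b0)"
 have S: "bij_betw S X V" "linear_on X S"
  unfolding S_def using Schur_bij[OF slice[OF B(3)] X(2) V(1) t0(1) b0] slice[OF B(3)]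
  by (auto simp: intertwines_def)
 let ?R = "inv_into X S"
 have R: "linear_on V ?R" "!!v. v : V ==> ?R v : X" "!!v. v : V ==> S (?R v) = v" "!!t. t : X ==> ?R (S t) = t"
  using lin_on_inv_into[OF S(2) sX S(1)] S(1)
  by (auto simp: bij_betw_def inv_into_into f_inv_into_f)
 have R_comm: "?R (a i v) = A i (?R v)" if "i : I" "v : V" for i v
 proof -
  have "S (A i (?R v)) = a i v"
   using slice[OF B(3)[of b0]] that R(2,3) unfolding intertwines_def S_def by metis
  then show ?thesis using R(4)[OF AX[OF that(1) R(2)[OF that(2)]]] by simp
 qed
 have "EX c. ALL v:V. slice_left (\<theta> b) (?R v) = c *C v" for b
 proof -
  have "intertwines I a V a V (%v. slice_left (\<theta> b) (?R v))"
   unfolding intertwines_def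
  proof (intro conjI ballI)
   show "linear_on V (%v. slice_left (\<theta> b) (?R v))"
    using lin_on_compose[OF R(1,2)] slice[OF B(3)] unfolding intertwines_def by blast
   show "(%v. slice_left (\<theta> b) (?R v)) ` V \<subseteq> V"
    using R(2) slice[OF B(3)] unfolding intertwines_def by blast
   show "slice_left (\<theta> b) (?R (a i v)) = a i (slice_left (\<theta> b) (?R v))" if "i : I" "v : V" for i v
    using R_comm[OF that] R(2)[OF that(2)] slice[OF B(3)] that(1) unfolding intertwines_def by metis
  qed
  from Schur_scalar[OF this V] show ?thesis by metis
 qed
 then obtain c where c: "!!b v. v : V ==> slice_left (\<theta> b) (?R v) = c b *C v" by metis
 define n where "n = (\<Sum>b\<in>B. c b *C b)"
 have Rn: "?R v = v **C n" if "v : V" for v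
 proof -
  have "?R v = (\<Sum>b\<in>B. slice_left (\<theta> b) (?R v) **C b)"
   by (rule expand[OF R(2)[OF that]])
  also have "\<dots> = v **C n"
   using that by (simp add: c n_def tensor_sum_right tens_bilinear)
  finally show ?thesis .
 qed
 have n: "n : W" "n ~= 0"
 proof -
  show "n : W" unfolding n_def using B(2) sW
   by (intro cv_subspace_sum cv_subspace_scale) auto
  have "S t0 : V" using S(1) t0(1) by (auto simp: bij_betw_def)
  then have "t0 = S t0 **C n" using Rn[of "S t0"] R(4)[OF t0(1)] by simp
  with t0(2) show "n ~= 0" by auto
 qed
 define Y where "Y = {w : W. ALL v:V. v **C w : U}"
 have "stable J b Y"
  unfolding stable_def
 proof (intro conjI ballI)
  show "csubspace Y"
   using sW U(1) unfolding Y_def cv_subspace_def by (simp add: tens_bilinear)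
  fix j assume j: "j : J"
  have "v **C b j w : U" if "w : Y" "v : V" for v w
   using bU[OF j, of "v **C w"] tensor_map_tens[OF sV sW id b(1)[OF j] that(2), of w] that
   by (simp add: Y_def)
  then show "b j ` Y \<subseteq> Y" using b(2)[OF j] by (auto simp: Y_def)
 qed
 moreover have "n : Y" unfolding Y_def using n Rn R(2) X(1) by fastforce
 ultimately have "Y = W"
  using irr_famD(4)[OF W(1), of Y] n by (auto simp: Y_def)
 then have "tensor_space V W \<subseteq> U"
  by (intro tensor_space_subset[OF U(1)]) (auto simp: Y_def)
 with U(2) show ?thesis by blast
qed

section \<open>The tensor product of two supermodules\<close>

definition graded_algebra :: "'g::complex_vector superalgebra => bool" where
 "graded_algebra G \<longleftrightarrow> graded_space (grade G) &
   bilinear_on (underlying G) (underlying G) (bracket G) &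
   (ALL i j. ALL x:grade G i. ALL y:grade G j. bracket G x y : grade G (i + j))"

lemma graded_algebraD:
 assumes "graded_algebra G"
 shows "graded_space (grade G)"
  "!!i j x y. x : grade G i ==> y : grade G j ==> bracket G x y : grade G (i + j)"
  "bilinear_on (underlying G) (underlying G) (bracket G)"
 using assms by (auto simp: graded_algebra_def)

lemma direct_sum_simps [simp]:
 "grade (direct_sum G H) i = grade G i \<times> grade H i"
 "bracket (direct_sum G H) (x, y) (x', y') = (bracket G x x', bracket H y y')"
 by (simp_all add: direct_sum_def)

lemma prod_scaleC [simp]: "c *C (x, y) = (c *C x, c *C y)"
 by (simp add: scaleC_prod_def)

lemma underlying_direct_sum: "underlying (direct_sum G H) = underlying G \<times> underlying H"
 unfolding total_def by (auto simp: direct_sum_def)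

lemma graded_direct_sum:
 assumes "graded_space (grade G)" "graded_space (grade H)"
 shows "graded_space (grade (direct_sum G H))"
proof -
 have "csubspace (A \<times> B)" if "csubspace A" "csubspace B" for A :: "'a set" and B :: "'b set"
  using that by (auto simp: cv_subspace_def zero_prod_def)
 then show ?thesis
  using assms unfolding graded_space_def by (auto simp: zero_prod_def)
qed

lemma bracket_zero:
 assumes "graded_algebra G" "x : underlying G"
 shows "bracket G x 0 = 0" "bracket G 0 x = 0"
 using graded_algebraD(3)[OF assms(1)] assms(2) lin_on_0 graded_total[OF graded_algebraD(1)[OF assms(1)]]
 unfolding bilinear_on_def by blast+

lemma bilinear_arith:
 "bilinear_on V W A ==> bilinear_on V W B ==> bilinear_on V W (%v w. A v w + B v w)"
 "bilinear_on V W A ==> bilinear_on V W (%v w. c *C A v w)"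
 "bilinear_on V W (%v w. 0)"
 unfolding bilinear_on_def by (auto intro: lin_on_arith)

lemma bilinear_sum:
 "(!!i. i : I ==> bilinear_on V W (B i)) ==> bilinear_on V W (%v w. \<Sum>i\<in>I. B i v w)"
 by (induction I rule: infinite_finite_induct) (simp_all add: bilinear_arith)

lemma self_neg_zero: "(u :: 'a::complex_vector) = - u ==> u = 0"
proof -
 assume "u = - u"
 then have "u + u = 0" by (metis add.right_inverse)
 moreover have "u + u = 2 *C u" by (metis one_add_one scaleC_add_left scaleC_one)
 ultimately show ?thesis by simp
qed

locale super_tensor =
 fixes G :: "'g::complex_vector superalgebra" and H :: "'h::complex_vector superalgebra"
  and M :: "('g, 'v::complex_vector) supermodule" and N :: "('h, 'w::complex_vector) supermodule"
 assumes G: "graded_algebra G" and H: "graded_algebra H"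
  and M: "is_supermodule G M" and N: "is_supermodule H N"
begin

abbreviation "ps \<equiv> parity_map (mgrade M)"
abbreviation "pn \<equiv> parity_map (mgrade N)"
abbreviation "MN \<equiv> tensor_space (space M) (space N)"
abbreviation "TM \<equiv> tensor_module H M N"
abbreviation "GH \<equiv> direct_sum G H"
abbreviation "pw (j::bit) v \<equiv> if j = 0 then v else ps v"
abbreviation "tm \<equiv> tensor_map (space M) (space N)"
abbreviation "tau \<equiv> tm ps (%w. w)"
abbreviation "sig \<equiv> tm ps pn"

lemmas gG = graded_algebraD(1)[OF G] and gH = graded_algebraD(1)[OF H]
lemmas gM = smodD(1)[OF M] and gN = smodD(1)[OF N]
lemmas sM = smodD(2)[OF M] and sN = smodD(2)[OF N]
lemmas lps = lin_on_parity[OF gM] and lpn = lin_on_parity[OF gN]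
lemmas lin_id = lin_on_arith(5)
lemmas psI = parity_in[OF gM] and pnI = parity_in[OF gN]
lemmas pss = parity_parity[OF gM] and pnn = parity_parity[OF gN]
lemmas aM = act_in[OF M gG] and aN = act_in[OF N gH]
lemmas laM = smodD(4)[OF M] and laN = smodD(4)[OF N]
lemmas tG = in_total[OF gG] and tH = in_total[OF gH]

lemma lpw: "linear_on (space M) (%v. pw j v)"
 by (cases j) (simp_all add: lin_id lps)

lemma pwI: "v : space M ==> pw j v : space M"
 by (simp add: psI)

lemmas csig = clinear_tensor_map[OF sM sN lps lpn]
lemmas ctau = clinear_tensor_map[OF sM sN lps lin_id]
lemmas sig_tens = tensor_map_tens[OF sM sN lps lpn]
lemmas tau_tens = tensor_map_tens[OF sM sN lps lin_id]

lemma tau_in: "u : MN ==> tau u : MN"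
 by (rule tensor_map_in[OF sM sN lps lin_id psI])

lemma sig_in: "u : MN ==> sig u : MN"
 by (rule tensor_map_in[OF sM sN lps lpn psI pnI])

lemma lin_clinear: "clinear f ==> linear_on S f"
 by (rule clinear_linear_on)

lemma mgrade_T: "mgrade TM k = cspan {v **C w | v w i j. v : mgrade M i & w : mgrade N j & i + j = k}"
 by (simp add: tensor_module_def tensor_grade_def)

lemma tens_in_grade: "v : mgrade M i ==> w : mgrade N j ==> i + j = k ==> v **C w : mgrade TM k"
 unfolding mgrade_T by (rule cv_span_base) blast

lemma sig_grade: "u : mgrade TM k ==> sig u = koszul 1 k *C u"
proof -
 assume u: "u : mgrade TM k"
 have "csubspace {u. sig u = koszul 1 k *C u}"
  unfolding cv_subspace_def
  by (simp add: cv_linear_add[OF csig] cv_linear_scale[OF csig]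
    cv_linear_0[OF csig] scaleC_add_right scaleC_scaleC mult.commute)
 moreover have "v **C w : {u. sig u = koszul 1 k *C u}"
  if "v : mgrade M i" "w : mgrade N j" "i + j = k" for v w i j
 proof -
  have "sig (v **C w) = (koszul 1 i * koszul 1 j) *C (v **C w)"
   using sig_tens[OF in_total[OF gM that(1)] in_total[OF gN that(2)]]
   by (simp add: parity_homogeneous[OF gM that(1)] parity_homogeneous[OF gN that(2)] tens_bilinear
    scaleC_scaleC mult.commute)
  then show ?thesis unfolding koszul_mult that(3) by simp
 qed
 ultimately have "mgrade TM k \<subseteq> {u. sig u = koszul 1 k *C u}"
  unfolding mgrade_T by (intro cv_span_minimal) blast+
 with u show ?thesis by blast
qed

lemma graded_T: "graded_space (mgrade TM)"
 unfolding graded_space_def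
proof (intro conjI)
 show "csubspace (mgrade TM 0)" "csubspace (mgrade TM 1)" by (simp_all add: mgrade_T)
 then have "0 : mgrade TM 0" "0 : mgrade TM 1" using cv_subspace_0 by blast+
 moreover have "u = 0" if "u : mgrade TM 0" "u : mgrade TM 1" for u
  using sig_grade[OF that(1)] sig_grade[OF that(2)] by (intro self_neg_zero) (simp add: scaleC_one)
 ultimately show "mgrade TM 0 \<inter> mgrade TM 1 = {0}" by blast
qed

lemma space_T: "space TM = MN"
proof
 have "mgrade TM k \<subseteq> MN" for k
  unfolding mgrade_T using in_total[OF gM] in_total[OF gN] tensor_in_space cs_tensor_space
  by (intro cv_span_minimal) blast+
 then show "space TM \<subseteq> MN"
  unfolding total_def using cv_subspace_add[OF cs_tensor_space] by blast
 show "MN \<subseteq> space TM"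
 proof (rule tensor_space_subset[OF graded_total[OF graded_T]])
  fix v w assume "v : space M" "w : space N"
  then obtain a b c d where *: "a : mgrade M 0" "b : mgrade M 1" "v = a + b"
    "c : mgrade N 0" "d : mgrade N 1" "w = c + d"
   by (metis total_cases[OF gM] total_cases[OF gN])
  have "v **C w = (a **C c + b **C d) + (a **C d + b **C c)"
   by (simp add: * tens_bilinear)
  moreover have "a **C c + b **C d : mgrade TM 0" "a **C d + b **C c : mgrade TM 1"
   using * by (auto intro!: cv_subspace_add graded_subspace[OF graded_T] tens_in_grade)
  ultimately show "v **C w : space TM" using totalI by metis
 qed
qed

lemma parity_T: "u : MN ==> parity_map (mgrade TM) u = sig u"
proof -
 assume "u : MN"
 then obtain a b where *: "a : mgrade TM 0" "b : mgrade TM 1" "u = a + b"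
  unfolding space_T[symmetric] by (rule total_cases[OF graded_T])
 then show ?thesis
  by (simp add: parity_sum[OF graded_T] cv_linear_add[OF csig] sig_grade scaleC_one)
qed

context
 fixes x y
 assumes x: "x : underlying G" and y: "y : underlying H"
begin

lemma act_T_lemma:
 "clinear (act TM (x, y))"
 "v : space M ==> w : space N ==> act TM (x, y) (v **C w) =
  act M x v **C w + (v **C act N (component (grade H) 0 y) w + ps v **C act N (component (grade H) 1 y) w)"
proof -
 let ?B = "%v w. act M x v **C w +
    (\<Sum>i\<in>{0, 1}. \<Sum>j\<in>{0, 1}. koszul j i *C
    (component (mgrade M) i v **C act N (component (grade H) j y) w))"
 have a: "act TM (x, y) = tensor_lift (space M) (space N) ?B"
  by (simp add: tensor_module_def)
 have B: "bilinear_on (space M) (space N) ?B"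
  by (intro bilinear_arith bilinear_sum bilinear_tensor lin_id laM[OF x] lin_on_component[OF gM]
    laN[OF tH[OF component_in[OF gH y]]])
 show "clinear (act TM (x, y))"
  unfolding a by (rule clinear_tensor_lift[OF sM sN B])
 assume v: "v : space M" and w: "w : space N"
 have "act TM (x, y) (v **C w) = ?B v w"
  unfolding a by (rule tensor_lift_tens[OF sM sN B v w])
 also have "\<dots> = act M x v **C w + ((component (mgrade M) 0 v + component (mgrade M) 1 v) **C act N (component (grade H) 0 y) w
   + ps v **C act N (component (grade H) 1 y) w)"
  by (simp add: parity_map_def tens_bilinear tensor_diff scaleC_one algebra_simps)
 finally show "act TM (x, y) (v **C w) =
  act M x v **C w + (v **C act N (component (grade H) 0 y) w + ps v **C act N (component (grade H) 1 y) w)"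
  unfolding component_add[OF gM v] .
qed

end

lemma act_N_0: "w : space N ==> act N 0 w = 0"
 using lin_on_0[OF smodD(3)[OF N] graded_total[OF gH]] .

lemma act_M_0: "v : space M ==> act M 0 v = 0"
 using lin_on_0[OF smodD(3)[OF M] graded_total[OF gG]] .

lemma act_pure:
 assumes "x : underlying G" "y : grade H j" "v : space M" "w : space N"
 shows "act TM (x, y) (v **C w) = act M x v **C w + pw j v **C act N y w"
 using act_T_lemma(2)[OF assms(1) tH[OF assms(2)] assms(3,4)] assms
 by (cases j) (simp_all add: component_homogeneous[OF gH assms(2)] act_N_0)

lemma act_T_in:
 assumes "x : underlying G" "y : underlying H" "u : MN"
 shows "act TM (x, y) u : MN"
proof (rule tensor_linear_maps_into[OF lin_clinear[OF act_T_lemma(1)[OF assms(1,2)]] cs_tensor_space _ assms(3)])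
 fix v w assume "v : space M" "w : space N"
 then show "act TM (x, y) (v **C w) : MN"
  unfolding act_T_lemma(2)[OF assms(1,2) \<open>v : space M\<close> \<open>w : space N\<close>]
  by (intro cv_subspace_add[OF cs_tensor_space] tensor_in_space aM aN psI assms
    tH[OF component_in[OF gH assms(2)]])
qed

lemma act_T_linear: "u : MN ==> linear_on (underlying GH) (%p. act TM p u)"
 unfolding linear_on_def underlying_direct_sum
proof (intro conjI allI ballI)
 fix p q assume u: "u : MN" and "p : underlying G \<times> underlying H" "q : underlying G \<times> underlying H"
 then obtain x y x' y' where *: "p = (x, y)" "q = (x', y')" and xs: "x : underlying G" "x' : underlying G"
  and ys: "y : underlying H" "y' : underlying H" by blast
 have s: "x + x' : underlying G" "y + y' : underlying H"
  using xs ys graded_total[OF gG] graded_total[OF gH] by (auto intro: csub_intros)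
 show "act TM (p + q) u = act TM p u + act TM q u"
  unfolding * add_Pair
 proof (rule tensor_linear_ext[OF _ _ _ u])
  show "linear_on MN (act TM (x + x', y + y'))" by (rule lin_clinear[OF act_T_lemma(1)[OF s]])
  show "linear_on MN (%u. act TM (x, y) u + act TM (x', y') u)"
   by (intro lin_on_arith lin_clinear act_T_lemma xs ys)
  fix v w assume v: "v : space M" and w: "w : space N"
  have 1: "act M (x + x') v = act M x v + act M x' v"
   by (rule lin_on_add[OF smodD(3)[OF M v] xs])
  have 2: "act N (component (grade H) i (y + y')) w = act N (component (grade H) i y) w + act N (component (grade H) i y') w" for i
   unfolding lin_on_add[OF lin_on_component[OF gH] ys]
   by (rule lin_on_add[OF smodD(3)[OF N w]]) (intro tH[OF component_in[OF gH]] ys)+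
  show "act TM (x + x', y + y') (v **C w) = act TM (x, y) (v **C w) + act TM (x', y') (v **C w)"
   unfolding act_T_lemma(2)[OF s v w] act_T_lemma(2)[OF xs(1) ys(1) v w] act_T_lemma(2)[OF xs(2) ys(2) v w] 1 2
   by (simp add: tens_bilinear algebra_simps)
 qed
next
 fix c p assume u: "u : MN" and "p : underlying G \<times> underlying H"
 then obtain x y where *: "p = (x, y)" and x: "x : underlying G" and y: "y : underlying H" by blast
 have s: "c *C x : underlying G" "c *C y : underlying H"
  using x y graded_total[OF gG] graded_total[OF gH] by (auto intro: csub_intros)
 show "act TM (c *C p) u = c *C act TM p u"
  unfolding * prod_scaleC
 proof (rule tensor_linear_ext[OF _ _ _ u])
  show "linear_on MN (act TM (c *C x, c *C y))" by (rule lin_clinear[OF act_T_lemma(1)[OF s]])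
  show "linear_on MN (%u. c *C act TM (x, y) u)"
   by (intro lin_on_arith lin_clinear act_T_lemma x y)
  fix v w assume v: "v : space M" and w: "w : space N"
  have 1: "act M (c *C x) v = c *C act M x v"
   by (rule lin_on_scale[OF smodD(3)[OF M v] x])
  have 2: "act N (component (grade H) i (c *C y)) w = c *C act N (component (grade H) i y) w" for i
   unfolding lin_on_scale[OF lin_on_component[OF gH] y]
   by (rule lin_on_scale[OF smodD(3)[OF N w]]) (intro tH[OF component_in[OF gH]] y)
  show "act TM (c *C x, c *C y) (v **C w) = c *C act TM (x, y) (v **C w)"
   unfolding act_T_lemma(2)[OF s v w] act_T_lemma(2)[OF x y v w] 1 2
   by (simp add: tens_bilinear scaleC_add_right)
 qed
qed

lemma pw_act:
 assumes "x : grade G j" "v : space M"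
 shows "pw i (act M x v) = koszul i j *C act M x (pw i v)"
 using act_parity[OF M gG assms] by (cases i) (simp_all add: scaleC_one)

lemma supermodule_T: "is_supermodule GH TM"
 unfolding is_supermodule_def bilinear_on_def space_T
proof (intro conjI ballI allI)
 show "graded_space (mgrade TM)" by (rule graded_T)
 show "linear_on (underlying GH) (%p. act TM p u)" if "u : MN" for u by (rule act_T_linear[OF that])
 show "linear_on MN (act TM p)" if "p : underlying GH" for p
  using that lin_clinear[OF act_T_lemma(1)] unfolding underlying_direct_sum by blast
next
 fix i j p u assume p: "p : grade GH i" and u: "u : mgrade TM j"
 obtain x y where xy: "p = (x, y)" "x : grade G i" "y : grade H i" using p by auto
 note c = act_T_lemma(1)[OF tG[OF xy(2)] tH[OF xy(3)]]
 have "csubspace {u. act TM (x, y) u : mgrade TM (i + j)}"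
  by (rule cv_linear_preimage[OF c graded_subspace[OF graded_T]])
 moreover have "act TM (x, y) (v **C w) : mgrade TM (i + j)"
  if v: "v : mgrade M a" and w: "w : mgrade N b" and ab: "a + b = j" for v w a b
 proof -
  have "pw i v : mgrade M a"
   using v parity_homogeneous[OF gM v] graded_subspace[OF gM] by (auto intro: csub_intros)
  moreover have "i + a + b = i + j" "a + (i + b) = i + j"
   unfolding ab[symmetric] by (simp_all only: add_ac)
  ultimately show ?thesis
   unfolding act_pure[OF tG[OF xy(2)] xy(3) in_total[OF gM v] in_total[OF gN w]]
   by (intro cv_subspace_add[OF graded_subspace[OF graded_T]]
    tens_in_grade[OF smodD(5)[OF M xy(2) v] w] tens_in_grade[OF _ smodD(5)[OF N xy(3) w]])
 qed
 ultimately have "mgrade TM j \<subseteq> {u. act TM (x, y) u : mgrade TM (i + j)}"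
  unfolding mgrade_T[of j] by (intro cv_span_minimal) blast+
 with u show "act TM p u : mgrade TM (i + j)" unfolding xy(1) by blast
next
 fix i j p q u assume p: "p : grade GH i" and q: "q : grade GH j" and u: "u : MN"
 obtain x y where xy: "p = (x, y)" "x : grade G i" "y : grade H i" using p by auto
 obtain x' y' where xy': "q = (x', y')" "x' : grade G j" "y' : grade H j" using q by auto
 note b = graded_algebraD(2)[OF G xy(2) xy'(2)] graded_algebraD(2)[OF H xy(3) xy'(3)]
 note P = tG[OF xy(2)] tH[OF xy(3)] and Q = tG[OF xy'(2)] tH[OF xy'(3)] and B = tG[OF b(1)] tH[OF b(2)]
 note cp = act_T_lemma(1)[OF P] and cq = act_T_lemma(1)[OF Q] and cb = act_T_lemma(1)[OF B]
 show "act TM (bracket GH p q) u = act TM p (act TM q u) - koszul i j *C act TM q (act TM p u)"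
  unfolding xy(1) xy'(1) direct_sum_simps
 proof (rule tensor_linear_ext[OF _ _ _ u])
  show "linear_on MN (act TM (bracket G x x', bracket H y y'))" by (rule lin_clinear[OF cb])
  show "linear_on MN (%u. act TM (x, y) (act TM (x', y') u) - koszul i j *C act TM (x', y') (act TM (x, y) u))"
   by (intro lin_on_arith lin_on_compose[OF lin_clinear[OF cq] act_T_in[OF Q] lin_clinear[OF cp]]
    lin_on_compose[OF lin_clinear[OF cp] act_T_in[OF P] lin_clinear[OF cq]])
  fix v w assume v: "v : space M" and w: "w : space N"
  have Mx: "act M x v : space M" "act M x' v : space M" and Ny: "act N y w : space N" "act N y' w : space N"
   using aM aN P Q v w by auto
  have pv: "pw k v : space M" for k using pwI[OF v] .
  have "act TM (x, y) (act TM (x', y') (v **C w)) =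
    act M x (act M x' v) **C w + pw i (act M x' v) **C act N y w +
    (act M x (pw j v) **C act N y' w + pw i (pw j v) **C act N y (act N y' w))"
   unfolding act_pure[OF Q(1) xy'(3) v w] cv_linear_add[OF cp]
    act_pure[OF P(1) xy(3) Mx(2) w] act_pure[OF P(1) xy(3) pv Ny(2)] ..
  moreover have "act TM (x', y') (act TM (x, y) (v **C w)) =
    act M x' (act M x v) **C w + pw j (act M x v) **C act N y' w +
    (act M x' (pw i v) **C act N y w + pw j (pw i v) **C act N y' (act N y w))"
   unfolding act_pure[OF P(1) xy(3) v w] cv_linear_add[OF cq]
    act_pure[OF Q(1) xy'(3) Mx(1) w] act_pure[OF Q(1) xy'(3) pv Ny(1)] ..
  moreover have "pw i (pw j v) = pw (i + j) v" "pw j (pw i v) = pw (i + j) v"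
   using pss[OF v] by (cases i; cases j; simp)+
  moreover have "koszul i j = koszul j i" by (simp add: koszul_def conj_commute)
  ultimately show "act TM (bracket G x x', bracket H y y') (v **C w) =
    act TM (x, y) (act TM (x', y') (v **C w)) - koszul i j *C act TM (x', y') (act TM (x, y) (v **C w))"
   unfolding act_pure[OF B(1) b(2) v w] smodD(6)[OF M xy(2) xy'(2) v] smodD(6)[OF N xy(3) xy'(3) w]
    pw_act[OF xy(2) v] pw_act[OF xy'(2) v]
   by (simp add: tens_bilinear tensor_diff scaleC_add_right scaleC_scaleC scaleC_one del: if_split)
 qed
qed

lemma graded_GH: "graded_space (grade GH)"
 by (rule graded_direct_sum[OF gG gH])

subsection \<open>The two factors separately\<close>

abbreviation "XL x \<equiv> act TM (x, 0)"
abbreviation "YR y \<equiv> act TM (0, y)"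

lemma zero_in: "0 : grade G i" "0 : grade H i" "0 : underlying G" "0 : underlying H"
 using cv_subspace_0 graded_subspace[OF gG] graded_subspace[OF gH] graded_total[OF gG] graded_total[OF gH] by blast+

lemma XL_pure: "x : underlying G ==> v : space M ==> w : space N ==> XL x (v **C w) = act M x v **C w"
 using act_pure[of x 0 0 v w] zero_in by (simp add: act_N_0)

lemma YR_pure: "y : grade H j ==> v : space M ==> w : space N ==> YR y (v **C w) = pw j v **C act N y w"
 using act_pure[of 0 y j v w] zero_in by (simp add: act_M_0)

lemma XL_lin: "x : underlying G ==> clinear (XL x)"
 by (rule act_T_lemma(1)) (simp_all add: zero_in)

lemma YR_lin: "y : underlying H ==> clinear (YR y)"
 by (rule act_T_lemma(1)) (simp_all add: zero_in)

lemma XL_in: "x : underlying G ==> u : MN ==> XL x u : MN"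
 by (rule act_T_in) (simp_all add: zero_in)

lemma YR_in: "y : underlying H ==> u : MN ==> YR y u : MN"
 by (rule act_T_in) (simp_all add: zero_in)

lemma act_split: "x : underlying G ==> y : underlying H ==> u : MN ==> act TM (x, y) u = XL x u + YR y u"
 using lin_on_add[OF act_T_linear, of u "(x, 0)" "(0, y)"] zero_in by (simp add: underlying_direct_sum)

lemma lin_comp2:
 assumes "clinear A" "clinear B"
 shows "linear_on S (%u. A (B u))"
 by (rule lin_on_compose[of _ B UNIV, OF lin_clinear[OF assms(2)] _ lin_clinear[OF assms(1)]]) simp

lemma tau_tau: "u : MN ==> tau (tau u) = u"
 by (rule tensor_linear_ext[OF lin_comp2[OF ctau ctau] lin_id])
  (simp_all add: tau_tens psI pss)

lemma tau_sig: "u : MN ==> tau (sig u) = sig (tau u)"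
 by (rule tensor_linear_ext[OF lin_comp2[OF ctau csig] lin_comp2[OF csig ctau]])
  (simp_all add: tau_tens sig_tens psI pnI pss)

lemma XL_tau:
 assumes "x : grade G i" "u : MN"
 shows "XL x (tau u) = koszul 1 i *C tau (XL x u)"
proof (rule tensor_linear_ext[OF lin_comp2[OF XL_lin[OF tG[OF assms(1)]] ctau]
   lin_on_arith(4)[OF lin_comp2[OF ctau XL_lin[OF tG[OF assms(1)]]]] _ assms(2)])
 fix v w assume v: "v : space M" and w: "w : space N"
 show "XL x (tau (v **C w)) = koszul 1 i *C tau (XL x (v **C w))"
  by (simp add: tau_tens[OF v w] XL_pure[OF tG[OF assms(1)]] psI v w aM[OF tG[OF assms(1)]] tau_tens
    act_parity[OF M gG assms(1) v] tens_bilinear scaleC_scaleC scaleC_one)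
qed

lemma YR_tau:
 assumes "y : grade H j" "u : MN"
 shows "YR y (tau u) = tau (YR y u)"
proof (rule tensor_linear_ext[OF lin_comp2[OF YR_lin[OF tH[OF assms(1)]] ctau]
   lin_comp2[OF ctau YR_lin[OF tH[OF assms(1)]]] _ assms(2)])
 fix v w assume v: "v : space M" and w: "w : space N"
 show "YR y (tau (v **C w)) = tau (YR y (v **C w))"
  by (simp add: tau_tens[OF v w] YR_pure[OF assms(1)] psI v w aN[OF tH[OF assms(1)]] tau_tens)
qed

lemma XL_eq: "x : underlying G ==> u : MN ==> tm (act M x) (%w. w) u = XL x u"
 by (rule tensor_linear_ext[OF lin_clinear[OF clinear_tensor_map[OF sM sN laM lin_id]] lin_clinear[OF XL_lin]])
  (simp_all add: tensor_map_tens[OF sM sN laM lin_id] XL_pure)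

lemma right_parity_eq: "u : MN ==> tm (%v. v) pn u = tau (sig u)"
 by (rule tensor_linear_ext[OF lin_clinear[OF clinear_tensor_map[OF sM sN lin_id lpn]] lin_comp2[OF ctau csig]])
  (simp_all add: tensor_map_tens[OF sM sN lin_id lpn] tau_tens sig_tens psI pnI pss)

lemma right_act_eq:
 assumes "y : grade H j" "u : MN"
 shows "tm (%v. v) (act N y) u = (if j = 0 then YR y u else tau (YR y u))"
proof -
 note l = laN[OF tH[OF assms(1)]]
 have "linear_on MN (%u. if j = 0 then YR y u else tau (YR y u))"
  using lin_clinear[OF YR_lin[OF tH[OF assms(1)]]] lin_comp2[OF ctau YR_lin[OF tH[OF assms(1)]]]
  by (cases "j = 0") simp_all
 then show ?thesis
  by (rule tensor_linear_ext[OF lin_clinear[OF clinear_tensor_map[OF sM sN lin_id l]] _ _ assms(2)])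
   (simp add: tensor_map_tens[OF sM sN lin_id l] YR_pure[OF assms(1)] tau_tens psI pss aN[OF tH[OF assms(1)]])
qed

lemma stable_T:
 assumes "U \<subseteq> MN"
 shows "stable (indices GH) (ops TM) U \<longleftrightarrow> csubspace U & sig ` U \<subseteq> U &
  (ALL i. ALL x:grade G i. XL x ` U \<subseteq> U) & (ALL j. ALL y:grade H j. YR y ` U \<subseteq> U)" (is "?L \<longleftrightarrow> ?R")
proof
 assume L: ?L
 then have *: "csubspace U" "!!u. u : U ==> parity_map (mgrade TM) u : U"
  "!!i p u. p : grade GH i ==> u : U ==> act TM p u : U"
  unfolding stable_def ball_indices by (auto simp: image_subset_iff)
 show ?R
 proof (intro conjI allI ballI image_subsetI)
  show "sig u : U" if "u : U" for u using *(2)[OF that] parity_T that assms by auto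
  show "XL x u : U" if "x : grade G i" "u : U" for i x u
   using *(3)[of "(x, 0)" i u] that zero_in by simp
  show "YR y u : U" if "y : grade H i" "u : U" for i y u
   using *(3)[of "(0, y)" i u] that zero_in by simp
 qed (rule *)
next
 assume R: ?R
 have a: "act TM (x, y) u : U" if "x : grade G j" "y : grade H j" "u : U" for x y j u
 proof -
  have "act TM (x, y) u = XL x u + YR y u"
   using act_split[OF tG[OF that(1)] tH[OF that(2)], of u] assms that(3) by blast
  moreover have "XL x u : U" "YR y u : U" using R that by blast+
  ultimately show ?thesis using R cv_subspace_add by metis
 qed
 show ?L
  unfolding stable_def ball_indices
 proof (intro conjI allI ballI image_subsetI)
  show "csubspace U" using R by blast
  show "ops TM None u : U" if "u : U" for u
   using that R parity_T[of u] assms by auto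
  show "ops TM (Some p) u : U" if "p : grade GH j" "u : U" for j p u
   using that a by auto
 qed
qed

lemma slice_left_XL:
 assumes "clinear \<theta>" "x : underlying G" "u : MN"
 shows "slice_left \<theta> (XL x u) = act M x (slice_left \<theta> u)"
 by (rule tensor_linear_ext[OF lin_comp2[OF clinear_slice_left[OF assms(1)] XL_lin[OF assms(2)]]
    lin_on_compose[of _ "slice_left \<theta>" "space M", OF lin_clinear[OF clinear_slice_left[OF assms(1)]]
    slice_left_in[OF assms(1) sM] laM[OF assms(2)]] _ assms(3)])
  (simp_all add: XL_pure[OF assms(2)] assms(1) lin_on_scale[OF laM[OF assms(2)]])

lemma slice_left_tau:
 assumes "clinear \<theta>" "u : MN"
 shows "slice_left \<theta> (tau u) = ps (slice_left \<theta> u)"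
 by (rule tensor_linear_ext[OF lin_comp2[OF clinear_slice_left[OF assms(1)] ctau]
    lin_on_compose[of _ "slice_left \<theta>" "space M", OF lin_clinear[OF clinear_slice_left[OF assms(1)]]
    slice_left_in[OF assms(1) sM] lps] _ assms(2)])
  (simp_all add: tau_tens assms(1) lin_on_scale[OF lps])

lemma slice_right_map:
 assumes "clinear \<theta>" "u : MN" "linear_on (space N) g"
 shows "slice_right \<theta> (tm (%v. v) g u) = g (slice_right \<theta> u)"
 by (rule tensor_linear_ext[OF lin_comp2[OF clinear_slice_right[OF assms(1)] clinear_tensor_map[OF sM sN lin_id assms(3)]]
    lin_on_compose[of _ "slice_right \<theta>" "space N", OF lin_clinear[OF clinear_slice_right[OF assms(1)]]
    slice_right_in[OF assms(1) sN] assms(3)] _ assms(2)])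
  (simp_all add: tensor_map_tens[OF sM sN lin_id assms(3)] assms(1) lin_on_scale[OF assms(3)])

end

section \<open>Irreducible products\<close>

lemma odd_endomorphismsD:
 assumes "\<phi> : odd_endomorphisms G M"
 shows "linear_on (space M) \<phi>" "!!i v. v : mgrade M i ==> \<phi> v : mgrade M (i + 1)"
  "!!j x v. x : grade G j ==> v : space M ==> \<phi> (act M x v) = koszul 1 j *C act M x (\<phi> v)"
 using assms unfolding odd_endomorphisms_def by blast+

lemma odd_endomorphism_parity:
 assumes "\<phi> : odd_endomorphisms G M" "graded_space (mgrade M)" "v : space M"
 shows "parity_map (mgrade M) (\<phi> v) = - \<phi> (parity_map (mgrade M) v)"
 using parity_of_homogeneous_map[OF assms(2,2) odd_endomorphismsD(1)[OF assms(1)], of 1 v]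
  odd_endomorphismsD(2)[OF assms(1)] assms(3)
 by (simp add: scaleC_one image_subset_iff add.commute)

lemma odd_endomorphism_in:
 assumes "\<phi> : odd_endomorphisms G M" "graded_space (mgrade M)" "v : space M"
 shows "\<phi> v : space M"
proof -
 obtain u w where uw: "u : mgrade M 0" "w : mgrade M 1" "v = u + w"
  by (rule total_cases[OF assms(2,3)])
 have "\<phi> u : space M" "\<phi> w : space M"
  using odd_endomorphismsD(2)[OF assms(1)] in_total[OF assms(2)] uw by blast+
 then show ?thesis
  using uw lin_on_add[OF odd_endomorphismsD(1)[OF assms(1)], of u w] in_total[OF assms(2)]
   cv_subspace_add[OF graded_total[OF assms(2)]] by metis
qed

lemma odd_endomorphismsI:
 assumes "graded_space (mgrade M)" "linear_on (space M) \<phi>" "!!v. v : space M ==> \<phi> v : space M"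
  and "!!v. v : space M ==> parity_map (mgrade M) (\<phi> v) = - \<phi> (parity_map (mgrade M) v)"
  and "!!j x v. x : grade G j ==> v : space M ==> \<phi> (act M x v) = koszul 1 j *C act M x (\<phi> v)"
 shows "\<phi> : odd_endomorphisms G M"
proof -
 have "\<phi> ` mgrade M j \<subseteq> mgrade M (1 + j)" for j
  by (rule homogeneous_map_of_parity[OF assms(1,1,3,2)]) (simp_all add: assms(4) scaleC_one)
 then show ?thesis
  using assms unfolding odd_endomorphisms_def by (simp add: add.commute)
qed

text \<open>The square of an odd endomorphism is an even one, hence a scalar; it is nonzero because the
  kernel is a submodule.  Rescaling makes it \<open>- 1\<close>.\<close>

lemma odd_endomorphism_normalize:
 assumes M: "irreducible_supermodule G M" "finite_dimensional (space M)" and G: "graded_space (grade G)"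
  and \<phi>: "\<phi> : odd_endomorphisms G M" and v: "v : space M" "\<phi> v ~= 0"
 obtains \<psi> where "\<psi> : odd_endomorphisms G M" "!!v. v : space M ==> \<psi> (\<psi> v) = - v"
proof -
 note M' = irr_smod[OF M(1)]
 have irr: "irreducible_family (indices G) (ops M) (space M)" using M irreducible_iff[OF G] by blast
 note gM = smodD(1)[OF M'] and sM = smodD(2)[OF M']
 note lin = odd_endomorphismsD(1)[OF \<phi>] and inM = odd_endomorphism_in[OF \<phi> gM]
  and par = odd_endomorphism_parity[OF \<phi> gM] and com = odd_endomorphismsD(3)[OF \<phi>]
 let ?p = "parity_map (mgrade M)"
 note pI = parity_in[OF gM]
 have neg: "\<phi> (- u) = - \<phi> u" if "u : space M" for u by (rule lin_on_neg[OF lin that])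
 have K: "stable (indices G) (ops M) {u : space M. \<phi> u = 0}"
  unfolding stable_def ball_indices
 proof (intro conjI allI ballI image_subsetI)
  show "csubspace {u : space M. \<phi> u = 0}" by (rule csubspace_kernel[OF lin sM])
  show "ops M None u : {u : space M. \<phi> u = 0}" if "u : {u : space M. \<phi> u = 0}" for u
   using that par[of u] pI[of u] lin_on_0[OF lin_on_parity[OF gM] sM] by auto
  show "ops M (Some x) u : {u : space M. \<phi> u = 0}"
   if "x : grade G j" "u : {u : space M. \<phi> u = 0}" for j x u
   using that com[OF that(1), of u] act_in[OF M' G in_total[OF G that(1)], of u]
    lin_on_0[OF smodD(4)[OF M' in_total[OF G that(1)]] sM] by auto
 qed
 have ker: "u = 0" if "u : space M" "\<phi> u = 0" for u
 proof (rule ccontr)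
  assume "u ~= 0"
  with that have "{u : space M. \<phi> u = 0} ~= {0}" by blast
  then have "{u : space M. \<phi> u = 0} = space M"
   using irr_famD(4)[OF irr _ K] by blast
  with v show False by blast
 qed
 have "intertwines (indices G) (ops M) (space M) (ops M) (space M) (%u. \<phi> (\<phi> u))"
  unfolding intertwines_def ball_indices
 proof (intro conjI allI ballI image_subsetI)
  show "linear_on (space M) (%u. \<phi> (\<phi> u))" by (rule lin_on_compose[OF lin inM lin])
  show "\<phi> (\<phi> u) : space M" if "u : space M" for u using that inM by blast
  show "\<phi> (\<phi> (ops M None u)) = ops M None (\<phi> (\<phi> u))" if "u : space M" for u
  proof -
   have "?p (\<phi> (\<phi> u)) = - \<phi> (?p (\<phi> u))" by (rule par[OF inM[OF that]])
   also have "\<dots> = \<phi> (\<phi> (?p u))" using par[OF that] neg[OF inM[OF pI[OF that]]] by simp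
   finally show ?thesis by simp
  qed
  show "\<phi> (\<phi> (ops M (Some x) u)) = ops M (Some x) (\<phi> (\<phi> u))" if "x : grade G j" "u : space M" for j x u
   using com[OF that] com[OF that(1) inM[OF that(2)]]
    lin_on_scale[OF lin act_in[OF M' G in_total[OF G that(1)] inM[OF that(2)]]]
   by (simp add: scaleC_scaleC scaleC_one)
 qed
 from Schur_scalar[OF this irr M(2)]
 obtain c where c: "!!u. u : space M ==> \<phi> (\<phi> u) = c *C u"
  by blast
 have "c ~= 0"
  using c[OF v(1)] ker[OF inM[OF v(1)]] v(2) by auto
 define k where "k = csqrt (- 1 / c)"
 have k: "k * k * c = - 1"
  using \<open>c ~= 0\<close> power2_csqrt[of "- 1 / c"] by (simp add: k_def power2_eq_square)
 define \<psi> where "\<psi> = (%u. k *C \<phi> u)"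
 show ?thesis
 proof (rule that[of \<psi>])
  show "\<psi> : odd_endomorphisms G M"
  proof (rule odd_endomorphismsI[OF gM])
   show "linear_on (space M) \<psi>" unfolding \<psi>_def by (intro lin_on_arith lin)
   show "\<psi> u : space M" if "u : space M" for u
    unfolding \<psi>_def by (rule cv_subspace_scale[OF sM inM[OF that]])
   show "?p (\<psi> u) = - \<psi> (?p u)" if "u : space M" for u
    using that par inM by (simp add: \<psi>_def lin_on_scale[OF lin_on_parity[OF gM]])
   show "\<psi> (act M x u) = koszul 1 j *C act M x (\<psi> u)" if "x : grade G j" "u : space M" for j x u
    using com[OF that] lin_on_scale[OF smodD(4)[OF M' in_total[OF G that(1)]] inM[OF that(2)]]
    by (simp add: \<psi>_def scaleC_scaleC mult.commute)
  qed
  show "\<psi> (\<psi> u) = - u" if "u : space M" for u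
  proof -
   have "\<psi> (\<psi> u) = (k * k * c) *C u"
    unfolding \<psi>_def lin_on_scale[OF lin inM[OF that]] c[OF that]
    by (simp add: scaleC_scaleC mult.assoc)
   then show ?thesis unfolding k by (simp add: scaleC_one)
  qed
 qed
qed

locale super_tensor_irreducible = super_tensor G H M N
 for G :: "'g::complex_vector superalgebra" and H :: "'h::complex_vector superalgebra"
  and M :: "('g, 'v::complex_vector) supermodule" and N :: "('h, 'w::complex_vector) supermodule" +
 assumes irrM: "irreducible_supermodule G M" and fdM: "finite_dimensional (space M)"
  and irrN: "irreducible_supermodule H N" and fdN: "finite_dimensional (space N)"
begin

lemma famM: "irreducible_family (indices G) (ops M) (space M)" using irrM irreducible_iff[OF gG] by blast
lemma famN: "irreducible_family (indices H) (ops N) (space N)" using irrN irreducible_iff[OF gH] by blast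

lemma fdMN: "finite_dimensional MN"
 by (rule finite_dimensional_tensor[OF fdM sM fdN sN])

lemma MN_nonzero: "MN ~= {0}"
proof -
 obtain v where v: "v : space M" "v ~= 0" by (rule irreducible_nonzero[OF irrM])
 obtain w where w: "w : space N" "w ~= 0" by (rule irreducible_nonzero[OF irrN])
 obtain B \<theta> where B: "finite B" "B \<subseteq> space N" "!!b. clinear (\<theta> b :: 'w => complex)"
  "!!w. w : space N ==> w = (\<Sum>b\<in>B. \<theta> b w *C b)"
  using dual_basis[OF fdN sN] by blast
 have "EX b:B. \<theta> b w ~= 0"
 proof (rule ccontr)
  assume "\<not> ?thesis"
  then have "(\<Sum>b\<in>B. \<theta> b w *C b) = 0" by simp
  with B(4)[OF w(1)] w(2) show False by simp
 qed
 then obtain b where "\<theta> b w ~= 0" by blast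
 then have "slice_left (\<theta> b) (v **C w) ~= 0" using v by (simp add: B(3))
 then have "v **C w ~= 0" using cv_linear_0[OF clinear_slice_left[OF B(3)]] by metis
 then show ?thesis using tensor_in_space[OF v(1) w(1)] by blast
qed

text \<open>Adding its image under \<open>\<sigma> \<otimes> 1\<close> makes a graded submodule stable under \<open>\<sigma> \<otimes> 1\<close> and hence under
  all operators on either factor.\<close>

lemma submodule_plus_twist:
 assumes U: "U \<subseteq> MN" "stable (indices GH) (ops TM) U" "U ~= {0}" and t: "t : MN"
 obtains u u' where "u : U" "u' : U" "t = u + tau u'"
proof -
 have st: "csubspace U" "!!u. u : U ==> sig u : U" "!!i x u. x : grade G i ==> u : U ==> XL x u : U"
  "!!j y u. y : grade H j ==> u : U ==> YR y u : U"
  using U(2) unfolding stable_T[OF U(1)] by blast+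
 have UM: "u : MN" if "u : U" for u using that U(1) by blast
 define U' where "U' = {u + tau u' | u u'. u : U & u' : U}"
 have I: "u + tau u' : U'" if "u : U" "u' : U" for u u' using that unfolding U'_def by blast
 have z: "0 : U" by (rule cv_subspace_0[OF st(1)])
 have "csubspace (tau ` U)"
  by (rule csubspace_image[OF lin_clinear[OF ctau] st(1) order_refl])
 have U'eq: "U' = {x + y | x y. x : U & y : tau ` U}" unfolding U'_def by blast
 have sU': "csubspace U'"
  unfolding U'eq by (rule complex_vector.subspace_sums[OF st(1) \<open>csubspace (tau ` U)\<close>])
 have UU': "U \<subseteq> U'" using I[OF _ z] cv_linear_0[OF ctau] by auto
 have U'M: "U' \<subseteq> MN"
  unfolding U'_def using UM tau_in cv_subspace_add[OF cs_tensor_space] by blast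
 have tauU': "tau r : U'" if r: "r : U'" for r
 proof -
  obtain u u' where uu: "u : U" "u' : U" "r = u + tau u'" using r unfolding U'_def by blast
  then have "tau r = u' + tau u"
   by (simp add: cv_linear_add[OF ctau] tau_tau UM add.commute)
  with I uu show ?thesis by metis
 qed
 have sigU': "sig r : U'" if r: "r : U'" for r
 proof -
  obtain u u' where uu: "u : U" "u' : U" "r = u + tau u'" using r unfolding U'_def by blast
  then have "sig r = sig u + tau (sig u')"
   by (simp add: cv_linear_add[OF csig] tau_sig UM)
  with I uu st show ?thesis by metis
 qed
 have XU': "XL x r : U'" if x: "x : grade G i" and r: "r : U'" for i x r
 proof -
  obtain u u' where uu: "u : U" "u' : U" "r = u + tau u'" using r unfolding U'_def by blast
  then have "XL x r = XL x u + tau (koszul 1 i *C XL x u')"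
   by (simp add: cv_linear_add[OF XL_lin[OF tG[OF x]]] XL_tau[OF x] UM
    cv_linear_scale[OF ctau])
  with I uu st(3)[OF x] show ?thesis using cv_subspace_scale[OF st(1)] by metis
 qed
 have YU': "YR y r : U'" if y: "y : grade H i" and r: "r : U'" for i y r
 proof -
  obtain u u' where uu: "u : U" "u' : U" "r = u + tau u'" using r unfolding U'_def by blast
  then have "YR y r = YR y u + tau (YR y u')"
   by (simp add: cv_linear_add[OF YR_lin[OF tH[OF y]]] YR_tau[OF y] UM)
  with I uu st(4)[OF y] show ?thesis by metis
 qed
 have "U' = MN"
 proof (rule tensor_irreducible[OF famM fdM famN fdN sU' U'M])
  show "U' ~= {0}" using U(3) UU' z by blast
  show "tm (ops M i) (%w. w) r : U'" if "i : indices G" "r : U'" for i r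
   using that tauU' XU' XL_eq[OF tG, of _ _ r] U'M unfolding indices_def by auto
  show "tm (%v. v) (ops N j) r : U'" if j: "j : indices H" and r: "r : U'" for j r
  proof (cases j)
   case None
   then show ?thesis using right_parity_eq[of r] r U'M tauU'[OF sigU'[OF r]] by auto
  next
   case (Some y)
   then obtain k where y: "y : grade H k" using j unfolding indices_def by blast
   have "tm (%v. v) (act N y) r = (if k = 0 then YR y r else tau (YR y r))"
    by (rule right_act_eq[OF y]) (use r U'M in blast)
   then show ?thesis using YU'[OF y r] tauU'[OF YU'[OF y r]] Some by simp
  qed
 qed
 with t show ?thesis using that unfolding U'_def by blast
qed

lemma submodule_twist:
 assumes U: "U \<subseteq> MN" "stable (indices GH) (ops TM) U"
 shows "tau ` U \<subseteq> MN" "stable (indices GH) (ops TM) (tau ` U)"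
proof -
 have st: "csubspace U" "!!u. u : U ==> sig u : U" "!!i x u. x : grade G i ==> u : U ==> XL x u : U"
  "!!j y u. y : grade H j ==> u : U ==> YR y u : U"
  using U(2) unfolding stable_T[OF U(1)] by blast+
 have UM: "u : MN" if "u : U" for u using that U(1) by blast
 show s: "tau ` U \<subseteq> MN" using UM tau_in by blast
 show "stable (indices GH) (ops TM) (tau ` U)"
  unfolding stable_T[OF s]
 proof (intro conjI allI ballI image_subsetI)
  show "csubspace (tau ` U)" by (rule csubspace_image[OF lin_clinear[OF ctau] st(1) order_refl])
  show "sig r : tau ` U" if r: "r : tau ` U" for r
  proof -
   obtain u where u: "u : U" "r = tau u" using r by blast
   show ?thesis unfolding u(2) tau_sig[OF UM[OF u(1)], symmetric] using st(2)[OF u(1)] by blast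
  qed
  show "XL x r : tau ` U" if x: "x : grade G i" and r: "r : tau ` U" for i x r
  proof -
   obtain u where u: "u : U" "r = tau u" using r by blast
   have "XL x r = tau (koszul 1 i *C XL x u)"
    using u XL_tau[OF x UM] by (simp add: cv_linear_scale[OF ctau])
   then show ?thesis using cv_subspace_scale[OF st(1) st(3)[OF x u(1)]] by blast
  qed
  show "YR y r : tau ` U" if y: "y : grade H i" and r: "r : tau ` U" for i y r
  proof -
   obtain u where u: "u : U" "r = tau u" using r by blast
   show ?thesis unfolding u(2) YR_tau[OF y UM[OF u(1)]] using st(4)[OF y u(1)] by blast
  qed
 qed
qed

lemma stable_inter: "stable I a A ==> stable I a B ==> stable I a (A \<inter> B)"
 unfolding stable_def by (simp add: complex_vector.subspace_inter) blast

lemma submodule_disjoint_twist: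
 assumes U: "U \<subseteq> MN" "stable (indices GH) (ops TM) U" "U ~= MN"
 shows "U \<inter> tau ` U = {0}"
proof (rule ccontr)
 assume nz: "U \<inter> tau ` U ~= {0}"
 have st: "stable (indices GH) (ops TM) (U \<inter> tau ` U)"
  by (rule stable_inter[OF U(2) submodule_twist(2)[OF U(1,2)]])
 have "t : U" if t: "t : MN" for t
 proof -
  have "U \<inter> tau ` U \<subseteq> MN" using U(1) by blast
  then obtain u u' where u: "u : U \<inter> tau ` U" "u' : U \<inter> tau ` U" "t = u + tau u'"
   by (rule submodule_plus_twist[OF _ st nz t])
  then obtain r where "r : U" "u' = tau r" by blast
  then have "tau u' : U" using tau_tau[of r] U(1) by auto
  moreover have "csubspace U" using U(2) unfolding stable_def by blast
  ultimately show ?thesis using u cv_subspace_add[of U u "tau u'"] by blast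
 qed
 then show False using U(1,3) by blast
qed

text \<open>If \<open>M \<otimes> N\<close> has a proper submodule \<open>U\<close>, then it is \<open>U \<oplus> (\<sigma> \<otimes> 1) U\<close>; the endomorphism that is \<open>1\<close> on
  \<open>U\<close> and \<open>-1\<close> on the complement has slices that are odd endomorphisms of the two factors.\<close>

lemma reducible_odd_endomorphisms:
 assumes U: "U \<subseteq> MN" "stable (indices GH) (ops TM) U" "U ~= {0}" "U ~= MN"
 shows "EX \<phi>:odd_endomorphisms G M. ALL v:space M. \<phi> (\<phi> v) = - v"
  and "EX \<psi>:odd_endomorphisms H N. ALL w:space N. \<psi> (\<psi> w) = - w"
proof -
 have st: "csubspace U" "!!u. u : U ==> sig u : U" "!!i x u. x : grade G i ==> u : U ==> XL x u : U"
  "!!j y u. y : grade H j ==> u : U ==> YR y u : U"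
  using U(2) unfolding stable_T[OF U(1)] by blast+
 note tw = submodule_twist[OF U(1,2)]
 have tt: "csubspace (tau ` U)" "!!u. u : tau ` U ==> sig u : tau ` U" "!!i x u. x : grade G i ==> u : tau ` U ==> XL x u : tau ` U"
  "!!j y u. y : grade H j ==> u : tau ` U ==> YR y u : tau ` U"
  using tw(2) unfolding stable_T[OF tw(1)] by blast+
 define D where "D = (%k::bit. if k = 0 then U else tau ` U)"
 have D01: "D 0 = U" "D 1 = tau ` U" by (simp_all add: D_def)
 have gD: "graded_space D"
  unfolding graded_space_def D01 using st(1) tt(1) submodule_disjoint_twist[OF U(1,2,4)] by blast
 have totD: "total D = MN"
 proof
  show "total D \<subseteq> MN"
  proof
   fix t assume "t : total D"
   then obtain a b where ab: "a : D 0" "b : D 1" "t = a + b" by (rule total_cases[OF gD])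
   then have "a : MN" "b : MN" using U(1) tw(1) unfolding D01 by blast+
   then show "t : MN" unfolding ab(3) by (rule cv_subspace_add[OF cs_tensor_space])
  qed
  show "MN \<subseteq> total D"
  proof
   fix t assume t: "t : MN"
   obtain u u' where "u : U" "u' : U" "t = u + tau u'" by (rule submodule_plus_twist[OF U(1-3) t])
   then show "t : total D" unfolding total_def D01 by blast
  qed
 qed
 define E where "E = parity_map D"
 have lE: "linear_on MN E" unfolding E_def totD[symmetric] by (rule lin_on_parity[OF gD])
 have E_in: "E u : MN" if "u : MN" for u
  using parity_in[OF gD, of u] that unfolding totD E_def .
 have EE: "E (E u) = u" if "u : MN" for u
  using parity_parity[OF gD, of u] that unfolding totD E_def .
 have Ecom: "E (f u) = koszul 1 k *C f (E u)" if "clinear f" "!!j. f ` D j \<subseteq> D (k + j)" "u : MN" for f k u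
  unfolding E_def using parity_of_homogeneous_map[OF gD gD lin_clinear[OF that(1)] that(2)] that(3)
  unfolding totD by blast
 have all2: "f ` D j \<subseteq> D (k + j)" if "f ` D 0 \<subseteq> D k" "f ` D 1 \<subseteq> D (k + 1)" for f k j
  using that by (cases j; cases k) simp_all
 have Esig: "E (sig u) = sig (E u)" if "u : MN" for u
  using Ecom[OF csig all2 that, of 0] st(2) tt(2) by (simp add: D01 image_subset_iff scaleC_one)
 have EX: "E (XL x u) = XL x (E u)" if "x : grade G i" "u : MN" for i x u
  using Ecom[OF XL_lin[OF tG[OF that(1)]] all2 that(2), of 0] st(3)[OF that(1)] tt(3)[OF that(1)]
  by (simp add: D01 image_subset_iff scaleC_one)
 have EY: "E (YR x u) = YR x (E u)" if "x : grade H i" "u : MN" for i x u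
  using Ecom[OF YR_lin[OF tH[OF that(1)]] all2 that(2), of 0] st(4)[OF that(1)] tt(4)[OF that(1)]
  by (simp add: D01 image_subset_iff scaleC_one)
 have Etau: "E (tau u) = - tau (E u)" if "u : MN" for u
 proof -
  have "tau ` tau ` U \<subseteq> U" using tau_tau U(1) by auto
  then show ?thesis using Ecom[OF ctau all2 that, of 1] by (simp add: D01 scaleC_one)
 qed
 have "EX v0:space M. EX w0:space N. E (v0 **C w0) ~= 0"
 proof (rule ccontr)
  assume "\<not> ?thesis"
  then have "E (v **C w) = 0" if "v : space M" "w : space N" for v w using that by blast
  then have "E t = 0" if "t : MN" for t
   using tensor_linear_ext[OF lE lin_on_arith(6) _ that] by blast
  then have "t = 0" if "t : MN" for t
   using EE[OF that] E_in[OF that] by simp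
  then show False using MN_nonzero cv_subspace_0[OF cs_tensor_space] by blast
 qed
 then obtain v0 w0 where vw: "v0 : space M" "w0 : space N" "E (v0 **C w0) ~= 0" by blast
 have E0: "E (v0 **C w0) : MN" by (rule E_in[OF tensor_in_space[OF vw(1,2)]])
 note tin = tensor_in_space
 show "EX \<phi>:odd_endomorphisms G M. ALL v:space M. \<phi> (\<phi> v) = - v"
 proof -
  obtain \<theta> where \<theta>: "clinear \<theta>" "slice_left \<theta> (E (v0 **C w0)) ~= 0"
   by (rule slice_left_separates[OF fdN sN E0 vw(3)])
  define f where "f = (%v. slice_left \<theta> (E (v **C w0)))"
  have lf: "linear_on (space M) f"
  proof -
   have 1: "linear_on (space M) (%v. v **C w0)" by (simp add: linear_on_def tens_bilinear)
   have 2: "linear_on (space M) (%v. E (v **C w0))"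
    by (rule lin_on_compose[OF 1 tin[OF _ vw(2)] lE])
   show ?thesis
    unfolding f_def
    by (rule lin_on_compose[OF 2 _ lin_clinear[OF clinear_slice_left[OF \<theta>(1)], of UNIV]]) simp
  qed
  have f_in: "f v : space M" if "v : space M" for v
   unfolding f_def by (rule slice_left_in[OF \<theta>(1) sM E_in[OF tin[OF that vw(2)]]])
  have fX: "f (act M x v) = act M x (f v)" if "x : grade G i" "v : space M" for i x v
   unfolding f_def XL_pure[OF tG[OF that(1)] that(2) vw(2), symmetric] EX[OF that(1) tin[OF that(2) vw(2)]]
   by (rule slice_left_XL[OF \<theta>(1) tG[OF that(1)] E_in[OF tin[OF that(2) vw(2)]]])
  have fp: "f (ps v) = - ps (f v)" if "v : space M" for v
   unfolding f_def tau_tens[OF that vw(2), symmetric] Etau[OF tin[OF that vw(2)]]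
    cv_linear_neg[OF clinear_slice_left[OF \<theta>(1)]]
    slice_left_tau[OF \<theta>(1) E_in[OF tin[OF that vw(2)]]] ..
  define \<phi> where "\<phi> = (%v. f (ps v))"
  have "\<phi> : odd_endomorphisms G M"
  proof (rule odd_endomorphismsI[OF gM])
   show "linear_on (space M) \<phi>" unfolding \<phi>_def by (rule lin_on_compose[OF lps psI lf])
   show "\<phi> v : space M" if "v : space M" for v unfolding \<phi>_def by (rule f_in[OF psI[OF that]])
   show "ps (\<phi> v) = - \<phi> (ps v)" if "v : space M" for v
    using fp[OF psI[OF that]] by (simp add: \<phi>_def)
   show "\<phi> (act M x v) = koszul 1 j *C act M x (\<phi> v)" if "x : grade G j" "v : space M" for j x v
    unfolding \<phi>_def act_parity[OF M gG that] lin_on_scale[OF lf aM[OF tG[OF that(1)] psI[OF that(2)]]]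
    fX[OF that(1) psI[OF that(2)]] ..
  qed
  moreover have "\<phi> (ps v0) ~= 0" using \<theta>(2) pss[OF vw(1)] by (simp add: \<phi>_def f_def)
  ultimately show ?thesis
   using odd_endomorphism_normalize[OF irrM fdM gG _ psI[OF vw(1)]] by metis
 qed
 show "EX \<psi>:odd_endomorphisms H N. ALL w:space N. \<psi> (\<psi> w) = - w"
 proof -
  obtain \<theta> where \<theta>: "clinear \<theta>" "slice_right \<theta> (E (v0 **C w0)) ~= 0"
   by (rule slice_right_separates[OF fdM sM E0 vw(3)])
  note cs = clinear_slice_right[OF \<theta>(1)]
  define g where "g = (%w. slice_right \<theta> (E (v0 **C w)))"
  have lg: "linear_on (space N) g"
  proof -
   have 1: "linear_on (space N) (%w. v0 **C w)" by (simp add: linear_on_def tens_bilinear)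
   have 2: "linear_on (space N) (%w. E (v0 **C w))"
    by (rule lin_on_compose[OF 1 tin[OF vw(1)] lE])
   show ?thesis
    unfolding g_def
    by (rule lin_on_compose[OF 2 _ lin_clinear[OF cs, of UNIV]]) simp
  qed
  have g_in: "g w : space N" if "w : space N" for w
   unfolding g_def by (rule slice_right_in[OF \<theta>(1) sN E_in[OF tin[OF vw(1) that]]])
  have gp: "pn (g w) = - g (pn w)" if w: "w : space N" for w
  proof -
   have "v0 **C pn w = tau (sig (v0 **C w))"
    by (simp add: sig_tens tau_tens vw psI pnI pss w)
   then have "E (v0 **C pn w) = - tm (%v. v) pn (E (v0 **C w))"
    using Etau[OF sig_in[OF tin[OF vw(1) w]]] Esig[OF tin[OF vw(1) w]] right_parity_eq[OF E_in[OF tin[OF vw(1) w]]] by simp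
   then show ?thesis
    unfolding g_def using slice_right_map[OF \<theta>(1) E_in[OF tin[OF vw(1) w]] lpn]
    by (simp add: cv_linear_neg[OF cs])
  qed
  have gY: "g (act N y w) = koszul 1 j *C act N y (g w)" if y: "y : grade H j" and w: "w : space N" for j y w
  proof -
   note u = tin[OF vw(1) w]
   have "v0 **C act N y w = (if j = 0 then YR y (v0 **C w) else tau (YR y (v0 **C w)))"
    by (simp add: YR_pure[OF y] tau_tens vw psI pss w aN[OF tH[OF y]])
   then have "E (v0 **C act N y w) = koszul 1 j *C tm (%v. v) (act N y) (E (v0 **C w))"
    unfolding right_act_eq[OF y E_in[OF u]]
    using Etau[OF YR_in[OF tH[OF y] u]] EY[OF y u]
    by (cases j) (simp_all add: scaleC_one)
   then show ?thesis
    unfolding g_def using slice_right_map[OF \<theta>(1) E_in[OF u] laN[OF tH[OF y]]]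
    by (simp add: cv_linear_scale[OF cs])
  qed
  have "g : odd_endomorphisms H N"
   by (rule odd_endomorphismsI[OF gN lg g_in gp gY])
  moreover have "g w0 ~= 0" using \<theta>(2) by (simp add: g_def)
  ultimately show ?thesis
   using odd_endomorphism_normalize[OF irrN fdN gH _ vw(2)] by metis
 qed
qed

context
 fixes \<phi> \<psi> R F
 assumes \<phi>: "\<phi> : odd_endomorphisms G M" "!!v. v : space M ==> \<phi> (\<phi> v) = - v"
  and \<psi>: "\<psi> : odd_endomorphisms H N" "!!w. w : space N ==> \<psi> (\<psi> w) = - w"
 defines "R \<equiv> %u. \<i> *C odd_tensor (mgrade M) (mgrade N) \<phi> \<psi> u"
  and "F \<equiv> {u : MN. R u = u}"
begin

lemmas l\<phi> = odd_endomorphismsD(1)[OF \<phi>(1)] and l\<psi> = odd_endomorphismsD(1)[OF \<psi>(1)]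
lemmas \<phi>I = odd_endomorphism_in[OF \<phi>(1) gM] and \<psi>I = odd_endomorphism_in[OF \<psi>(1) gN]
lemmas \<phi>p = odd_endomorphism_parity[OF \<phi>(1) gM] and \<psi>p = odd_endomorphism_parity[OF \<psi>(1) gN]
lemmas \<phi>x = odd_endomorphismsD(3)[OF \<phi>(1)] and \<psi>y = odd_endomorphismsD(3)[OF \<psi>(1)]

lemma R_lemma: "clinear R" "v : space M ==> w : space N ==> R (v **C w) = \<i> *C (\<phi> (ps v) **C \<psi> w)"
proof -
 let ?B = "%v w. \<Sum>i\<in>{0, 1}. koszul 1 i *C (\<phi> (component (mgrade M) i v) **C \<psi> w)"
 have B: "bilinear_on (space M) (space N) ?B"
  by (intro bilinear_sum bilinear_arith bilinear_tensor l\<psi>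
    lin_on_compose[OF lin_on_component[OF gM] in_total[OF gM component_in[OF gM]] l\<phi>])
 have c: "clinear (odd_tensor (mgrade M) (mgrade N) \<phi> \<psi>)"
  unfolding odd_tensor_def by (rule clinear_tensor_lift[OF sM sN B])
 then show "clinear R" unfolding R_def clinear_iff by (simp add: scaleC_add_right scaleC_scaleC mult.commute)
 assume v: "v : space M" and w: "w : space N"
 have ci: "component (mgrade M) i v : space M" for i by (rule in_total[OF gM component_in[OF gM v]])
 have "odd_tensor (mgrade M) (mgrade N) \<phi> \<psi> (v **C w) = ?B v w"
  unfolding odd_tensor_def by (rule tensor_lift_tens[OF sM sN B v w])
 also have "\<dots> = \<phi> (ps v) **C \<psi> w"
  unfolding parity_map_def lin_on_diff[OF l\<phi> sM ci ci] by (simp add: tensor_diff scaleC_one)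
 finally show "R (v **C w) = \<i> *C (\<phi> (ps v) **C \<psi> w)" by (simp add: R_def)
qed

lemma R_in: "u : MN ==> R u : MN"
 by (rule tensor_linear_maps_into[OF lin_clinear[OF R_lemma(1)] cs_tensor_space])
  (simp_all add: R_lemma(2) cv_subspace_scale[OF cs_tensor_space] tensor_in_space \<phi>I psI \<psi>I)

lemma \<phi>pp: "v : space M ==> \<phi> (ps (\<phi> (ps v))) = v"
 using \<phi>p[OF psI] \<phi>(2) pss lin_on_neg[OF l\<phi> \<phi>I, of v] by (simp add: psI)

lemma RR: "u : MN ==> R (R u) = u"
proof (rule tensor_linear_ext[OF lin_comp2[OF R_lemma(1) R_lemma(1)] lin_id])
 fix v w assume v: "v : space M" and w: "w : space N"
 show "R (R (v **C w)) = v **C w"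
  by (simp add: R_lemma v w cv_linear_scale[OF R_lemma(1)] \<phi>I psI \<psi>I \<phi>pp \<psi>(2) tensor_neg
    scaleC_scaleC scaleC_one)
qed

lemma R_sig: "u : MN ==> R (sig u) = sig (R u)"
 by (rule tensor_linear_ext[OF lin_comp2[OF R_lemma(1) csig] lin_comp2[OF csig R_lemma(1)]])
  (simp_all add: R_lemma sig_tens psI pnI \<phi>I \<psi>I cv_linear_scale[OF csig] \<phi>p \<psi>p tensor_neg)

lemma R_tau: "u : MN ==> R (tau u) = - tau (R u)"
 by (rule tensor_linear_ext[OF lin_comp2[OF R_lemma(1) ctau] lin_on_arith(3)[OF lin_comp2[OF ctau R_lemma(1)]]])
  (simp_all add: R_lemma tau_tens psI pnI \<phi>I \<psi>I cv_linear_scale[OF ctau] \<phi>p tensor_neg)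

lemma R_XL:
 assumes "x : grade G i" "u : MN"
 shows "R (XL x u) = XL x (R u)"
proof (rule tensor_linear_ext[OF lin_comp2[OF R_lemma(1) XL_lin[OF tG[OF assms(1)]]]
   lin_comp2[OF XL_lin[OF tG[OF assms(1)]] R_lemma(1)] _ assms(2)])
 fix v w assume v: "v : space M" and w: "w : space N"
 note x = tG[OF assms(1)]
 have "\<phi> (ps (act M x v)) = act M x (\<phi> (ps v))"
  unfolding act_parity[OF M gG assms(1) v] lin_on_scale[OF l\<phi> aM[OF x psI[OF v]]] \<phi>x[OF assms(1) psI[OF v]]
  by (simp add: scaleC_scaleC scaleC_one)
 then show "R (XL x (v **C w)) = XL x (R (v **C w))"
  by (simp add: R_lemma XL_pure[OF x] v w aM[OF x] psI \<phi>I \<psi>I cv_linear_scale[OF XL_lin[OF x]])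
qed

lemma R_YR:
 assumes "y : grade H j" "u : MN"
 shows "R (YR y u) = YR y (R u)"
proof (rule tensor_linear_ext[OF lin_comp2[OF R_lemma(1) YR_lin[OF tH[OF assms(1)]]]
   lin_comp2[OF YR_lin[OF tH[OF assms(1)]] R_lemma(1)] _ assms(2)])
 fix v w assume v: "v : space M" and w: "w : space N"
 note y = tH[OF assms(1)]
 have "pw j (\<phi> (ps v)) = koszul 1 j *C \<phi> (ps (pw j v))"
  using \<phi>p[OF psI[OF v]] by (cases j) (simp_all add: scaleC_one)
 then show "R (YR y (v **C w)) = YR y (R (v **C w))"
  by (simp add: R_lemma(2)[OF pwI[OF v]] R_lemma(2) YR_pure[OF assms(1)] v w aN[OF y] psI pwI[OF v] \<phi>I \<psi>I \<psi>y[OF assms(1)]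
    cv_linear_scale[OF YR_lin[OF y]] tens_bilinear scaleC_scaleC mult.commute del: if_split)
qed

lemma F_submodule: "F \<subseteq> MN" "stable (indices GH) (ops TM) F"
proof -
 show s: "F \<subseteq> MN" by (auto simp: F_def)
 have "csubspace F"
  unfolding F_def cv_subspace_def
  using cs_tensor_space[of "space M" "space N"]
  by (simp add: cv_linear_0[OF R_lemma(1)] cv_linear_add[OF R_lemma(1)]
    cv_linear_scale[OF R_lemma(1)] csub_intros)
 then show "stable (indices GH) (ops TM) F"
  unfolding stable_T[OF s]
  by (auto simp: F_def R_sig R_XL R_YR sig_in XL_in[OF tG] YR_in[OF tH])
qed

lemma F_decompose:
 assumes "u : MN"
 obtains a b where "a : F" "b : F" "u = a + tau b"
proof -
 let ?a = "(1/2) *C (u + R u)" and ?c = "(1/2) *C (u - R u)"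
 note sT = cs_tensor_space[of "space M" "space N"]
 have a: "?a : F"
  unfolding F_def using assms R_in[OF assms] RR[OF assms]
  by (simp add: csub_intros sT cv_linear_add[OF R_lemma(1)]
    cv_linear_scale[OF R_lemma(1)] add.commute)
 have c: "?c : MN" "R ?c = - ?c"
  using assms R_in[OF assms] RR[OF assms]
  by (simp_all add: csub_intros sT cv_linear_diff[OF R_lemma(1)]
    cv_linear_scale[OF R_lemma(1)] cv_scale_right_diff_distrib)
 have "tau ?c : F" unfolding F_def using R_tau[OF c(1)] c tau_in[OF c(1)]
  by (simp add: cv_linear_neg[OF ctau])
 moreover have "u = ?a + ?c"
 proof -
  have "?a + ?c = (1/2) *C (u + u)" by (simp add: scaleC_add_right[symmetric])
  also have "u + u = 2 *C u" by (metis one_add_one scaleC_add_left scaleC_one)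
  finally show ?thesis by (simp add: scaleC_scaleC scaleC_one)
 qed
 ultimately show ?thesis using a that[of ?a "tau ?c"] tau_tau[OF c(1)] by simp
qed

lemma F_nontrivial: "F ~= {0}" "F ~= MN"
proof -
 show "F ~= {0}"
 proof
  assume F: "F = {0}"
  have "u = 0" if "u : MN" for u
  proof -
   obtain a b where "a : F" "b : F" "u = a + tau b" by (rule F_decompose[OF \<open>u : MN\<close>])
   with F show ?thesis by (simp add: cv_linear_0[OF ctau])
  qed
  then show False using MN_nonzero cv_subspace_0[OF cs_tensor_space] by blast
 qed
 show "F ~= MN"
 proof
  assume F: "F = MN"
  have "u = 0" if "u : MN" for u
  proof -
   have "R (tau u) = tau u" "R u = u" using F that tau_in[OF that] unfolding F_def by blast+
   then have "tau u = - tau u" using R_tau[OF that] by simp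
   then have "tau u = 0" by (rule self_neg_zero)
   then show ?thesis using tau_tau[OF that] cv_linear_0[OF ctau] by simp
  qed
  then show False using MN_nonzero cv_subspace_0[OF cs_tensor_space] by blast
 qed
qed

lemma F_irreducible: "irreducible_family (indices GH) (ops TM) F"
 unfolding irreducible_family_def
proof (intro conjI allI impI)
 show "operators (indices GH) (ops TM) F"
  by (rule operators_subset[OF supermodule_operators[OF supermodule_T graded_GH]])
   (use F_submodule space_T in auto)
 show "F ~= {0}" by (rule F_nontrivial)
 fix W assume W: "W \<subseteq> F & stable (indices GH) (ops TM) W"
 show "W = {0} \<or> W = F"
 proof (cases "W = {0}")
  case False
  have "f : W" if f: "f : F" for f
  proof -
   have "W \<subseteq> MN" "f : MN" using W f F_submodule(1) by blast+
   then obtain a b where ab: "a : W" "b : W" "f = a + tau b"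
    using submodule_plus_twist[OF _ conjunct2[OF W] False, of f] by metis
   have F: "R a = a" "R b = b" "b : MN" "R f = f" using ab f W unfolding F_def by blast+
   have "R f = a - tau b"
    unfolding ab(3) cv_linear_add[OF R_lemma(1)] R_tau[OF F(3)] F(1,2) by simp
   then have "tau b = - tau b" using F(4) ab(3) by simp
   then have "tau b = 0" by (rule self_neg_zero)
   with ab show ?thesis by simp
  qed
  with W show ?thesis by blast
 qed simp
qed

text \<open>The even homomorphism \<open>1 \<otimes> \<psi> \<sigma>\<close> of \<open>M \<otimes> N\<close> exchanges \<open>F\<close> with its complement.\<close>

lemma hom_from_F:
 assumes V: "is_supermodule GH V" and f: "mhom_on GH TM V f" and u: "u : MN" "f u ~= 0"
 obtains g where "mhom_on GH TM V g" "EX u:F. g u ~= 0"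
proof -
 let ?g = "%w. \<psi> (pn w)"
 have lg: "linear_on (space N) ?g" by (rule lin_on_compose[OF lpn pnI l\<psi>])
 have gI: "?g w : space N" if "w : space N" for w using that by (rule \<psi>I[OF pnI])
 let ?D = "tm (%v. v) ?g"
 note cD = clinear_tensor_map[OF sM sN lin_id lg] and D_tens = tensor_map_tens[OF sM sN lin_id lg]
 have D_in: "?D t : MN" if "t : MN" for t
  by (rule tensor_map_in[OF sM sN lin_id lg _ gI that]) simp
 have DX: "?D (XL x t) = XL x (?D t)" if x: "x : grade G i" and t: "t : MN" for i x t
  by (rule tensor_linear_ext[OF lin_comp2[OF cD XL_lin[OF tG[OF x]]] lin_comp2[OF XL_lin[OF tG[OF x]] cD] _ t])
   (simp add: XL_pure[OF tG[OF x]] D_tens aM[OF tG[OF x]] gI)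
 have DY: "?D (YR y t) = YR y (?D t)" if y: "y : grade H j" and t: "t : MN" for j y t
 proof (rule tensor_linear_ext[OF lin_comp2[OF cD YR_lin[OF tH[OF y]]] lin_comp2[OF YR_lin[OF tH[OF y]] cD] _ t])
  fix v w assume v: "v : space M" and w: "w : space N"
  have "?g (act N y w) = act N y (?g w)"
   unfolding act_parity[OF N gH y w] lin_on_scale[OF l\<psi> aN[OF tH[OF y] pnI[OF w]]] \<psi>y[OF y pnI[OF w]]
   by (simp add: scaleC_scaleC scaleC_one)
  then show "?D (YR y (v **C w)) = YR y (?D (v **C w))"
   by (simp add: YR_pure[OF y] D_tens aN[OF tH[OF y]] gI v w pwI[OF v] D_tens[OF pwI[OF v]] del: if_split)
 qed
 have RD: "R (?D t) = - ?D (R t)" if t: "t : MN" for t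
 proof (rule tensor_linear_ext[OF lin_comp2[OF R_lemma(1) cD] lin_on_arith(3)[OF lin_comp2[OF cD R_lemma(1)]] _ t])
  fix v w assume v: "v : space M" and w: "w : space N"
  have "\<psi> (?g w) = - ?g (\<psi> w)"
   using \<psi>p[OF w] lin_on_neg[OF l\<psi> \<psi>I[OF pnI[OF w]]] by simp
  then show "R (?D (v **C w)) = - ?D (R (v **C w))"
   by (simp add: R_lemma D_tens v w gI \<phi>I psI \<psi>I cv_linear_scale[OF cD] tensor_neg)
 qed
 have DD: "?D (?D t) = t" if t: "t : MN" for t
 proof (rule tensor_linear_ext[OF lin_comp2[OF cD cD] lin_id _ t])
  fix v w assume v: "v : space M" and w: "w : space N"
  have "?g (?g w) = w"
   using \<psi>p[OF pnI[OF w]] lin_on_neg[OF l\<psi> \<psi>I[OF w]] pnn[OF w] \<psi>(2)[OF w] by simp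
  then show "?D (?D (v **C w)) = v **C w" by (simp add: D_tens v w gI)
 qed
 have hD: "mhom_on GH TM TM ?D"
 proof (rule module_hom_onI[OF supermodule_T supermodule_T graded_GH], unfold space_T)
  show "linear_on MN ?D" by (rule lin_clinear[OF cD])
  show "!!t. t : MN ==> ?D t : MN" by (rule D_in)
  show "?D (act TM p t) = act TM p (?D t)" if "p : grade GH i" "t : MN" for i p t
  proof -
   obtain x y where p: "p = (x, y)" "x : grade G i" "y : grade H i" using \<open>p : grade GH i\<close> by auto
   show ?thesis
    unfolding p(1) act_split[OF tG[OF p(2)] tH[OF p(3)] that(2)]
    act_split[OF tG[OF p(2)] tH[OF p(3)] D_in[OF that(2)]] cv_linear_add[OF cD]
    DX[OF p(2) that(2)] DY[OF p(3) that(2)] ..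
  qed
 qed
 show ?thesis
 proof (cases "EX u:F. f u ~= 0")
  case True
  then show ?thesis using f that by blast
 next
  case False
  obtain a b where ab: "a : F" "b : F" "u = a + tau b" by (rule F_decompose[OF u(1)])
  have bM: "b : MN" "R b = b" "a : MN" using ab unfolding F_def by blast+
  let ?d = "?D (tau b)"
  have "?d : F"
   unfolding F_def using D_in[OF tau_in[OF bM(1)]] RD[OF tau_in[OF bM(1)]] R_tau[OF bM(1)] bM(2)
   by (simp add: cv_linear_neg[OF cD])
  moreover have "f (?D ?d) ~= 0"
   unfolding DD[OF tau_in[OF bM(1)]]
   using u(2) ab False lin_on_add[OF mhomD(1)[OF f], of a "tau b"] bM tau_in
   by (simp add: space_T)
  ultimately show ?thesis
   using module_hom_compose[OF hD f] that by blast
 qed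
qed

end

lemma irreducible_product_cases:
 obtains "irreducible_supermodule GH TM" "irreducible_product G H M N = TM"
 | F where "F \<subseteq> MN" "irreducible_family (indices GH) (ops TM) F"
  "irreducible_product G H M N = restrict TM F"
  "!!V f u. is_supermodule GH V ==> mhom_on GH TM (V :: ('g \<times> 'h, 'x::complex_vector) supermodule) f ==> u : MN ==> f u ~= 0 ==>
   EX g. mhom_on GH TM V g & (EX u:F. g u ~= 0)"
proof (cases "irreducible_supermodule GH TM")
 case True
 then show ?thesis using that(1) by (simp add: irreducible_product_def)
next
 case False
 then obtain U where U: "U \<subseteq> MN" "stable (indices GH) (ops TM) U" "U ~= {0}" "U ~= MN"
  using supermodule_T supermodule_operators[OF supermodule_T graded_GH] MN_nonzero
  unfolding irreducible_iff[OF graded_GH] irreducible_family_def space_T by blast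
 define \<phi> where "\<phi> = odd_generator G M"
 define \<psi> where "\<psi> = odd_generator H N"
 have "EX \<phi>. \<phi> : odd_endomorphisms G M & (ALL v:space M. \<phi> (\<phi> v) = - v)"
  "EX \<psi>. \<psi> : odd_endomorphisms H N & (ALL v:space N. \<psi> (\<psi> v) = - v)"
  using reducible_odd_endomorphisms[OF U] by blast+
 from someI_ex[OF this(1)] someI_ex[OF this(2)]
 have \<phi>: "\<phi> : odd_endomorphisms G M" "!!v. v : space M ==> \<phi> (\<phi> v) = - v"
  and \<psi>: "\<psi> : odd_endomorphisms H N" "!!w. w : space N ==> \<psi> (\<psi> w) = - w"
  unfolding \<phi>_def \<psi>_def odd_generator_def by blast+
 let ?R = "%u. \<i> *C odd_tensor (mgrade M) (mgrade N) \<phi> \<psi> u"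
 let ?F = "{u : MN. ?R u = u}"
 show ?thesis
 proof (rule that(2)[of ?F])
  show "?F \<subseteq> MN" by blast
  show "irreducible_family (indices GH) (ops TM) ?F"
   by (rule F_irreducible[OF \<phi> \<psi>])
  have "{u : mgrade TM k. ?R u = u} = ?F \<inter> mgrade TM k" for k
   using in_total[OF graded_T, of _ k] unfolding space_T by blast
  then show "irreducible_product G H M N = restrict TM ?F"
   using False by (simp add: irreducible_product_def restrict_def Let_def \<phi>_def \<psi>_def)
  show "EX g. mhom_on GH TM V g & (EX u:?F. g u ~= 0)"
   if h: "is_supermodule GH V" "mhom_on GH TM V f" "u : MN" "f u ~= 0"
   for V :: "('g \<times> 'h, 'x) supermodule" and f u
  proof -
   obtain g where "mhom_on GH TM V g" "EX u:?F. g u ~= 0"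
    by (rule hom_from_F[OF \<phi> \<psi> h])
   then show ?thesis by blast
  qed
 qed
qed

lemma irreducible_product:
 shows irreducible_irreducible_product: "irreducible_supermodule GH (irreducible_product G H M N)"
  and space_irreducible_product: "space (irreducible_product G H M N) \<subseteq> MN"
  and act_irreducible_product: "act (irreducible_product G H M N) = act TM"
proof -
 note st = irr_famD(1)[THEN operators_stable]
 show "irreducible_supermodule GH (irreducible_product G H M N)"
  by (rule irreducible_product_cases)
   (use restrict_irreducible[OF supermodule_T graded_GH] space_T in auto)
 show "space (irreducible_product G H M N) \<subseteq> MN"
  by (rule irreducible_product_cases)
   (use restrict(1)[OF supermodule_T graded_GH _ st] space_T in auto)
 show "act (irreducible_product G H M N) = act TM"
  by (rule irreducible_product_cases) (auto simp: restrict_def)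
qed

lemma iso_irreducible_product:
 assumes V: "irreducible_supermodule GH (V :: ('g \<times> 'h, 'x::complex_vector) supermodule)"
  and f: "mhom_on GH TM V f" "u : MN" "f u ~= 0"
 shows "module_iso GH (irreducible_product G H M N) V"
proof -
 note V' = irr_smod[OF V]
 have "occurs GH (irreducible_product G H M N) V"
 proof (rule irreducible_product_cases[where 'x = 'x])
  assume "irreducible_product G H M N = TM"
  then show ?thesis using f unfolding occurs_def by (auto simp: space_T)
 next
  fix F assume F: "F \<subseteq> MN" "irreducible_family (indices GH) (ops TM) F"
   "irreducible_product G H M N = restrict TM F"
   and *: "!!V f u. is_supermodule GH V ==> mhom_on GH TM (V :: ('g \<times> 'h, 'x) supermodule) f ==> u : MN ==> f u ~= 0 ==>
    EX g. mhom_on GH TM V g & (EX u:F. g u ~= 0)"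
  obtain g where g: "mhom_on GH TM V g" "EX u:F. g u ~= 0"
   using *[OF V' f] by blast
  have "F \<subseteq> space TM" using F(1) space_T by simp
  note R = restrict[OF supermodule_T graded_GH this operators_stable[OF irr_famD(1)[OF F(2)]]]
  have "mhom_on GH (restrict TM F) V g"
   using g(1) F(1) unfolding mhom_on_def R(1,3) space_T
   by (auto intro: lin_on_subset)
  with g(2) show ?thesis unfolding occurs_def F(3) R(1) by blast
 qed
 then show ?thesis
  using occurs_iff_iso[OF irreducible_irreducible_product V graded_GH] by blast
qed

end

section \<open>Pulling modules back along homomorphisms\<close>

definition superalgebra_hom ::
 "'h::complex_vector superalgebra => 'g::complex_vector superalgebra => ('h => 'g) => bool" where
 "superalgebra_hom H G h \<longleftrightarrow> linear_on (underlying H) h & (ALL i. h ` grade H i \<subseteq> grade G i) &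
   (ALL i j. ALL x:grade H i. ALL y:grade H j. h (bracket H x y) = bracket G (h x) (h y))"

lemma pullback_simps [simp]:
 "mgrade (pullback h M) = mgrade M" "act (pullback h M) x = act M (h x)"
 by (simp_all add: pullback_def)

lemma superalgebra_homD:
 assumes "superalgebra_hom H G h" "graded_space (grade H)"
 shows "linear_on (underlying H) h" "!!i x. x : grade H i ==> h x : grade G i"
  "!!i j x y. x : grade H i ==> y : grade H j ==> h (bracket H x y) = bracket G (h x) (h y)"
  "!!x. x : underlying H ==> h x : underlying G"
proof -
 show h1: "linear_on (underlying H) h" "!!i x. x : grade H i ==> h x : grade G i"
  "!!i j x y. x : grade H i ==> y : grade H j ==> h (bracket H x y) = bracket G (h x) (h y)"
  using assms(1) unfolding superalgebra_hom_def by blast+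
 show "h x : underlying G" if x: "x : underlying H" for x
 proof -
  obtain u w where uw: "u : grade H 0" "w : grade H 1" "x = u + w" by (rule total_cases[OF assms(2) x])
  then have "h x = h u + h w"
   using lin_on_add[OF h1(1)] in_total[OF assms(2)] by blast
  with uw h1(2) show ?thesis using totalI by metis
 qed
qed

lemma pullback_supermodule:
 assumes M: "is_supermodule G M" and h: "superalgebra_hom H G h" and H: "graded_space (grade H)"
 shows "is_supermodule H (pullback h M)"
 unfolding is_supermodule_def bilinear_on_def pullback_simps
proof (intro conjI ballI allI)
 note h = superalgebra_homD[OF h H]
 show "graded_space (mgrade M)" by (rule smodD(1)[OF M])
 show "linear_on (underlying H) (%x. act M (h x) v)" if "v : space M" for v
  by (rule lin_on_compose[OF h(1,4) smodD(3)[OF M that]])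
 show "linear_on (space M) (act M (h x))" if "x : underlying H" for x
  by (rule smodD(4)[OF M h(4)[OF that]])
 show "act M (h x) v : mgrade M (i + j)" if "x : grade H i" "v : mgrade M j" for i j x v
  by (rule smodD(5)[OF M h(2)[OF that(1)] that(2)])
 show "act M (h (bracket H x y)) v = act M (h x) (act M (h y) v) - koszul i j *C act M (h y) (act M (h x) v)"
  if "x : grade H i" "y : grade H j" "v : space M" for i j x y v
  unfolding h(3)[OF that(1,2)] by (rule smodD(6)[OF M h(2)[OF that(1)] h(2)[OF that(2)] that(3)])
qed

lemma pullback_irreducible:
 assumes M: "irreducible_supermodule G M" and h: "superalgebra_hom H G h" and H: "graded_space (grade H)"
  and G: "graded_space (grade G)" and surj: "!!i. grade G i \<subseteq> h ` grade H i"
 shows "irreducible_supermodule H (pullback h M)"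
proof -
 note M' = irr_smod[OF M]
 have irr: "irreducible_family (indices G) (ops M) (space M)" using M irreducible_iff[OF G] by blast
 note P = pullback_supermodule[OF M' h H]
 have st: "stable (indices G) (ops M) W" if W: "stable (indices H) (ops (pullback h M)) W" for W
 proof -
  have "act M x ` W \<subseteq> W" if "x : grade G j" for j x
  proof -
   obtain y where "y : grade H j" "x = h y" using surj \<open>x : grade G j\<close> by blast
   then show ?thesis using W unfolding stable_def ball_indices by auto
  qed
  then show ?thesis using W unfolding stable_def ball_indices by auto
 qed
 show ?thesis
  unfolding irreducible_iff[OF H]
  using P supermodule_operators[OF P H] irr st unfolding irreducible_family_def by auto
qed

lemma pullback_hom:
 assumes f: "mhom_on G M N f" and h: "superalgebra_hom H G h" and H: "graded_space (grade H)"
 shows "mhom_on H (pullback h M) (pullback h N) f"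
 using f superalgebra_homD(4)[OF h H] unfolding mhom_on_def by auto

lemma pullback_iso:
 assumes f: "module_iso G M N" and h: "superalgebra_hom H G h" and H: "graded_space (grade H)"
 shows "module_iso H (pullback h M) (pullback h N)"
 using f pullback_hom[OF _ h H] unfolding module_iso_iff pullback_simps by blast

abbreviation left_part :: "('g \<times> 'h::complex_vector, 'v) supermodule => ('g, 'v) supermodule" where
 "left_part \<equiv> pullback (%x. (x, 0))"

abbreviation right_part :: "('g::complex_vector \<times> 'h, 'v) supermodule => ('h, 'v) supermodule" where
 "right_part \<equiv> pullback (%y. (0, y))"

lemma
 assumes G: "graded_algebra G" and H: "graded_algebra H"
 shows hom_left: "superalgebra_hom G (direct_sum G H) (%x. (x, 0))"
  and hom_right: "superalgebra_hom H (direct_sum G H) (%y. (0, y))"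
proof -
 have z: "0 : grade G i" "0 : grade H i" "0 : underlying G" "0 : underlying H" for i
  using cv_subspace_0 graded_subspace graded_total graded_algebraD(1) G H by blast+
 show "superalgebra_hom G (direct_sum G H) (%x. (x, 0))"
  unfolding superalgebra_hom_def linear_on_def using z bracket_zero[OF H] by auto
 show "superalgebra_hom H (direct_sum G H) (%x. (0, x))"
  unfolding superalgebra_hom_def linear_on_def using z bracket_zero[OF G] by auto
qed

section \<open>Modules of homomorphisms\<close>

lemma finite_dimensional_functions:
 fixes V :: "'v::complex_vector set" and W :: "'w::complex_vector set"
 assumes "finite_dimensional V" "csubspace V" "finite_dimensional W"
 shows "finite_dimensional {f. linear_on V f & f ` V \<subseteq> W & (ALL v. v ~: V --> f v = 0)}"
proof -
 obtain B \<theta> where B: "finite B" "B \<subseteq> V" "!!b. clinear (\<theta> b :: 'v => complex)" "!!v. v : V ==> v = (\<Sum>b\<in>B. \<theta> b v *C b)"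
  using dual_basis[OF assms(1,2)] by blast
 obtain C where C: "finite C" "W \<subseteq> cspan C" using assms(3) finite_dimensional_def by blast
 define E :: "'v => 'w => 'v => 'w" where "E = (%b w v. if v : V then \<theta> b v *C w else 0)"
 let ?S = "(%(b, c). E b c) ` (B \<times> C)"
 have E: "E b w : cspan ?S" if b: "b : B" and w: "w : cspan C" for b w
 proof -
  have "E b (x + y) = E b x + E b y" "E b (k *C x) = k *C E b x" "E b 0 = 0" for x y k
   by (auto simp: E_def fun_eq_iff scaleC_add_right scaleC_fun_def scaleC_scaleC mult.commute)
  then have "csubspace {w. E b w : cspan ?S}"
   unfolding cv_subspace_def
   by (auto intro: cv_span_add cv_span_scale cv_span_zero)
  moreover have "C \<subseteq> {w. E b w : cspan ?S}" using b by (auto intro!: cv_span_base)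
  ultimately have "cspan C \<subseteq> {w. E b w : cspan ?S}" by (intro cv_span_minimal)
  with w show ?thesis by blast
 qed
 have "f : cspan ?S" if f: "linear_on V f" "f ` V \<subseteq> W" "ALL v. v ~: V --> f v = 0" for f
 proof -
  have 1: "f v = (\<Sum>b\<in>B. E b (f b) v)" for v
  proof (cases "v : V")
   case True
   have "f v = f (\<Sum>b\<in>B. \<theta> b v *C b)" using B(4)[OF True] by simp
   also have "\<dots> = (\<Sum>b\<in>B. \<theta> b v *C f b)"
    using B(2) by (subst lin_on_sum[OF f(1) assms(2)])
    (auto intro!: cv_subspace_scale assms(2) sum.cong lin_on_scale[OF f(1)])
   finally show ?thesis using True by (simp add: E_def)
  qed (use f in \<open>simp add: E_def\<close>)
  have 2: "(\<Sum>b\<in>B. E b (f b)) v = (\<Sum>b\<in>B. E b (f b) v)" for v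
   by (induction B rule: infinite_finite_induct) simp_all
  have "f = (\<Sum>b\<in>B. E b (f b))" by (rule ext) (rule trans[OF 1 2[symmetric]])
  moreover have "(\<Sum>b\<in>B. E b (f b)) : cspan ?S"
   using B(2) C(2) f(2) by (intro cv_span_sum E) auto
  ultimately show ?thesis by simp
 qed
 moreover have "finite ?S" using B C by simp
 ultimately show ?thesis unfolding finite_dimensional_def by blast
qed

definition hom_grade ::
 "'g::complex_vector superalgebra => ('g, 'v::complex_vector) supermodule =>
  ('g, 'x::complex_vector) supermodule => bit => ('v => 'x) set" where
 "hom_grade G M V k = {f. linear_on (space M) f & f ` space M \<subseteq> space V & (ALL v. v ~: space M --> f v = 0) &
   (ALL i. ALL x:grade G i. ALL v:space M. f (act M x v) = act V x (f v)) &
   (ALL v:space M. parity_map (mgrade V) (f v) = koszul 1 k *C f (parity_map (mgrade M) v))}"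

definition hom_module ::
 "'g::complex_vector superalgebra => 'h::complex_vector superalgebra => ('g, 'v::complex_vector) supermodule =>
  ('g \<times> 'h, 'x::complex_vector) supermodule => ('h, 'v => 'x) supermodule" where
 "hom_module G H M V = \<lparr>mgrade = hom_grade G M (left_part V),
   act = (%y f v. if v : space M
    then act V (0, component (grade H) 0 y) (f v) +
    act V (0, component (grade H) 1 y) (f (parity_map (mgrade M) v)) else 0)\<rparr>"

locale hom_space =
 fixes G :: "'g::complex_vector superalgebra" and H :: "'h::complex_vector superalgebra"
  and M :: "('g, 'v::complex_vector) supermodule" and V :: "('g \<times> 'h, 'x::complex_vector) supermodule"
 assumes G: "graded_algebra G" and H: "graded_algebra H"
  and M: "is_supermodule G M" and V: "is_supermodule (direct_sum G H) V"
begin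

abbreviation "XX \<equiv> hom_module G H M V"
abbreviation "ps \<equiv> parity_map (mgrade M)"
abbreviation "pv \<equiv> parity_map (mgrade V)"
abbreviation "pw (j::bit) v \<equiv> if j = 0 then v else ps v"
abbreviation "GH \<equiv> direct_sum G H"

lemmas gG = graded_algebraD(1)[OF G] and gH = graded_algebraD(1)[OF H]
lemmas gM = smodD(1)[OF M] and gV = smodD(1)[OF V]
lemmas sM = smodD(2)[OF M] and sV = smodD(2)[OF V]
lemmas psI = parity_in[OF gM] and pss = parity_parity[OF gM]
lemmas lps = lin_on_parity[OF gM] and lpv = lin_on_parity[OF gV]
lemmas tG = in_total[OF gG] and tH = in_total[OF gH]
lemmas aM = act_in[OF M gG]

lemma gGH: "graded_space (grade GH)" by (rule graded_direct_sum[OF gG gH])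

lemma z: "0 : grade G i" "0 : grade H i" "0 : underlying G" "0 : underlying H"
 using cv_subspace_0 graded_subspace[OF gG] graded_subspace[OF gH] graded_total[OF gG] graded_total[OF gH] by blast+

lemma pwI: "v : space M ==> pw j v : space M" by (simp add: psI)

lemma lpw: "linear_on (space M) (%v. pw j v)"
 by (cases j) (simp_all add: lin_on_arith lps)

lemma gradeD:
 assumes "f : hom_grade G M (left_part V) k"
 shows "linear_on (space M) f" "!!v. v : space M ==> f v : space V" "!!v. v ~: space M ==> f v = 0"
  "!!i x v. x : grade G i ==> v : space M ==> f (act M x v) = act V (x, 0) (f v)"
  "!!v. v : space M ==> pv (f v) = koszul 1 k *C f (ps v)"
 using assms unfolding hom_grade_def by auto

lemma lV: "x : underlying G ==> linear_on (space V) (act V (x, 0))" "y : underlying H ==> linear_on (space V) (act V (0, y))"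
 using smodD(4)[OF V] z unfolding underlying_direct_sum by blast+

lemma aV: "x : underlying G ==> u : space V ==> act V (x, 0) u : space V"
 "y : underlying H ==> u : space V ==> act V (0, y) u : space V"
 using act_in[OF V gGH] z unfolding underlying_direct_sum by blast+

lemma hom_grade_subspace: "csubspace (hom_grade G M (left_part V) k)"
 unfolding cv_subspace_def
proof (intro conjI ballI allI)
 note z0 = lin_on_0[OF lV(1) sV] lin_on_0[OF lpv sV]
 show "0 : hom_grade G M (left_part V) k"
  unfolding hom_grade_def using cv_subspace_0[OF sV] z0(1)[OF tG] z0(2)
  by (auto simp: lin_on_arith(6) zero_fun_def)
 fix f g assume f: "f : hom_grade G M (left_part V) k" and g: "g : hom_grade G M (left_part V) k"
 show "f + g : hom_grade G M (left_part V) k"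
  unfolding hom_grade_def
  using lin_on_arith(1)[OF gradeD(1)[OF f] gradeD(1)[OF g]] gradeD(2-)[OF f] gradeD(2-)[OF g]
   cv_subspace_add[OF sV]
  by (auto simp: plus_fun_def lin_on_add[OF lV(1)[OF tG]] lin_on_add[OF lpv] scaleC_add_right)
next
 fix c f assume f: "f : hom_grade G M (left_part V) k"
 show "c *C f : hom_grade G M (left_part V) k"
  unfolding hom_grade_def
  using lin_on_arith(4)[OF gradeD(1)[OF f], of c] gradeD(2-)[OF f]
   cv_subspace_scale[OF sV]
  by (auto simp: scaleC_fun_def lin_on_scale[OF lV(1)[OF tG]] lin_on_scale[OF lpv] scaleC_scaleC mult.commute)
qed

lemma graded_X: "graded_space (mgrade XX)"
proof -
 have "f = 0" if f: "f : hom_grade G M (left_part V) 0" and g: "f : hom_grade G M (left_part V) 1" for f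
 proof
  fix v
  have "f (ps w) = 0" if "w : space M" for w
   using gradeD(5)[OF f that] gradeD(5)[OF g that] by (intro self_neg_zero) (simp add: scaleC_one)
  then show "f v = 0 v"
   using pss[of v] psI[of v] gradeD(3)[OF f, of v] by (cases "v : space M") (auto simp: zero_fun_def, metis)
 qed
 then show ?thesis
  unfolding graded_space_def hom_module_def
  using hom_grade_subspace cv_subspace_0[OF hom_grade_subspace] by auto
qed

lemma spaceD:
 assumes "f : space XX"
 shows "linear_on (space M) f" "!!v. v : space M ==> f v : space V" "!!v. v ~: space M ==> f v = 0"
  "!!i x v. x : grade G i ==> v : space M ==> f (act M x v) = act V (x, 0) (f v)"
proof -
 obtain a b where "a : mgrade XX 0" "b : mgrade XX 1" and f: "f = a + b"
  by (rule total_cases[OF graded_X assms])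
 then have ab: "a : hom_grade G M (left_part V) 0" "b : hom_grade G M (left_part V) 1"
  by (simp_all add: hom_module_def)
 show "linear_on (space M) f" "!!v. v : space M ==> f v : space V" "!!v. v ~: space M ==> f v = 0"
  "!!i x v. x : grade G i ==> v : space M ==> f (act M x v) = act V (x, 0) (f v)"
  unfolding f using lin_on_arith(1)[OF gradeD(1)[OF ab(1)] gradeD(1)[OF ab(2)]]
   gradeD(2-4)[OF ab(1)] gradeD(2-4)[OF ab(2)] cv_subspace_add[OF sV]
  by (auto simp: plus_fun_def lin_on_add[OF lV(1)[OF tG]])
qed

lemma fd_X:
 assumes "finite_dimensional (space M)" "finite_dimensional (space V)"
 shows "finite_dimensional (space XX)"
 by (rule finite_dimensional_subset[OF finite_dimensional_functions[OF assms(1) sM assms(2)]])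
  (use spaceD in blast)

lemma act_X:
 assumes y: "y : grade H j" and f: "f : space XX" and v: "v : space M"
 shows "act XX y f v = act V (0, y) (f (pw j v))"
proof -
 have "act V (0, 0) u = 0" if "u : space V" for u
  using lin_on_0[OF smodD(3)[OF V that] graded_total[OF gGH]] by (simp add: zero_prod_def)
 then show ?thesis
  using v spaceD(2)[OF f] psI[OF v]
  by (cases j) (simp_all add: hom_module_def component_homogeneous[OF gH y])
qed

lemma act_X_out: "v ~: space M ==> act XX y f v = 0"
 by (simp add: hom_module_def)

lemma act_commute:
 assumes x: "x : grade G i" and y: "y : grade H j" and u: "u : space V"
 shows "act V (0, y) (act V (x, 0) u) = koszul i j *C act V (x, 0) (act V (0, y) u)"
proof -
 have "act V (bracket GH (0, y) (x, 0)) u = act V (0, y) (act V (x, 0) u) - koszul j i *C act V (x, 0) (act V (0, y) u)"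
  by (rule smodD(6)[OF V _ _ u]) (use x y z in auto)
 moreover have "bracket GH (0, y) (x, 0) = 0"
  using bracket_zero[OF G tG[OF x]] bracket_zero[OF H tH[OF y]] by (simp add: zero_prod_def)
 moreover have "act V 0 u = 0"
  using lin_on_0[OF smodD(3)[OF V u] graded_total[OF gGH]] .
 ultimately show ?thesis by (simp add: koszul_def conj_commute)
qed

lemma act_X_grade:
 assumes y: "y : grade H i" and f: "f : mgrade XX j"
 shows "act XX y f : mgrade XX (i + j)"
proof -
 have f': "f : hom_grade G M (left_part V) j" using f by (simp add: hom_module_def)
 note fs = in_total[OF graded_X f]
 note A = act_X[OF y fs]
 note yH = tH[OF y]
 have "act XX y f : hom_grade G M (left_part V) (i + j)"
  unfolding hom_grade_def mem_Collect_eq pullback_simps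
 proof (intro conjI allI ballI impI)
  have "linear_on (space M) (%v. act V (0, y) (f (pw i v)))"
   by (rule lin_on_compose[OF lin_on_compose[OF lpw pwI gradeD(1)[OF f']] gradeD(2)[OF f' pwI] lV(2)[OF yH]])
  then show "linear_on (space M) (act XX y f)"
   using lin_on_cong[of "space M" "act XX y f" "%v. act V (0, y) (f (pw i v))"] A sM by blast
  show "act XX y f ` space M \<subseteq> space V"
   using A aV(2)[OF yH gradeD(2)[OF f' pwI]] by auto
  show "act XX y f v = 0" if "v ~: space M" for v by (rule act_X_out[OF that])
  show "act XX y f (act M x v) = act V (x, 0) (act XX y f v)" if x: "x : grade G k" and v: "v : space M" for k x v
  proof -
   have pa: "pw i (act M x v) = koszul i k *C act M x (pw i v)"
    using act_parity[OF M gG x v] by (cases i) (simp_all add: scaleC_one)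
   have "act XX y f (act M x v) = act V (0, y) (f (koszul i k *C act M x (pw i v)))"
    unfolding A[OF aM[OF tG[OF x] v]] pa ..
   also have "\<dots> = koszul i k *C act V (0, y) (act V (x, 0) (f (pw i v)))"
    unfolding lin_on_scale[OF gradeD(1)[OF f'] aM[OF tG[OF x] pwI[OF v]]] gradeD(4)[OF f' x pwI[OF v]]
    by (rule lin_on_scale[OF lV(2)[OF yH] aV(1)[OF tG[OF x] gradeD(2)[OF f' pwI[OF v]]]])
   also have "\<dots> = act V (x, 0) (act XX y f v)"
    unfolding act_commute[OF x y gradeD(2)[OF f' pwI[OF v]]] A[OF v]
    by (simp add: scaleC_scaleC scaleC_one koszul_def del: if_split)
   finally show ?thesis .
  qed
  show "pv (act XX y f v) = koszul 1 (i + j) *C act XX y f (ps v)" if v: "v : space M" for v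
  proof -
   have "(0, y) : grade GH i" using y z by simp
   from act_parity[OF V gGH this gradeD(2)[OF f' pwI[OF v]]]
   have "pv (act XX y f v) = koszul 1 i *C act V (0, y) (pv (f (pw i v)))" unfolding A[OF v] .
   also have "\<dots> = (koszul 1 i * koszul 1 j) *C act V (0, y) (f (ps (pw i v)))"
    unfolding gradeD(5)[OF f' pwI[OF v]] lin_on_scale[OF lV(2)[OF yH] gradeD(2)[OF f' psI[OF pwI[OF v]]]]
    by (simp add: scaleC_scaleC)
   also have "ps (pw i v) = pw i (ps v)" by simp
   finally show ?thesis unfolding koszul_mult A[OF psI[OF v]] .
  qed
 qed
 then show ?thesis by (simp add: hom_module_def)
qed

lemma supermodule_X: "is_supermodule H XX"
 unfolding is_supermodule_def bilinear_on_def
proof (intro conjI ballI allI)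
 show "graded_space (mgrade XX)" by (rule graded_X)
 show "act XX y f : mgrade XX (i + j)" if "y : grade H i" "f : mgrade XX j" for i j y f
  by (rule act_X_grade[OF that])
 have lin_y: "linear_on (underlying H) (%y. act V (0, component (grade H) k y) u)" if u: "u : space V" for k u
 proof -
  have "linear_on (underlying H) (%y. (0, y) :: 'g \<times> 'h)" by (simp add: linear_on_def)
  then have 1: "linear_on (underlying H) (%y. act V (0, y) u)"
   by (rule lin_on_compose[OF _ _ smodD(3)[OF V u]]) (use z in \<open>simp add: underlying_direct_sum\<close>)
  show ?thesis
   by (rule lin_on_compose[OF lin_on_component[OF gH] _ 1]) (rule tH[OF component_in[OF gH]])
 qed
 show "linear_on (underlying H) (%y. act XX y f)" if f: "f : space XX" for f
  unfolding linear_on_def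
 proof (intro conjI ballI allI)
  show "act XX (y + y') f = act XX y f + act XX y' f" if "y : underlying H" "y' : underlying H" for y y'
   using lin_on_add[OF lin_y that] spaceD(2)[OF f] psI by (auto simp: fun_eq_iff hom_module_def algebra_simps)
  show "act XX (c *C y) f = c *C act XX y f" if "y : underlying H" for c y
   using lin_on_scale[OF lin_y that] spaceD(2)[OF f] psI by (auto simp: fun_eq_iff hom_module_def scaleC_fun_def scaleC_add_right)
 qed
 have sX: "csubspace (space XX)" by (rule graded_total[OF graded_X])
 show "linear_on (space XX) (act XX y)" if y: "y : underlying H" for y
 proof -
  note l = lV(2)[OF tH[OF component_in[OF gH y]]]
  show ?thesis
   unfolding linear_on_def
  proof (intro conjI ballI allI)
   show "act XX y (f + g) = act XX y f + act XX y g" if "f : space XX" "g : space XX" for f g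
    using lin_on_add[OF l] spaceD(2)[OF that(1)] spaceD(2)[OF that(2)] psI
    by (auto simp: fun_eq_iff hom_module_def algebra_simps)
   show "act XX y (c *C f) = c *C act XX y f" if "f : space XX" for c f
    using lin_on_scale[OF l] spaceD(2)[OF that] psI
    by (auto simp: fun_eq_iff hom_module_def scaleC_fun_def scaleC_add_right)
  qed
 qed
 show "act XX (bracket H y y') f = act XX y (act XX y' f) - koszul i j *C act XX y' (act XX y f)"
  if y: "y : grade H i" and y': "y' : grade H j" and f: "f : space XX" for i j y y' f
 proof
  fix v
  have X1: "act XX r f : space XX" if "r : grade H k" for k r
  proof -
   obtain a b where ab: "a : mgrade XX 0" "b : mgrade XX 1" "f = a + b" by (rule total_cases[OF graded_X f])
   have "act XX r f = act XX r a + act XX r b"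
   proof
    fix v
    show "act XX r f v = (act XX r a + act XX r b) v"
    using lin_on_add[OF lV(2)[OF tH[OF that]]] spaceD(2)[OF in_total[OF graded_X ab(1)]] spaceD(2)[OF in_total[OF graded_X ab(2)]]
    by (cases "v : space M") (simp_all add: act_X_out act_X[OF that] f in_total[OF graded_X ab(1)] in_total[OF graded_X ab(2)] pwI del: if_split, simp add: ab(3) psI)
   qed
   then show ?thesis
    using act_X_grade[OF that ab(1)] act_X_grade[OF that ab(2)] in_total[OF graded_X] cv_subspace_add[OF sX] by metis
  qed
  show "act XX (bracket H y y') f v = (act XX y (act XX y' f) - koszul i j *C act XX y' (act XX y f)) v"
  proof (cases "v : space M")
   case True
   have b: "bracket H y y' : grade H (i + j)" by (rule graded_algebraD(2)[OF H y y'])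
   have pp: "pw j (pw i v) = pw (i + j) v" "pw i (pw j v) = pw (i + j) v"
    using pss[OF True] by (cases i; cases j; simp)+
   have in_V: "f (pw (i + j) v) : space V" by (rule spaceD(2)[OF f pwI[OF True]])
   have "act V (bracket GH (0, y) (0, y')) (f (pw (i + j) v)) =
    act V (0, y) (act V (0, y') (f (pw (i + j) v))) - koszul i j *C act V (0, y') (act V (0, y) (f (pw (i + j) v)))"
    by (rule smodD(6)[OF V _ _ in_V]) (use y y' z in auto)
   moreover have "bracket GH (0, y) (0, y') = (0, bracket H y y')"
    using bracket_zero[OF G z(3)] by simp
   ultimately have "act XX (bracket H y y') f v =
    act V (0, y) (act V (0, y') (f (pw (i + j) v))) - koszul i j *C act V (0, y') (act V (0, y) (f (pw (i + j) v)))"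
    using act_X[OF b f True] by simp
   then show ?thesis
    unfolding fun_diff_def scaleC_fun_def act_X[OF y X1[OF y'] True] act_X[OF y' X1[OF y] True]
    act_X[OF y' f pwI[OF True]] act_X[OF y f pwI[OF True]] pp .
  qed (simp add: act_X_out scaleC_fun_def)
 qed
qed

text \<open>A homomorphism into the module of homomorphisms is the same as a pairing, that is, a homomorphism
  from the tensor product.\<close>

lemma hom_from_pairing:
 assumes N: "is_supermodule H (N :: ('h, 'w::complex_vector) supermodule)"
  and g: "mhom_on H N XX g" and n: "n : space N" "g n ~= 0"
 obtains f u where "mhom_on GH (tensor_module H M N) V f"
  "u : tensor_space (space M) (space N)" "f u ~= 0"
proof -
 interpret T: super_tensor G H M N by unfold_locales (rule G H M N)+
 note gD = mhomD[OF g]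
 let ?B = "%v n. g n v"
 have B: "bilinear_on (space M) (space N) ?B"
  unfolding bilinear_on_def
 proof (intro conjI ballI)
  show "linear_on (space M) (g n)" if "n : space N" for n by (rule spaceD(1)[OF gD(2)[OF that]])
  show "linear_on (space N) (%n. g n v)" for v
   using gD(1) unfolding linear_on_def by (simp add: scaleC_fun_def)
 qed
 define f where "f = tensor_lift (space M) (space N) ?B"
 have cf: "clinear f" unfolding f_def by (rule clinear_tensor_lift[OF sM T.sN B])
 have ft: "f (v **C n) = g n v" if "v : space M" "n : space N" for v n
  unfolding f_def by (rule tensor_lift_tens[OF sM T.sN B that])
 have f_in: "f t : space V" if "t : T.MN" for t
  by (rule tensor_linear_maps_into[OF clinear_linear_on[OF cf] sV _ that]) (simp add: ft spaceD(2) gD(2))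
 have "mhom_on GH T.TM V f"
 proof (rule module_hom_onI[OF T.supermodule_T V gGH], unfold T.space_T)
  show "linear_on T.MN f" by (rule clinear_linear_on[OF cf])
  show "!!t. t : T.MN ==> f t : space V" by (rule f_in)
  fix i p t assume "p : grade GH i" and t: "t : T.MN"
  then obtain x y where p: "p = (x, y)" "x : grade G i" "y : grade H i" by auto
  note xy = tG[OF p(2)] tH[OF p(3)]
  have pU: "p : underlying GH" unfolding p(1) underlying_direct_sum using xy by blast
  show "f (act T.TM p t) = act V p (f t)"
  proof (rule tensor_linear_ext[OF _ _ _ t])
   show "linear_on T.MN (%t. f (act T.TM p t))"
    unfolding p(1) by (rule T.lin_comp2[OF cf T.act_T_lemma(1)[OF xy]])
   show "linear_on T.MN (%t. act V p (f t))"
    by (rule lin_on_compose[OF clinear_linear_on[OF cf] f_in smodD(4)[OF V pU]])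
   fix v n assume v: "v : space M" and n: "n : space N"
   note gn = gD(2)[OF n]
   have "f (act T.TM p (v **C n)) = f (act M x v **C n + pw i v **C act N y n)"
    unfolding p(1) T.act_pure[OF xy(1) p(3) v n] ..
   also have "\<dots> = g n (act M x v) + g (act N y n) (pw i v)"
    unfolding cv_linear_add[OF cf] ft[OF aM[OF xy(1) v] n] ft[OF pwI[OF v] T.aN[OF xy(2) n]] ..
   also have "g (act N y n) (pw i v) = act V (0, y) (g n (pw i (pw i v)))"
    unfolding gD(3)[OF xy(2) n] act_X[OF p(3) gn pwI[OF v]] ..
   also have "pw i (pw i v) = v" using pss[OF v] by simp
   also have "g n (act M x v) + act V (0, y) (g n v) = act V (x, 0) (g n v) + act V (0, y) (g n v)"
    unfolding spaceD(4)[OF gn p(2) v] ..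
   also have "\<dots> = act V p (g n v)"
    using lin_on_add[OF smodD(3)[OF V spaceD(2)[OF gn v]], of "(x, 0)" "(0, y)"] xy z
    by (simp add: underlying_direct_sum p(1))
   finally show "f (act T.TM p (v **C n)) = act V p (f (v **C n))" unfolding ft[OF v n] .
  qed
 qed
 moreover obtain v where v: "g n v ~= 0" using n(2) by (metis ext zero_fun_apply)
 moreover have "v : space M" using v spaceD(3)[OF gD(2)[OF n(1)]] by blast
 ultimately show ?thesis using that[of f "v **C n"] tensor_in_space[of v "space M" n "space N"] n(1) ft by simp
qed

end

section \<open>Irreducible modules over a direct sum\<close>

lemma separated_occurs:
 assumes Q: "is_supermodule G Q" "finite_dimensional (space Q)" "space Q ~= {0}" and G: "graded_space (grade G)"
  and M: "irreducible_supermodule G M"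
  and sep: "!!u. u : space Q ==> u ~= 0 ==> EX \<Lambda>. mhom_on G Q M \<Lambda> & \<Lambda> u ~= 0"
 shows "occurs G M Q"
proof -
 obtain W where W: "W \<subseteq> space Q" "irreducible_supermodule G (restrict Q W)"
  "space (restrict Q W) = W" "mhom_on G (restrict Q W) Q (%v. v)"
  by (rule exists_irreducible_submodule[OF Q(1) G Q(2,3)])
 obtain w where w: "w : space (restrict Q W)" "w ~= 0" by (rule irreducible_nonzero[OF W(2)])
 then obtain \<Lambda> where \<Lambda>: "mhom_on G Q M \<Lambda>" "\<Lambda> w ~= 0" using sep[of w] W(1,3) by blast
 have "occurs G (restrict Q W) M"
  unfolding occurs_def using module_hom_compose[OF W(4) \<Lambda>(1)] \<Lambda>(2) w(1) by blast
 then have "module_iso G (restrict Q W) M" using occurs_iff_iso[OF W(2) M G] by blast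
 then have "module_iso G M (restrict Q W)"
  by (rule module_iso_sym[OF _ irr_smod[OF W(2)] G])
 then have "occurs G M (restrict Q W)" by (rule module_iso_imp_occurs[OF _ M])
 then show ?thesis by (rule occurs_trans_injective[OF _ W(4)])
qed

context super_tensor_irreducible
begin

lemmas P_irr = irreducible_irreducible_product
abbreviation "PP \<equiv> irreducible_product G H M N"

lemma product_separates_left:
 assumes "u : space PP" "u ~= 0"
 obtains \<Lambda> where "mhom_on G (left_part PP) M \<Lambda>" "\<Lambda> u ~= 0"
proof -
 have uM: "u : MN" using assms(1) space_irreducible_product by blast
 obtain \<theta> where \<theta>: "clinear \<theta>" "slice_left \<theta> u ~= 0"
  by (rule slice_left_separates[OF fdN sN uM assms(2)])
 have "mhom_on G (left_part PP) M (slice_left \<theta>)"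
  unfolding mhom_on_def pullback_simps
 proof (intro conjI ballI image_subsetI)
  show "linear_on (space PP) (slice_left \<theta>)" by (rule clinear_linear_on[OF clinear_slice_left[OF \<theta>(1)]])
  show "slice_left \<theta> t : space M" if "t : space PP" for t
   using slice_left_in[OF \<theta>(1) sM, of t] that space_irreducible_product by blast
  show "slice_left \<theta> (act PP (x, 0) t) = act M x (slice_left \<theta> t)" if "x : underlying G" "t : space PP" for x t
   using slice_left_XL[OF \<theta>(1) that(1), of t] that(2) space_irreducible_product
   unfolding act_irreducible_product by blast
 qed
 with \<theta>(2) show ?thesis using that by blast
qed

text \<open>An operator \<open>y\<close> on the second factor acts as \<open>\<sigma>\<^bsup>|y|\<^esup> \<otimes> y\<close>, so a slice \<open>S\<close> has to be replaced by
  \<open>S + S (\<sigma> \<otimes> 1)\<close> or by \<open>\<sigma> (S - S (\<sigma> \<otimes> 1))\<close> to become a homomorphism.\<close>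

lemma product_separates_right:
 assumes "u : space PP" "u ~= 0"
 obtains \<Lambda> where "mhom_on H (right_part PP) N \<Lambda>" "\<Lambda> u ~= 0"
proof -
 have PM: "space PP \<subseteq> MN" by (rule space_irreducible_product)
 have uM: "u : MN" using assms(1) PM by blast
 obtain \<theta> where \<theta>: "clinear \<theta>" "slice_right \<theta> u ~= 0"
  by (rule slice_right_separates[OF fdM sM uM assms(2)])
 define S :: "('v, 'w) tensor => 'w" where "S = slice_right \<theta>"
 define S' where "S' = (%t. S (tau t))"
 have cS: "clinear S" unfolding S_def by (rule clinear_slice_right[OF \<theta>(1)])
 have lS: "linear_on A S" and lS': "linear_on A S'" for A
  unfolding S'_def by (rule clinear_linear_on[OF cS]) (rule lin_comp2[OF cS ctau])
 have SI: "S t : space N" "S' t : space N" if "t : MN" for t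
  unfolding S'_def S_def using slice_right_in[OF \<theta>(1) sN] that tau_in by blast+
 have Sy: "S (YR y t) = act N y (if j = 0 then S t else S' t)"
  "S' (YR y t) = act N y (if j = 0 then S' t else S t)" if y: "y : grade H j" and t: "t : MN" for y j t
 proof -
  note m = slice_right_map[OF \<theta>(1) _ laN[OF tH[OF y]]]
  have e: "S (if j = 0 then YR y r else tau (YR y r)) = act N y (S r)" if "r : MN" for r
   using m[OF that] unfolding right_act_eq[OF y that] S_def .
  show "S (YR y t) = act N y (if j = 0 then S t else S' t)"
   using e[OF t] e[OF tau_in[OF t]] unfolding YR_tau[OF y t] tau_tau[OF YR_in[OF tH[OF y] t]] S'_def
   by (cases "j = 0") simp_all
  show "S' (YR y t) = act N y (if j = 0 then S' t else S t)"
   using e[OF t] e[OF tau_in[OF t]] unfolding YR_tau[OF y t] S'_def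
   by (cases "j = 0") simp_all
 qed
 have supP: "is_supermodule H (right_part PP)"
  by (rule pullback_supermodule[OF irr_smod[OF P_irr] hom_right[OF G H] gH])
 define A where "A = (%t. S t + S' t)"
 define B where "B = (%t. pn (S t - S' t))"
 have hA: "mhom_on H (right_part PP) N A"
 proof (rule module_hom_onI[OF supP N gH], unfold pullback_simps act_irreducible_product)
  show "linear_on (space PP) A" unfolding A_def by (intro lin_on_arith lS lS')
  show "A t : space N" if "t : space PP" for t
   unfolding A_def using SI that PM by (intro cv_subspace_add[OF sN]) blast+
  fix j y t assume y: "y : grade H j" and "t : space PP"
  then have t: "t : MN" using PM by blast
  show "A (YR y t) = act N y (A t)"
   unfolding A_def Sy[OF y t] lin_on_add[OF laN[OF tH[OF y]] SI[OF t]] by (simp add: add.commute)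
 qed
 have hB: "mhom_on H (right_part PP) N B"
 proof (rule module_hom_onI[OF supP N gH], unfold pullback_simps act_irreducible_product)
  have dI: "S t - S' t : space N" if "t : MN" for t
   using SI[OF that] by (rule cv_subspace_diff[OF sN])
  show "linear_on (space PP) B"
   unfolding B_def by (rule lin_on_compose[OF lin_on_arith(2)[OF lS lS'] _ lpn]) (use dI PM in blast)
  show "B t : space N" if "t : space PP" for t
   unfolding B_def using dI that PM pnI by blast
  fix j y t assume y: "y : grade H j" and "t : space PP"
  then have t: "t : MN" using PM by blast
  note ly = laN[OF tH[OF y]]
  have d: "act N y (S t - S' t) = act N y (S t) - act N y (S' t)"
   by (rule lin_on_diff[OF ly sN SI[OF t]])
  have "S (YR y t) - S' (YR y t) = koszul 1 j *C act N y (S t - S' t)"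
   unfolding d Sy[OF y t] by (cases j) (simp_all add: scaleC_one)
  then have "B (YR y t) = koszul 1 j *C pn (act N y (S t - S' t))"
   unfolding B_def using lin_on_scale[OF lpn aN[OF tH[OF y] dI[OF t]]] by simp
  also have "\<dots> = act N y (B t)"
   unfolding B_def act_parity[OF N gH y dI[OF t]] by (simp add: scaleC_scaleC scaleC_one)
  finally show "B (YR y t) = act N y (B t)" .
 qed
 have "A u ~= 0 \<or> B u ~= 0"
 proof (rule ccontr)
  assume "\<not> ?thesis"
  then have A0: "S u + S' u = 0" and "pn (S u - S' u) = 0" by (simp_all add: A_def B_def)
  moreover have "S u - S' u : space N" using SI[OF uM] by (rule cv_subspace_diff[OF sN])
  ultimately have "S u - S' u = 0"
   using pnn[of "S u - S' u"] lin_on_0[OF lpn sN] by simp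
  with A0 have "S u = - S u" by (simp add: eq_neg_iff_add_eq_0)
  then have "S u = 0" by (rule self_neg_zero)
  with \<theta>(2) show False by (simp add: S_def)
 qed
 then show ?thesis using hA hB that by blast
qed

lemma fd_product: "finite_dimensional (space PP)"
 using finite_dimensional_subset[OF fdMN space_irreducible_product] .

lemma product_contains_factors: "occurs G M (left_part PP)" "occurs H N (right_part PP)"
proof -
 note P = irr_smod[OF P_irr]
 have nz: "space PP ~= {0}" using P_irr unfolding irreducible_supermodule_def by blast
 show "occurs G M (left_part PP)"
  by (rule separated_occurs[OF pullback_supermodule[OF P hom_left[OF G H] gG] _ _ gG irrM])
   (use fd_product nz product_separates_left in \<open>simp_all, metis\<close>)
 show "occurs H N (right_part PP)"
  by (rule separated_occurs[OF pullback_supermodule[OF P hom_right[OF G H] gH] _ _ gH irrN])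
   (use fd_product nz product_separates_right in \<open>simp_all, metis\<close>)
qed

end

locale direct_sum_module =
 fixes G :: "'g::complex_vector superalgebra" and H :: "'h::complex_vector superalgebra"
  and V :: "('g \<times> 'h, 'x::complex_vector) supermodule"
 assumes G: "graded_algebra G" and H: "graded_algebra H"
  and V: "irreducible_supermodule (direct_sum G H) V" "finite_dimensional (space V)"
begin

lemmas gG = graded_algebraD(1)[OF G] and gH = graded_algebraD(1)[OF H]
lemmas V' = irr_smod[OF V(1)]

lemma factorization:
 assumes M: "irreducible_supermodule G M" "finite_dimensional (space M)" and occ: "occurs G M (left_part V)"
 obtains N' where "irreducible_supermodule H N'" "finite_dimensional (space N')"
  "mhom_on H N' (hom_module G H M V) (%f. f)"
  "module_iso (direct_sum G H) (irreducible_product G H M N') V"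
proof -
 note M' = irr_smod[OF M(1)]
 interpret X: hom_space G H M V by unfold_locales (rule G H M' V')+
 obtain g k where g: "mhom_on G M (left_part V) g" "inj_on g (space M)"
  "irreducible_supermodule G (left_part V) --> bij_betw g (space M) (space (left_part V))"
  "!!v. v : space M ==> parity_map (mgrade (left_part V)) (g v) = koszul 1 k *C g (parity_map (mgrade M) v)"
  using homogeneous_hom_from_irreducible[OF M(1) pullback_supermodule[OF V' hom_left[OF G H] gG] gG occ] by metis
 define f where "f = (%v. if v : space M then g v else 0)"
 have fg: "f v = g v" if "v : space M" for v using that by (simp add: f_def)
 have lf: "linear_on (space M) f"
  using mhomD(1)[OF g(1)] lin_on_cong[of "space M" f g] fg X.sM by blast
 have "f : hom_grade G M (left_part V) k"
  unfolding hom_grade_def mem_Collect_eq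
 proof (intro conjI allI ballI impI)
  show "f ` space M \<subseteq> space (left_part V)" using mhomD(2)[OF g(1)] fg by auto
  show "f v = 0" if "v ~: space M" for v using that by (simp add: f_def)
  show "f (act M x v) = act (left_part V) x (f v)" if "x : grade G i" "v : space M" for i x v
   using mhomD(3)[OF g(1) X.tG[OF that(1)] that(2)] fg[OF that(2)] fg[OF X.aM[OF X.tG[OF that(1)] that(2)]] by simp
  show "parity_map (mgrade (left_part V)) (f v) = koszul 1 k *C f (parity_map (mgrade M) v)" if "v : space M" for v
   using g(4)[OF that] fg[OF that] fg[OF X.psI[OF that]] by simp
 qed (rule lf)
 then have fX: "f : space X.XX"
  by (intro in_total[OF X.graded_X, of f k]) (simp add: hom_module_def)
 obtain v where v: "v : space M" "v ~= 0" by (rule irreducible_nonzero[OF M(1)])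
 have "f v ~= 0"
  using inj_on_nonzero[OF g(2) mhomD(1)[OF g(1)] X.sM v] fg[OF v(1)] by simp
 then have "f ~= 0" by (auto simp: zero_fun_def)
 then have nz: "space X.XX ~= {0}" using fX by blast
 obtain W where W: "W \<subseteq> space X.XX" "irreducible_supermodule H (restrict X.XX W)"
  "space (restrict X.XX W) = W" "mhom_on H (restrict X.XX W) X.XX (%v. v)"
  by (rule exists_irreducible_submodule[OF X.supermodule_X gH X.fd_X[OF M(2) V(2)] nz])
 have fdW: "finite_dimensional (space (restrict X.XX W))"
  using finite_dimensional_subset[OF X.fd_X[OF M(2) V(2)] W(1)] W(3) by simp
 obtain n where n: "n : space (restrict X.XX W)" "n ~= 0" by (rule irreducible_nonzero[OF W(2)])
 obtain h u where h: "mhom_on X.GH (tensor_module H M (restrict X.XX W)) V h"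
  "u : tensor_space (space M) (space (restrict X.XX W))" "h u ~= 0"
  by (rule X.hom_from_pairing[where g = "%v. v" and n = n, OF irr_smod[OF W(2)] W(4) n])
 interpret T: super_tensor_irreducible G H M "restrict X.XX W"
  by unfold_locales (rule G H M' M W(2) fdW irr_smod[OF W(2)])+
 show ?thesis
  by (rule that[OF W(2) fdW W(4) T.iso_irreducible_product[OF V(1) h]])
qed

lemma separates_left:
 assumes M: "irreducible_supermodule G M" "finite_dimensional (space M)" and occ: "occurs G M (left_part V)"
  and u: "u : space V" "u ~= 0"
 obtains \<Lambda> where "mhom_on G (left_part V) M \<Lambda>" "\<Lambda> u ~= 0"
proof -
 obtain N' where N': "irreducible_supermodule H N'" "finite_dimensional (space N')"
  "mhom_on H N' (hom_module G H M V) (%f. f)"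
  "module_iso (direct_sum G H) (irreducible_product G H M N') V"
  by (rule factorization[OF M occ])
 interpret T: super_tensor_irreducible G H M N'
  by unfold_locales (rule G H irr_smod[OF M(1)] M N' irr_smod[OF N'(1)])+
 have "module_iso (direct_sum G H) V T.PP"
  by (rule module_iso_sym[OF N'(4) irr_smod[OF T.P_irr] T.graded_GH])
 then obtain j where j: "mhom_on (direct_sum G H) V T.PP j" "bij_betw j (space V) (space T.PP)"
  unfolding module_iso_iff by blast
 have "j u ~= 0" using j(2) inj_on_nonzero[OF _ mhomD(1)[OF j(1)] smodD(2)[OF V'] u] unfolding bij_betw_def by blast
 then obtain \<Lambda> where \<Lambda>: "mhom_on G (left_part T.PP) M \<Lambda>" "\<Lambda> (j u) ~= 0"
  using T.product_separates_left[of "j u"] mhomD(2)[OF j(1) u(1)] by metis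
 show ?thesis
  by (rule that[OF module_hom_compose[OF pullback_hom[OF j(1) hom_left[OF G H] gG] \<Lambda>(1)] \<Lambda>(2)])
qed

theorem determined_by_factors:
 assumes M: "irreducible_supermodule G M" "finite_dimensional (space M)" "occurs G M (left_part V)"
  and N: "irreducible_supermodule H N" "finite_dimensional (space N)" "occurs H N (right_part V)"
 shows "module_iso (direct_sum G H) (irreducible_product G H M N) V"
proof -
 note M' = irr_smod[OF M(1)] and Ns = irr_smod[OF N(1)]
 obtain N' where N': "irreducible_supermodule H N'" "finite_dimensional (space N')"
  "mhom_on H N' (hom_module G H M V) (%f. f)"
  "module_iso (direct_sum G H) (irreducible_product G H M N') V"
  by (rule factorization[OF M])
 interpret T: super_tensor_irreducible G H M N'
  by unfold_locales (rule G H M' M N' irr_smod[OF N'(1)])+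
 interpret X: hom_space G H M V by unfold_locales (rule G H M' V')+
 have "module_iso (direct_sum G H) V T.PP"
  by (rule module_iso_sym[OF N'(4) irr_smod[OF T.P_irr] T.graded_GH])
 then obtain j where j: "mhom_on (direct_sum G H) V T.PP j" "bij_betw j (space V) (space T.PP)"
  unfolding module_iso_iff by blast
 obtain f n where f: "mhom_on H N (right_part V) f" "n : space N" "f n ~= 0"
  using N(3) unfolding occurs_def by blast
 have fn: "f n : space V" using mhomD(2)[OF f(1,2)] by simp
 have "j (f n) ~= 0" using j(2) inj_on_nonzero[OF _ mhomD(1)[OF j(1)] smodD(2)[OF V'] fn f(3)] unfolding bij_betw_def by blast
 then obtain \<Lambda> where \<Lambda>: "mhom_on H (right_part T.PP) N' \<Lambda>" "\<Lambda> (j (f n)) ~= 0"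
  using T.product_separates_right[of "j (f n)"] mhomD(2)[OF j(1) fn] by metis
 have "mhom_on H N N' (%v. \<Lambda> (j (f v)))"
  by (rule module_hom_compose[OF f(1) module_hom_compose[OF pullback_hom[OF j(1) hom_right[OF G H] gH] \<Lambda>(1)]])
 then have "occurs H N N'" unfolding occurs_def using f(2) \<Lambda>(2) by blast
 then have "module_iso H N N'" using occurs_iff_iso[OF N(1) N'(1) gH] by blast
 then obtain g where g: "mhom_on H N N' g" "bij_betw g (space N) (space N')"
  unfolding module_iso_iff by blast
 obtain m where m: "m : space N" "m ~= 0" by (rule irreducible_nonzero[OF N(1)])
 have "g m ~= 0" using g(2) inj_on_nonzero[OF _ mhomD(1)[OF g(1)] smodD(2)[OF Ns] m] unfolding bij_betw_def by blast
 obtain h u where h: "mhom_on X.GH (tensor_module H M N) V h"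
  "u : tensor_space (space M) (space N)" "h u ~= 0"
  by (rule X.hom_from_pairing[OF Ns module_hom_compose[OF g(1) N'(3)] m(1) \<open>g m ~= 0\<close>])
 interpret T': super_tensor_irreducible G H M N
  by unfold_locales (rule G H M' M N Ns)+
 show ?thesis by (rule T'.iso_irreducible_product[OF V(1) h])
qed

end

section \<open>Transport of structure\<close>

lemma irreducible_family_transport:
 assumes V: "irreducible_family I a V" and f: "intertwines I a V b W f" "bij_betw f V W" and W: "operators I b W"
 shows "irreducible_family I b W"
 unfolding irreducible_family_def
proof (intro conjI allI impI)
 note V' = irr_famD[OF V]
 have lf: "linear_on V f" and com: "!!i v. i : I ==> v : V ==> f (a i v) = b i (f v)"
  using f(1) unfolding intertwines_def by auto
 have f0: "f 0 = 0" by (rule lin_on_0[OF lf V'(2)])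
 show "operators I b W" by (rule W)
 show "W ~= {0}"
 proof
  assume "W = {0}"
  then have "f ` V = {0}" using f(2) by (simp add: bij_betw_def)
  then have "v = 0" if "v : V" for v
   using inj_onD[of f V v 0] f(2) f0 cv_subspace_0[OF V'(2)] that unfolding bij_betw_def by auto
  then show False using V'(3) cv_subspace_0[OF V'(2)] by blast
 qed
 fix U assume U: "U \<subseteq> W & stable I b U"
 have sU: "csubspace U" using U unfolding stable_def by blast
 define U' where "U' = {v : V. f v : U}"
 have "stable I a U'"
  unfolding stable_def
 proof (intro conjI ballI image_subsetI)
  show "csubspace U'" unfolding U'_def by (rule csubspace_preimage[OF lf V'(2) sU])
  show "a i v : U'" if "i : I" "v : U'" for i v
  proof -
   have "b i (f v) : U" using that U unfolding U'_def stable_def by blast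
   moreover have "a i v : V" using that V'(1) unfolding U'_def operators_def by blast
   ultimately show ?thesis using com[of i v] that unfolding U'_def by simp
  qed
 qed
 moreover have "f ` U' = U" using f(2) U unfolding U'_def bij_betw_def by blast
 ultimately show "U = {0} \<or> U = W"
  using V'(4)[of U'] f0 f(2) unfolding U'_def bij_betw_def by fastforce
qed

lemma transport_module:
 assumes M: "is_supermodule G M" and G: "graded_space (grade G)"
  and f: "linear_on (space M) f" "inj_on f (space M)"
 defines "M' \<equiv> \<lparr>mgrade = (%i. f ` mgrade M i), act = (%x v. f (act M x (inv_into (space M) f v)))\<rparr>"
 shows "is_supermodule G M'" "space M' = f ` space M"
  "intertwines (indices G) (ops M) (space M) (ops M') (space M') f"
proof -
 note gM = smodD(1)[OF M] and sM = smodD(2)[OF M]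
 have inv: "inv_into (space M) f (f v) = v" if "v : space M" for v by (rule inv_into_f_f[OF f(2) that])
 have gr: "mgrade M' i = f ` mgrade M i" for i by (simp add: M'_def)
 have act: "act M' x (f v) = f (act M x v)" if "v : space M" for x v
  using inv[OF that] by (simp add: M'_def)
 note t = in_total[OF gM]
 have f0: "f 0 = 0" by (rule lin_on_0[OF f(1) sM])
 have gM': "graded_space (mgrade M')"
 proof -
  have "csubspace (mgrade M' i)" for i
   unfolding gr by (rule csubspace_image[OF f(1) graded_subspace[OF gM]]) (use t in blast)
  moreover have "w = 0" if w: "w : mgrade M' 0" "w : mgrade M' 1" for w
  proof -
   obtain u v where uv: "u : mgrade M 0" "v : mgrade M 1" "w = f u" "w = f v" using w unfolding gr by blast
   then have "u = v" using inj_onD[OF f(2)] t by blast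
   then have "u = 0" using grades_disjoint[OF gM] uv by blast
   then show ?thesis using uv f0 by simp
  qed
  ultimately show ?thesis unfolding graded_space_def using cv_subspace_0 by blast
 qed
 show sp: "space M' = f ` space M"
 proof
  show "space M' \<subseteq> f ` space M"
  proof
   fix w assume "w : space M'"
   then obtain u v where "u : mgrade M 0" "v : mgrade M 1" "w = f u + f v" unfolding total_def gr by blast
   then have "w = f (u + v)" "u + v : space M"
    using lin_on_add[OF f(1) t t] by (auto intro: totalI)
   then show "w : f ` space M" by blast
  qed
  show "f ` space M \<subseteq> space M'"
  proof safe
   fix v assume "v : space M"
   then obtain a b where "a : mgrade M 0" "b : mgrade M 1" "v = a + b" by (rule total_cases[OF gM])
   then show "f v : space M'"
    using lin_on_add[OF f(1) t t, of a 0 b 1] totalI[of "f a" "mgrade M'" "f b"] unfolding gr by auto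
  qed
 qed
 have lact: "linear_on (space M') (act M' x)" if x: "x : underlying G" for x
  unfolding linear_on_def sp
 proof (intro conjI ballI allI)
  note l = smodD(4)[OF M x] and ai = act_in[OF M G x]
  fix u w assume "u : f ` space M" "w : f ` space M"
  then obtain p q where pq: "p : space M" "q : space M" "u = f p" "w = f q" by blast
  have pp: "p + q : space M" using pq sM by (auto intro: cv_subspace_add)
  show "act M' x (u + w) = act M' x u + act M' x w"
   unfolding pq(3,4) lin_on_add[OF f(1) pq(1,2), symmetric] act[OF pp] act[OF pq(1)] act[OF pq(2)]
    lin_on_add[OF l pq(1,2)] by (rule lin_on_add[OF f(1) ai[OF pq(1)] ai[OF pq(2)]])
 next
  note l = smodD(4)[OF M x] and ai = act_in[OF M G x]
  fix c u assume "u : f ` space M"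
  then obtain p where p: "p : space M" "u = f p" by blast
  have cp: "c *C p : space M" using p sM by (auto intro: cv_subspace_scale)
  show "act M' x (c *C u) = c *C act M' x u"
   unfolding p(2) lin_on_scale[OF f(1) p(1), symmetric] act[OF cp] act[OF p(1)]
    lin_on_scale[OF l p(1)] by (rule lin_on_scale[OF f(1) ai[OF p(1)]])
 qed
 show "is_supermodule G M'"
  unfolding is_supermodule_def bilinear_on_def
 proof (intro conjI ballI allI)
  show "graded_space (mgrade M')" by (rule gM')
  show "linear_on (space M') (act M' x)" if "x : underlying G" for x by (rule lact[OF that])
  show "linear_on (underlying G) (%x. act M' x w)" if w: "w : space M'" for w
  proof -
   obtain v where v: "v : space M" "w = f v" using w unfolding sp by blast
   show ?thesis
    unfolding v(2) act[OF v(1)]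
    by (rule lin_on_compose[OF smodD(3)[OF M v(1)] act_in[OF M G _ v(1)] f(1)])
  qed
  show "act M' x w : mgrade M' (i + j)" if x: "x : grade G i" and w: "w : mgrade M' j" for i j x w
  proof -
   obtain v where v: "v : mgrade M j" "w = f v" using w unfolding gr by blast
   show ?thesis unfolding v(2) act[OF t[OF v(1)]] gr using smodD(5)[OF M x v(1)] by blast
  qed
  show "act M' (bracket G x y) w = act M' x (act M' y w) - koszul i j *C act M' y (act M' x w)"
   if x: "x : grade G i" and y: "y : grade G j" and w: "w : space M'" for i j x y w
  proof -
   obtain v where v: "v : space M" "w = f v" using w unfolding sp by blast
   note xv = act_in_homogeneous[OF M G x v(1)] and yv = act_in_homogeneous[OF M G y v(1)]
   note xy = act_in_homogeneous[OF M G x yv] and yx = act_in_homogeneous[OF M G y xv]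
   show ?thesis
    unfolding v(2) act[OF v(1)] act[OF xv] act[OF yv] smodD(6)[OF M x y v(1)]
    lin_on_diff[OF f(1) sM xy cv_subspace_scale[OF sM yx]] lin_on_scale[OF f(1) yx] ..
  qed
 qed
 show "intertwines (indices G) (ops M) (space M) (ops M') (space M') f"
  unfolding intertwines_def ball_indices ops_simps
 proof (intro conjI allI ballI)
  show "linear_on (space M) f" by (rule f(1))
  show "f ` space M \<subseteq> space M'" by (simp add: sp)
  show "f (parity_map (mgrade M) v) = parity_map (mgrade M') (f v)" if "v : space M" for v
   using parity_of_homogeneous_map[OF gM gM' f(1), of 0 v] that unfolding gr by (simp add: scaleC_one)
  show "f (act M x v) = act M' x (f v)" if "v : space M" for x v using act[OF that] by simp
 qed
qed

lemma finite_dimensional_embedding: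
 assumes "finite_dimensional V" "csubspace V"
 obtains f :: "'v::complex_vector => nat => complex" where "linear_on V f" "inj_on f V"
proof -
 obtain B \<theta> where B: "finite B" "B \<subseteq> V" "!!b. clinear (\<theta> b :: 'v => complex)" "!!v. v : V ==> v = (\<Sum>b\<in>B. \<theta> b v *C b)"
  using dual_basis[OF assms] by blast
 obtain e where e: "bij_betw e {0..<card B} B" using ex_bij_betw_nat_finite[OF B(1)] by blast
 define f where "f = (%v i. if i < card B then \<theta> (e i) v else 0)"
 have lf: "linear_on V f"
  unfolding linear_on_def f_def
  by (auto simp: fun_eq_iff scaleC_fun_def cv_linear_add[OF B(3)] cv_linear_scale[OF B(3)])
 have "inj_on f V"
 proof (rule lin_on_inj_on[OF lf assms(2)])
  fix v assume v: "v : V" "f v = 0"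
  have "\<theta> b v = 0" if "b : B" for b
  proof -
   have "b : e ` {0..<card B}" using e \<open>b : B\<close> by (simp add: bij_betw_def)
   then obtain i where "i < card B" "b = e i" by auto
   then show ?thesis using v(2) by (simp add: f_def fun_eq_iff) metis
  qed
  then have "(\<Sum>b\<in>B. \<theta> b v *C b) = 0" by simp
  then show "v = 0" using B(4)[OF v(1)] by simp
 qed
 with lf show ?thesis by (rule that)
qed

lemma
 fixes M :: "('g::complex_vector, 'v::complex_vector) supermodule"
 assumes M: "irreducible_supermodule G M" "finite_dimensional (space M)" and G: "graded_space (grade G)"
 shows coordinatize_irreps: "coordinatize M : irreps G"
  and coordinatize_iso: "module_iso G M (coordinatize M)"
proof -
 note M' = irr_smod[OF M(1)]
 note sM = smodD(2)[OF M']
 have irr: "irreducible_family (indices G) (ops M) (space M)" using M irreducible_iff[OF G] by blast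
 define f where "f = (SOME f :: 'v => nat => complex. linear_on (space M) f & inj_on f (space M))"
 have "EX f :: 'v => nat => complex. linear_on (space M) f & inj_on f (space M)"
  using finite_dimensional_embedding[OF M(2) sM] by metis
 from someI_ex[OF this] have f: "linear_on (space M) f" "inj_on f (space M)" unfolding f_def by blast+
 note T = transport_module[OF M' G f]
 have c: "coordinatize M = \<lparr>mgrade = (%i. f ` mgrade M i), act = (%x v. f (act M x (inv_into (space M) f v)))\<rparr>"
  by (simp add: coordinatize_def f_def Let_def)
 note T = T[folded c]
 have b: "bij_betw f (space M) (space (coordinatize M))" using f(2) T(2) by (simp add: bij_betw_def)
 have "irreducible_supermodule G (coordinatize M)"
  unfolding irreducible_iff[OF G]
  using T(1) irreducible_family_transport[OF irr T(3) b supermodule_operators[OF T(1) G]] by blast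
 moreover have "finite_dimensional (space (coordinatize M))"
  unfolding T(2) by (rule finite_dimensional_image[OF M(2) sM f(1)])
 ultimately show "coordinatize M : irreps G" by (simp add: irreps_def)
 show "module_iso G M (coordinatize M)"
  using T(3) b unfolding module_hom_even[OF M' T(1) G] module_iso_iff by blast
qed

lemma irrepsD:
 assumes "M : irreps G"
 shows "irreducible_supermodule G M" "finite_dimensional (space M)" "is_supermodule G M"
 using assms irr_smod unfolding irreps_def by auto

section \<open>The trivial module\<close>

lemma trivial_module_irreps:
 assumes G: "graded_space (grade G)"
 shows "trivial_module : irreps G"
proof -
 let ?e = "(%m. if m = 0 then 1 else 0) :: nat => complex"
 have g: "mgrade trivial_module 0 = cspan {?e}" "mgrade trivial_module 1 = {0}"
  by (simp_all add: trivial_module_def)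
 have sp: "space trivial_module = cspan {?e}"
  unfolding total_def g by auto
 have a: "act trivial_module x v = 0" for x :: 'a and v by (simp add: trivial_module_def)
 have s: "is_supermodule G trivial_module"
  unfolding is_supermodule_def bilinear_on_def a
 proof (intro conjI ballI allI)
  show "graded_space (mgrade trivial_module)"
   unfolding graded_space_def g using cv_span_zero by auto
  show "0 : mgrade trivial_module (i + j)" for i j
   by (simp add: trivial_module_def cv_span_zero)
 qed (simp_all add: lin_on_arith)
 have e: "?e ~= 0" by (auto simp: fun_eq_iff)
 have "?e : cspan {?e}" by (rule cv_span_base) simp
 then have nz: "space trivial_module ~= {0}" using e unfolding sp by blast
 have "W = {0} \<or> W = cspan {?e}" if W: "csubspace W" "W \<subseteq> cspan {?e}" for W
 proof (cases "W = {0}")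
  case False
  then obtain w where w: "w : W" "w ~= 0" using cv_subspace_0[OF W(1)] by blast
  then obtain c where c: "w = c *C ?e" using W(2) unfolding cv_span_singleton by blast
  with w have "c ~= 0" by auto
  then have "?e = inverse c *C w" unfolding c by (simp add: scaleC_scaleC scaleC_one)
  then have "?e : W" using cv_subspace_scale[OF W(1) w(1)] by metis
  then have "cspan {?e} \<subseteq> W" using W(1) by (intro cv_span_minimal) auto
  with W(2) show ?thesis by blast
 qed simp
 then have "irreducible_family (indices G) (ops trivial_module) (space trivial_module)"
  using supermodule_operators[OF s G] nz unfolding irreducible_family_def sp stable_def by blast
 moreover have "finite_dimensional (space trivial_module)"
  unfolding sp finite_dimensional_def by blast
 ultimately show ?thesis using s unfolding irreps_def irreducible_iff[OF G] by blast
qed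

lemma irreducible_trivial_action:
 assumes V: "irreducible_supermodule G V" and G: "graded_space (grade G)"
  and triv: "!!x v. x : underlying G ==> v : space V ==> act V x v = 0"
 shows "module_iso G trivial_module V"
proof -
 note V' = irr_smod[OF V]
 note gV = smodD(1)[OF V'] and sV = smodD(2)[OF V']
 have irr: "irreducible_family (indices G) (ops V) (space V)" using V irreducible_iff[OF G] by blast
 let ?e = "(%m. if m = 0 then 1 else 0) :: nat => complex"
 have sp: "space trivial_module = cspan {?e}"
  unfolding total_def by (auto simp: trivial_module_def)
 obtain u where u: "u : space V" "u ~= 0" by (rule irreducible_nonzero[OF V])
 obtain a b where ab: "a : mgrade V 0" "b : mgrade V 1" "u = a + b" by (rule total_cases[OF gV u(1)])
 then have "a ~= 0 \<or> b ~= 0" using u(2) by auto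
 then obtain i v where v: "v : mgrade V i" "v ~= 0" using ab by blast
 note vV = in_total[OF gV v(1)]
 have sub: "cspan {v} \<subseteq> space V" using vV sV by (intro cv_span_minimal) auto
 have "stable (indices G) (ops V) (cspan {v})"
  unfolding stable_def ball_indices ops_simps
 proof (intro conjI allI ballI image_subsetI)
  show "parity_map (mgrade V) w : cspan {v}" if w: "w : cspan {v}" for w
  proof -
   obtain c where "w = c *C v" using w unfolding cv_span_singleton by blast
   then show ?thesis
    using lin_on_scale[OF lin_on_parity[OF gV] vV] parity_homogeneous[OF gV v(1)]
    by (simp add: cv_span_scale cv_span_base)
  qed
  show "act V x w : cspan {v}" if "x : grade G j" "w : cspan {v}" for j x w
   using triv[OF in_total[OF G that(1)], of w] that(2) sub cv_span_zero[of "{v}"] by auto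
 qed simp
 moreover have "cspan {v} ~= {0}" using v(2) cv_span_base[of v "{v}"] by blast
 ultimately have V_eq: "space V = cspan {v}" using irr_famD(4)[OF irr sub] by metis
 define f where "f = (%w :: nat => complex. w 0 *C v)"
 have lf: "linear_on A f" for A
  by (simp add: linear_on_def f_def scaleC_add_left scaleC_fun_def scaleC_complex_def scaleC_scaleC)
 have fe: "f (c *C ?e) = c *C v" for c by (simp add: f_def scaleC_fun_def scaleC_complex_def)
 have "inj_on f (space trivial_module)"
 proof (rule lin_on_inj_on[OF lf])
  show "csubspace (space trivial_module)" unfolding sp by simp
  fix w assume w: "w : space trivial_module" "f w = 0"
  then obtain c where c: "w = c *C ?e" unfolding sp cv_span_singleton by blast
  with w(2) fe[of c] v(2) show "w = 0" by simp
 qed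
 moreover have "f ` space trivial_module = space V"
  unfolding sp V_eq cv_span_singleton image_image fe ..
 ultimately have b: "bij_betw f (space trivial_module) (space V)" by (simp add: bij_betw_def)
 then have "act V x (f w) = 0" if "x : underlying G" "w : space trivial_module" for x w
  using triv[OF that(1)] that(2) unfolding bij_betw_def by blast
 then show ?thesis
  unfolding module_iso_def using b lf by (auto simp: trivial_module_def f_def intro!: exI[of _ f])
qed

section \<open>Direct powers and iterated products\<close>

lemma lie_graded_algebra: "lie_superalgebra G ==> graded_algebra G"
 unfolding lie_superalgebra_def graded_algebra_def by blast

lemma grade_direct_power: "x : grade (direct_power k G) p \<longleftrightarrow> (ALL i. if i < k then x i : grade G p else x i = 0)"
 by (simp add: direct_power_def)

lemma grade_direct_powerD:
 "x : grade (direct_power k G) p ==> i < k ==> x i : grade G p"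
 "x : grade (direct_power k G) p ==> \<not> i < k ==> x i = 0"
 unfolding grade_direct_power by (drule spec[of _ i], simp)+

lemma superalgebra_homI:
 assumes "!!x y. h (x + y) = h x + h y" "!!c x. h (c *C x) = c *C h x"
  "!!i x. x : grade H i ==> h x : grade G i"
  "!!i j x y. x : grade H i ==> y : grade H j ==> h (bracket H x y) = bracket G (h x) (h y)"
 shows "superalgebra_hom H G h"
 using assms unfolding superalgebra_hom_def linear_on_def by blast

lemma bracket_direct_power: "bracket (direct_power k G) x y = (%i. if i < k then bracket G (x i) (y i) else 0)"
 by (simp add: direct_power_def)

abbreviation insert_at :: "nat => 'g::zero => nat => 'g" where
 "insert_at i x \<equiv> (%j. if j = i then x else 0)"

context
 fixes L :: "'g::complex_vector superalgebra"
 assumes L: "graded_algebra L"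
begin

lemmas gL = graded_algebraD(1)[OF L]

lemma zero_L: "0 : grade L p" "0 : underlying L"
 using cv_subspace_0 graded_subspace[OF gL] graded_total[OF gL] by blast+

lemma underlying_direct_power:
 "x : underlying (direct_power k L) \<longleftrightarrow> (ALL i. if i < k then x i : underlying L else x i = 0)"
proof
 assume "x : underlying (direct_power k L)"
 then obtain u w where uw: "u : grade (direct_power k L) 0" "w : grade (direct_power k L) 1" "x = u + w"
  unfolding total_def by blast
 have "if i < k then u i + w i : underlying L else u i + w i = 0" for i
  using uw(1,2)[unfolded grade_direct_power, rule_format, of i] by (auto intro: totalI)
 then show "ALL i. if i < k then x i : underlying L else x i = 0" unfolding uw(3) by simp
next
 assume x: "ALL i. if i < k then x i : underlying L else x i = 0"
 let ?c = "%p i. if i < k then component (grade L) p (x i) else 0"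
 have xi: "x i : underlying L" if "i < k" for i using x that by metis
 have c: "?c p : grade (direct_power k L) p" for p
  unfolding grade_direct_power using component_in[OF gL] xi by auto
 have "?c 0 i + ?c 1 i = x i" for i
  using x[rule_format, of i] component_add[OF gL, of "x i"] by simp
 then have eq: "?c 0 + ?c 1 = x" by (simp add: fun_eq_iff)
 from totalI[of "?c 0" "grade (direct_power k L)" "?c 1", OF c c]
 show "x : underlying (direct_power k L)" unfolding eq .
qed

lemma graded_direct_power: "graded_space (grade (direct_power k L))"
proof -
 have "csubspace (grade (direct_power k L) p)" for p
 proof -
  note s = graded_subspace[OF gL, of p]
  show ?thesis
   unfolding cv_subspace_def
  proof (intro conjI ballI allI)
   show "0 : grade (direct_power k L) p"
    unfolding grade_direct_power using cv_subspace_0[OF s] by simp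
   show "x + y : grade (direct_power k L) p"
    if "x : grade (direct_power k L) p" "y : grade (direct_power k L) p" for x y
    unfolding grade_direct_power
    using cv_subspace_add[OF s] grade_direct_powerD[OF that(1)] grade_direct_powerD[OF that(2)] by simp
   show "c *C x : grade (direct_power k L) p" if "x : grade (direct_power k L) p" for c x
    unfolding grade_direct_power scaleC_fun_def
    using cv_subspace_scale[OF s] grade_direct_powerD[OF that] by simp
  qed
 qed
 moreover have "x = 0" if "x : grade (direct_power k L) 0" "x : grade (direct_power k L) 1" for x
 proof
  fix i show "x i = 0 i"
   using grade_direct_powerD[OF that(1), of i] grade_direct_powerD[OF that(2), of i] grades_disjoint[OF gL, of "x i"]
   by (cases "i < k") simp_all
 qed
 ultimately show ?thesis unfolding graded_space_def using cv_subspace_0 by blast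
qed

lemma graded_algebra_direct_power: "graded_algebra (direct_power k L)"
 unfolding graded_algebra_def
proof (intro conjI allI ballI)
 show "graded_space (grade (direct_power k L))" by (rule graded_direct_power)
 show "bracket (direct_power k L) x y : grade (direct_power k L) (i + j)"
  if "x : grade (direct_power k L) i" "y : grade (direct_power k L) j" for i j x y
  unfolding grade_direct_power bracket_direct_power
  using graded_algebraD(2)[OF L grade_direct_powerD(1)[OF that(1)] grade_direct_powerD(1)[OF that(2)]] by simp
 note B = graded_algebraD(3)[OF L, unfolded bilinear_on_def]
 have l: "!!w. w : underlying L ==> linear_on (underlying L) (%v. bracket L v w)"
  "!!v. v : underlying L ==> linear_on (underlying L) (bracket L v)" using B by blast+
 show "bilinear_on (underlying (direct_power k L)) (underlying (direct_power k L)) (bracket (direct_power k L))"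
 proof -
  have u: "x i : underlying L" if "x : underlying (direct_power k L)" "i < k" for x i
   using that(1)[unfolded underlying_direct_power, rule_format, of i] that(2) by simp
  show ?thesis
   unfolding bilinear_on_def bracket_direct_power linear_on_def fun_eq_iff scaleC_fun_def
   by (simp add: u lin_on_add[OF l(1)] lin_on_scale[OF l(1)] lin_on_add[OF l(2)] lin_on_scale[OF l(2)])
 qed
qed

abbreviation "splitk k x \<equiv> ((%i. if i < Suc k then x i else 0), x (Suc k))"
abbreviation "joink k \<equiv> (%(z, y) i. if i < Suc k then z i else if i = Suc k then y else 0)"

lemma split_hom:
 "superalgebra_hom (direct_power (Suc (Suc k)) L) (direct_sum (direct_power (Suc k) L) L) (%x. splitk k x)"
 "grade (direct_sum (direct_power (Suc k) L) L) p \<subseteq> (%x. splitk k x) ` grade (direct_power (Suc (Suc k)) L) p"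
proof -
 show "superalgebra_hom (direct_power (Suc (Suc k)) L) (direct_sum (direct_power (Suc k) L) L) (%x. splitk k x)"
 proof (rule superalgebra_homI)
  show "splitk k x : grade (direct_sum (direct_power (Suc k) L) L) i"
   if "x : grade (direct_power (Suc (Suc k)) L) i" for x i
   using grade_direct_powerD[OF that] by (simp add: grade_direct_power)
 qed (auto simp: fun_eq_iff scaleC_fun_def bracket_direct_power)
 show "grade (direct_sum (direct_power (Suc k) L) L) p \<subseteq> (%x. splitk k x) ` grade (direct_power (Suc (Suc k)) L) p"
 proof
  fix q assume "q : grade (direct_sum (direct_power (Suc k) L) L) p"
  then obtain z y where q: "q = (z, y)" "z : grade (direct_power (Suc k) L) p" "y : grade L p" by auto
  note z = grade_direct_powerD(1)[OF q(2)] and z0 = grade_direct_powerD(2)[OF q(2)]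
  have "splitk k (joink k (z, y)) = q" unfolding q(1) by (simp add: fun_eq_iff z0)
  moreover have "joink k (z, y) : grade (direct_power (Suc (Suc k)) L) p"
   unfolding grade_direct_power using z q(3) by auto
  ultimately show "q : (%x. splitk k x) ` grade (direct_power (Suc (Suc k)) L) p"
   by (intro image_eqI[of _ _ "joink k (z, y)"]) simp_all
 qed
qed

lemma join_hom:
 "superalgebra_hom (direct_sum (direct_power (Suc k) L) L) (direct_power (Suc (Suc k)) L) (joink k)"
 "grade (direct_power (Suc (Suc k)) L) p \<subseteq> joink k ` grade (direct_sum (direct_power (Suc k) L) L) p"
proof -
 show "superalgebra_hom (direct_sum (direct_power (Suc k) L) L) (direct_power (Suc (Suc k)) L) (joink k)"
 proof (rule superalgebra_homI)
  show "joink k q : grade (direct_power (Suc (Suc k)) L) i"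
   if "q : grade (direct_sum (direct_power (Suc k) L) L) i" for q i
   using that grade_direct_powerD[of "fst q" "Suc k" L i] by (auto simp: grade_direct_power)
 qed (auto simp: fun_eq_iff scaleC_fun_def bracket_direct_power)
 show "grade (direct_power (Suc (Suc k)) L) p \<subseteq> joink k ` grade (direct_sum (direct_power (Suc k) L) L) p"
 proof
  fix x assume x: "x : grade (direct_power (Suc (Suc k)) L) p"
  note x1 = grade_direct_powerD(1)[OF x] and x0 = grade_direct_powerD(2)[OF x]
  have "joink k (splitk k x) = x" using x0 by (auto simp: fun_eq_iff)
  moreover have "splitk k x : grade (direct_sum (direct_power (Suc k) L) L) p"
   using x1 by (auto simp: grade_direct_power)
  ultimately show "x : joink k ` grade (direct_sum (direct_power (Suc k) L) L) p"
   by (intro image_eqI[of _ _ "splitk k x"]) simp_all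
 qed
qed

lemma insert_hom: "i < k ==> superalgebra_hom L (direct_power k L) (insert_at i)"
 using zero_L bracket_zero(1)[OF L zero_L(2)]
 by (intro superalgebra_homI)
  (simp_all add: fun_eq_iff scaleC_fun_def grade_direct_power bracket_direct_power)

lemma replace_hom:
 assumes "i < k"
 shows "superalgebra_hom (direct_sum L (direct_power k L)) (direct_power k L) (%(x, z) j. if j = i then x else z j)"
  "grade (direct_power k L) p \<subseteq> (%(x, z) j. if j = i then x else z j) ` grade (direct_sum L (direct_power k L)) p"
proof -
 show "superalgebra_hom (direct_sum L (direct_power k L)) (direct_power k L) (%(x, z) j. if j = i then x else z j)"
 proof (rule superalgebra_homI)
  show "(case q of (x, z) => %j. if j = i then x else z j) : grade (direct_power k L) p"
   if "q : grade (direct_sum L (direct_power k L)) p" for q p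
   using that grade_direct_powerD[of "snd q" k L p] assms by (auto simp: grade_direct_power)
 qed (use assms in \<open>auto simp: fun_eq_iff scaleC_fun_def bracket_direct_power\<close>)
 show "grade (direct_power k L) p \<subseteq> (%(x, z) j. if j = i then x else z j) ` grade (direct_sum L (direct_power k L)) p"
 proof
  fix x assume x: "x : grade (direct_power k L) p"
  then have "x i : grade L p" using grade_direct_powerD(1) assms by blast
  then have "(x i, x) : grade (direct_sum L (direct_power k L)) p" using x by simp
  moreover have "x = (case (x i, x) of (x, z) => %j. if j = i then x else z j)" by (auto simp: fun_eq_iff)
  ultimately show "x : (%(x, z) j. if j = i then x else z j) ` grade (direct_sum L (direct_power k L)) p"
   by (rule image_eqI[rotated])
 qed
qed

text \<open>Every module that occurs in the restriction to the \<open>i\<close>-th copy of \<open>L\<close> exhausts that restriction; to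
  see this, view the direct power as a quotient of the direct sum of \<open>L\<close> and itself.\<close>

lemma power_separates:
 assumes V: "irreducible_supermodule (direct_power k L) V" "finite_dimensional (space V)" and i: "i < k"
  and M: "irreducible_supermodule L M" "finite_dimensional (space M)" "occurs L M (pullback (insert_at i) V)"
  and u: "u : space V" "u ~= 0"
 obtains \<Lambda> where "mhom_on L (pullback (insert_at i) V) M \<Lambda>" "\<Lambda> u ~= 0"
proof -
 let ?D = "direct_sum L (direct_power k L)" and ?V = "pullback (%(x, z) j. if j = i then x else z j) V"
 note gD = graded_direct_sum[OF gL graded_direct_power]
 have V': "irreducible_supermodule ?D ?V"
  by (rule pullback_irreducible[OF V(1) replace_hom(1)[OF i] gD graded_direct_power replace_hom(2)[OF i]])
 interpret D: direct_sum_module L "direct_power k L" ?V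
  by unfold_locales (use L graded_algebra_direct_power V' V(2) in simp_all)
 have e: "left_part ?V = pullback (insert_at i) V" by (simp add: pullback_def cong: if_cong)
 obtain \<Lambda> where "mhom_on L (left_part ?V) M \<Lambda>" "\<Lambda> u ~= 0"
  by (rule D.separates_left[OF M(1,2)]) (use M(3) u in \<open>simp_all add: e\<close>)
 then show ?thesis using that unfolding e by blast
qed

lemma occurring_unique:
 assumes V: "irreducible_supermodule (direct_power k L) V" "finite_dimensional (space V)" and i: "i < k"
  and M: "irreducible_supermodule L M" "finite_dimensional (space M)" "occurs L M (pullback (insert_at i) V)"
  and N: "irreducible_supermodule L N" "occurs L N (pullback (insert_at i) V)"
 shows "module_iso L N M"
proof -
 obtain f n where f: "mhom_on L N (pullback (insert_at i) V) f" "n : space N" "f n ~= 0"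
  using N(2) unfolding occurs_def by blast
 have "f n : space V" using mhomD(2)[OF f(1,2)] by simp
 then obtain \<Lambda> where \<Lambda>: "mhom_on L (pullback (insert_at i) V) M \<Lambda>" "\<Lambda> (f n) ~= 0"
  by (rule power_separates[OF V i M _ f(3)])
 have "occurs L N M" unfolding occurs_def using module_hom_compose[OF f(1) \<Lambda>(1)] f(2) \<Lambda>(2) by blast
 then show ?thesis using occurs_iff_iso[OF N(1) M(1) gL] by blast
qed

lemma occurs_through_iso:
 assumes "occurs G M (pullback h N)" "module_iso H N P" "is_supermodule H N"
  and "superalgebra_hom G H h" "graded_space (grade G)"
 shows "occurs G M (pullback h P)"
proof -
 obtain j where j: "mhom_on H N P j" "bij_betw j (space N) (space P)"
  using assms(2) unfolding module_iso_iff by blast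
 show ?thesis
  by (rule occurs_trans_injective[OF assms(1) pullback_hom[OF j(1) assms(4,5)]])
   (use inj_on_nonzero[OF _ mhomD(1)[OF j(1)] smodD(2)[OF assms(3)]] j(2) in \<open>auto simp: bij_betw_def\<close>)
qed

lemma iterated_product_irreducible:
 assumes "!!i. i \<le> k ==> \<rho> i : irreps L"
 shows "iterated_product L \<rho> (Suc k) : irreps (direct_power (Suc k) L) &
  (ALL i<=k. occurs L (\<rho> i) (pullback (insert_at i) (iterated_product L \<rho> (Suc k))))"
 using assms
proof (induction k)
 case 0
 note \<rho> = irrepsD[OF 0[OF order_refl]]
 have h: "superalgebra_hom (direct_power (Suc 0) L) L (%x. x 0)"
  by (rule superalgebra_homI)
   (simp_all add: grade_direct_powerD bracket_direct_power scaleC_fun_def)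
 have surj: "grade L p \<subseteq> (%x. x 0) ` grade (direct_power (Suc 0) L) p" for p
 proof
  fix x assume "x : grade L p"
  then have "insert_at 0 x : grade (direct_power (Suc 0) L) p" by (simp add: grade_direct_power)
  then show "x : (%x. x 0) ` grade (direct_power (Suc 0) L) p" by (intro image_eqI[of _ _ "insert_at 0 x"]) simp_all
 qed
 have "irreducible_supermodule (direct_power (Suc 0) L) (pullback (%x. x 0) (\<rho> 0))"
  by (rule pullback_irreducible[OF \<rho>(1) h graded_direct_power gL surj])
 moreover have "pullback (insert_at 0) (pullback (%x. x 0) (\<rho> 0)) = \<rho> 0" by (simp add: pullback_def)
 ultimately show ?case
  using \<rho>(2) module_iso_imp_occurs[OF module_iso_refl \<rho>(1)] by (simp add: irreps_def)
next
 case (Suc k)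
 let ?D = "direct_power (Suc k) L" and ?P = "iterated_product L \<rho> (Suc k)"
 let ?Q = "irreducible_product ?D L ?P (\<rho> (Suc k))"
 let ?I = "iterated_product L \<rho> (Suc (Suc k))"
 have P: "?P : irreps ?D" "!!i. i \<le> k ==> occurs L (\<rho> i) (pullback (insert_at i) ?P)"
  using Suc by simp_all
 note P' = irrepsD[OF P(1)] and \<rho> = irrepsD[OF Suc.prems[OF order_refl]]
 interpret T: super_tensor_irreducible ?D L ?P "\<rho> (Suc k)"
  by unfold_locales (use L graded_algebra_direct_power P' \<rho> in simp_all)
 note C = coordinatize_irreps[OF T.P_irr T.fd_product T.graded_GH] coordinatize_iso[OF T.P_irr T.fd_product T.graded_GH]
 have I: "?I = pullback (%x. splitk k x) (coordinatize ?Q)" by simp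
 have irr: "?I : irreps (direct_power (Suc (Suc k)) L)"
  using pullback_irreducible[OF irrepsD(1)[OF C(1)] split_hom(1) graded_direct_power T.graded_GH split_hom(2)]
   irrepsD(2)[OF C(1)] unfolding I irreps_def by simp
 have occ: "occurs L (\<rho> i) (pullback (insert_at i) ?I)" if i: "i \<le> Suc k" for i
 proof (cases "i = Suc k")
  case True
  have "occurs L (\<rho> i) (right_part ?Q)" using T.product_contains_factors(2) True by simp
  then have "occurs L (\<rho> i) (right_part (coordinatize ?Q))"
   by (rule occurs_through_iso[OF _ C(2) irr_smod[OF T.P_irr] hom_right[OF graded_algebra_direct_power L] gL])
  moreover have "pullback (insert_at i) ?I = right_part (coordinatize ?Q)"
   unfolding I pullback_def using True by (simp add: zero_fun_def[symmetric] cong: if_cong)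
  ultimately show ?thesis by simp
 next
  case False
  then have i': "i \<le> k" "i < Suc k" using i by simp_all
  obtain g where g: "mhom_on ?D ?P (left_part ?Q) g" "inj_on g (space ?P)"
   "irreducible_supermodule ?D (left_part ?Q) --> bij_betw g (space ?P) (space (left_part ?Q))"
   by (rule nonzero_hom_from_irreducible[OF P'(1)
    pullback_supermodule[OF irr_smod[OF T.P_irr] hom_left[OF graded_algebra_direct_power L] graded_direct_power]
    graded_direct_power T.product_contains_factors(1)])
  have "occurs L (\<rho> i) (pullback (insert_at i) (left_part ?Q))"
   by (rule occurs_trans_injective[OF P(2)[OF i'(1)] pullback_hom[OF g(1) insert_hom[OF i'(2)] gL]])
    (use inj_on_nonzero[OF g(2) mhomD(1)[OF g(1)] smodD(2)[OF P'(3)]] in simp)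
  moreover have "pullback (insert_at i) (left_part M) = pullback (%x. (insert_at i x, 0)) M" for M :: "((nat => 'g) \<times> 'g, 'z) supermodule"
   by (simp add: pullback_def)
  moreover have "superalgebra_hom L (direct_sum ?D L) (%x. (insert_at i x, 0))"
   using insert_hom[OF i'(2)] zero_L bracket_zero(1)[OF L zero_L(2)]
   unfolding superalgebra_hom_def linear_on_def image_subset_iff by auto
  ultimately have "occurs L (\<rho> i) (pullback (%x. (insert_at i x, 0)) (coordinatize ?Q))"
   using occurs_through_iso[OF _ C(2) irr_smod[OF T.P_irr] _ gL] by metis
  moreover have "pullback (insert_at i) ?I = pullback (%x. (insert_at i x, 0)) (coordinatize ?Q)"
  proof -
   have "splitk k (insert_at i x) = (insert_at i x, 0)" for x :: 'g using i' by (auto simp: fun_eq_iff)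
   then show ?thesis unfolding I pullback_def by simp
  qed
  ultimately show ?thesis by simp
 qed
 show ?case using irr occ by blast
qed

text \<open>Induction on \<open>k\<close>: the power with exponent \<open>k + 2\<close> is the direct sum of the power with exponent \<open>k + 1\<close>
  and one more copy of \<open>L\<close>, and the irreducible product is determined by what occurs for the two summands.\<close>

lemma iterated_product_unique:
 assumes "irreducible_supermodule (direct_power (Suc k) L) (V :: (nat => 'g, 'x::complex_vector) supermodule)"
  "finite_dimensional (space V)" "!!i. i \<le> k ==> \<rho> i : irreps L"
  "!!i. i \<le> k ==> occurs L (\<rho> i) (pullback (insert_at i) V)"
 shows "module_iso (direct_power (Suc k) L) (iterated_product L \<rho> (Suc k)) V"
 using assms
proof (induction k arbitrary: V)
 case 0
 have I: "iterated_product L \<rho> (Suc 0) : irreps (direct_power (Suc 0) L)"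
  using iterated_product_irreducible[of 0 \<rho>] 0(3) by simp
 obtain f v where f: "mhom_on L (\<rho> 0) (pullback (insert_at 0) V) f" "v : space (\<rho> 0)" "f v ~= 0"
  using 0(4)[OF order_refl] unfolding occurs_def by blast
 have "mhom_on (direct_power (Suc 0) L) (pullback (%x. x 0) (\<rho> 0)) V f"
  unfolding mhom_on_def pullback_simps
 proof (intro conjI ballI)
  show "linear_on (space (\<rho> 0)) f" "f ` space (\<rho> 0) \<subseteq> space V"
   using mhomD[OF f(1)] by auto
  fix x v assume x: "x : underlying (direct_power (Suc 0) L)" and v: "v : space (\<rho> 0)"
  have "insert_at 0 (x 0) = x" "x 0 : underlying L"
   using x unfolding underlying_direct_power by (auto simp: fun_eq_iff)
  then show "f (act (\<rho> 0) (x 0) v) = act V x (f v)"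
   using mhomD(3)[OF f(1) _ v, of "x 0"] by simp
 qed
 then have "occurs (direct_power (Suc 0) L) (iterated_product L \<rho> (Suc 0)) V"
  unfolding occurs_def using f(2,3) by auto
 then show ?case using occurs_iff_iso[OF irrepsD(1)[OF I] 0(1) graded_direct_power] by blast
next
 case (Suc k)
 let ?D = "direct_power (Suc k) L" and ?P = "iterated_product L \<rho> (Suc k)"
 let ?Q = "irreducible_product ?D L ?P (\<rho> (Suc k))"
 let ?I = "iterated_product L \<rho> (Suc (Suc k))" and ?DL = "direct_sum ?D L"
 let ?V = "pullback (joink k) V"
 note gDL = graded_direct_sum[OF graded_direct_power gL]
 have P: "?P : irreps ?D" using iterated_product_irreducible[of k \<rho>] Suc.prems(3) by simp
 note P' = irrepsD[OF P] and \<rho> = irrepsD[OF Suc.prems(3)[OF order_refl]]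
 have irrV: "irreducible_supermodule ?DL ?V"
  by (rule pullback_irreducible[OF Suc.prems(1) join_hom(1) gDL graded_direct_power join_hom(2)])
 interpret D: direct_sum_module ?D L ?V
  by unfold_locales (use L graded_algebra_direct_power irrV Suc.prems(2) in simp_all)
 note lsup = pullback_supermodule[OF D.V' hom_left[OF graded_algebra_direct_power L] graded_direct_power]
 have nz: "space (left_part ?V) ~= {0}" using irrV unfolding irreducible_supermodule_def by simp
 have fdl: "finite_dimensional (space (left_part ?V))" using Suc.prems(2) by simp
 obtain W where W: "W \<subseteq> space (left_part ?V)" "irreducible_supermodule ?D (restrict (left_part ?V) W)"
  "space (restrict (left_part ?V) W) = W" "mhom_on ?D (restrict (left_part ?V) W) (left_part ?V) (%v. v)"
  by (rule exists_irreducible_submodule[OF lsup graded_direct_power fdl nz])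
 let ?W = "restrict (left_part ?V) W"
 have fdW: "finite_dimensional (space ?W)" using finite_dimensional_subset[OF fdl W(1)] W(3) by simp
 obtain w where w: "w : space ?W" "w ~= 0" by (rule irreducible_nonzero[OF W(2)])
 have occW: "occurs ?D ?W (left_part ?V)" unfolding occurs_def using W(4) w by blast
 have j: "joink k (insert_at i x, 0) = insert_at i x" if "i \<le> k" for i and x :: 'g using that by (auto simp: fun_eq_iff)
 have "occurs L (\<rho> i) (pullback (insert_at i) ?W)" if i: "i \<le> k" for i
 proof -
  have "pullback (insert_at i) (left_part ?V) = pullback (insert_at i) V"
   using j[OF i] by (simp add: pullback_def)
  then have "occurs L (\<rho> i) (pullback (insert_at i) (left_part ?V))" using Suc.prems(4)[of i] i by simp
  then obtain f v where f: "mhom_on L (\<rho> i) (pullback (insert_at i) (left_part ?V)) f" "v : space (\<rho> i)" "f v ~= 0"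
   unfolding occurs_def by blast
  have "f v : space ?V" using mhomD(2)[OF f(1,2)] by simp
  then obtain \<Lambda> where \<Lambda>: "mhom_on ?D (left_part ?V) ?W \<Lambda>" "\<Lambda> (f v) ~= 0"
   by (rule D.separates_left[OF W(2) fdW occW _ f(3)])
  have "i < Suc k" using i by simp
  from module_hom_compose[OF f(1) pullback_hom[OF \<Lambda>(1) insert_hom[OF this] gL]]
  show ?thesis unfolding occurs_def using f(2) \<Lambda>(2) by blast
 qed
 then have "module_iso ?D ?P ?W" using Suc.IH[OF W(2) fdW] Suc.prems(3) by simp
 then have "occurs ?D ?P ?W" by (rule module_iso_imp_occurs[OF _ P'(1)])
 then have occP: "occurs ?D ?P (left_part ?V)" by (rule occurs_trans[OF _ W(2) lsup graded_direct_power occW])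
 have "right_part ?V = pullback (insert_at (Suc k)) V"
 proof -
  have "joink k (0, x) = insert_at (Suc k) x" for x :: 'g by (auto simp: fun_eq_iff)
  then show ?thesis by (simp add: pullback_def)
 qed
 then have occR: "occurs L (\<rho> (Suc k)) (right_part ?V)" using Suc.prems(4)[of "Suc k"] by simp
 have iso: "module_iso ?DL ?Q ?V"
  by (rule D.determined_by_factors[OF P'(1,2) occP \<rho>(1,2) occR])
 interpret T: super_tensor_irreducible ?D L ?P "\<rho> (Suc k)"
  by unfold_locales (use L graded_algebra_direct_power P' \<rho> in simp_all)
 have "module_iso ?DL (coordinatize ?Q) ?Q"
  by (rule module_iso_sym[OF coordinatize_iso[OF T.P_irr T.fd_product gDL] irr_smod[OF T.P_irr] gDL])
 then have "module_iso ?DL (coordinatize ?Q) ?V" using iso by (rule module_iso_trans)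
 then have "module_iso (direct_power (Suc (Suc k)) L) ?I (pullback (%x. splitk k x) ?V)"
  using pullback_iso[OF _ split_hom(1) graded_direct_power] by simp
 then obtain f where f: "mhom_on (direct_power (Suc (Suc k)) L) ?I (pullback (%x. splitk k x) ?V) f"
  "bij_betw f (space ?I) (space V)" unfolding module_iso_iff pullback_simps by blast
 have "joink k (splitk k x) = x" if "x : underlying (direct_power (Suc (Suc k)) L)" for x
  using that unfolding underlying_direct_power by (auto simp: fun_eq_iff split: if_splits)
 then have "mhom_on (direct_power (Suc (Suc k)) L) ?I V f"
  using f(1) unfolding mhom_on_def pullback_simps by simp
 with f(2) show ?case unfolding module_iso_iff by blast
qed

end

section \<open>Maximal ideals and characters\<close>

definition algebra_ideal :: "'a::comm_unital_complex_algebra set => bool" where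
 "algebra_ideal I \<longleftrightarrow> csubspace I & (ALL a:I. ALL b. a * b : I)"

lemma algebra_idealD:
 assumes "algebra_ideal I"
 shows "csubspace I" "!!a b. a : I ==> a * b : I" "!!a b. a : I ==> b * a : I" "0 : I"
  "!!a b. a : I ==> b : I ==> a + b : I" "!!a b. a : I ==> b : I ==> a - b : I" "!!a. a : I ==> - a : I"
  "!!c a. a : I ==> c *C a : I"
 using assms unfolding algebra_ideal_def by (auto intro: csub_intros simp: mult.commute)

lemma scaleC_mult_right: "(x :: 'a::comm_unital_complex_algebra) * (c *C y) = c *C (x * y)"
 using scaleC_mult_left[of c y x] by (simp add: mult.commute)

lemma scaleC_conv_mult: "c *C (x :: 'a::comm_unital_complex_algebra) = x * (c *C 1)"
 by (simp add: scaleC_mult_right)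

lemma algebra_idealI:
 assumes "0 : I" "!!a b. a : I ==> b : I ==> a + b : I" "!!a b. a : I ==> a * b : I"
 shows "algebra_ideal I"
proof -
 have "c *C a : I" if "a : I" for c a
  unfolding scaleC_conv_mult[of c a] by (rule assms(3)[OF that])
 with assms show ?thesis by (simp add: algebra_ideal_def cv_subspace_def)
qed

lemma cring_ring_of_algebra: "cring (ring_of_algebra :: 'a::comm_unital_complex_algebra ring)"
proof (rule cringI)
 show "abelian_group (ring_of_algebra :: 'a ring)"
  by (rule abelian_groupI) (auto simp: ring_of_algebra_def add.assoc add.commute intro: exI[of _ "- _"])
 show "Group.comm_monoid (ring_of_algebra :: 'a ring)"
  by (rule comm_monoidI) (auto simp: ring_of_algebra_def mult.assoc mult.commute mult.left_commute)
qed (auto simp: ring_of_algebra_def distrib_right)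

lemma ideal_iff: "ideal I (ring_of_algebra :: 'a::comm_unital_complex_algebra ring) \<longleftrightarrow> algebra_ideal I"
proof
 interpret R: cring "ring_of_algebra :: 'a ring" by (rule cring_ring_of_algebra)
 assume "ideal I (ring_of_algebra :: 'a ring)"
 then interpret I: ideal I "ring_of_algebra :: 'a ring" .
 have m: "a * b : I" if "a : I" for a b
  using I.I_r_closed[OF that, of b] by (simp add: ring_of_algebra_def)
 have "0 : I" "!!a b. a : I ==> b : I ==> a + b : I"
  using I.zero_closed I.a_closed by (auto simp: ring_of_algebra_def)
 then show "algebra_ideal I" using m by (rule algebra_idealI)
next
 assume I: "algebra_ideal I"
 interpret R: cring "ring_of_algebra :: 'a ring" by (rule cring_ring_of_algebra)
 note D = algebra_idealD[OF I]
 have inv: "inv\<^bsub>add_monoid ring_of_algebra\<^esub> a = - a" for a :: 'a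
 proof -
  have "\<ominus>\<^bsub>ring_of_algebra\<^esub> a = - a"
   by (rule R.minus_equality) (auto simp: ring_of_algebra_def)
  then show ?thesis by (simp add: a_inv_def)
 qed
 have "subgroup I (add_monoid (ring_of_algebra :: 'a ring))"
  by (rule group.subgroupI[OF R.a_group]) (use D inv in \<open>auto simp: ring_of_algebra_def\<close>)
 then show "ideal I ring_of_algebra"
  by (intro idealI R.ring_axioms) (use D in \<open>auto simp: ring_of_algebra_def\<close>)
qed

lemma MaxSpec_iff:
 "m : MaxSpec \<longleftrightarrow> algebra_ideal m & 1 ~: m & (ALL J. algebra_ideal J & m \<subseteq> J & 1 ~: J --> J = m)"
proof -
 have c: "carrier (ring_of_algebra :: 'a ring) = UNIV" by (simp add: ring_of_algebra_def)
 have one: "J = UNIV" if "algebra_ideal J" "1 : J" for J :: "'a set"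
  using algebra_idealD(2)[OF that] by auto
 show ?thesis
 proof
  assume "m : MaxSpec"
  then interpret m: maximalideal m "ring_of_algebra :: 'a ring" by (simp add: MaxSpec_def)
  have i: "algebra_ideal m" using m.is_ideal ideal_iff by blast
  have "1 ~: m" using m.I_notcarr one[OF i] c by blast
  moreover have "J = m" if "algebra_ideal J & m \<subseteq> J & 1 ~: J" for J
   using m.I_maximal[of J] that ideal_iff c by blast
  ultimately show "algebra_ideal m & 1 ~: m & (ALL J. algebra_ideal J & m \<subseteq> J & 1 ~: J --> J = m)" using i by blast
 next
  assume m: "algebra_ideal m & 1 ~: m & (ALL J. algebra_ideal J & m \<subseteq> J & 1 ~: J --> J = m)"
  interpret i: ideal m "ring_of_algebra :: 'a ring" using m ideal_iff by blast
  have "maximalideal m (ring_of_algebra :: 'a ring)"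
  proof (unfold_locales)
   show "carrier ring_of_algebra ~= m" using m c by blast
   show "J = m \<or> J = carrier ring_of_algebra" if "ideal J (ring_of_algebra :: 'a ring)" "m \<subseteq> J" for J
    using that m one[of J] ideal_iff c by blast
  qed
  then show "m : MaxSpec" by (simp add: MaxSpec_def)
 qed
qed

lemma ideal_adjoin:
 assumes "algebra_ideal I"
 shows "algebra_ideal {x + a * b | x b. x : I}" "I \<subseteq> {x + a * b | x b. x : I}" "a : {x + a * b | x b. x : I}"
proof -
 note D = algebra_idealD[OF assms]
 have e: "x + a * b + (y + a * c) = (x + y) + a * (b + c)" for x y b c by (simp add: algebra_simps)
 have e3: "(x + a * b) * c = x * c + a * (b * c)" for x b c by (simp add: algebra_simps)
 have z: "0 = 0 + a * 0" by simp
 show "algebra_ideal {x + a * b | x b. x : I}"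
 proof (rule algebra_idealI)
  show "0 : {x + a * b | x b. x : I}" using z D(4) by blast
  fix u v assume "u : {x + a * b | x b. x : I}"
  then obtain x b where u: "u = x + a * b" "x : I" by blast
  show "u * v : {x + a * b | x b. x : I}" unfolding u(1) e3 using D(2)[OF u(2)] by blast
  assume "v : {x + a * b | x b. x : I}"
  then obtain y c where v: "v = y + a * c" "y : I" by blast
  show "u + v : {x + a * b | x b. x : I}" unfolding u(1) v(1) e using D(5)[OF u(2) v(2)] by blast
 qed
 have "x = x + a * 0" for x by simp
 then show "I \<subseteq> {x + a * b | x b. x : I}" by blast
 have "a = 0 + a * 1" by simp
 then show "a : {x + a * b | x b. x : I}" using D(4) by blast
qed

text \<open>Krull's lemma: an ideal that is maximal among those disjoint from a multiplicative set is prime.\<close>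

lemma exists_prime_ideal:
 assumes I: "algebra_ideal I" and S: "1 : S" "!!s t. s : S ==> t : S ==> s * t : S" "I \<inter> S = {}"
 obtains P where "algebra_ideal P" "I \<subseteq> P" "P \<inter> S = {}" "ALL a b. a * b : P --> a : P \<or> b : P"
  "ALL J. algebra_ideal J --> P \<subseteq> J --> J \<inter> S = {} --> J = P"
proof -
 define A where "A = {J. algebra_ideal J & I \<subseteq> J & J \<inter> S = {}}"
 have "A ~= {}" using I S(3) by (auto simp: A_def)
 moreover have "\<Union>C \<in> A" if C: "C ~= {}" "subset.chain A C" for C
 proof -
  have CA: "C \<subseteq> A" and ch: "!!X Y. X : C ==> Y : C ==> X \<subseteq> Y \<or> Y \<subseteq> X"
   using C(2) unfolding subset_chain_def by blast+
  have D: "algebra_ideal X" if "X : C" for X using CA that by (auto simp: A_def)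
  have "x + y : \<Union>C" if xy: "x \<in> \<Union>C" "y \<in> \<Union>C" for x y
  proof -
   obtain X Y where XY: "X : C" "Y : C" "x : X" "y : Y" using xy by blast
   from ch[OF XY(1,2)] show ?thesis
    using algebra_idealD(5)[OF D[OF XY(1)]] algebra_idealD(5)[OF D[OF XY(2)]] XY by blast
  qed
  moreover have "0 : \<Union>C" using C(1) algebra_idealD(4)[OF D] by blast
  moreover have "x * b : \<Union>C" if "x \<in> \<Union>C" for b x using that algebra_idealD(2)[OF D] by blast
  ultimately have "algebra_ideal (\<Union>C)" by (intro algebra_idealI)
  then show ?thesis using C(1) CA unfolding A_def by blast
 qed
 ultimately obtain P where P: "P : A" "!!X. X : A ==> P \<subseteq> X ==> X = P"
  using subset_Zorn_nonempty[of A] by blast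
 have P': "algebra_ideal P" "I \<subseteq> P" "P \<inter> S = {}" using P(1) by (auto simp: A_def)
 have max: "J = P" if "algebra_ideal J" "P \<subseteq> J" "J \<inter> S = {}" for J
  by (rule P(2)) (use that P' in \<open>auto simp: A_def\<close>)
 have meets: "EX x b. x : P & x + a * b : S" if a: "a ~: P" for a
 proof (rule ccontr)
  assume n: "\<not> ?thesis"
  have "{x + a * b | x b. x : P} \<inter> S = {}" using n by blast
  from max[OF ideal_adjoin(1,2)[OF P'(1)] this] have "a : P" using ideal_adjoin(3)[OF P'(1), of a] by simp
  with a show False ..
 qed
 have prime: "a : P \<or> b : P" if ab: "a * b : P" for a b
 proof (rule ccontr)
  assume "\<not> ?thesis"
  then obtain x c y d where *: "x : P" "x + a * c : S" "y : P" "y + b * d : S" using meets by metis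
  have "(x + a * c) * (y + b * d) = x * (y + b * d) + (y * (a * c) + (a * b) * (c * d))" by (simp add: algebra_simps)
  moreover have "\<dots> : P"
   by (intro algebra_idealD(5)[OF P'(1)] algebra_idealD(2)[OF P'(1)] * ab)
  ultimately show False using S(2)[OF *(2,4)] P'(3) by auto
 qed
 show ?thesis by (rule that[OF P']) (use prime max in blast)+
qed

lemma exists_maximal_ideal:
 assumes "algebra_ideal I" "1 ~: I"
 obtains m where "m : MaxSpec" "I \<subseteq> m"
proof -
 obtain P where "algebra_ideal P" "I \<subseteq> P" "P \<inter> {1} = {}" "ALL a b. a * b : P --> a : P \<or> b : P"
  "ALL J. algebra_ideal J --> P \<subseteq> J --> J \<inter> {1} = {} --> J = P"
  by (rule exists_prime_ideal[OF assms(1), of "{1}"]) (use assms(2) in auto)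
 then show ?thesis using that[of P] unfolding MaxSpec_iff by auto
qed

lemma MaxSpec_prime:
 assumes m: "m : MaxSpec" and ab: "a * b : m" and a: "a ~: m"
 shows "b : m"
proof -
 have m': "algebra_ideal m" "1 ~: m" "!!J. algebra_ideal J ==> m \<subseteq> J ==> 1 ~: J ==> J = m"
  using m unfolding MaxSpec_iff by auto
 have "1 : {x + a * b | x b. x : m}"
  using m'(3)[OF ideal_adjoin(1,2)[OF m'(1)], of a] ideal_adjoin(3)[OF m'(1), of a] a by auto
 then obtain x c where x: "x : m" "x + a * c = 1" by auto
 have "x * b + (a * b) * c = b * (x + a * c)" by (simp add: algebra_simps)
 then have eq: "x * b + (a * b) * c = b" using x(2) by simp
 have "x * b + (a * b) * c : m"
  by (intro algebra_idealD(5)[OF m'(1)] algebra_idealD(2)[OF m'(1)] x(1) ab)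
 then show ?thesis unfolding eq .
qed

text \<open>If every element is a scalar modulo a proper ideal \<open>m\<close>, then \<open>m\<close> is maximal and \<open>eval_at m\<close> is the
  corresponding character.\<close>

definition character_ideal :: "'a::comm_unital_complex_algebra set => bool" where
 "character_ideal m \<longleftrightarrow> algebra_ideal m & 1 ~: m & (ALL f. EX c. f - c *C 1 : m)"

context
 fixes m :: "'a::comm_unital_complex_algebra set"
 assumes m: "character_ideal m"
begin

lemma character_ideal_unique: "f - c *C 1 : m ==> f - d *C 1 : m ==> c = d"
proof (rule ccontr)
 assume a: "f - c *C 1 : m" "f - d *C 1 : m" "c ~= d"
 have I: "algebra_ideal m" "1 ~: m" using m by (auto simp: character_ideal_def)
 have "(f - c *C 1) - (f - d *C 1) = (d - c) *C (1 :: 'a)" by (simp add: complex_vector.scale_left_diff_distrib)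
 then have "inverse (d - c) *C (d - c) *C (1 :: 'a) : m"
  using algebra_idealD(6,8)[OF I(1)] a by metis
 then show False using a(3) I(2) by (simp add: scaleC_scaleC scaleC_one)
qed

lemma eval_at_eq: "f - c *C 1 : m ==> eval_at m f = c"
 unfolding eval_at_def using character_ideal_unique by blast

lemma eval_at_in: "f - eval_at m f *C 1 : m"
 using m eval_at_eq unfolding character_ideal_def by metis

lemma eval_at_add: "eval_at m (f + g) = eval_at m f + eval_at m g"
proof (rule eval_at_eq)
 have I: "algebra_ideal m" using m by (auto simp: character_ideal_def)
 have "f + g - (eval_at m f + eval_at m g) *C 1 = (f - eval_at m f *C 1) + (g - eval_at m g *C 1)"
  by (simp add: scaleC_add_left)
 then show "f + g - (eval_at m f + eval_at m g) *C 1 : m"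
  using algebra_idealD(5)[OF I eval_at_in eval_at_in] by metis
qed

lemma eval_at_scale: "eval_at m (c *C f) = c * eval_at m f"
proof (rule eval_at_eq)
 have I: "algebra_ideal m" using m by (auto simp: character_ideal_def)
 have "c *C f - (c * eval_at m f) *C 1 = c *C (f - eval_at m f *C 1)"
  by (simp add: cv_scale_right_diff_distrib scaleC_scaleC)
 then show "c *C f - (c * eval_at m f) *C 1 : m"
  using algebra_idealD(8)[OF I eval_at_in] by metis
qed

lemma eval_at_mult: "eval_at m (f * g) = eval_at m f * eval_at m g"
proof (rule eval_at_eq)
 have I: "algebra_ideal m" using m by (auto simp: character_ideal_def)
 have "f * g - (eval_at m f * eval_at m g) *C 1 = (f - eval_at m f *C 1) * g + eval_at m f *C (g - eval_at m g *C 1)"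
  by (simp add: cv_scale_right_diff_distrib scaleC_scaleC left_diff_distrib scaleC_mult_left)
 then show "f * g - (eval_at m f * eval_at m g) *C 1 : m"
  using algebra_idealD(5)[OF I algebra_idealD(2)[OF I eval_at_in] algebra_idealD(8)[OF I eval_at_in]] by metis
qed

lemma eval_at_one: "eval_at m 1 = 1"
 using m by (intro eval_at_eq) (simp add: scaleC_one algebra_idealD character_ideal_def)

lemma eval_at_zero_iff: "eval_at m f = 0 \<longleftrightarrow> f : m"
 using eval_at_in[of f] eval_at_eq[of f 0] by auto

lemma character_ideal_MaxSpec: "m : MaxSpec"
proof -
 have I: "algebra_ideal m" "1 ~: m" using m by (auto simp: character_ideal_def)
 have "J = m" if J: "algebra_ideal J" "m \<subseteq> J" "1 ~: J" for J
 proof -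
  have "f : m" if f: "f : J" for f
  proof (rule ccontr)
   assume "f ~: m"
   then have c: "eval_at m f ~= 0" by (simp add: eval_at_zero_iff)
   have "f - (f - eval_at m f *C 1) : J"
    using algebra_idealD(6)[OF J(1) f] eval_at_in[of f] J(2) by blast
   then have "eval_at m f *C 1 : J" by simp
   from algebra_idealD(8)[OF J(1) this, of "inverse (eval_at m f)"]
   show False using c J(3) by (simp add: scaleC_scaleC scaleC_one)
  qed
  then show ?thesis using J(2) by blast
 qed
 then show ?thesis using I unfolding MaxSpec_iff by blast
qed

lemma linear_eval_at: "clinear (eval_at m)"
 unfolding clinear_iff using eval_at_add eval_at_scale by (simp add: scaleC_complex_def)

end

lemma linear_mult: "linear_on UNIV (%x :: 'a::comm_unital_complex_algebra. f * x)"
 by (simp add: linear_on_def distrib_left scaleC_mult_right)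

subsection \<open>The Nullstellensatz over an uncountable field\<close>

text \<open>If \<open>f\<close> is not a scalar modulo the maximal ideal \<open>m\<close>, then the inverses of the \<open>f - c\<close> modulo \<open>m\<close> form an
  uncountable linearly independent family, whereas a finitely generated algebra has countable dimension.\<close>

lemma finitely_generated_exhaustion:
 assumes "finitely_generated_algebra TYPE('a::comm_unital_complex_algebra)"
 obtains P :: "nat => 'a::comm_unital_complex_algebra set" where "!!n. finite (P n)" "!!x. EX n. x : cspan (P n)"
proof -
 obtain S :: "'a set" where S: "finite S" "!!B. csubalgebra B ==> S \<subseteq> B ==> B = UNIV"
  using assms unfolding finitely_generated_algebra_def by blast
 define P where "P = rec_nat {1} (%_ Q. Q \<union> (%(s, p). s * p) ` (S \<times> Q))"
 have P: "P 0 = {1}" "P (Suc n) = P n \<union> (%(s, p). s * p) ` (S \<times> P n)" for n by (simp_all add: P_def)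
 have fin: "finite (P n)" for n by (induction n) (use S(1) P in auto)
 have mono: "P n \<subseteq> P k" if "n \<le> k" for n k using that by (induction k rule: dec_induct) (auto simp: P)
 define U where "U = (\<Union>n. cspan (P n))"
 have sU: "csubspace U"
  unfolding cv_subspace_def
 proof (intro conjI ballI allI)
  show "0 : U" by (auto simp: U_def cv_span_zero)
  show "c *C x : U" if "x : U" for c x using that cv_span_scale unfolding U_def by blast
  fix x y assume "x : U" "y : U"
  then obtain n k where "x : cspan (P n)" "y : cspan (P k)" by (auto simp: U_def)
  then have "x : cspan (P (max n k))" "y : cspan (P (max n k))"
   using cv_span_mono[OF mono[of n "max n k"]] cv_span_mono[OF mono[of k "max n k"]] by auto
  then show "x + y : U" unfolding U_def using cv_span_add by blast
 qed
 define N where "N = {x. ALL u:U. x * u : U}"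
 have "csubalgebra N"
  unfolding csubalgebra_def cv_subspace_def N_def
  using sU by (auto simp: distrib_right scaleC_mult_left mult.assoc csub_intros)
 moreover have "S \<subseteq> N"
 proof
  fix s assume s: "s : S"
  have "s * u : cspan (P (Suc n))" if u: "u : cspan (P n)" for u n
  proof -
   have "csubspace {u. s * u : cspan (P (Suc n))}"
    unfolding cv_subspace_def
    by (auto simp: distrib_left scaleC_mult_right cv_span_add cv_span_scale cv_span_zero)
   moreover have "P n \<subseteq> {u. s * u : cspan (P (Suc n))}"
    using s by (auto simp: P intro!: cv_span_base)
   ultimately have "cspan (P n) \<subseteq> {u. s * u : cspan (P (Suc n))}" by (intro cv_span_minimal)
   with u show ?thesis by blast
  qed
  then show "s : N" unfolding N_def U_def by blast
 qed
 ultimately have "N = UNIV" by (rule S(2))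
 moreover have "1 : cspan (P 0)" by (rule cv_span_base) (simp add: P)
 then have "1 : U" unfolding U_def by blast
 ultimately have "x * 1 : U" for x unfolding N_def by blast
 then have "EX n. x : cspan (P n)" for x by (simp add: U_def)
 with fin show ?thesis by (rule that)
qed

lemmas mult_operator = linear_mult cv_subspace_UNIV UNIV_I UNIV_I

lemma poly_op_roots:
 fixes f :: "'a::comm_unital_complex_algebra"
 assumes "finite J"
 shows "poly_op (%x. f * x) (\<Prod>c\<in>J. [:- c, 1:]) 1 = (\<Prod>c\<in>J. f - c *C 1)"
 using assms
proof (induction J)
 case empty
 have "poly_op (%x. f * x) (pCons 1 0) 1 = 1"
  by (subst poly_op_pCons[OF mult_operator]) (simp add: poly_op_def scaleC_one)
 then show ?case by (simp add: one_pCons)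
next
 case (insert c J)
 then show ?case
  by (simp add: poly_op_linear_factor[OF mult_operator] left_diff_distrib scaleC_mult_left
    del: mult_pCons_left)
qed

theorem Nullstellensatz:
 assumes fg: "finitely_generated_algebra TYPE('a::comm_unital_complex_algebra)" and m: "m : (MaxSpec :: 'a::comm_unital_complex_algebra set set)"
 shows "character_ideal m"
proof (rule ccontr)
 have I: "algebra_ideal m" "1 ~: m" using m unfolding MaxSpec_iff by auto
 note D = algebra_idealD[OF I(1)]
 assume "\<not> character_ideal m"
 then obtain f where f: "!!c. f - c *C 1 ~: m" using I unfolding character_ideal_def by blast
 have "EX g. (f - c *C 1) * g - 1 : m" for c
 proof -
  let ?a = "f - c *C 1"
  have "1 : {x + ?a * b | x b. x : m}"
   using m ideal_adjoin[OF I(1), of ?a] f[of c] unfolding MaxSpec_iff by blast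
  then obtain x b where "x : m" "x + ?a * b = 1" by auto
  then have "?a * b - 1 = - x" by (simp add: algebra_simps)
  then show ?thesis using D(7)[OF \<open>x : m\<close>] by metis
 qed
 then obtain g where g: "!!c. (f - c *C 1) * g c - 1 : m" by metis
 obtain P :: "nat => 'a set" where P: "!!n. finite (P n)" "!!x. EX n. x : cspan (P n)"
  by (rule finitely_generated_exhaustion[OF fg]) blast
 have "EX n. infinite {c. g c : cspan (P n)}"
 proof (rule ccontr)
  assume "\<not> ?thesis"
  then have "countable (\<Union>n. {c. g c : cspan (P n)})" by (intro countable_UN) (auto intro: countable_finite)
  moreover have "(\<Union>n. {c. g c : cspan (P n)}) = UNIV" using P(2) by auto
  ultimately show False using uncountable_UNIV_complex by simp
 qed
 then obtain n where n: "infinite {c. g c : cspan (P n)}" by blast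
 obtain J where J: "J \<subseteq> {c. g c : cspan (P n)}" "finite J" "card J = Suc (card (P n))"
  using infinite_arbitrarily_large[OF n] by blast
 obtain \<alpha> where \<alpha>: "EX c:J. \<alpha> c ~= 0" "(\<Sum>c\<in>J. \<alpha> c *C g c) = 0"
  using dependent_family[OF P(1)[of n] J(2), of g] J by auto
 let ?F = "%K. \<Prod>c\<in>K. f - c *C 1"
 define p where "p = (\<Sum>c\<in>J. smult (\<alpha> c) (\<Prod>d\<in>J - {c}. [:- d, 1:]))"
 have "poly_op (%x. f * x) p 1 = (\<Sum>c\<in>J. \<alpha> c *C ?F (J - {c}))"
  using J(2) by (simp add: p_def poly_op_sum[OF mult_operator] poly_op_smult[OF mult_operator] poly_op_roots)
 moreover have "?F J * g c - ?F (J - {c}) : m" if "c : J" for c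
 proof -
  have "?F J * g c - ?F (J - {c}) = ?F (J - {c}) * ((f - c *C 1) * g c - 1)"
   using J(2) that by (simp add: prod.remove[of J c] algebra_simps)
  then show ?thesis using D(3)[OF g] by metis
 qed
 then have "(\<Sum>c\<in>J. \<alpha> c *C (?F J * g c - ?F (J - {c}))) : m"
  by (intro cv_subspace_sum[OF D(1)] D(8))
 moreover have "(\<Sum>c\<in>J. \<alpha> c *C (?F J * g c - ?F (J - {c}))) = ?F J * (\<Sum>c\<in>J. \<alpha> c *C g c) - (\<Sum>c\<in>J. \<alpha> c *C ?F (J - {c}))"
  by (simp add: cv_scale_right_diff_distrib sum_subtractf sum_distrib_left scaleC_mult_right)
 ultimately have "- poly_op (%x. f * x) p 1 : m" unfolding \<alpha>(2) by simp
 then have pm: "poly_op (%x. f * x) p 1 : m" using D(7) by fastforce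
 have "p ~= 0"
 proof
  assume "p = 0"
  obtain c where c: "c : J" "\<alpha> c ~= 0" using \<alpha>(1) by blast
  have "poly p c = (\<Sum>d\<in>J. \<alpha> d * (\<Prod>e\<in>J - {d}. c - e))"
   by (simp add: p_def poly_sum poly_prod)
  also have "\<dots> = (\<Sum>d\<in>{c}. \<alpha> d * (\<Prod>e\<in>J - {d}. c - e))"
   using J(2) c(1) by (intro sum.mono_neutral_right) auto
  finally show False using \<open>p = 0\<close> c(2) J(2) by simp
 qed
 obtain z q where "poly_op (%x. f * x) q 1 ~: m" "f * poly_op (%x. f * x) q 1 - z *C poly_op (%x. f * x) q 1 : m"
  using eigenvector_of_annihilator[OF mult_operator D(1) I(2) \<open>p ~= 0\<close> pm] by blast
 moreover have "f * w - z *C w = w * (f - z *C 1)" for w by (simp add: algebra_simps scaleC_mult_right)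
 ultimately have "f - z *C 1 : m" using MaxSpec_prime[OF m] by metis
 with f show False by blast
qed

subsection \<open>Semiprime ideals of finite codimension\<close>

lemma finite_codim_mono:
 assumes "finite_codim V S" "S \<subseteq> S'"
 shows "finite_codim V S'"
proof -
 obtain B where B: "finite B" "ALL x:V. EX y:cspan B. x - y : S" using assms(1) finite_codim_def by metis
 have "EX y:cspan B. x - y : S'" if x: "x : V" for x
 proof -
  obtain y where "y : cspan B" "x - y : S" using B(2) x by blast
  then show ?thesis using assms(2) by auto
 qed
 with B(1) show ?thesis unfolding finite_codim_def by auto
qed

text \<open>Every \<open>f\<close> satisfies a polynomial equation modulo \<open>P\<close>; as \<open>P\<close> is prime, one of the
  linear factors \<open>f - c\<close> lies in \<open>P\<close>.\<close>

lemma prime_finite_codim_character: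
 assumes P: "algebra_ideal P" "1 ~: P" "!!a b. a * b : P ==> a : P \<or> b : P" and fc: "finite_codim UNIV P"
 shows "character_ideal P"
 unfolding character_ideal_def
proof (intro conjI allI)
 note D = algebra_idealD[OF P(1)]
 fix f
 obtain p where p: "p ~= 0" "poly_op (%x. f * x) p 1 : P"
  using finite_codim_annihilator[OF mult_operator fc D(1)] by blast
 obtain z q where "poly_op (%x. f * x) q 1 ~: P" "f * poly_op (%x. f * x) q 1 - z *C poly_op (%x. f * x) q 1 : P"
  using eigenvector_of_annihilator[OF mult_operator D(1) P(2) p] by blast
 moreover have "f * w - z *C w = w * (f - z *C 1)" for w by (simp add: algebra_simps scaleC_mult_right)
 ultimately show "EX c. f - c *C 1 : P" using P(3) by metis
qed (use P in auto)

text \<open>No power of \<open>a\<close> lies in \<open>J\<close>, so some prime ideal above \<open>J\<close> avoids all of them.\<close>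

lemma semiprime_separation:
 assumes J: "algebra_ideal J" "finite_codim UNIV J" "!!a. a * a : J ==> a : J" and a: "a ~: J"
 obtains m where "character_ideal m" "J \<subseteq> m" "a ~: m"
proof -
 have pow: "a ^ n ~: J" for n
 proof (induction n rule: less_induct)
  case (less n)
  show ?case
  proof (cases "n \<le> 1")
   case True
   then have "n = 0 \<or> n = 1" by auto
   moreover have "1 ~: J" using a algebra_idealD(2)[OF J(1), of 1 a] by auto
   ultimately show ?thesis using a by auto
  next
   case False
   let ?k = "(n + 1) div 2"
   have "?k < n" using False by linarith
   then have k: "a ^ ?k * a ^ ?k ~: J" using less J(3) by blast
   have e: "a ^ ?k * a ^ ?k = a ^ n * a ^ (2 * ?k - n)"
   proof -
    have "?k + ?k = n + (2 * ?k - n)" using False by presburger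
    then show ?thesis unfolding power_add[symmetric] by (rule arg_cong)
   qed
   show ?thesis using k algebra_idealD(2)[OF J(1), of "a ^ n"] unfolding e by blast
  qed
 qed
 let ?S = "range (%n. a ^ n)"
 have S: "1 : ?S" "J \<inter> ?S = {}" by (rule range_eqI[of _ _ 0], simp) (use pow in auto)
 have mult: "s * t : ?S" if "s : ?S" "t : ?S" for s t
  using that by (auto simp: power_add[symmetric])
 obtain P where P: "algebra_ideal P" "J \<subseteq> P" "P \<inter> ?S = {}" "ALL a b. a * b : P --> a : P \<or> b : P"
  "ALL J. algebra_ideal J --> P \<subseteq> J --> J \<inter> ?S = {} --> J = P"
  by (rule exists_prime_ideal[OF J(1) S(1) mult S(2)])
 have "a ^ 0 ~: P" "a ^ 1 ~: P" using P(3) by blast+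
 then have "1 ~: P" "a ~: P" by simp_all
 then show ?thesis
  using that[OF prime_finite_codim_character[OF P(1) _ P(4)[rule_format] finite_codim_mono[OF J(2) P(2)]] P(2)] by blast
qed

lemma dual_element:
 assumes fin: "finite Z" and Z: "!!m. m : Z ==> character_ideal m" and m0: "character_ideal m0"
 obtains e where "eval_at m0 e = 1" "ALL m:Z. m ~= m0 --> eval_at m e = 0"
proof -
 have "EX e. eval_at m0 e = 1 & (ALL m:Z. m ~= m0 --> eval_at m e = 0)"
  using fin Z
 proof (induction Z)
  case empty
  show ?case using eval_at_one[OF m0] by auto
 next
  case (insert m Z)
  then obtain e where e: "eval_at m0 e = 1" "ALL m:Z. m ~= m0 --> eval_at m e = 0" by auto
  show ?case
  proof (cases "m = m0")
   case True
   then show ?thesis using e by auto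
  next
   case False
   have cm: "character_ideal m" using insert by blast
   have "\<not> m \<subseteq> m0"
    using character_ideal_MaxSpec[OF cm] m0 False unfolding MaxSpec_iff character_ideal_def by blast
   then obtain f where f: "f : m" "f ~: m0" by blast
   let ?g = "inverse (eval_at m0 f) *C f * e"
   have "eval_at m0 f ~= 0" "eval_at m f = 0" using f eval_at_zero_iff[OF m0] eval_at_zero_iff[OF cm] by auto
   then have "eval_at m0 ?g = 1" "eval_at m ?g = 0"
    using e(1) by (simp_all add: eval_at_mult[OF m0] eval_at_scale[OF m0] eval_at_mult[OF cm] eval_at_scale[OF cm])
   moreover have "eval_at m' ?g = 0" if "m' : Z" "m' ~= m0" for m'
   proof -
    have "character_ideal m'" using insert that by blast
    then show ?thesis using that e(2) by (simp add: eval_at_mult)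
   qed
   ultimately show ?thesis by auto
  qed
 qed
 then show ?thesis using that by blast
qed

text \<open>Dual functions for distinct points above \<open>J\<close> are linearly independent modulo \<open>J\<close>.\<close>

lemma finite_codim_finitely_many_characters:
 assumes J: "algebra_ideal J" "finite_codim UNIV J"
 shows "finite {m. character_ideal m & J \<subseteq> m}" (is "finite ?T")
proof (rule ccontr)
 assume "infinite ?T"
 obtain B where B: "finite B" "!!x. EX y:cspan B. x - y : J" using J(2) unfolding finite_codim_def by blast
 obtain I where I: "I \<subseteq> ?T" "finite I" "card I = Suc (card B)"
  using infinite_arbitrarily_large[OF \<open>infinite ?T\<close>] by blast
 have ch: "character_ideal m" if "m : I" for m using I(1) that by blast
 have "EX e. eval_at m e = 1 & (ALL m':I. m' ~= m --> eval_at m' e = 0)" if m: "m : I" for m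
 proof -
  obtain e where "eval_at m e = 1" "ALL m':I. m' ~= m --> eval_at m' e = 0"
   by (rule dual_element[OF I(2) ch ch[OF m]])
  then show ?thesis by blast
 qed
 then obtain e where e: "!!m. m : I ==> eval_at m (e m) = 1"
  "!!m m'. m : I ==> m' : I ==> m' ~= m ==> eval_at m' (e m) = 0" by metis
 have "ALL m. EX y. y : cspan B & e m - y : J" using B(2) by blast
 from choice[OF this] obtain y where y: "!!m. y m : cspan B" "!!m. e m - y m : J" by blast
 obtain c where c: "EX m:I. c m ~= 0" "(\<Sum>m\<in>I. c m *C y m) = 0"
  using dependent_family[OF B(1) I(2), of y] y(1) I(3) by auto
 have "(\<Sum>m\<in>I. c m *C e m) = (\<Sum>m\<in>I. c m *C (e m - y m))"
  using c(2) by (simp add: cv_scale_right_diff_distrib sum_subtractf)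
 then have in_J: "(\<Sum>m\<in>I. c m *C e m) : J"
  using y(2) algebra_idealD[OF J(1)] by (simp add: cv_subspace_sum)
 have "c m = 0" if m: "m : I" for m
 proof -
  have cm: "character_ideal m" "J \<subseteq> m" using m I(1) by auto
  have "eval_at m (\<Sum>k\<in>I. c k *C e k) = (\<Sum>k\<in>I. c k * eval_at m (e k))"
   by (simp add: cv_linear_sum[OF linear_eval_at[OF cm(1)]] eval_at_scale[OF cm(1)])
  also have "\<dots> = (\<Sum>k\<in>{m}. c k * eval_at m (e k))"
   using I(2) m e by (intro sum.mono_neutral_right) auto
  finally have "eval_at m (\<Sum>k\<in>I. c k *C e k) = c m" using e(1)[OF m] by simp
  moreover have "eval_at m (\<Sum>k\<in>I. c k *C e k) = 0"
   using in_J cm eval_at_zero_iff[OF cm(1)] by blast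
  ultimately show ?thesis by simp
 qed
 with c(1) show False by blast
qed

section \<open>Free actions\<close>

lemma algebra_automorphismD:
 assumes "acts_by algebra_automorphism (\<beta> :: 't::ab_group_add => 'a::comm_unital_complex_algebra => 'a)"
 shows "clinear (\<beta> s)" "\<beta> s (x * y) = \<beta> s x * \<beta> s y" "\<beta> s 1 = 1" "\<beta> 0 x = x"
  "\<beta> (s + t) x = \<beta> s (\<beta> t x)" "\<beta> s (\<beta> (- s) x) = x" "\<beta> (- s) (\<beta> s x) = x"
proof -
 show "clinear (\<beta> s)" "\<beta> s (x * y) = \<beta> s x * \<beta> s y" "\<beta> s 1 = 1"
  using assms unfolding acts_by_def algebra_automorphism_def by auto
 have add: "\<beta> (s + t) x = \<beta> s (\<beta> t x)" for s t x using assms unfolding acts_by_def by simp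
 have 0: "\<beta> 0 x = x" for x using assms unfolding acts_by_def by simp
 show "\<beta> (s + t) x = \<beta> s (\<beta> t x)" "\<beta> 0 x = x" by (fact add, fact 0)
 show "\<beta> s (\<beta> (- s) x) = x" "\<beta> (- s) (\<beta> s x) = x" using add[of s "- s" x] add[of "- s" s x] 0 by simp_all
qed

context
 fixes \<beta> :: "'t::{finite, ab_group_add} => 'a::comm_unital_complex_algebra => 'a"
 assumes \<beta>: "acts_by algebra_automorphism \<beta>"
begin

lemmas b = algebra_automorphismD[OF \<beta>]

lemma b_lin: "\<beta> s (x + y) = \<beta> s x + \<beta> s y" "\<beta> s (x - y) = \<beta> s x - \<beta> s y" "\<beta> s (c *C x) = c *C \<beta> s x" "\<beta> s 0 = 0"
 using cv_linear_add[OF b(1)] cv_linear_diff[OF b(1)] cv_linear_scale[OF b(1)] cv_linear_0[OF b(1)] by auto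

lemma b_image_iff: "\<beta> s x : \<beta> s ` I \<longleftrightarrow> x : I"
proof
 assume "\<beta> s x : \<beta> s ` I"
 then obtain y where "y : I" "\<beta> s x = \<beta> s y" by blast
 then have "\<beta> (- s) (\<beta> s x) = \<beta> (- s) (\<beta> s y)" by simp
 then show "x : I" using \<open>y : I\<close> by (simp add: b)
qed blast

lemma b_image_mem: "x : \<beta> s ` I \<longleftrightarrow> \<beta> (- s) x : I"
 using b_image_iff[of s "\<beta> (- s) x"] by (simp add: b)

lemma b_image_image: "\<beta> s ` \<beta> t ` I = \<beta> (s + t) ` I"
 by (simp add: image_image b(5))

lemma b_image_ideal: "algebra_ideal I ==> algebra_ideal (\<beta> s ` I)"
 unfolding algebra_ideal_def cv_subspace_def Ball_def b_image_mem
 by (auto simp: b b_lin)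

lemma b_image_character:
 assumes "character_ideal m"
 shows "character_ideal (\<beta> s ` m)" "eval_at (\<beta> s ` m) f = eval_at m (\<beta> (- s) f)"
proof -
 have e: "f - eval_at m (\<beta> (- s) f) *C 1 : \<beta> s ` m" for f
  unfolding b_image_mem by (simp add: b b_lin eval_at_in[OF assms])
 show c: "character_ideal (\<beta> s ` m)"
  unfolding character_ideal_def
 proof (intro conjI allI)
  show "algebra_ideal (\<beta> s ` m)" "1 ~: \<beta> s ` m"
   using assms b_image_ideal[of m s] b_image_mem[of 1 s m] unfolding character_ideal_def by (auto simp: b)
  show "EX c. f - c *C 1 : \<beta> s ` m" for f using e by blast
 qed
 show "eval_at (\<beta> s ` m) f = eval_at m (\<beta> (- s) f)" by (rule eval_at_eq[OF c e])
qed

lemma b_image_MaxSpec: "m : MaxSpec ==> \<beta> s ` m : MaxSpec"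
 unfolding MaxSpec_iff
proof (intro conjI allI impI)
 assume m: "algebra_ideal m & 1 ~: m & (ALL J. algebra_ideal J & m \<subseteq> J & 1 ~: J --> J = m)"
 show "algebra_ideal (\<beta> s ` m)" using b_image_ideal m by blast
 show "1 ~: \<beta> s ` m" using m b_image_mem[of 1 s m] by (simp add: b)
 fix J assume J: "algebra_ideal J & \<beta> s ` m \<subseteq> J & 1 ~: J"
 have "\<beta> (- s) ` J = m"
 proof -
  have "algebra_ideal (\<beta> (- s) ` J)" "1 ~: \<beta> (- s) ` J" using J b_image_ideal b_image_mem[of 1 "- s" J] by (auto simp: b)
  moreover have "m \<subseteq> \<beta> (- s) ` J" using J by (auto simp: b_image_mem)
  ultimately show ?thesis using m by blast
 qed
 then have "\<beta> s ` \<beta> (- s) ` J = \<beta> s ` m" by simp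
 then show "J = \<beta> s ` m" unfolding b_image_image by (simp add: b image_cong[where g = id])
qed

text \<open>For a free action the pairs \<open>(a, b)\<close> below play the role of the Galois coordinates of Chase, Harrison
  and Rosenberg.  For a single \<open>s \<noteq> 0\<close> they exist because the ideal generated by the \<open>c - s c\<close> lies in no
  maximal ideal; products of such families handle all \<open>s\<close> at once.\<close>

definition twisted_sum :: "('a \<times> 'a) list => 't => 'a" where
 "twisted_sum xs s = (\<Sum>p\<leftarrow>xs. fst p * \<beta> s (snd p))"

lemma twisted_sum_product:
 "twisted_sum [(fst p * fst q, snd p * snd q). p \<leftarrow> xs, q \<leftarrow> ys] s = twisted_sum xs s * twisted_sum ys s"
proof -
 have "(\<Sum>p\<leftarrow>map (%q. (fst a * fst q, snd a * snd q)) ys. fst p * \<beta> s (snd p)) = fst a * \<beta> s (snd a) * (\<Sum>p\<leftarrow>ys. fst p * \<beta> s (snd p))" for a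
  by (induction ys) (simp_all add: b algebra_simps)
 then show ?thesis
  unfolding twisted_sum_def by (induction xs) (simp_all add: distrib_right)
qed

lemma free_single:
 assumes free: "!!m. m : MaxSpec ==> \<beta> s ` m ~= m"
 obtains xs where "twisted_sum xs 0 = 1" "twisted_sum xs s = 0"
proof -
 let ?D = "%xs. twisted_sum xs 0 - twisted_sum xs s"
 define I where "I = range ?D"
 have app: "twisted_sum (xs @ ys) t = twisted_sum xs t + twisted_sum ys t" for xs ys t by (simp add: twisted_sum_def)
 have scale: "twisted_sum (map (%p. (c * fst p, snd p)) xs) t = c * twisted_sum xs t" for c xs t
  unfolding twisted_sum_def by (induction xs) (simp_all add: algebra_simps)
 have m: "c * x : I" if x: "x : I" for c x
 proof -
  obtain xs where "x = ?D xs" using x unfolding I_def by blast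
  then have "c * x = ?D (map (%p. (c * fst p, snd p)) xs)" by (simp only: scale right_diff_distrib)
  then show ?thesis unfolding I_def by blast
 qed
 have "algebra_ideal I"
 proof (rule algebra_idealI)
  have "0 = ?D []" by (simp add: twisted_sum_def)
  then show "0 : I" unfolding I_def by blast
  show "x + y : I" if xy: "x : I" "y : I" for x y
  proof -
   obtain xs ys where "x = ?D xs" "y = ?D ys" using xy unfolding I_def by blast
   then have "x + y = ?D (xs @ ys)" by (simp add: app)
   then show ?thesis unfolding I_def by blast
  qed
  show "x * c : I" if "x : I" for c x using m[OF that, of c] by (simp add: mult.commute)
 qed
 have diff: "c - \<beta> s c : I" for c
 proof -
  have "c - \<beta> s c = ?D [(1, c)]" by (simp add: twisted_sum_def b)
  then show ?thesis unfolding I_def by blast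
 qed
 have "1 : I"
 proof (rule ccontr)
  assume "1 ~: I"
  then obtain m where m: "m : MaxSpec" "I \<subseteq> m" by (rule exists_maximal_ideal[OF \<open>algebra_ideal I\<close>])
  have im: "algebra_ideal m" "1 ~: m" using m(1) unfolding MaxSpec_iff by auto
  have "\<beta> s c : m" if "c : m" for c
  proof -
   have "c - (c - \<beta> s c) : m" using algebra_idealD(6)[OF im(1) that] diff m(2) by blast
   then show ?thesis by simp
  qed
  then have "\<beta> s ` m \<subseteq> m" by blast
  then have "m = \<beta> s ` m" using b_image_MaxSpec[OF m(1), of s] im unfolding MaxSpec_iff by blast
  with free[OF m(1)] show False by simp
 qed
 then obtain xs where xs: "1 = ?D xs" unfolding I_def by blast
 let ?ys = "(- twisted_sum xs s, 1) # xs"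
 have "twisted_sum ?ys 0 = 1" "twisted_sum ?ys s = 0"
  using xs by (simp_all add: twisted_sum_def b)
 then show ?thesis by (rule that)
qed

lemma Galois_coordinates:
 assumes free: "!!s m. m : MaxSpec ==> \<beta> s ` m = m ==> s = 0"
 obtains N :: nat and a b where "!!s. (\<Sum>i<N. a i * \<beta> s (b i)) = (if s = 0 then 1 else 0)"
proof -
 have "EX xs. twisted_sum xs 0 = 1 & (ALL s:Q. twisted_sum xs s = 0)" if "finite Q" "0 ~: Q" for Q
  using that
 proof (induction Q)
  case empty
  have "twisted_sum [(1, 1)] 0 = 1" by (simp add: twisted_sum_def b)
  then show ?case by blast
 next
  case (insert s Q)
  then obtain xs where xs: "twisted_sum xs 0 = 1" "ALL s:Q. twisted_sum xs s = 0" by auto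
  have "\<beta> s ` m ~= m" if "m : MaxSpec" for m using free[OF that, of s] insert.prems by auto
  then obtain ys where ys: "twisted_sum ys 0 = 1" "twisted_sum ys s = 0" by (rule free_single)
  show ?case
   by (rule exI[of _ "[(fst p * fst q, snd p * snd q). p \<leftarrow> xs, q \<leftarrow> ys]"])
    (use xs ys in \<open>auto simp: twisted_sum_product\<close>)
 qed
 from this[of "UNIV - {0}"] obtain xs where xs: "twisted_sum xs 0 = 1" "ALL s:UNIV - {0}. twisted_sum xs s = 0" by auto
 show ?thesis
 proof (rule that)
  fix s
  have "(\<Sum>i<length xs. fst (xs ! i) * \<beta> s (snd (xs ! i))) = twisted_sum xs s"
   unfolding twisted_sum_def by (simp add: sum_list_sum_nth atLeast0LessThan)
  then show "(\<Sum>i<length xs. fst (xs ! i) * \<beta> s (snd (xs ! i))) = (if s = 0 then 1 else 0)"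
   using xs by simp
 qed
qed

end

section \<open>Two lemmas on families of operators\<close>

text \<open>The eigenvalue of \<open>[n, Y]\<close> on a common eigenvector \<open>v\<close> vanishes: modulo the span of lower powers,
  \<open>(n - \<lambda> n) Y\<^sup>k v\<close> is \<open>k \<lambda> [n, Y]\<close> times \<open>Y\<^sup>k\<^sup>-\<^sup>1 v\<close>, and in finite dimension some \<open>Y\<^sup>k v\<close>
  depends on the lower powers.\<close>

lemma common_eigenvalue_of_commutator:
 assumes V: "finite_dimensional V" "csubspace V"
  and Y: "linear_on V Y" "!!v. v : V ==> Y v : V"
  and n: "!!t. t : N ==> linear_on V (n t)" "!!t v. t : N ==> v : V ==> n t v : V"
  and D: "!!t. t : N ==> D t : N" "!!t v. t : N ==> v : V ==> n t (Y v) = Y (n t v) + n (D t) v"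
  and v: "v : V" "v ~= 0" "!!t. t : N ==> n t v = ev t *C v"
  and t: "t : N"
 shows "ev (D t) = (0::complex)"
proof (rule ccontr)
 assume nz: "ev (D t) ~= 0"
 define u where "u = (%k. (Y ^^ k) v)"
 have u: "u 0 = v" "u (Suc k) = Y (u k)" for k by (simp_all add: u_def)
 have uV: "u k : V" for k by (induction k) (simp_all add: u v(1) Y(2))
 define F where "F = (%k::nat. cspan (u ` {..<k}))"
 have sF: "csubspace (F k)" for k by (simp add: F_def)
 have FV: "F k \<subseteq> V" for k
  unfolding F_def using uV V(2) by (intro cv_span_minimal) auto
 have uF: "u j : F k" if "j < k" for j k unfolding F_def using that by (intro cv_span_base) auto
 have F_mono: "F j \<subseteq> F k" if "j \<le> k" for j k
  unfolding F_def using that by (intro cv_span_mono) auto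
 have F_into: "f x : A" if "linear_on V f" "csubspace A" "!!j. j < k ==> f (u j) : A" "x : F k" for f A k x
 proof -
  have "u ` {..<k} \<subseteq> {x : V. f x : A}" using that(3) uV by auto
  then have "F k \<subseteq> {x : V. f x : A}"
   unfolding F_def by (intro cv_span_minimal csubspace_preimage[OF that(1) V(2) that(2)])
  with that(4) show ?thesis by blast
 qed
 have YF: "Y x : F (Suc k)" if "x : F k" for x k
  by (rule F_into[OF Y(1) sF _ that]) (simp add: u(2)[symmetric] uF)
 have one: "n t (u k) - ev t *C u k : F k" if "t : N" for t k
  using that
 proof (induction k arbitrary: t)
  case 0
  then show ?case using v(3) by (simp add: u cv_subspace_0[OF sF])
 next
  case (Suc k)
  have "n t (u (Suc k)) - ev t *C u (Suc k) =
    Y (n t (u k) - ev t *C u k) + ((n (D t) (u k) - ev (D t) *C u k) + ev (D t) *C u k)"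
   using D(2)[OF Suc.prems uV] n(2)[OF Suc.prems uV] uV V(2)
   by (simp add: u lin_on_diff[OF Y(1)] lin_on_scale[OF Y(1)] cv_subspace_scale)
  also have "\<dots> : F (Suc k)"
   using YF[OF Suc.IH[OF Suc.prems]] Suc.IH[OF D(1)[OF Suc.prems]] F_mono[of k "Suc k"] uF[of k "Suc k"]
   by (intro cv_subspace_add[OF sF] cv_subspace_scale[OF sF]) auto
  finally show ?case .
 qed
 have two: "n t (u k) - ev t *C u k - (of_nat k * ev (D t)) *C u (k - 1) : F (k - 1)" if "t : N" for t k
  using that
 proof (induction k arbitrary: t)
  case 0
  then show ?case using v(3) by (simp add: u cv_subspace_0[OF sF])
 next
  case (Suc k)
  let ?r = "n t (u k) - ev t *C u k - (of_nat k * ev (D t)) *C u (k - 1)"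
  have r: "?r : F (k - 1)" by (rule Suc.IH[OF Suc.prems])
  have "?r : V" "n t (u k) : V" using r FV n(2)[OF Suc.prems uV] by auto
  have "n t (u k) = ?r + ev t *C u k + (of_nat k * ev (D t)) *C u (k - 1)" by simp
  then have "Y (n t (u k)) = Y (?r + ev t *C u k + (of_nat k * ev (D t)) *C u (k - 1))" by (rule arg_cong)
  also have "\<dots> = Y ?r + ev t *C u (Suc k) + (of_nat k * ev (D t)) *C Y (u (k - 1))"
   using \<open>?r : V\<close> uV V(2)
   by (simp only: lin_on_add[OF Y(1)] lin_on_scale[OF Y(1)] u csub_intros)
  also have "(of_nat k * ev (D t)) *C Y (u (k - 1)) = (of_nat k * ev (D t)) *C u k"
   by (cases k) (simp_all add: u)
  finally have Yn: "Y (n t (u k)) = Y ?r + ev t *C u (Suc k) + (of_nat k * ev (D t)) *C u k" .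
  have "n t (u (Suc k)) - ev t *C u (Suc k) - (of_nat (Suc k) * ev (D t)) *C u k =
    Y ?r + (n (D t) (u k) - ev (D t) *C u k)"
  proof -
   have "n t (u (Suc k)) = Y (n t (u k)) + n (D t) (u k)" using D(2)[OF Suc.prems uV] by (simp add: u)
   then show ?thesis unfolding Yn by (simp add: scaleC_add_left distrib_right algebra_simps)
  qed
  also have "\<dots> : F k"
  proof (intro cv_subspace_add[OF sF] one[OF D(1)[OF Suc.prems]])
   show "Y ?r : F k"
   proof (cases k)
    case 0
    then have "?r = 0" using r by (simp add: F_def)
    then show ?thesis using lin_on_0[OF Y(1) V(2)] cv_subspace_0[OF sF] by simp
   next
    case (Suc j)
    then show ?thesis using YF[OF r] by simp
   qed
  qed
  finally show ?case by simp
 qed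
 have "EX k. u k : F k"
 proof (rule ccontr)
  assume indep: "\<nexists>k. u k : F k"
  obtain B where B: "finite B" "V \<subseteq> cspan B" using V(1) finite_dimensional_def by blast
  have "!!i. i : {..card B} ==> u i : cspan B" using uV B(2) by blast
  then obtain c where c: "EX i:{..card B}. c i ~= 0" "(\<Sum>i\<le>card B. c i *C u i) = 0"
   using dependent_family[OF B(1), of "{..card B}" u] by auto
  define k where "k = Max {i. i \<le> card B & c i ~= 0}"
  have "{i. i \<le> card B & c i ~= 0} ~= {}" using c(1) by auto
  then have k: "k \<le> card B" "c k ~= 0" "!!i. i \<le> card B ==> c i ~= 0 ==> i \<le> k"
   using Max_in[of "{i. i \<le> card B & c i ~= 0}"] by (auto simp: k_def)
  have "(\<Sum>i\<le>card B. c i *C u i) = (\<Sum>i\<in>insert k {..<k}. c i *C u i)"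
  proof (rule sum.mono_neutral_right)
   show "ALL i:{..card B} - insert k {..<k}. c i *C u i = 0"
   proof
    fix i assume i: "i : {..card B} - insert k {..<k}"
    have "c i = 0" by (rule ccontr) (use i k(3)[of i] in auto)
    then show "c i *C u i = 0" by simp
   qed
  qed (use k(1) in auto)
  then have "c k *C u k + (\<Sum>i<k. c i *C u i) = 0" using c(2) by simp
  then have "c k *C u k = - (\<Sum>i<k. c i *C u i)" by (simp add: eq_neg_iff_add_eq_0)
  moreover have "(\<Sum>i<k. c i *C u i) : F k"
   by (intro cv_subspace_sum[OF sF] cv_subspace_scale[OF sF] uF) simp
  ultimately have "c k *C u k : F k" using cv_subspace_neg[OF sF] by simp
  then have "inverse (c k) *C c k *C u k : F k" by (rule cv_subspace_scale[OF sF])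
  then have "u k : F k" using k(2) by (simp add: scaleC_scaleC scaleC_one)
  with indep show False by blast
 qed
 then obtain k where k: "u k : F k" "!!j. j < k ==> u j ~: F j"
  using exists_least_iff[of "%k. u k : F k"] by blast
 have "k ~= 0" using k(1) v(2) by (cases k) (auto simp: F_def u)
 have lin: "linear_on V (%x. n t x - ev t *C x)" by (intro lin_on_arith n(1)[OF t])
 have "n t (u k) - ev t *C u k : F (k - 1)"
 proof (rule F_into[OF lin sF _ k(1)])
  fix j assume "j < k"
  then show "n t (u j) - ev t *C u j : F (k - 1)" using subsetD[OF F_mono one[OF t]] by simp
 qed
 then have "(n t (u k) - ev t *C u k) - (n t (u k) - ev t *C u k - (of_nat k * ev (D t)) *C u (k - 1)) : F (k - 1)"
  using two[OF t, of k] by (rule cv_subspace_diff[OF sF])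
 then have "(of_nat k * ev (D t)) *C u (k - 1) : F (k - 1)" by simp
 then have "inverse (of_nat k * ev (D t)) *C (of_nat k * ev (D t)) *C u (k - 1) : F (k - 1)"
  by (rule cv_subspace_scale[OF sF])
 moreover have "inverse (of_nat k * ev (D t)) * (of_nat k * ev (D t)) = 1"
  using nz \<open>k ~= 0\<close> by (intro left_inverse) simp
 ultimately have "u (k - 1) : F (k - 1)" by (simp only: scaleC_scaleC scaleC_one)
 with k(2)[of "k - 1"] \<open>k ~= 0\<close> show False by simp
qed

text \<open>On an irreducible subspace each operator of a commuting family is a scalar.\<close>

lemma commuting_common_eigenvector:
 assumes n: "operators N n V" and V: "finite_dimensional V" "V ~= {0}"
  and com: "!!s t v. s : N ==> t : N ==> v : V ==> n s (n t v) = n t (n s v)"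
 obtains v where "v : V" "v ~= 0" "ALL t:N. EX c. n t v = c *C v"
proof -
 obtain W where W: "W \<subseteq> V" "irreducible_family N n W" by (rule exists_irreducible_subspace[OF n V])
 have oW: "operators N n W" by (rule irr_famD(1)[OF W(2)])
 obtain v where v: "v : W" "v ~= 0"
  using irr_famD(2,3)[OF W(2)] cv_subspace_0 by blast
 have "EX c. n t v = c *C v" if t: "t : N" for t
 proof -
  have "intertwines N n W n W (n t)"
   unfolding intertwines_def using oW t com[OF t] W(1) unfolding operators_def by auto
  then obtain c where "!!w. w : W ==> n t w = c *C w"
   using Schur_scalar[OF _ W(2) finite_dimensional_subset[OF V(1) W(1)]] by blast
  with v(1) show ?thesis by blast
 qed
 with v W(1) show ?thesis using that by blast
qed

text \<open>On an irreducible subspace the image of each operator is a submodule, and it is proper because the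
  operator has square zero.\<close>

lemma anticommuting_common_kernel:
 assumes n: "operators N n V" and V: "finite_dimensional V" "V ~= {0}"
  and com: "!!s t v. s : N ==> t : N ==> v : V ==> n s (n t v) = - n t (n s v)"
 obtains v where "v : V" "v ~= 0" "ALL t:N. n t v = 0"
proof -
 obtain W where W: "W \<subseteq> V" "irreducible_family N n W" by (rule exists_irreducible_subspace[OF n V])
 have sW: "csubspace W" by (rule irr_famD(2)[OF W(2)])
 obtain v where v: "v : W" "v ~= 0"
  using irr_famD(2,3)[OF W(2)] cv_subspace_0 by blast
 have lW: "linear_on W (n t)" "n t ` W \<subseteq> W" if "t : N" for t
  using irr_famD(1)[OF W(2)] that unfolding operators_def by blast+
 have "n t v = 0" if t: "t : N" for t
 proof -
  have sq: "n t (n t w) = 0" if "w : W" for w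
   using com[OF t t] W(1) that by (intro self_neg_zero) blast
  have "stable N n (n t ` W)"
   unfolding stable_def
  proof (intro conjI ballI)
   show "csubspace (n t ` W)" by (rule csubspace_image[OF lW(1)[OF t] sW order_refl])
   fix s assume s: "s : N"
   show "n s ` n t ` W \<subseteq> n t ` W"
   proof safe
    fix w assume w: "w : W"
    have "n s (n t w) = n t (- n s w)"
    using com[OF s t] W(1) w lW(2)[OF s] lin_on_neg[OF lW(1)[OF t]] by (metis image_subset_iff subsetD)
    moreover have "- n s w : W" using lW(2)[OF s] w cv_subspace_neg[OF sW] by blast
    ultimately show "n s (n t w) : n t ` W" by blast
   qed
  qed
  then have "n t ` W = {0} \<or> n t ` W = W"
   using irr_famD(4)[OF W(2) lW(2)[OF t]] by blast
  then show ?thesis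
  proof
   assume "n t ` W = W"
   then obtain w where w: "w : W" "v = n t w" using v(1) by blast
   obtain w' where "w' : W" "w = n t w'" using w(1) \<open>n t ` W = W\<close> by blast
   then have "v = 0" using sq w(2) by simp
   with v(2) show ?thesis ..
  qed (use v(1) in blast)
 qed
 with v W(1) show ?thesis using that by blast
qed

section \<open>Equivariant map superalgebras\<close>

lemma finite_codim_kernel:
 assumes \<phi>: "clinear \<phi>" "!!x. \<phi> x : W" and W: "finite_dimensional W"
 shows "finite_codim UNIV {x. \<phi> x = 0}"
proof -
 have lin: "linear_on UNIV \<phi>" by (rule clinear_linear_on[OF \<phi>(1)])
 have r: "csubspace (range \<phi>)" by (rule csubspace_image[OF lin cv_subspace_UNIV order_refl])
 have "finite_dimensional (range \<phi>)" by (rule finite_dimensional_subset[OF W]) (use \<phi>(2) in blast)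
 then obtain B where B: "finite B" "B \<subseteq> range \<phi>" "complex_vector.independent B" "cspan B = range \<phi>"
  by (rule finite_dimensional_basis[OF _ r])
 have "ALL b. EX x. b : B --> \<phi> x = b" using B(2) by blast
 from choice[OF this] obtain g where g: "!!b. b : B ==> \<phi> (g b) = b" by blast
 have "cspan B \<subseteq> \<phi> ` cspan (g ` B)"
 proof (rule cv_span_minimal)
  show "B \<subseteq> \<phi> ` cspan (g ` B)"
  proof
   fix b assume b: "b : B"
   have "g b : cspan (g ` B)" using b by (intro cv_span_base) blast
   then show "b : \<phi> ` cspan (g ` B)" using g[OF b] by (metis imageI)
  qed
  show "csubspace (\<phi> ` cspan (g ` B))" by (rule csubspace_image[OF lin]) simp_all
 qed
 then have "EX y:cspan (g ` B). x - y : {x. \<phi> x = 0}" for x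
 proof -
  have "\<phi> x : \<phi> ` cspan (g ` B)" using \<open>cspan B \<subseteq> _\<close> B(4) by blast
  then obtain y where "y : cspan (g ` B)" "\<phi> x = \<phi> y" by blast
  then show ?thesis using cv_linear_diff[OF \<phi>(1)] by auto
 qed
 then show ?thesis unfolding finite_codim_def using B(1) by blast
qed

lemma finite_dimensional_finite_support:
 fixes K :: "'k set" and W :: "'w::complex_vector set"
 assumes K: "finite K" and W: "finite_dimensional W"
 shows "finite_dimensional {f. (ALL q. f q : W) & (ALL q. q ~: K --> f q = 0)}"
proof -
 obtain C where C: "finite C" "W \<subseteq> cspan C" using W finite_dimensional_def by blast
 define E :: "'k => 'w => 'k => 'w" where "E = (%p c q. if q = p then c else 0)"
 let ?S = "(%(p, c). E p c) ` (K \<times> C)"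
 have E: "E p w : cspan ?S" if p: "p : K" and w: "w : cspan C" for p w
 proof -
  have "E p (x + y) = E p x + E p y" "E p (k *C x) = k *C E p x" "E p 0 = 0" for x y k
   by (auto simp: E_def fun_eq_iff scaleC_fun_def)
  then have "csubspace {w. E p w : cspan ?S}"
   unfolding cv_subspace_def
   by (auto intro: cv_span_add cv_span_scale cv_span_zero)
  moreover have "C \<subseteq> {w. E p w : cspan ?S}" using p by (auto intro!: cv_span_base)
  ultimately have "cspan C \<subseteq> {w. E p w : cspan ?S}" by (intro cv_span_minimal)
  with w show ?thesis by blast
 qed
 have "f : cspan ?S" if f: "ALL q. f q : W" "ALL q. q ~: K --> f q = 0" for f
 proof -
  have 2: "(\<Sum>p\<in>K. E p (f p)) q = (\<Sum>p\<in>K. E p (f p) q)" for q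
   by (induction K rule: infinite_finite_induct) simp_all
  have 1: "(\<Sum>p\<in>K. E p (f p) q) = f q" for q
   using f(2) K by (cases "q : K") (simp_all add: E_def)
  have "f = (\<Sum>p\<in>K. E p (f p))" by (rule ext) (simp only: 1 2)
  moreover have "(\<Sum>p\<in>K. E p (f p)) : cspan ?S"
   using f(1) C(2) by (intro cv_span_sum E) auto
  ultimately show ?thesis by simp
 qed
 moreover have "finite ?S" using K C by simp
 ultimately show ?thesis unfolding finite_dimensional_def by blast
qed

locale equivariant =
 fixes L :: "'g::complex_vector superalgebra"
  and \<alpha> :: "'t::{finite, ab_group_add} => 'g => 'g"
  and \<beta> :: "'t => 'a::comm_unital_complex_algebra => 'a"
 assumes L: "lie_superalgebra L" and UL: "underlying L = UNIV" and fdL: "finite_dimensional (UNIV :: 'g set)"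
  and perfect0: "grade L 0 \<subseteq> cspan {bracket L x y | x y. x : grade L 0 & y : grade L 0}"
  and perfect1: "grade L 1 \<subseteq> cspan {bracket L x y | x y. x : grade L 0 & y : grade L 1}"
  and alpha: "acts_by (superalgebra_automorphism L) \<alpha>"
  and beta: "acts_by algebra_automorphism \<beta>"
  and fg: "finitely_generated_algebra TYPE('a)"
  and free: "!!s m. m : (MaxSpec :: 'a set set) ==> \<beta> s ` m = m ==> s = 0"
begin

abbreviation "CC \<equiv> current_superalgebra L :: ('g, 'a) tensor superalgebra"
abbreviation "EE \<equiv> equivariant_map_superalgebra L \<alpha> \<beta>"
abbreviation "br \<equiv> bracket CC"
abbreviation "dg s \<equiv> diagonal_action L \<alpha> \<beta> s"

lemmas gaL = lie_graded_algebra[OF L]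
lemmas gL = graded_algebraD(1)[OF gaL]
lemmas bb = algebra_automorphismD[OF beta]
lemma blL: "clinear (bracket L x)" "clinear (%x. bracket L x y)"
 using graded_algebraD(3)[OF gaL] unfolding UL bilinear_on_def linear_on_UNIV by auto

lemma aa: "clinear (\<alpha> s)" "x : grade L i ==> \<alpha> s x : grade L i" "\<alpha> s (bracket L x y) = bracket L (\<alpha> s x) (\<alpha> s y)"
 "\<alpha> 0 x = x" "\<alpha> (s + t) x = \<alpha> s (\<alpha> t x)"
proof -
 note h = alpha[unfolded acts_by_def superalgebra_automorphism_def UL linear_on_UNIV]
 show "clinear (\<alpha> s)" "\<alpha> s (bracket L x y) = bracket L (\<alpha> s x) (\<alpha> s y)" using h by blast+
 show "\<alpha> 0 x = x" "\<alpha> (s + t) x = \<alpha> s (\<alpha> t x)" using h by (metis id_apply, metis comp_apply)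
 have "\<alpha> s ` grade L i = grade L i" using h by blast
 then show "x : grade L i ==> \<alpha> s x : grade L i" by blast
qed

lemma aa_lin: "\<alpha> s (x + y) = \<alpha> s x + \<alpha> s y" "\<alpha> s (c *C x) = c *C \<alpha> s x"
 using cv_linear_add[OF aa(1)] cv_linear_scale[OF aa(1)] by auto

lemma aa_inv: "\<alpha> s (\<alpha> (- s) x) = x" "\<alpha> (- s) (\<alpha> s x) = x"
 using aa(5)[of s "- s" x] aa(5)[of "- s" s x] aa(4) by simp_all

lemma tensor_ext_UNIV:
 fixes F G :: "('g, 'a) tensor => 'z::complex_vector"
 assumes "clinear F" "clinear G" "!!x f. F (x **C f) = G (x **C f)"
 shows "F t = G t"
 by (rule tensor_linear_ext[of UNIV UNIV, OF clinear_linear_on[OF assms(1)] clinear_linear_on[OF assms(2)]])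
  (simp_all add: assms(3) tensor_space_UNIV)

lemma dg_lemma: "clinear (dg s)" "dg s (x **C f) = \<alpha> s x **C \<beta> s f"
proof -
 have B: "bilinear_on UNIV UNIV (%x f. \<alpha> s x **C \<beta> s f)"
  by (rule bilinear_tensor) (simp_all add: linear_on_UNIV aa(1) bb(1))
 show "clinear (dg s)"
  unfolding diagonal_action_def UL by (rule clinear_tensor_lift[OF _ _ B]) simp_all
 show "dg s (x **C f) = \<alpha> s x **C \<beta> s f"
  unfolding diagonal_action_def UL by (rule tensor_lift_tens[OF _ _ B]) simp_all
qed

lemmas dg_add = cv_linear_add[OF dg_lemma(1)]
 and dg_scale = cv_linear_scale[OF dg_lemma(1)] and dg_sum = cv_linear_sum[OF dg_lemma(1)]

lemma clinear_comp: "clinear f ==> clinear g ==> clinear (%x. f (g x))"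
 unfolding clinear_iff by simp

lemma clinear_plus: "clinear f ==> clinear g ==> clinear (%x. f x + g x)"
 unfolding clinear_iff by (simp add: scaleC_add_right)

lemma clinear_times: "clinear f ==> clinear (%x. c *C f x)"
 unfolding clinear_iff by (simp add: scaleC_add_right scaleC_scaleC mult.commute)

lemma clinear_sum: "(!!i. i : I ==> clinear (f i)) ==> clinear (%x. \<Sum>i\<in>I. f i x)"
 unfolding clinear_iff by (simp add: sum.distrib cv_scale_sum_right)

lemma dg_dg: "dg s (dg r t) = dg (s + r) t"
 by (rule tensor_ext_UNIV[OF clinear_comp[OF dg_lemma(1) dg_lemma(1)] dg_lemma(1)]) (simp add: dg_lemma(2) aa(5) bb(5))

lemma br_tens: "br (x **C f) (y **C g) = bracket L x y **C (f * g)"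
 by (rule current_bracket_tens[OF L]) (simp_all add: UL)

lemma br_linear: "clinear (br t)" "clinear (%t. br t u)"
proof -
 define I where "I = (%x f u. tensor_lift UNIV UNIV (%y g. bracket L x y **C (f * g)) u :: ('g, 'a) tensor)"
 note U = cv_subspace_UNIV
 have b1: "bilinear_on UNIV UNIV (%y g. bracket L x y **C (f * g))" for x and f :: 'a
  by (rule bilinear_tensor) (simp_all add: linear_on_UNIV blL linear_mult[unfolded linear_on_UNIV])
 have I_lin: "clinear (I x f)" for x f unfolding I_def by (rule clinear_tensor_lift[OF U U b1])
 have I_tens: "I x f (y **C g) = bracket L x y **C (f * g)" for x f y g
  unfolding I_def by (rule tensor_lift_tens[OF U U b1]) simp_all
 note l = cv_linear_add[OF blL(2)] cv_linear_scale[OF blL(2)]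
 have I_add: "I (x + x') f u = I x f u + I x' f u" "I x (f + f') u = I x f u + I x f' u"
  "I (c *C x) f u = c *C I x f u" "I x (c *C f) u = c *C I x f u" for x x' f f' u c
  by (rule tensor_ext_UNIV[OF I_lin clinear_plus[OF I_lin I_lin]] tensor_ext_UNIV[OF I_lin clinear_times[OF I_lin]],
   simp add: I_tens l tens_bilinear distrib_right scaleC_mult_left)+
 have b2: "bilinear_on UNIV UNIV (%x f. I x f u)" for u
  unfolding bilinear_on_def linear_on_def using I_add by simp
 have br: "br t u = tensor_lift UNIV UNIV (%x f. I x f u) t" for t u
  by (simp add: current_superalgebra_def UL I_def)
 show lin2: "clinear (%t. br t u)" for u
  unfolding br by (rule clinear_tensor_lift[OF U U b2])
 have brI: "br (x **C f) u = I x f u" for x f u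
  unfolding br by (rule tensor_lift_tens[OF U U b2]) simp_all
 have "br t (u + u') = br t u + br t u'" "br t (c *C u) = c *C br t u" for u u' c
  by (rule tensor_ext_UNIV[OF lin2 clinear_plus[OF lin2 lin2]] tensor_ext_UNIV[OF lin2 clinear_times[OF lin2]],
   simp add: brI cv_linear_add[OF I_lin] cv_linear_scale[OF I_lin])+
 then show "clinear (br t)" unfolding clinear_iff by simp
qed

lemmas br_add_left = cv_linear_add[OF br_linear(2)] and br_sum_left = cv_linear_sum[OF br_linear(2)]
 and br_sum_right = cv_linear_sum[OF br_linear(1)]

lemma dg_br: "dg s (br t u) = br (dg s t) (dg s u)"
proof (rule tensor_ext_UNIV[of "%t. dg s (br t u)" "%t. br (dg s t) (dg s u)"])
 show "clinear (%t. dg s (br t u))" by (rule clinear_comp[OF dg_lemma(1) br_linear(2)])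
 show "clinear (%t. br (dg s t) (dg s u))"
  using clinear_comp[of "%t. br t (dg s u)", OF br_linear(2) dg_lemma(1)] .
 fix x f
 show "dg s (br (x **C f) u) = br (dg s (x **C f)) (dg s u)"
  by (rule tensor_ext_UNIV[OF clinear_comp[OF dg_lemma(1) br_linear(1)] clinear_comp[OF br_linear(1) dg_lemma(1)]])
   (simp add: br_tens dg_lemma(2) aa(3) bb(2))
qed

subsection \<open>The trace\<close>

definition Tr :: "('g, 'a) tensor => ('g, 'a) tensor" where
 "Tr t = (\<Sum>s\<in>UNIV. dg s t)"

lemma Tr_linear: "clinear Tr"
 unfolding Tr_def by (rule clinear_sum) (rule dg_lemma(1))

lemmas Tr_add = cv_linear_add[OF Tr_linear] and Tr_scale = cv_linear_scale[OF Tr_linear]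
 and Tr_sum = cv_linear_sum[OF Tr_linear] and Tr_0 = cv_linear_0[OF Tr_linear]

lemma bij_plus: "bij (%r :: 't. s + r)"
 by (rule bij_betw_byWitness[of _ "%r. - s + r"]) auto

lemma dg_Tr: "dg s (Tr t) = Tr t"
proof -
 have "dg s (Tr t) = (\<Sum>r\<in>UNIV. dg (s + r) t)" by (simp add: Tr_def dg_sum dg_dg)
 also have "\<dots> = Tr t" unfolding Tr_def by (rule sum.reindex_bij_betw[OF bij_plus])
 finally show ?thesis .
qed

lemma Tr_dg: "Tr (dg s t) = Tr t"
proof -
 have "Tr (dg s t) = (\<Sum>r\<in>UNIV. dg (s + r) t)" by (simp add: Tr_def dg_dg add.commute)
 also have "\<dots> = Tr t" unfolding Tr_def by (rule sum.reindex_bij_betw[OF bij_plus])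
 finally show ?thesis .
qed

lemma Tr_invariant: "(!!s. dg s t = t) ==> t = Tr ((1 / of_nat CARD('t)) *C t)"
proof -
 assume t: "!!s. dg s t = t"
 have "Tr t = of_nat CARD('t) *C t"
  by (simp add: Tr_def t complex_vector.sum_constant_scale)
 then show ?thesis by (simp add: Tr_scale scaleC_scaleC scaleC_one)
qed

lemma br_Tr: "br (Tr t) (Tr u) = Tr (\<Sum>s\<in>UNIV. br t (dg s u))"
proof -
 have "br (Tr t) (Tr u) = (\<Sum>s\<in>UNIV. br (dg s t) (dg s (Tr u)))"
  unfolding dg_Tr Tr_def[of t] by (rule br_sum_left)
 also have "\<dots> = Tr (br t (Tr u))" by (simp add: Tr_def[of "br t (Tr u)"] dg_br)
 finally show ?thesis by (simp add: Tr_def[of u] br_sum_right)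
qed

lemma br_Tr_tens: "br (Tr (x **C f)) (Tr (y **C g)) = (\<Sum>s\<in>UNIV. Tr (bracket L x (\<alpha> s y) **C (f * \<beta> s g)))"
 unfolding br_Tr by (simp add: dg_lemma(2) br_tens Tr_sum)

subsection \<open>Gradings\<close>

lemma grade_CC: "grade CC i = cspan {x **C f | x f. x : grade L i}"
 by (simp add: current_superalgebra_def)

lemma grade_EE: "grade EE i = {t : grade CC i. ALL s. dg s t = t}"
 by (simp add: equivariant_map_superalgebra_def)

lemma bracket_EE: "bracket EE = br"
 by (simp add: equivariant_map_superalgebra_def)

lemma dg_grade: "t : grade CC i ==> dg s t : grade CC i"
proof -
 assume t: "t : grade CC i"
 have "csubspace {t. dg s t : grade CC i}"
  by (rule cv_linear_preimage[OF dg_lemma(1)]) (simp add: grade_CC)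
 moreover have "\<alpha> s x **C \<beta> s f : grade CC i" if "x : grade L i" for x f
  unfolding grade_CC using aa(2)[OF that] by (blast intro: cv_span_base)
 then have "{x **C f | x f. x : grade L i} \<subseteq> {t. dg s t : grade CC i}"
  by (auto simp: dg_lemma(2))
 ultimately have "grade CC i \<subseteq> {t. dg s t : grade CC i}"
  unfolding grade_CC[of i] by (intro cv_span_minimal) (simp_all add: grade_CC)
 with t show ?thesis by blast
qed

lemma Tr_grade: "t : grade CC i ==> Tr t : grade EE i"
 unfolding grade_EE using dg_Tr dg_grade by (auto simp: Tr_def grade_CC intro!: cv_span_sum)

lemma Tr_in_grade: "x : grade L i ==> Tr (x **C f) : grade EE i"
 by (rule Tr_grade) (auto simp: grade_CC intro!: cv_span_base)

text \<open>The parity operator of \<open>L\<close>, tensored with the identity, separates the even from the odd part.\<close>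

lemma graded_EE: "graded_space (grade EE)"
proof -
 let ?p = "tensor_map UNIV UNIV (parity_map (grade L)) (%f :: 'a. f)"
 have lp: "linear_on UNIV (parity_map (grade L))" using lin_on_parity[OF gL] unfolding UL .
 note U = cv_subspace_UNIV
 note cp = clinear_tensor_map[OF U U lp lin_on_arith(5)] and pt = tensor_map_tens[OF U U lp lin_on_arith(5)]
 have p: "?p t = koszul 1 i *C t" if t: "t : grade CC i" for t i
 proof -
  have "csubspace {t. ?p t = koszul 1 i *C t}"
   unfolding cv_subspace_def
   by (simp add: cv_linear_add[OF cp] cv_linear_scale[OF cp]
    cv_linear_0[OF cp] scaleC_add_right scaleC_scaleC mult.commute)
  moreover have "{x **C f | x f. x : grade L i} \<subseteq> {t. ?p t = koszul 1 i *C t}"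
   by (auto simp: pt parity_homogeneous[OF gL] tens_bilinear)
  ultimately have "grade CC i \<subseteq> {t. ?p t = koszul 1 i *C t}"
   unfolding grade_CC by (intro cv_span_minimal)
  with t show ?thesis by blast
 qed
 have s: "csubspace (grade EE i)" for i
  unfolding cv_subspace_def grade_EE
  by (auto simp: grade_CC dg_add dg_scale cv_linear_0[OF dg_lemma(1)]
    cv_span_zero cv_span_add cv_span_scale)
 moreover have "t = 0" if "t : grade EE 0" "t : grade EE 1" for t
  using p[of t 0] p[of t 1] that by (intro self_neg_zero) (simp add: grade_EE scaleC_one)
 ultimately show ?thesis
  unfolding graded_space_def using cv_subspace_0[OF s] by blast
qed

lemma grade_EE_span: "grade EE i \<subseteq> cspan {Tr (x **C f) | x f. x : grade L i}"
proof
 fix t assume t: "t : grade EE i"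
 have "csubspace {t. Tr t : cspan {Tr (x **C f) | x f. x : grade L i}}"
  by (rule cv_linear_preimage[OF Tr_linear]) simp
 moreover have "{x **C f | x f. x : grade L i} \<subseteq> {t. Tr t : cspan {Tr (x **C f) | x f. x : grade L i}}"
  by (auto intro!: cv_span_base)
 ultimately have "grade CC i \<subseteq> {t. Tr t : cspan {Tr (x **C f) | x f. x : grade L i}}"
  unfolding grade_CC by (intro cv_span_minimal)
 moreover have "(1 / of_nat CARD('t)) *C t : grade CC i"
  using t by (simp add: grade_EE grade_CC cv_span_scale)
 moreover have "t = Tr ((1 / of_nat CARD('t)) *C t)" using t by (intro Tr_invariant) (simp add: grade_EE)
 ultimately show "t : cspan {Tr (x **C f) | x f. x : grade L i}" by auto
qed

lemma Tr_in_EE: "Tr (x **C f) : underlying EE"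
proof -
 have "x : underlying L" by (simp add: UL)
 then obtain u w where uw: "u : grade L 0" "w : grade L 1" "x = u + w" by (rule total_cases[OF gL])
 show ?thesis
  unfolding uw(3) tens_bilinear Tr_add by (intro totalI Tr_in_grade uw)
qed

lemma perfect_induct:
 assumes A: "csubspace A" and b: "!!i j x y. x : grade L i ==> y : grade L j ==> bracket L x y : A"
 shows "z : A"
proof -
 have "z : underlying L" by (simp add: UL)
 then obtain u w where uw: "u : grade L 0" "w : grade L 1" "z = u + w" by (rule total_cases[OF gL])
 have "cspan {bracket L x y | x y. x : grade L 0 & y : grade L 0} \<subseteq> A"
  "cspan {bracket L x y | x y. x : grade L 0 & y : grade L 1} \<subseteq> A"
  using b by (intro cv_span_minimal[OF _ A]; blast)+
 then have "u : A" "w : A" using uw perfect0 perfect1 by blast+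
 then show ?thesis unfolding uw(3) by (rule cv_subspace_add[OF A])
qed

end

lemma tens_zero: "x **C 0 = 0"
 using tens_bilinear(4)[of x 0 0] by simp

lemma tens_sum: "x **C (\<Sum>i\<in>I. f i) = (\<Sum>i\<in>I. x **C f i)"
 by (induction I rule: infinite_finite_induct) (simp_all add: tens_zero tens_bilinear)

section \<open>The annihilator of an irreducible module\<close>

locale equivariant_module = equivariant L \<alpha> \<beta>
 for L :: "'g::complex_vector superalgebra"
  and \<alpha> :: "'t::{finite, ab_group_add} => 'g => 'g"
  and \<beta> :: "'t => 'a::comm_unital_complex_algebra => 'a" +
 fixes V :: "(('g, 'a) tensor, 'v::complex_vector) supermodule"
 assumes V: "irreducible_supermodule (equivariant_map_superalgebra L \<alpha> \<beta>) V"
  and fdV: "finite_dimensional (space V)"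
begin

abbreviation "r x f \<equiv> act V (Tr (x **C f))"

lemmas mV = irr_smod[OF V]
lemmas sV = smodD(2)[OF mV]
lemmas sEE = graded_total[OF graded_EE]

lemma r_in: "v : space V ==> r x f v : space V"
 by (rule act_in[OF mV graded_EE Tr_in_EE])

lemma r_linear: "linear_on (space V) (r x f)"
 by (rule smodD(4)[OF mV Tr_in_EE])

lemmas r_add = lin_on_add[OF r_linear] and r_scale = lin_on_scale[OF r_linear]
 and r_0 = lin_on_0[OF r_linear sV]

lemma act_Tr_sum: "v : space V ==> act V (\<Sum>i\<in>I. Tr (x i **C f i)) v = (\<Sum>i\<in>I. r (x i) (f i) v)"
 by (rule lin_on_sum[OF smodD(3)[OF mV] sEE]) (simp_all add: Tr_in_EE)

lemma r_add_index:
 assumes "v : space V"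
 shows "r (x + y) f v = r x f v + r y f v" "r x (f + g) v = r x f v + r x g v"
  "r (c *C x) f v = c *C r x f v" "r x (c *C f) v = c *C r x f v"
 by (simp_all add: tens_bilinear Tr_add Tr_scale lin_on_add[OF smodD(3)[OF mV assms]]
   lin_on_scale[OF smodD(3)[OF mV assms]] Tr_in_EE)

lemma r_zero_index: "v : space V ==> r 0 f v = 0" "v : space V ==> r x 0 v = 0"
 "v : space V ==> act V (Tr 0) v = 0"
 using r_add_index(3)[of v 0 0 f] r_add_index(4)[of v x 0 0]
  lin_on_0[OF smodD(3)[OF mV] sEE] Tr_0 by simp_all

lemma r_kernel: "csubspace {x. ALL f:F. ALL v:U. v : space V --> r x (h f) v = 0}"
 unfolding cv_subspace_def by (simp add: r_add_index r_zero_index)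

lemma r_bracket:
 assumes "x : grade L i" "y : grade L j" "v : space V"
 shows "r x f (r y g v) = koszul i j *C r y g (r x f v) + (\<Sum>s\<in>UNIV. r (bracket L x (\<alpha> s y)) (f * \<beta> s g) v)"
proof -
 have "act V (br (Tr (x **C f)) (Tr (y **C g))) v = r x f (r y g v) - koszul i j *C r y g (r x f v)"
  using smodD(6)[OF mV Tr_in_grade[OF assms(1)] Tr_in_grade[OF assms(2)] assms(3)]
  unfolding bracket_EE .
 moreover have "act V (br (Tr (x **C f)) (Tr (y **C g))) v = (\<Sum>s\<in>UNIV. r (bracket L x (\<alpha> s y)) (f * \<beta> s g) v)"
  unfolding br_Tr_tens by (rule act_Tr_sum[OF assms(3)])
 ultimately show ?thesis by simp
qed

text \<open>Galois coordinates remove the terms with \<open>s \<noteq> 0\<close> from the bracket of two traces.\<close>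

lemma Tr_bracket:
 assumes ab: "!!s. (\<Sum>i<N. a i * \<beta> s (b i)) = (if s = 0 then 1 else 0)"
 shows "Tr (bracket L x y **C (c * d)) = (\<Sum>i<N. br (Tr (x **C (c * a i))) (Tr (y **C (b i * d))))"
proof -
 have "(\<Sum>i<N. br (Tr (x **C (c * a i))) (Tr (y **C (b i * d)))) =
   (\<Sum>s\<in>UNIV. \<Sum>i<N. Tr (bracket L x (\<alpha> s y) **C (c * a i * \<beta> s (b i * d))))"
  unfolding br_Tr_tens by (rule sum.swap)
 also have "\<dots> = (\<Sum>s\<in>UNIV. if s = (0 :: 't) then Tr (bracket L x y **C (c * d)) else 0)"
 proof (rule sum.cong[OF refl])
  fix s :: 't
  have "(\<Sum>i<N. Tr (bracket L x (\<alpha> s y) **C (c * a i * \<beta> s (b i * d)))) =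
    Tr (bracket L x (\<alpha> s y) **C (\<Sum>i<N. c * a i * \<beta> s (b i * d)))"
   unfolding tens_sum Tr_sum ..
  also have "(\<Sum>i<N. c * a i * \<beta> s (b i * d)) = c * (\<Sum>i<N. a i * \<beta> s (b i)) * \<beta> s d"
   by (simp add: bb(2) sum_distrib_left sum_distrib_right mult.assoc)
  finally show "(\<Sum>i<N. Tr (bracket L x (\<alpha> s y) **C (c * a i * \<beta> s (b i * d)))) =
    (if s = 0 then Tr (bracket L x y **C (c * d)) else 0)"
   by (simp add: ab aa(4) bb(4) tens_zero Tr_0)
 qed
 finally show ?thesis by simp
qed

lemma galois: "EX (N::nat) a b. ALL s. (\<Sum>i<N. a i * \<beta> s (b i)) = (if s = 0 then 1 else 0)"
proof (rule Galois_coordinates[OF beta])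
 show "s = 0" if "m : MaxSpec" "\<beta> s ` m = m" for s m by (rule free[OF that])
 fix N :: nat and a b assume "!!s. (\<Sum>i<N. a i * \<beta> s (b i)) = (if s = 0 then 1 else 0)"
 then show ?thesis by blast
qed

definition annihilator :: "'a set" where
 "annihilator = {a. ALL x b. ALL v:space V. r x (a * b) v = 0}"

lemma annihilatorD: "a : annihilator ==> v : space V ==> r x a v = 0"
 unfolding annihilator_def using mult.right_neutral[of a] by (metis (mono_tags, lifting) mem_Collect_eq)

lemma annihilatorI: "(!!x b v. v : space V ==> r x (a * b) v = 0) ==> a : annihilator"
 unfolding annihilator_def by blast

lemma annihilator_ideal: "algebra_ideal annihilator"
 by (rule algebra_idealI)
  (auto simp: annihilator_def r_zero_index distrib_right r_add_index mult.assoc)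

lemmas annD = algebra_idealD[OF annihilator_ideal]

lemma annihilator_invariant:
 assumes a: "a : annihilator"
 shows "\<beta> s a : annihilator"
proof (rule annihilatorI)
 fix x b v assume v: "v : space V"
 have "x **C (\<beta> s a * b) = dg s (\<alpha> (- s) x **C (a * \<beta> (- s) b))"
  by (simp add: dg_lemma(2) aa_inv bb)
 then have "r x (\<beta> s a * b) v = r (\<alpha> (- s) x) (a * \<beta> (- s) b) v" by (simp add: Tr_dg)
 then show "r x (\<beta> s a * b) v = 0" using annihilatorD[OF annD(2)[OF a] v] by simp
qed

text \<open>If all \<open>x \<otimes> c a\<^sub>i\<close> with \<open>x\<close> in a basis of \<open>L\<close> act as zero, then \<open>Tr_bracket\<close> and perfectness
  put \<open>c\<close> into the annihilator.  These are finitely many linear conditions with values in a finite-dimensional space.\<close>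

lemma annihilator_finite_codim: "finite_codim UNIV annihilator"
proof -
 obtain N :: nat and a b where ab: "!!s. (\<Sum>i<N. a i * \<beta> s (b i)) = (if s = 0 then 1 else 0)"
  using galois by blast
 obtain D where D: "finite D" "D \<subseteq> space V" "complex_vector.independent D" "cspan D = space V"
  by (rule finite_dimensional_basis[OF fdV sV])
 obtain X :: "'g set" where X: "finite X" "X \<subseteq> UNIV" "complex_vector.independent X" "cspan X = UNIV"
  by (rule finite_dimensional_basis[OF fdL cv_subspace_UNIV])
 define \<phi> where "\<phi> = (%c (x, i, d). if (x, i, d) : X \<times> {..<N} \<times> D then r x (c * a i) d else 0)"
 have "\<phi> (c + c') = \<phi> c + \<phi> c'" "\<phi> (k *C c) = k *C \<phi> c" for c c' k
  using D(2) by (auto simp: \<phi>_def fun_eq_iff distrib_right r_add_index subset_iff scaleC_fun_def scaleC_mult_left)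
 then have lin: "clinear \<phi>" unfolding clinear_iff by simp
 have "\<phi> c : {f. (ALL q. f q : space V) & (ALL q. q ~: X \<times> {..<N} \<times> D --> f q = 0)}" for c
  using D(2) r_in cv_subspace_0[OF sV] by (auto simp: \<phi>_def)
 moreover have "finite_dimensional {f :: 'g \<times> nat \<times> 'v => 'v. (ALL q. f q : space V) & (ALL q. q ~: X \<times> {..<N} \<times> D --> f q = 0)}"
  by (rule finite_dimensional_finite_support[OF _ fdV]) (simp add: X(1) D(1))
 ultimately have "finite_codim UNIV {c. \<phi> c = 0}" by (rule finite_codim_kernel[OF lin])
 moreover have "{c. \<phi> c = 0} \<subseteq> annihilator"
 proof
  fix c assume "c : {c. \<phi> c = 0}"
  then have \<phi>: "\<phi> c q = 0" for q by simp
  have z: "r x (c * a i) v = 0" if i: "i < N" and v: "v : space V" for x i v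
  proof -
   have 1: "r x (c * a i) d = 0" if "x : X" "d : D" for x d using \<phi>[of "(x, i, d)"] that i by (simp add: \<phi>_def)
   have 2: "r x (c * a i) d = 0" if d: "d : D" for x d
   proof -
    have "cspan X \<subseteq> {x. ALL f:{c * a i}. ALL v:{d}. v : space V --> r x f v = 0}"
    by (rule cv_span_minimal[OF _ r_kernel]) (use 1 d in auto)
    then show ?thesis using X(4) d D(2) by auto
   qed
   have "csubspace {v : space V. r x (c * a i) v = 0}"
    unfolding cv_subspace_def using sV
    by (auto simp: r_add r_scale r_0 cv_subspace_def)
   then have "cspan D \<subseteq> {v : space V. r x (c * a i) v = 0}"
    by (intro cv_span_minimal) (use 2 D(2) in auto)
   then show ?thesis using v D(4) by blast
  qed
  show "c : annihilator"
  proof (rule annihilatorI)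
   fix z d v assume v: "v : space V"
   have "z : {z. ALL f:{c * d}. ALL v:{v}. v : space V --> r z f v = 0}"
   proof (rule perfect_induct[OF r_kernel])
    fix i j x y assume xy: "x : grade L i" "y : grade L j"
    have "r (bracket L x y) (c * d) v = (\<Sum>k<N. act V (br (Tr (x **C (c * a k))) (Tr (y **C (b k * d)))) v)"
    unfolding Tr_bracket[where N = N and a = a and b = b and x = x and y = y and c = c and d = d, OF ab]
    proof (rule lin_on_sum[OF smodD(3)[OF mV v] sEE])
    fix k
    show "br (Tr (x **C (c * a k))) (Tr (y **C (b k * d))) : underlying EE"
    unfolding br_Tr_tens by (intro cv_subspace_sum[OF sEE] Tr_in_EE)
    qed
    also have "\<dots> = 0"
    proof (intro sum.neutral ballI)
    fix k assume k: "k : {..<N}"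
    then have k: "k < N" by simp
    have "act V (br (Tr (x **C (c * a k))) (Tr (y **C (b k * d)))) v =
    r x (c * a k) (r y (b k * d) v) - koszul i j *C r y (b k * d) (r x (c * a k) v)"
    using smodD(6)[OF mV Tr_in_grade[OF xy(1)] Tr_in_grade[OF xy(2)] v] unfolding bracket_EE .
    then show "act V (br (Tr (x **C (c * a k))) (Tr (y **C (b k * d)))) v = 0"
    by (simp add: z[OF k] r_in v r_0)
    qed
    finally show "bracket L x y : {z. ALL f:{c * d}. ALL v:{v}. v : space V --> r z f v = 0}" by simp
   qed
   then show "r z (c * d) v = 0" using v by simp
  qed
 qed
 ultimately show ?thesis by (rule finite_codim_mono)
qed

subsection \<open>Ideals of square zero act trivially\<close>

text \<open>The vectors killed by all \<open>x \<otimes> c\<close> with \<open>c \<in> I\<close> form a submodule, because commuting with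
  \<open>y \<otimes> g\<close> multiplies \<open>c\<close> by translates of \<open>g\<close>.  If it is nonzero, it is all of \<open>V\<close>.\<close>

lemma common_kernel:
 assumes I: "algebra_ideal I" and w: "w : space V" "w ~= 0" "!!i x c. x : grade L i ==> c : I ==> r x c w = 0"
 shows "I \<subseteq> annihilator"
proof -
 note ID = algebra_idealD[OF I]
 define W where "W = {v : space V. ALL x. ALL c:I. r x c v = 0}"
 have W_hom: "v : W" if v: "v : space V" "!!i x c. x : grade L i ==> c : I ==> r x c v = 0" for v
 proof -
  have "r z c v = 0" if c: "c : I" for z c
  proof -
   have "z : underlying L" by (simp add: UL)
   then obtain x y where "x : grade L 0" "y : grade L 1" "z = x + y" by (rule total_cases[OF gL])
   then show ?thesis using v c by (simp add: r_add_index)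
  qed
  then show ?thesis using v(1) by (simp add: W_def)
 qed
 have "w : W" using W_hom[OF w(1)] w(3) by blast
 have WV: "W \<subseteq> space V" by (auto simp: W_def)
 have sW: "csubspace W"
  unfolding W_def cv_subspace_def using sV
  by (auto simp: r_add r_scale r_0 cv_subspace_def)
 have W0: "r x c u = 0" if "u : W" "c : I" for x c u using that by (simp add: W_def)
 have "stable (indices EE) (ops V) W"
  unfolding stable_def ball_indices ops_simps
 proof (intro conjI allI ballI sW)
  show "parity_map (mgrade V) ` W \<subseteq> W"
  proof safe
   fix u assume u: "u : W"
   then have uV: "u : space V" using WV by blast
   show "parity_map (mgrade V) u : W"
   proof (rule W_hom)
    show "parity_map (mgrade V) u : space V" by (rule parity_in[OF smodD(1)[OF mV] uV])
    fix i x c assume x: "x : grade L i" and c: "c : I"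
    have "parity_map (mgrade V) 0 = koszul 1 i *C r x c (parity_map (mgrade V) u)"
    using act_parity[OF mV graded_EE Tr_in_grade[OF x] uV, of c] W0[OF u c] by simp
    moreover have "parity_map (mgrade V) 0 = 0" by (rule lin_on_0[OF lin_on_parity[OF smodD(1)[OF mV]] sV])
    moreover have "koszul 1 i ~= 0" by (cases i) simp_all
    ultimately show "r x c (parity_map (mgrade V) u) = 0" by simp
   qed
  qed
  fix j t assume t: "t : grade EE j"
  show "act V t ` W \<subseteq> W"
  proof safe
   fix u assume u: "u : W"
   then have uV: "u : space V" using WV by blast
   have gen: "r y g u : W" if y: "y : grade L j" for y g
   proof (rule W_hom)
    show "r y g u : space V" by (rule r_in[OF uV])
    fix i x c assume x: "x : grade L i" and c: "c : I"
    have "(\<Sum>s\<in>UNIV. r (bracket L x (\<alpha> s y)) (c * \<beta> s g) u) = 0"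
    by (intro sum.neutral ballI W0[OF u] ID(2)[OF c])
    then show "r x c (r y g u) = 0"
    using r_bracket[OF x y uV, of c g] W0[OF u c] by (simp add: r_0)
   qed
   have "cspan {Tr (x **C f) | x f. x : grade L j} \<subseteq> {t : underlying EE. act V t u : W}"
    by (rule cv_span_minimal[OF _ csubspace_preimage[OF smodD(3)[OF mV uV] sEE sW]])
    (use gen Tr_in_EE in blast)
   then show "act V t u : W" using t grade_EE_span by blast
  qed
 qed
 then have "W = {0} \<or> W = space V"
  using irr_famD(4)[of "indices EE" "ops V" "space V" W] V WV unfolding irreducible_iff[OF graded_EE] by blast
 then have "W = space V" using \<open>w : W\<close> w(2) by blast
 show ?thesis
 proof
  fix c assume c: "c : I"
  show "c : annihilator"
   by (rule annihilatorI) (use W0[OF _ ID(2)[OF c]] \<open>W = space V\<close> in blast)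
 qed
qed

text \<open>Here \<open>N0\<close> is the even part of the space of operators given by \<open>I\<close>.  It is commutative on \<open>V\<close>
  and stable under brackets, so it has a common eigenvector, and \<open>common_eigenvalue_of_commutator\<close> makes the eigenvalues of
  commutators vanish; by \<open>Tr_bracket\<close> and perfectness \<open>N0\<close> is spanned by commutators.  On the common kernel of \<open>N0\<close> the odd
  operators anticommute and hence have a common kernel.\<close>

lemma square_zero_ideal:
 assumes I: "algebra_ideal I" and inv: "!!s c. c : I ==> \<beta> s c : I" and sq: "!!c d. c : I ==> d : I ==> c * d : annihilator"
 shows "I \<subseteq> annihilator"
proof -
 obtain N :: nat and a b where ab: "!!s. (\<Sum>i<N. a i * \<beta> s (b i)) = (if s = 0 then 1 else 0)"
  using galois by blast
 note ID = algebra_idealD[OF I]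
 have com: "r x c (r y d v) = koszul i j *C r y d (r x c v)"
  if "x : grade L i" "y : grade L j" "c : I" "d : I" "v : space V" for x i y j c d v
 proof -
  have "(\<Sum>s\<in>UNIV. r (bracket L x (\<alpha> s y)) (c * \<beta> s d) v) = 0"
   by (intro sum.neutral ballI annihilatorD sq inv that)
  then show ?thesis using r_bracket[OF that(1,2,5)] by simp
 qed
 define N0 where "N0 = cspan {Tr (x **C c) | x c. x : grade L 0 & c : I}"
 have N0_gen: "Tr (x **C c) : N0" if "x : grade L 0" "c : I" for x c
  unfolding N0_def using that by (intro cv_span_base) blast
 have sN0: "csubspace N0" by (simp add: N0_def)
 have N0_ind: "t : A" if "t : N0" "csubspace A" "!!x c. x : grade L 0 ==> c : I ==> Tr (x **C c) : A" for t A
 proof -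
  have "N0 \<subseteq> A" unfolding N0_def by (rule cv_span_minimal[OF _ that(2)]) (use that(3) in blast)
  with that(1) show ?thesis by blast
 qed
 have N0_EE: "t : grade EE 0" if "t : N0" for t
  by (rule N0_ind[OF that graded_subspace[OF graded_EE] Tr_in_grade])
 have N0_und: "t : underlying EE" if "t : N0" for t
  by (rule in_total[OF graded_EE N0_EE[OF that]])
 have N0_br: "br t (Tr (y **C g)) : N0" if "t : N0" "y : grade L 0" for t y g
 proof -
  have "t : {t. br t (Tr (y **C g)) : N0}"
  proof (rule N0_ind[OF that(1)])
   show "csubspace {t. br t (Tr (y **C g)) : N0}"
    by (rule cv_linear_preimage[OF br_linear(2) sN0])
   show "Tr (x **C c) : {t. br t (Tr (y **C g)) : N0}" if "x : grade L 0" "c : I" for x c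
    unfolding mem_Collect_eq br_Tr_tens
    using graded_algebraD(2)[OF gaL that(1) aa(2)[OF \<open>y : grade L 0\<close>]]
    by (intro cv_subspace_sum[OF sN0] N0_gen ID(2)[OF that(2)]) simp
  qed
  then show ?thesis by simp
 qed
 have lin: "linear_on (space V) (act V t)" "!!v. v : space V ==> act V t v : space V" if "t : N0" for t
  using smodD(4)[OF mV N0_und[OF that]] act_in[OF mV graded_EE N0_und[OF that]] by blast+
 have ker: "csubspace {t. t : underlying EE & act V t v = 0}" if "v : space V" for v
  by (rule csubspace_kernel[OF smodD(3)[OF mV that] sEE])
 have com0: "act V t (act V u v) = act V u (act V t v)" if "t : N0" "u : N0" "v : space V" for t u v
 proof -
  have 1: "br t u : {w. w : underlying EE & act V w v = 0}" if t: "t : N0" and u: "EX y d. y : grade L 0 & d : I & u = Tr (y **C d)" for t u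
  proof -
   obtain y d where y: "y : grade L 0" "d : I" "u = Tr (y **C d)" using u by blast
   have "t : {t. br t u : {w. w : underlying EE & act V w v = 0}}"
   proof (rule N0_ind[OF t])
    show "csubspace {t. br t u : {w. w : underlying EE & act V w v = 0}}"
    by (rule cv_linear_preimage[OF br_linear(2) ker[OF \<open>v : space V\<close>]])
    show "Tr (x **C c) : {t. br t u : {w. w : underlying EE & act V w v = 0}}" if "x : grade L 0" "c : I" for x c
    proof -
    have "br (Tr (x **C c)) u : {w. w : underlying EE & act V w v = 0}"
    unfolding y(3) br_Tr_tens
    proof (rule cv_subspace_sum[OF ker[OF \<open>v : space V\<close>]])
    fix s
    have "c * \<beta> s d : annihilator" by (rule sq[OF that(2) inv[OF y(2)]])
    then show "Tr (bracket L x (\<alpha> s y) **C (c * \<beta> s d)) : {w. w : underlying EE & act V w v = 0}"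
    using Tr_in_EE annihilatorD[OF _ \<open>v : space V\<close>] by simp
    qed
    then show ?thesis by (rule CollectI)
    qed
   qed
   then show ?thesis by simp
  qed
  have "u : {u. br t u : {w. w : underlying EE & act V w v = 0}}"
  proof (rule N0_ind[OF \<open>u : N0\<close>])
   show "csubspace {u. br t u : {w. w : underlying EE & act V w v = 0}}"
    by (rule cv_linear_preimage[OF br_linear(1) ker[OF \<open>v : space V\<close>]])
   show "Tr (x **C c) : {u. br t u : {w. w : underlying EE & act V w v = 0}}" if "x : grade L 0" "c : I" for x c
    using 1[OF \<open>t : N0\<close>, of "Tr (x **C c)"] that by blast
  qed
  then have "act V (br t u) v = 0" by simp
  then show ?thesis
   using smodD(6)[OF mV N0_EE[OF that(1)] N0_EE[OF that(2)] that(3)] unfolding bracket_EE by (simp add: scaleC_one)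
 qed
 have V0: "space V ~= {0}" using V unfolding irreducible_supermodule_def by blast
 have "operators N0 (act V) (space V)" unfolding operators_def using lin sV by blast
 then obtain v where v: "v : space V" "v ~= 0" "ALL t:N0. EX c. act V t v = c *C v"
  by (rule commuting_common_eigenvector[of N0 "act V" "space V", OF _ fdV V0 com0])
 then have "ALL t. EX c. t : N0 --> act V t v = c *C v" by blast
 from choice[OF this] obtain ev where ev: "!!t. t : N0 ==> act V t v = ev t *C v" by blast
 have br0: "act V (br t (Tr (y **C g))) v = 0" if t: "t : N0" and y: "y : grade L 0" for t y g
 proof -
  have "ev (br t (Tr (y **C g))) = 0"
  proof (rule common_eigenvalue_of_commutator[of "space V" "r y g" N0 "act V" "%t. br t (Tr (y **C g))" v ev t])
   fix t v assume tv: "t : N0" "v : space V"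
   show "act V t (r y g v) = r y g (act V t v) + act V (br t (Tr (y **C g))) v"
    using smodD(6)[OF mV N0_EE[OF tv(1)] Tr_in_grade[OF y] tv(2)] unfolding bracket_EE by (simp add: scaleC_one)
  next
   show "!!v. v : space V ==> r y g v : space V" by (rule r_in)
   show "!!t. t : N0 ==> br t (Tr (y **C g)) : N0" by (rule N0_br[OF _ y])
  qed (simp_all only: fdV sV r_linear lin v(1,2) ev t not_False_eq_True)
  then show ?thesis using ev[OF N0_br[OF t y]] by simp
 qed
 have ev0: "r z c v = 0" if z: "z : grade L 0" and c: "c : I" for z c
 proof -
  have "cspan {bracket L x y | x y. x : grade L 0 & y : grade L 0} \<subseteq> {z. ALL f:{c}. ALL w:{v}. w : space V --> r z f w = 0}"
  proof (rule cv_span_minimal[OF _ r_kernel], safe)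
   fix x y assume xy: "x : grade L 0" "y : grade L 0"
   note g = N0_gen[OF xy(1) ID(2)[OF c]]
   have "r (bracket L x y) (c * 1) v = (\<Sum>k<N. act V (br (Tr (x **C (c * a k))) (Tr (y **C (b k * 1)))) v)"
    unfolding Tr_bracket[where N = N and a = a and b = b and x = x and y = y and c = c and d = 1, OF ab]
    by (rule lin_on_sum[OF smodD(3)[OF mV v(1)] sEE]) (rule N0_und[OF N0_br[OF g xy(2)]])
   also have "\<dots> = 0" by (intro sum.neutral ballI br0[OF g xy(2)])
   finally show "r (bracket L x y) c v = 0" by simp
  qed
  then show ?thesis using z perfect0 v(1) by blast
 qed
 define W0 where "W0 = {v : space V. ALL x:grade L 0. ALL c:I. r x c v = 0}"
 define N1 where "N1 = {(x, c). x : grade L 1 & c : I}"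
 have "csubspace W0"
  unfolding W0_def cv_subspace_def using sV
  by (auto simp: r_add r_scale r_0 cv_subspace_def)
 moreover have "linear_on W0 (r x c)" for x c
  using r_linear[of x c] unfolding linear_on_def W0_def by blast
 moreover have "r x c u : W0" if "x : grade L 1" "c : I" "u : W0" for x c u
  using that com[of _ 0 x 1 _ c u] unfolding W0_def by (simp add: r_in r_0)
 ultimately have "operators N1 (%(x, c). r x c) W0" unfolding operators_def N1_def by auto
 moreover have "finite_dimensional W0" by (rule finite_dimensional_subset[OF fdV]) (simp add: W0_def)
 moreover have "W0 ~= {0}" using v(1,2) ev0 by (auto simp: W0_def)
 moreover have "(case p of (x, c) => r x c) ((case q of (y, d) => r y d) u) = - (case q of (y, d) => r y d) ((case p of (x, c) => r x c) u)"
  if pq: "p : N1" "q : N1" and u: "u : W0" for p q u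
 proof -
  obtain x c y d where "p = (x, c)" "q = (y, d)" by (cases p, cases q)
  then show ?thesis using pq u com[of x 1 y 1 c d u] by (simp add: N1_def W0_def scaleC_one)
 qed
 ultimately obtain w where w: "w : W0" "w ~= 0" "ALL p:N1. (case p of (x, c) => r x c) w = 0"
  by (rule anticommuting_common_kernel[of N1 "%(x, c). r x c" W0])
 have "r x c w = 0" if "x : grade L i" "c : I" for i x c
  using w(1,3) that by (cases i) (auto simp: W0_def N1_def)
 moreover have "w : space V" using w(1) by (simp add: W0_def)
 ultimately show ?thesis using common_kernel[OF I _ w(2)] by blast
qed

text \<open>If \<open>a\<^sup>2\<close> annihilates but \<open>a\<close> does not, choose a largest product of translates of \<open>a\<close>
  that does not annihilate.  The translates of this product generate an invariant ideal of square zero.\<close>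

lemma annihilator_semiprime:
 assumes sq: "a * a : annihilator"
 shows "a : annihilator"
proof (rule ccontr)
 assume a: "a ~: annihilator"
 define P where "P = (%S. \<Prod>s\<in>S. \<beta> s a)"
 have PP: "\<beta> t (P S) = P ((+) t ` S)" for t S
 proof -
  have "\<beta> t (P S) = (\<Prod>s\<in>S. \<beta> t (\<beta> s a))"
   unfolding P_def by (induction S rule: infinite_finite_induct) (simp_all add: bb)
  also have "\<dots> = P ((+) t ` S)" unfolding P_def by (subst prod.reindex) (simp_all add: bb(5))
  finally show ?thesis .
 qed
 let ?C = "{S. S ~= {} & P S ~: annihilator}"
 have "{0} : ?C" using a by (simp add: P_def bb(4))
 then have ne: "?C ~= {}" by blast
 obtain S where S: "S : ?C" "!!S'. S' : ?C ==> card S' \<le> card S"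
 proof -
  have "finite (card ` ?C)" by simp
  then have "Max (card ` ?C) : card ` ?C" using ne by (intro Max_in) auto
  then obtain S where "Max (card ` ?C) = card S" "S : ?C" by (rule imageE)
  then show ?thesis using that[of S] Max_ge[OF \<open>finite (card ` ?C)\<close>, OF imageI] by simp
 qed
 have prod: "P A * P B : annihilator" if A: "card A = card S" and B: "card B = card S" for A B
 proof (cases "A = B")
  case True
  have "A ~= {}" using A S(1) card_0_eq[of S] by auto
  then obtain s where s: "s : A" by blast
  have "P A = \<beta> s a * P (A - {s})" unfolding P_def by (rule prod.remove[OF _ s]) simp
  then have "P A * P B = \<beta> s (a * a) * (P (A - {s}) * P (A - {s}))" using True by (simp add: bb(2) mult_ac)
  then show ?thesis using annD(2)[OF annihilator_invariant[OF sq]] by simp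
 next
  case False
  have "card S < card (A \<union> B)"
  proof (rule ccontr)
   assume "\<not> card S < card (A \<union> B)"
   then have "A = A \<union> B" "B = A \<union> B" using A B by (intro card_seteq; simp)+
   with False show False by simp
  qed
  then have "A \<union> B ~: ?C" using S(2)[of "A \<union> B"] by auto
  moreover have "A \<union> B ~= {}" using \<open>card S < card (A \<union> B)\<close> by auto
  ultimately have "P (A \<union> B) : annihilator" by blast
  moreover have "P A * P B = P (A \<union> B) * P (A \<inter> B)" unfolding P_def by (rule prod.union_inter[symmetric]) simp_all
  ultimately show ?thesis using annD(2) by simp
 qed
 let ?f = "P S"
 let ?G = "{\<beta> t ?f * c | t c. True} \<union> annihilator"
 have ideal: "algebra_ideal (cspan ?G)"
  unfolding algebra_ideal_def
 proof (intro conjI ballI allI)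
  fix x b assume x: "x : cspan ?G"
  have "csubspace {x. x * b : cspan ?G}"
   unfolding cv_subspace_def
   by (simp add: cv_span_zero cv_span_add cv_span_scale distrib_right scaleC_mult_left)
  moreover have "?G \<subseteq> {x. x * b : cspan ?G}"
  proof
   fix x assume "x : ?G"
   then have "x * b : ?G" using annD(2) mult.assoc by blast
   then show "x : {x. x * b : cspan ?G}" by (simp only: mem_Collect_eq cv_span_base)
  qed
  ultimately have "cspan ?G \<subseteq> {x. x * b : cspan ?G}" by (intro cv_span_minimal)
  with x show "x * b : cspan ?G" by blast
 qed simp
 have inv: "\<beta> s x : cspan ?G" if "x : cspan ?G" for s x
 proof -
  have "csubspace {x. \<beta> s x : cspan ?G}"
   by (rule cv_linear_preimage[OF bb(1)]) simp
  moreover have "?G \<subseteq> {x. \<beta> s x : cspan ?G}"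
  proof
   fix x assume "x : ?G"
   moreover have "\<beta> s (\<beta> t ?f * c) = \<beta> (s + t) ?f * \<beta> s c" for t c by (simp add: bb)
   ultimately have "\<beta> s x : ?G" using annihilator_invariant by blast
   then show "x : {x. \<beta> s x : cspan ?G}" by (simp only: mem_Collect_eq cv_span_base)
  qed
  ultimately have "cspan ?G \<subseteq> {x. \<beta> s x : cspan ?G}" by (intro cv_span_minimal)
  with that show ?thesis by blast
 qed
 have sub: "csubspace {x. x * g : annihilator}" for g
  unfolding cv_subspace_def
  by (simp add: annD(4,5,8) distrib_right scaleC_mult_left)
 have gg: "x * y : annihilator" if xy: "x : ?G" "y : ?G" for x y
 proof -
  have "\<beta> t ?f * c * (\<beta> u ?f * d) : annihilator" for t c u d
  proof -
   have "\<beta> t ?f * c * (\<beta> u ?f * d) = (P ((+) t ` S) * P ((+) u ` S)) * (c * d)" by (simp add: PP mult_ac)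
   moreover have "P ((+) t ` S) * P ((+) u ` S) : annihilator" by (rule prod) (simp_all add: card_image)
   ultimately show ?thesis using annD(2) by simp
  qed
  then show ?thesis using xy annD(2,3) by blast
 qed
 have g2: "x * y : annihilator" if "x : cspan ?G" "y : ?G" for x y
 proof -
  have "cspan ?G \<subseteq> {x. x * y : annihilator}"
   by (rule cv_span_minimal[OF _ sub]) (use gg that(2) in blast)
  with that(1) show ?thesis by blast
 qed
 have g3: "x * y : annihilator" if "x : cspan ?G" "y : cspan ?G" for x y
 proof -
  have "cspan ?G \<subseteq> {y. y * x : annihilator}"
  proof (rule cv_span_minimal[OF _ sub], rule subsetI)
   fix y assume "y : ?G"
   then have "x * y : annihilator" by (rule g2[OF that(1)])
   then show "y : {y. y * x : annihilator}" by (simp only: mem_Collect_eq mult.commute)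
  qed
  then have "y * x : annihilator" using that(2) by blast
  then show ?thesis by (simp only: mult.commute)
 qed
 have "cspan ?G \<subseteq> annihilator" by (rule square_zero_ideal[OF ideal inv g3])
 moreover have "?f : cspan ?G"
 proof (rule cv_span_base)
  have "?f = \<beta> 0 ?f * 1" by (simp add: bb(4))
  then show "?f : ?G" by blast
 qed
 ultimately show False using S(1) by blast
qed

definition supp :: "'a set set" where
 "supp = {m. character_ideal m & annihilator \<subseteq> m}"

lemma finite_supp: "finite supp"
 unfolding supp_def by (rule finite_codim_finitely_many_characters[OF annihilator_ideal annihilator_finite_codim])

lemma annihilator_eq: "a : annihilator \<longleftrightarrow> (ALL m:supp. a : m)"
proof
 assume "ALL m:supp. a : m"
 then show "a : annihilator"
  using semiprime_separation[OF annihilator_ideal annihilator_finite_codim annihilator_semiprime, of a]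
  unfolding supp_def by blast
qed (auto simp: supp_def)

lemma supp_invariant: "m : supp ==> \<beta> s ` m : supp"
 unfolding supp_def using b_image_character(1)[OF beta] annihilator_invariant[of _ "- s"] b_image_mem[OF beta]
 by blast

end

section \<open>Local constituents\<close>

context equivariant
begin

text \<open>The finite set \<open>Z\<close> is existentially quantified so that the notion refers to \<open>V\<close> alone and is therefore
  preserved by isomorphisms and comparable between modules with different supports.\<close>

definition occ :: "(('g, 'a) tensor, 'v::complex_vector) supermodule => 'a set => ('g, 'w::complex_vector) supermodule => bool" where
 "occ V m \<rho> \<longleftrightarrow> (EX Z f. finite Z & Z \<subseteq> MaxSpec & linear_on (space \<rho>) f & f ` space \<rho> \<subseteq> space V & (EX v:space \<rho>. f v ~= 0) &
   (ALL x a. (ALL z:Z - {m}. a : z) --> (ALL v:space \<rho>. f (eval_at m a *C act \<rho> x v) = act V (Tr (x **C a)) (f v))))"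

lemma occI:
 assumes "finite Z" "Z \<subseteq> MaxSpec" "linear_on (space \<rho>) f" "!!v. v : space \<rho> ==> f v : space V" "u : space \<rho>" "f u ~= 0"
  "!!x a v. ALL z:Z - {m}. a : z ==> v : space \<rho> ==> f (eval_at m a *C act \<rho> x v) = act V (Tr (x **C a)) (f v)"
 shows "occ V m \<rho>"
 unfolding occ_def
 by (rule exI[of _ Z], rule exI[of _ f], intro conjI assms(1-3) image_subsetI assms(4) bexI[OF _ assms(5)] assms(6))
  (assumption, intro allI impI ballI, rule assms(7))

lemma occE:
 assumes "occ V m \<rho>"
 obtains Z f u where "finite Z" "Z \<subseteq> MaxSpec" "linear_on (space \<rho>) f" "f ` space \<rho> \<subseteq> space V" "u : space \<rho>" "f u ~= 0"
  "ALL x a. (ALL z:Z - {m}. a : z) --> (ALL v:space \<rho>. f (eval_at m a *C act \<rho> x v) = act V (Tr (x **C a)) (f v))"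
 using assms unfolding occ_def by (elim exE conjE bexE) (rule that; assumption)

lemma point: "m : (MaxSpec :: 'a set set) ==> character_ideal m"
 by (rule Nullstellensatz[OF fg])

lemma dual:
 assumes "finite Z" "Z \<subseteq> MaxSpec" "m : (MaxSpec :: 'a set set)"
 obtains e where "eval_at m e = 1" "ALL z:Z - {m}. e : z"
proof -
 have Z: "!!z. z : Z ==> character_ideal z" using assms(2) point by blast
 obtain e where e: "eval_at m e = 1" "ALL z:Z. z ~= m --> eval_at z e = 0"
  by (rule dual_element[OF assms(1) Z point[OF assms(3)]])
 have "ALL z:Z - {m}. e : z" using e(2) by (auto simp: eval_at_zero_iff[OF Z, symmetric])
 with e(1) show ?thesis by (rule that)
qed

lemma occ_hom:
 assumes o: "occ V m \<rho>" and g: "mhom_on EE V W g" "inj_on g (space V)" and V: "csubspace (space V)"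
 shows "occ W m \<rho>"
proof -
 obtain Z f u where f: "finite Z" "Z \<subseteq> MaxSpec" "linear_on (space \<rho>) f" "f ` space \<rho> \<subseteq> space V" "u : space \<rho>" "f u ~= 0"
  "ALL x a. (ALL z:Z - {m}. a : z) --> (ALL v:space \<rho>. f (eval_at m a *C act \<rho> x v) = act V (Tr (x **C a)) (f v))"
  by (rule occE[OF o])
 have fV: "f v : space V" if "v : space \<rho>" for v using f(4) that by blast
 show ?thesis
 proof (rule occI[of Z \<rho> "%v. g (f v)" W u, OF f(1,2) _ _ f(5)])
  show "linear_on (space \<rho>) (%v. g (f v))" by (rule lin_on_compose[OF f(3) fV mhomD(1)[OF g(1)]])
  show "g (f v) : space W" if "v : space \<rho>" for v by (rule mhomD(2)[OF g(1) fV[OF that]])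
  show "g (f u) ~= 0" by (rule inj_on_nonzero[OF g(2) mhomD(1)[OF g(1)] V fV[OF f(5)] f(6)])
  fix x a v assume a: "ALL z:Z - {m}. a : z" and v: "v : space \<rho>"
  have "f (eval_at m a *C act \<rho> x v) = act V (Tr (x **C a)) (f v)"
   by (rule f(7)[THEN spec, THEN spec, THEN mp, THEN bspec, OF a v])
  then show "g (f (eval_at m a *C act \<rho> x v)) = act W (Tr (x **C a)) (g (f v))"
   by (simp add: mhomD(3)[OF g(1) Tr_in_EE fV[OF v]])
 qed
qed

lemma occ_iso:
 assumes "module_iso EE V W" "csubspace (space V)" "occ V m \<rho>"
 shows "occ W m \<rho>"
 using assms(1) occ_hom[OF assms(3) _ _ assms(2)] unfolding module_iso_iff bij_betw_def by blast

lemma occ_comp: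
 assumes o: "occ V m \<rho>" and \<sigma>: "is_supermodule L \<sigma>" and g: "mhom_on L \<sigma> \<rho> g" and s: "space \<rho> \<subseteq> g ` space \<sigma>"
 shows "occ V m \<sigma>"
proof -
 obtain Z f u where f: "finite Z" "Z \<subseteq> MaxSpec" "linear_on (space \<rho>) f" "f ` space \<rho> \<subseteq> space V" "u : space \<rho>" "f u ~= 0"
  "ALL x a. (ALL z:Z - {m}. a : z) --> (ALL v:space \<rho>. f (eval_at m a *C act \<rho> x v) = act V (Tr (x **C a)) (f v))"
  by (rule occE[OF o])
 obtain w where w: "w : space \<sigma>" "u = g w" using s f(5) by blast
 show ?thesis
 proof (rule occI[of Z \<sigma> "%v. f (g v)" V w, OF f(1,2) _ _ w(1)])
  show "linear_on (space \<sigma>) (%v. f (g v))" by (rule lin_on_compose[OF mhomD(1,2)[OF g] f(3)])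
  show "f (g v) : space V" if "v : space \<sigma>" for v using f(4) mhomD(2)[OF g that] by blast
  show "f (g w) ~= 0" using f(6) w(2) by simp
  fix x a v assume a: "ALL z:Z - {m}. a : z" and v: "v : space \<sigma>"
  have x: "x : underlying L" by (simp add: UL)
  have "g (eval_at m a *C act \<sigma> x v) = eval_at m a *C act \<rho> x (g v)"
   by (simp only: lin_on_scale[OF mhomD(1)[OF g] act_in[OF \<sigma> gL x v]] mhomD(3)[OF g x v])
  moreover have "f (eval_at m a *C act \<rho> x (g v)) = act V (Tr (x **C a)) (f (g v))"
   by (rule f(7)[THEN spec, THEN spec, THEN mp, THEN bspec, OF a mhomD(2)[OF g v]])
  ultimately show "f (g (eval_at m a *C act \<sigma> x v)) = act V (Tr (x **C a)) (f (g v))" by simp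
 qed
qed

lemma occ_iso_right:
 assumes "module_iso L \<sigma> \<rho>" "is_supermodule L \<sigma>" "occ V m \<rho>"
 shows "occ V m \<sigma>"
 using assms(1) occ_comp[OF assms(3,2)] unfolding module_iso_iff bij_betw_def by blast

lemma alpha_hom: "superalgebra_hom L L (\<alpha> s)"
 by (rule superalgebra_homI) (simp_all add: aa_lin aa(2,3))

lemma alpha_irreps: "M : irreps L ==> pullback (\<alpha> s) M : irreps L"
proof -
 assume M: "M : irreps L"
 have "grade L i \<subseteq> \<alpha> s ` grade L i" for i
 proof
  fix x assume "x : grade L i"
  then have "\<alpha> (- s) x : grade L i" by (rule aa(2))
  then show "x : \<alpha> s ` grade L i" using aa_inv(1) by (metis imageI)
 qed
 then have "irreducible_supermodule L (pullback (\<alpha> s) M)"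
  by (rule pullback_irreducible[OF irrepsD(1)[OF M] alpha_hom gL gL])
 then show ?thesis using irrepsD(2)[OF M] by (simp add: irreps_def)
qed

lemma pullback_alpha: "pullback (\<alpha> (- s)) (pullback (\<alpha> s) M) = M" "pullback (\<alpha> s) (pullback (\<alpha> (- s)) M) = M"
 by (simp_all add: pullback_def aa_inv)

text \<open>The traces of \<open>\<alpha> s x \<otimes> \<beta> s a\<close> and \<open>x \<otimes> a\<close> coincide, so the same linear map serves at both points.\<close>

lemma occ_twist:
 assumes o: "occ V (\<beta> s ` m) \<rho>" and m: "m : MaxSpec"
 shows "occ V m (pullback (\<alpha> s) \<rho>)"
proof -
 let ?n = "\<beta> s ` m"
 obtain Z f u where f: "finite Z" "Z \<subseteq> MaxSpec" "linear_on (space \<rho>) f" "f ` space \<rho> \<subseteq> space V" "u : space \<rho>" "f u ~= 0"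
  "ALL x a. (ALL z:Z - {?n}. a : z) --> (ALL v:space \<rho>. f (eval_at ?n a *C act \<rho> x v) = act V (Tr (x **C a)) (f v))"
  by (rule occE[OF o])
 show ?thesis
 proof (rule occI[of "(%z. \<beta> (- s) ` z) ` Z" "pullback (\<alpha> s) \<rho>" f V u])
  show "(%z. \<beta> (- s) ` z) ` Z \<subseteq> MaxSpec" using f(2) b_image_MaxSpec[OF beta] by blast
  fix x a v assume a: "ALL z:(%z. \<beta> (- s) ` z) ` Z - {m}. a : z" and "v : space (pullback (\<alpha> s) \<rho>)"
  then have v: "v : space \<rho>" by simp
  have "\<beta> s a : z" if z: "z : Z - {?n}" for z
  proof -
   have "\<beta> (- s) ` z ~= m"
   proof
    assume "\<beta> (- s) ` z = m"
    then have "?n = \<beta> s ` \<beta> (- s) ` z" by simp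
    also have "\<dots> = z" unfolding b_image_image[OF beta] by (simp add: bb(4))
    finally show False using z by blast
   qed
   then have "a : \<beta> (- s) ` z" using a z by blast
   then show ?thesis unfolding b_image_mem[OF beta] by simp
  qed
  then have "ALL z:Z - {?n}. \<beta> s a : z" by (rule ballI)
  note f(7)[THEN spec, THEN spec, THEN mp, THEN bspec, OF this v, of "\<alpha> s x"]
  moreover have "eval_at ?n (\<beta> s a) = eval_at m a" by (simp add: b_image_character(2)[OF beta point[OF m]] bb)
  moreover have "Tr (\<alpha> s x **C \<beta> s a) = Tr (x **C a)" using Tr_dg[of s "x **C a"] by (simp add: dg_lemma(2))
  ultimately show "f (eval_at m a *C act (pullback (\<alpha> s) \<rho>) x v) = act V (Tr (x **C a)) (f v)" by simp
 qed (use f in auto)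
qed

lemma occ_twist_iff: "m : MaxSpec ==> occ V (\<beta> s ` m) (pullback (\<alpha> (- s)) \<rho>) \<longleftrightarrow> occ V m \<rho>"
proof
 assume m: "m : MaxSpec"
 show "occ V m \<rho>" if "occ V (\<beta> s ` m) (pullback (\<alpha> (- s)) \<rho>)"
  using occ_twist[OF that m] unfolding pullback_alpha .
 have e: "\<beta> (- s) ` \<beta> s ` m = m" unfolding b_image_image[OF beta] by (simp add: bb(4))
 show "occ V (\<beta> s ` m) (pullback (\<alpha> (- s)) \<rho>)" if "occ V m \<rho>"
  by (rule occ_twist[OF _ b_image_MaxSpec[OF beta m]]) (use that e in simp)
qed

end

context equivariant_module
begin

lemma supp_MaxSpec: "supp \<subseteq> MaxSpec"
 using character_ideal_MaxSpec by (auto simp: supp_def)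

lemma mod_annihilator:
 assumes "ALL z:supp. eval_at z a = eval_at z b" and v: "v : space V"
 shows "r x a v = r x b v"
proof -
 have "a - b : z" if z: "z : supp" for z
 proof -
  have c: "character_ideal z" using z by (simp add: supp_def)
  have "eval_at z (a - b) = 0" using assms(1) z by (simp add: cv_linear_diff[OF linear_eval_at[OF c]])
  then show ?thesis by (simp add: eval_at_zero_iff[OF c])
 qed
 then have "a - b : annihilator" using annihilator_eq by blast
 then have "r x (b + (a - b)) v = r x b v" using annihilatorD[OF _ v] by (simp only: r_add_index[OF v] add_0_right)
 then show ?thesis by simp
qed

definition idem :: "'a set => 'a" where
 "idem m = (SOME e. eval_at m e = 1 & (ALL z:supp - {m}. e : z))"

lemma idem:
 assumes "m : MaxSpec"
 shows "eval_at m (idem m) = 1" "!!z. z : supp ==> eval_at z (idem m) = (if z = m then 1 else 0)"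
proof -
 obtain e where "eval_at m e = 1" "ALL z:supp - {m}. e : z" by (rule dual[OF finite_supp supp_MaxSpec assms])
 then have "eval_at m e = 1 & (ALL z:supp - {m}. e : z)" by (rule conjI)
 then have i: "eval_at m (idem m) = 1 & (ALL z:supp - {m}. idem m : z)" unfolding idem_def by (rule someI)
 then show "eval_at m (idem m) = 1" by blast
 show "eval_at z (idem m) = (if z = m then 1 else 0)" if "z : supp" for z
  using i that eval_at_zero_iff[of z "idem m"] by (auto simp: supp_def)
qed

lemma local_function:
 assumes m: "m : MaxSpec" and a: "ALL z:supp - {m}. a : z" and v: "v : space V"
 shows "r x a v = eval_at m a *C r x (idem m) v"
proof -
 have "r x a v = r x (eval_at m a *C idem m) v"
 proof (rule mod_annihilator[OF _ v], rule ballI)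
  fix z assume z: "z : supp"
  then have c: "character_ideal z" by (simp add: supp_def)
  show "eval_at z a = eval_at z (eval_at m a *C idem m)"
   using a z by (auto simp: eval_at_scale[OF c] idem(2)[OF m z] eval_at_zero_iff[OF c])
 qed
 then show ?thesis by (simp add: r_add_index[OF v])
qed

text \<open>The localisation of \<open>V\<close> at \<open>m\<close>: the Lie superalgebra \<open>L\<close> acts through a function that is \<open>1\<close> at \<open>m\<close> and
  \<open>0\<close> at the other points of the support.\<close>

definition loc :: "'a set => ('g, 'v) supermodule" where
 "loc m = \<lparr>mgrade = mgrade V, act = (%x. r x (idem m))\<rparr>"

lemma loc_simps [simp]: "mgrade (loc m) = mgrade V" "act (loc m) x = r x (idem m)"
 by (simp_all add: loc_def)

text \<open>In the bracket of two traces the terms with \<open>s \<noteq> 0\<close> contain the product of \<open>idem m\<close> with one of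
  its translates, which vanishes on the support since the action is free.\<close>

lemma loc_supermodule:
 assumes m: "m : MaxSpec"
 shows "is_supermodule L (loc m)"
 unfolding is_supermodule_def bilinear_on_def loc_simps
proof (intro conjI ballI allI)
 show "graded_space (mgrade V)" by (rule smodD(1)[OF mV])
 show "linear_on (underlying L) (%x. r x (idem m) v)" if "v : space V" for v
  unfolding linear_on_def by (simp add: r_add_index[OF that])
 show "linear_on (space V) (r x (idem m))" for x by (rule r_linear)
 show "r x (idem m) v : mgrade V (i + j)" if "x : grade L i" "v : mgrade V j" for i j x v
  by (rule smodD(5)[OF mV Tr_in_grade[OF that(1)] that(2)])
 show "r (bracket L x y) (idem m) v = r x (idem m) (r y (idem m) v) - koszul i j *C r y (idem m) (r x (idem m) v)"
  if x: "x : grade L i" and y: "y : grade L j" and v: "v : space V" for i j x y v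
 proof -
  have "r (bracket L x (\<alpha> s y)) (idem m * \<beta> s (idem m)) v = (if s = 0 then r (bracket L x y) (idem m) v else 0)" for s
  proof -
   have "r (bracket L x (\<alpha> s y)) (idem m * \<beta> s (idem m)) v = r (bracket L x (\<alpha> s y)) (if s = 0 then idem m else 0) v"
   proof (rule mod_annihilator[OF _ v], rule ballI)
    fix z assume z: "z : supp"
    then have c: "character_ideal z" by (simp add: supp_def)
    have s: "eval_at z (\<beta> s (idem m)) = (if \<beta> (- s) ` z = m then 1 else 0)"
    using b_image_character(2)[OF beta c, of "- s" "idem m"] idem(2)[OF m supp_invariant[OF z, of "- s"]] by simp
    have "\<not> (z = m & \<beta> (- s) ` z = m)" if "s ~= 0" using free[OF m, of "- s"] that by auto
    then show "eval_at z (idem m * \<beta> s (idem m)) = eval_at z (if s = 0 then idem m else 0)"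
    using idem(2)[OF m z] cv_linear_0[OF linear_eval_at[OF c]]
    by (cases "s = 0") (auto simp: eval_at_mult[OF c] s bb(4))
   qed
   then show ?thesis by (simp add: aa(4) tens_zero r_zero_index[OF v])
  qed
  then show ?thesis using r_bracket[OF x y v, of "idem m" "idem m"] by simp
 qed
qed

lemma occ_iff:
 assumes m: "m : MaxSpec" and \<rho>: "is_supermodule L \<rho>"
 shows "occ V m \<rho> \<longleftrightarrow> occurs L \<rho> (loc m)"
proof
 assume "occurs L \<rho> (loc m)"
 then obtain f u where f: "mhom_on L \<rho> (loc m) f" "u : space \<rho>" "f u ~= 0" unfolding occurs_def by blast
 note f' = mhomD[OF f(1), unfolded loc_simps]
 show "occ V m \<rho>"
 proof (rule occI[OF finite_supp supp_MaxSpec f'(1,2) f(2,3)])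
  fix x a v assume a: "ALL z:supp - {m}. a : z" and v: "v : space \<rho>"
  have x: "x : underlying L" by (simp add: UL)
  show "f (eval_at m a *C act \<rho> x v) = r x a (f v)"
   unfolding local_function[OF m a f'(2)[OF v]] lin_on_scale[OF f'(1) act_in[OF \<rho> gL x v]] f'(3)[OF x v] ..
 qed
next
 assume o: "occ V m \<rho>"
 obtain Z f u where f: "finite Z" "Z \<subseteq> MaxSpec" "linear_on (space \<rho>) f" "f ` space \<rho> \<subseteq> space V" "u : space \<rho>" "f u ~= 0"
  "ALL x a. (ALL z:Z - {m}. a : z) --> (ALL v:space \<rho>. f (eval_at m a *C act \<rho> x v) = r x a (f v))"
  by (rule occE[OF o])
 obtain e where e: "eval_at m e = 1" "ALL z:(Z \<union> supp) - {m}. e : z"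
  by (rule dual[of "Z \<union> supp" m]) (use f(1,2) finite_supp supp_MaxSpec m in auto)
 have "f (act \<rho> x v) = r x (idem m) (f v)" if v: "v : space \<rho>" for x v
 proof -
  have fv: "f v : space V" using f(4) v by blast
  have "ALL z:Z - {m}. e : z" using e(2) by blast
  then have "f (eval_at m e *C act \<rho> x v) = r x e (f v)"
   by (rule f(7)[THEN spec, THEN spec, THEN mp, THEN bspec, OF _ v])
  also have "\<dots> = eval_at m e *C r x (idem m) (f v)" by (rule local_function[OF m _ fv]) (use e(2) in blast)
  finally show ?thesis by (simp add: e(1) scaleC_one)
 qed
 then have "mhom_on L \<rho> (loc m) f" unfolding mhom_on_def using f(3,4) by simp
 then show "occurs L \<rho> (loc m)" unfolding occurs_def using f(5,6) by blast
qed

lemma space_nonzero: "space V ~= {0}"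
 using V unfolding irreducible_supermodule_def by blast

lemma occ_exists:
 assumes m: "m : MaxSpec"
 obtains \<rho> where "\<rho> : irreps L" "occ V m \<rho>"
proof -
 note lm = loc_supermodule[OF m]
 have "finite_dimensional (space (loc m))" "space (loc m) ~= {0}" using fdV space_nonzero by simp_all
 then obtain W where W: "W \<subseteq> space (loc m)" "irreducible_supermodule L (restrict (loc m) W)"
  "space (restrict (loc m) W) = W" "mhom_on L (restrict (loc m) W) (loc m) (%v. v)"
  by (rule exists_irreducible_submodule[OF lm gL])
 have fd: "finite_dimensional (space (restrict (loc m) W))"
  unfolding W(3) by (rule finite_dimensional_subset[OF fdV]) (use W(1) in simp)
 note c = coordinatize_irreps[OF W(2) fd gL] coordinatize_iso[OF W(2) fd gL]
 obtain w where "w : space (restrict (loc m) W)" "w ~= 0" by (rule irreducible_nonzero[OF W(2)])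
 then have "occurs L (restrict (loc m) W) (loc m)" unfolding occurs_def using W(4) by blast
 then have "occ V m (restrict (loc m) W)" using occ_iff[OF m irr_smod[OF W(2)]] by blast
 then have "occ V m (coordinatize (restrict (loc m) W))"
  by (rule occ_iso_right[OF module_iso_sym[OF c(2) irr_smod[OF W(2)] gL] irrepsD(3)[OF c(1)]])
 then show ?thesis using that c(1) by blast
qed

text \<open>Outside the support the localisation is a trivial module.\<close>

lemma trivial_not_supp:
 assumes m: "m : MaxSpec" "m ~: supp" and \<rho>: "irreducible_supermodule L \<rho>"
 shows "occ V m \<rho> \<longleftrightarrow> module_iso L trivial_module \<rho>"
proof -
 have triv: "r x (idem m) v = 0" if "v : space V" for x v
 proof -
  have "r x (idem m) v = r x 0 v"
   by (rule mod_annihilator[OF _ that]) (use idem(2)[OF m(1)] m(2) cv_linear_0[OF linear_eval_at] in \<open>auto simp: supp_def\<close>)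
  then show ?thesis using r_zero_index(2)[OF that] by simp
 qed
 note m\<rho> = irr_smod[OF \<rho>]
 show ?thesis
 proof
  assume "occ V m \<rho>"
  then have "occurs L \<rho> (loc m)" using occ_iff[OF m(1) m\<rho>] by blast
  then obtain g where g: "mhom_on L \<rho> (loc m) g" "inj_on g (space \<rho>)"
   "irreducible_supermodule L (loc m) --> bij_betw g (space \<rho>) (space (loc m))"
   by (rule nonzero_hom_from_irreducible[OF \<rho> loc_supermodule[OF m(1)] gL])
  show "module_iso L trivial_module \<rho>"
  proof (rule irreducible_trivial_action[OF \<rho> gL], rule ccontr)
   fix x v assume xv: "x : underlying L" "v : space \<rho>" "act \<rho> x v ~= 0"
   have "g (act \<rho> x v) ~= 0"
    by (rule inj_on_nonzero[OF g(2) mhomD(1)[OF g(1)] smodD(2)[OF m\<rho>] act_in[OF m\<rho> gL xv(1,2)] xv(3)])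
   then show False using mhomD(3)[OF g(1) xv(1,2)] triv mhomD(2)[OF g(1) xv(2)] by simp
  qed
 next
  assume iso: "module_iso L trivial_module \<rho>"
  obtain v where v: "v : space V" "v ~= 0" by (rule irreducible_nonzero[OF V])
  have T: "(trivial_module :: 'g coord_module) : irreps L" by (rule trivial_module_irreps[OF gL])
  obtain w where w: "w : space (trivial_module :: 'g coord_module)" "w ~= 0" by (rule irreducible_nonzero[OF irrepsD(1)[OF T]])
  then obtain p where p: "w p ~= 0" by (auto simp: fun_eq_iff)
  have "occurs L (trivial_module :: 'g coord_module) (loc m)"
   unfolding occurs_def mhom_on_def
  proof (intro exI[of _ "%w. w p *C v"] conjI ballI bexI[OF _ w(1)])
   show "linear_on (space (trivial_module :: 'g coord_module)) (%w. w p *C v)"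
    unfolding linear_on_def by (simp add: scaleC_add_left scaleC_fun_def scaleC_scaleC scaleC_complex_def)
   show "(%w. w p *C v) ` space (trivial_module :: 'g coord_module) \<subseteq> space (loc m)"
    using cv_subspace_scale[OF sV v(1)] by auto
   show "w p *C v ~= 0" using p v(2) by simp
   fix x and u :: "nat => complex"
   show "act trivial_module x u p *C v = act (loc m) x (u p *C v)"
    using triv[OF cv_subspace_scale[OF sV v(1)]] by (simp add: trivial_module_def)
  qed
  then have "occ V m (trivial_module :: 'g coord_module)" using occ_iff[OF m(1) irrepsD(3)[OF T]] by blast
  then show "occ V m \<rho>" by (rule occ_iso_right[OF module_iso_sym[OF iso irrepsD(3)[OF T] gL] m\<rho>])
 qed
qed

text \<open>A vector on which \<open>L\<close> acts trivially at \<open>m\<close> is killed by all functions vanishing on the rest of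
  the support, so by \<open>common_kernel\<close> these functions annihilate \<open>V\<close>, which excludes \<open>m\<close> from the support.\<close>

lemma not_trivial_supp:
 assumes m: "m : supp" and \<rho>: "is_supermodule L \<rho>" "!!x v. v : space \<rho> ==> act \<rho> x v = 0"
 shows "\<not> occ V m \<rho>"
proof
 assume o: "occ V m \<rho>"
 have mM: "m : MaxSpec" using m supp_MaxSpec by blast
 have c: "character_ideal z" if "z : supp" for z using that by (simp add: supp_def)
 obtain f u where f: "mhom_on L \<rho> (loc m) f" "u : space \<rho>" "f u ~= 0"
  using o unfolding occ_iff[OF mM \<rho>(1)] occurs_def by blast
 note f' = mhomD[OF f(1), unfolded loc_simps]
 have "f 0 = 0" by (rule lin_on_0[OF f'(1) smodD(2)[OF \<rho>(1)]])
 then have z: "r x (idem m) (f u) = 0" for x using f'(3)[of x u] \<rho>(2)[OF f(2)] f(2) by (simp add: UL)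
 let ?I = "{a. ALL z:supp - {m}. a : z}"
 have "?I \<subseteq> annihilator"
 proof (rule common_kernel[OF _ f'(2)[OF f(2)] f(3)])
  have "algebra_ideal z" if "z : supp" for z using c[OF that] by (simp add: character_ideal_def)
  then show "algebra_ideal ?I"
   by (intro algebra_idealI) (auto intro: algebra_idealD)
  fix x a assume "a : ?I"
  then have "ALL z:supp - {m}. a : z" by blast
  then show "r x a (f u) = 0" using local_function[OF mM _ f'(2)[OF f(2)]] z by simp
 qed
 moreover have "idem m : ?I"
 proof (intro CollectI ballI)
  fix z assume z: "z : supp - {m}"
  then have "eval_at z (idem m) = 0" using idem(2)[OF mM, of z] by simp
  then show "idem m : z" using eval_at_zero_iff[OF c] z by blast
 qed
 ultimately have "idem m : m" using annihilator_eq m by blast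
 then have "eval_at m (idem m) = 0" by (rule eval_at_zero_iff[OF c[OF m], THEN iffD2])
 then show False using idem(1)[OF mM] by simp
qed

end

section \<open>Evaluation at orbit representatives\<close>

lemma sum_apply: "(\<Sum>i\<in>I. f i) p = (\<Sum>i\<in>I. f i p)"
 by (induction I rule: infinite_finite_induct) simp_all

locale points = equivariant L \<alpha> \<beta>
 for L :: "'g::complex_vector superalgebra"
  and \<alpha> :: "'t::{finite, ab_group_add} => 'g => 'g"
  and \<beta> :: "'t => 'a::comm_unital_complex_algebra => 'a" +
 fixes ms :: "'a set list"
 assumes ms: "set ms \<subseteq> MaxSpec"
  and ms_orbits: "!!i j s. i < length ms ==> j < length ms ==> ms ! i = \<beta> s ` (ms ! j) ==> i = j"
begin

abbreviation "k \<equiv> length ms"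
abbreviation "ev \<equiv> evaluation L ms"
abbreviation "DP \<equiv> direct_power k L"

definition orb :: "'a set set" where
 "orb = (\<Union>m\<in>set ms. range (%s. \<beta> s ` m))"

lemma ms_in: "i < k ==> ms ! i : MaxSpec"
 using ms nth_mem by blast

lemmas ms_char = point[OF ms_in]

lemma orb: "finite orb" "orb \<subseteq> MaxSpec" "i < k ==> \<beta> s ` (ms ! i) : orb"
proof -
 show "finite orb" by (simp add: orb_def)
 show "orb \<subseteq> MaxSpec" using ms b_image_MaxSpec[OF beta] by (auto simp: orb_def)
 show "i < k ==> \<beta> s ` (ms ! i) : orb" using nth_mem by (auto simp: orb_def)
qed

lemma ms_orb: "i < k ==> ms ! i : orb"
 using orb(3)[of i 0] by (simp add: bb(4))

lemma orbE:
 assumes "z : orb"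
 obtains s j where "j < k" "z = \<beta> s ` (ms ! j)"
 using assms by (auto simp: orb_def in_set_conv_nth)

lemma ms_orbit_iff: "i < k ==> j < k ==> \<beta> s ` (ms ! i) = ms ! j \<longleftrightarrow> i = j & s = 0"
 using ms_orbits[of j i s] free[OF ms_in, of i s] by (auto simp: bb(4))

lemma ev_point: "clinear (%t. ev t i)" "ev (x **C a) i = (if i < k then eval_at (ms ! i) a *C x else 0)"
proof -
 note U = cv_subspace_UNIV
 have B: "bilinear_on UNIV UNIV (%(x :: 'g) f. eval_at (ms ! i) f *C x)" if "i < k"
  unfolding bilinear_on_def linear_on_def
  by (simp add: scaleC_add_right scaleC_add_left scaleC_scaleC eval_at_add[OF ms_char[OF that]] eval_at_scale[OF ms_char[OF that]] mult.commute)
 show "clinear (%t. ev t i)"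
  using clinear_tensor_lift[OF U U B] unfolding evaluation_def UL by (cases "i < k") (simp_all add: clinear_iff)
 show "ev (x **C a) i = (if i < k then eval_at (ms ! i) a *C x else 0)"
  using tensor_lift_tens[OF U U B] unfolding evaluation_def UL by simp
qed

lemma ev_linear: "clinear ev"
 using ev_point(1) unfolding clinear_iff by (simp add: fun_eq_iff scaleC_fun_def)

lemma ev_out: "\<not> i < k ==> ev t i = 0"
 by (simp add: evaluation_def)

lemma ev_Tr: "i < k ==> ev (Tr (x **C a)) i = (\<Sum>s\<in>UNIV. eval_at (ms ! i) (\<beta> s a) *C \<alpha> s x)"
 unfolding Tr_def cv_linear_sum[OF ev_point(1)] by (simp add: dg_lemma(2) ev_point(2))

lemma ev_local:
 assumes j: "j < k" and a: "ALL z:orb - {ms ! j}. a : z"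
 shows "ev (Tr (x **C a)) = insert_at j (eval_at (ms ! j) a *C x)"
proof
 fix i
 show "ev (Tr (x **C a)) i = insert_at j (eval_at (ms ! j) a *C x) i"
 proof (cases "i < k")
  case True
  have c: "eval_at (ms ! i) (\<beta> s a) *C \<alpha> s x = (if s = 0 then insert_at j (eval_at (ms ! j) a *C x) i else 0)" for s
  proof (cases "\<beta> (- s) ` (ms ! i) = ms ! j")
   case True
   then have "i = j & s = 0" using ms_orbit_iff[OF \<open>i < k\<close> j, of "- s"] by simp
   then show ?thesis by (simp add: aa(4) bb(4))
  next
   case False
   have z: "\<beta> (- s) ` (ms ! i) : orb - {ms ! j}" using orb(3)[OF \<open>i < k\<close>] False by blast
   have "eval_at (\<beta> (- s) ` (ms ! i)) a = 0"
    using a z eval_at_zero_iff[OF b_image_character(1)[OF beta ms_char[OF \<open>i < k\<close>]]] by blast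
   then have "eval_at (ms ! i) (\<beta> s a) = 0" by (simp add: b_image_character(2)[OF beta ms_char[OF \<open>i < k\<close>]])
   moreover have "\<not> (i = j & s = 0)" using False ms_orbit_iff[OF \<open>i < k\<close> j, of "- s"] by simp
   ultimately show ?thesis by auto
  qed
  show ?thesis unfolding ev_Tr[OF True] c by simp
 qed (use j ev_out in auto)
qed

lemma ev_vanish:
 assumes "ALL z:orb. a : z"
 shows "ev (Tr (x **C a)) = 0"
proof (cases "k = 0")
 case False
 then have "0 < k" by simp
 then have "ev (Tr (x **C a)) = insert_at 0 (eval_at (ms ! 0) a *C x)" using assms by (intro ev_local) auto
 moreover have "eval_at (ms ! 0) a = 0"
  using assms ms_orb[OF \<open>0 < k\<close>] eval_at_zero_iff[OF ms_char[OF \<open>0 < k\<close>]] by blast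
 ultimately show ?thesis by (simp add: fun_eq_iff)
qed (simp add: fun_eq_iff evaluation_def)

lemma ev_br: "ev (br t u) = bracket DP (ev t) (ev u)"
proof
 fix i
 note l = ev_point(1)[of i]
 show "ev (br t u) i = bracket DP (ev t) (ev u) i"
 proof (cases "i < k")
  case True
  have "ev (br t u) i = bracket L (ev t i) (ev u i)"
  proof (rule tensor_ext_UNIV[of "%t. ev (br t u) i" "%t. bracket L (ev t i) (ev u i)"])
   show "clinear (%t. ev (br t u) i)" by (rule clinear_comp[OF l br_linear(2)])
   show "clinear (%t. bracket L (ev t i) (ev u i))"
    using clinear_comp[of "%y. bracket L y (ev u i)", OF blL(2) l] .
   fix x and a :: 'a
   show "ev (br (x **C a) u) i = bracket L (ev (x **C a) i) (ev u i)"
   proof (rule tensor_ext_UNIV[OF clinear_comp[OF l br_linear(1)] clinear_comp[OF blL(1) l]])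
    fix y and b :: 'a
    show "ev (br (x **C a) (y **C b)) i = bracket L (ev (x **C a) i) (ev (y **C b) i)"
    using True by (simp add: br_tens ev_point(2) eval_at_mult[OF ms_char] scaleC_scaleC
    cv_linear_scale[OF blL(1)] cv_linear_scale[OF blL(2)] mult.commute)
   qed
  qed
  then show ?thesis using True by (simp add: bracket_direct_power)
 qed (simp add: bracket_direct_power ev_out)
qed

lemma ev_grade: "t : grade CC p ==> ev t : grade DP p"
proof -
 assume t: "t : grade CC p"
 have "ev t i : grade L p" for i
 proof -
  note s = graded_subspace[OF gL, of p]
  have "cspan {x **C f | x f. x : grade L p} \<subseteq> {t. ev t i : grade L p}"
   by (rule cv_span_minimal[OF _ cv_linear_preimage[OF ev_point(1) s]])
    (auto simp: ev_point(2) cv_subspace_scale[OF s] cv_subspace_0[OF s])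
  then show ?thesis using t unfolding grade_CC by blast
 qed
 then show ?thesis by (simp add: grade_direct_power ev_out)
qed

lemma ev_hom: "superalgebra_hom EE DP ev"
 by (rule superalgebra_homI)
  (simp_all add: cv_linear_add[OF ev_linear] cv_linear_scale[OF ev_linear] ev_grade grade_EE bracket_EE ev_br)

definition local_unit :: "nat => 'a" where
 "local_unit i = (SOME e. eval_at (ms ! i) e = 1 & (ALL z:orb - {ms ! i}. e : z))"

lemma local_unit:
 assumes "i < k"
 shows "eval_at (ms ! i) (local_unit i) = 1" "ALL z:orb - {ms ! i}. local_unit i : z"
proof -
 obtain e where "eval_at (ms ! i) e = 1" "ALL z:orb - {ms ! i}. e : z" by (rule dual[OF orb(1,2) ms_in[OF assms]])
 then have "eval_at (ms ! i) e = 1 & (ALL z:orb - {ms ! i}. e : z)" by (rule conjI)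
 then have "eval_at (ms ! i) (local_unit i) = 1 & (ALL z:orb - {ms ! i}. local_unit i : z)" unfolding local_unit_def by (rule someI)
 then show "eval_at (ms ! i) (local_unit i) = 1" "ALL z:orb - {ms ! i}. local_unit i : z" by blast+
qed

text \<open>A linear section of the evaluation map.\<close>

definition lift :: "(nat => 'g) => ('g, 'a) tensor" where
 "lift z = (\<Sum>i<k. Tr (z i **C local_unit i))"

lemma tens_zero_left: "0 **C (f :: 'a) = (0 :: ('g, 'a) tensor)"
 using tens_bilinear(3)[of 0 0 f] by simp

lemma lift_linear: "clinear lift"
 unfolding lift_def by (rule clinear_sum) (simp add: clinear_iff scaleC_fun_def tens_bilinear Tr_add Tr_scale)

lemma lift_grade: "z : grade DP p ==> lift z : grade EE p"
 unfolding lift_def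
 by (rule cv_subspace_sum[OF graded_subspace[OF graded_EE]]) (simp add: Tr_in_grade grade_direct_powerD(1))

lemma lift_underlying: "lift z : underlying EE"
 unfolding lift_def by (rule cv_subspace_sum[OF graded_total[OF graded_EE]]) (rule Tr_in_EE)

lemma lift_insert: "j < k ==> lift (insert_at j x) = Tr (x **C local_unit j)"
proof -
 assume "j < k"
 have "lift (insert_at j x) = (\<Sum>i<k. if i = j then Tr (x **C local_unit j) else 0)"
  unfolding lift_def by (rule sum.cong) (simp_all add: tens_zero_left Tr_0)
 then show ?thesis using \<open>j < k\<close> by simp
qed

lemma ev_lift:
 assumes "!!i. \<not> i < k ==> z i = 0"
 shows "ev (lift z) = z"
proof
 fix p
 have "ev (lift z) p = (\<Sum>i<k. ev (Tr (z i **C local_unit i)) p)"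
  unfolding lift_def cv_linear_sum[OF ev_linear] sum_apply ..
 also have "\<dots> = (\<Sum>i<k. if i = p then z i else 0)"
  by (rule sum.cong) (auto simp: ev_local[OF _ local_unit(2)] local_unit(1) scaleC_one)
 also have "\<dots> = z p" using assms[of p] by simp
 finally show "ev (lift z) p = z p" .
qed

lemma product_irreps:
 assumes "!!i. i < k ==> \<rho> i : irreps L"
 shows "iterated_product L \<rho> k : irreps DP"
proof (cases k)
 case 0
 then show ?thesis using trivial_module_irreps[OF graded_direct_power[OF gaL], of 0] by simp
next
 case (Suc n)
 then show ?thesis using iterated_product_irreducible[OF gaL, of n \<rho>] assms by simp
qed

lemma evaluation_module_irreps:
 assumes "!!i. i < k ==> \<rho> i : irreps L"
 shows "evaluation_module L ms \<rho> : irreps EE"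
proof -
 have P: "iterated_product L \<rho> k : irreps DP" by (rule product_irreps[OF assms])
 have "grade DP p \<subseteq> ev ` grade EE p" for p
 proof
  fix z assume z: "z : grade DP p"
  have "z = ev (lift z)" using ev_lift[of z] grade_direct_powerD(2)[OF z] by simp
  then show "z : ev ` grade EE p" using lift_grade[OF z] by blast
 qed
 then have "irreducible_supermodule EE (pullback ev (iterated_product L \<rho> k))"
  by (rule pullback_irreducible[OF irrepsD(1)[OF P] ev_hom graded_EE graded_direct_power[OF gaL]])
 then show ?thesis using irrepsD(2)[OF P] by (simp add: irreps_def evaluation_module_def)
qed

lemma evaluation_module_occ:
 assumes \<rho>: "!!i. i < k ==> \<rho> i : irreps L" and j: "j < k"
 shows "occ (evaluation_module L ms \<rho>) (ms ! j) (\<rho> j)"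
proof -
 obtain n where n: "k = Suc n" using j by (cases k) auto
 have "occurs L (\<rho> j) (pullback (insert_at j) (iterated_product L \<rho> k))"
  using iterated_product_irreducible[OF gaL, of n \<rho>] \<rho> j n by simp
 then obtain f u where f: "mhom_on L (\<rho> j) (pullback (insert_at j) (iterated_product L \<rho> k)) f" "u : space (\<rho> j)" "f u ~= 0"
  unfolding occurs_def by blast
 note f' = mhomD[OF f(1), unfolded pullback_simps]
 show ?thesis
 proof (rule occI[of orb "\<rho> j" f "evaluation_module L ms \<rho>" u "ms ! j", OF orb(1,2) f'(1) _ f(2,3)])
  show "f v : space (evaluation_module L ms \<rho>)" if "v : space (\<rho> j)" for v
   using f'(2)[OF that] by (simp add: evaluation_module_def)
  fix x a v assume a: "ALL z:orb - {ms ! j}. a : z" and v: "v : space (\<rho> j)"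
  have x: "y : underlying L" for y by (simp add: UL)
  have "f (eval_at (ms ! j) a *C act (\<rho> j) x v) = f (act (\<rho> j) (eval_at (ms ! j) a *C x) v)"
   using lin_on_scale[OF smodD(3)[OF irrepsD(3)[OF \<rho>[OF j]] v] x] by simp
  also have "\<dots> = act (iterated_product L \<rho> k) (insert_at j (eval_at (ms ! j) a *C x)) (f v)" by (rule f'(3)[OF x v])
  finally show "f (eval_at (ms ! j) a *C act (\<rho> j) x v) = act (evaluation_module L ms \<rho>) (Tr (x **C a)) (f v)"
   by (simp add: evaluation_module_def ev_local[OF j a])
 qed
qed

lemma evaluation_module_occ_trivial:
 assumes \<rho>: "!!i. i < k ==> \<rho> i : irreps L" and m: "m ~: orb"
 shows "occ (evaluation_module L ms \<rho>) m (trivial_module :: 'g coord_module)"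
proof -
 let ?E = "evaluation_module L ms \<rho>" and ?T = "trivial_module :: 'g coord_module"
 have E: "?E : irreps EE" by (rule evaluation_module_irreps[OF \<rho>])
 have P: "iterated_product L \<rho> k : irreps DP" by (rule product_irreps[OF \<rho>])
 have s: "(c *C u) p = c * u p" for c and u :: "nat => complex" and p by (simp add: scaleC_fun_def scaleC_complex_def)
 note sE = smodD(2)[OF irrepsD(3)[OF E]]
 obtain v where v: "v : space ?E" "v ~= 0" by (rule irreducible_nonzero[OF irrepsD(1)[OF E]])
 obtain w where w: "w : space ?T" "w ~= 0" by (rule irreducible_nonzero[OF irrepsD(1)[OF trivial_module_irreps[OF gL]]])
 then obtain p where p: "w p ~= 0" by (auto simp: fun_eq_iff)
 show ?thesis
 proof (rule occI[of orb ?T "%u. u p *C v" ?E w m, OF orb(1,2) _ _ w(1)])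
  show "linear_on (space ?T) (%u. u p *C v)"
   unfolding linear_on_def by (simp add: scaleC_add_left s scaleC_scaleC)
  show "u p *C v : space ?E" for u :: "nat => complex" by (rule cv_subspace_scale[OF sE v(1)])
  show "w p *C v ~= 0" using p v(2) by simp
  fix x a and u :: "nat => complex" assume "ALL z:orb - {m}. a : z"
  then have "ALL z:orb. a : z" using m by blast
  then have "act ?E (Tr (x **C a)) (u p *C v) = act (iterated_product L \<rho> k) 0 (u p *C v)"
   by (simp add: evaluation_module_def ev_vanish)
  also have "\<dots> = 0"
   by (rule lin_on_0[OF smodD(3)[OF irrepsD(3)[OF P]] graded_total[OF graded_direct_power[OF gaL]]])
    (use cv_subspace_scale[OF sE v(1)] in \<open>simp add: evaluation_module_def\<close>)
  finally show "(eval_at m a *C act ?T x u) p *C v = act ?E (Tr (x **C a)) (u p *C v)"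
   by (simp add: trivial_module_def)
 qed
qed

end

locale module_points = equivariant_module L \<alpha> \<beta> V + points L \<alpha> \<beta> ms
 for L :: "'g::complex_vector superalgebra"
  and \<alpha> :: "'t::{finite, ab_group_add} => 'g => 'g"
  and \<beta> :: "'t => 'a::comm_unital_complex_algebra => 'a"
  and V :: "(('g, 'a) tensor, 'v::complex_vector) supermodule" and ms +
 assumes cover: "supp = orb"
begin

text \<open>Modulo functions vanishing on the support, \<open>a\<close> is the combination of translates of the local units
  whose coefficients are the values of \<open>a\<close> on the orbits.\<close>

lemma lift_ev_Tr:
 assumes v: "v : space V"
 shows "act V (lift (ev (Tr (x **C a)))) v = r x a v"
proof -
 let ?c = "%i s. eval_at (ms ! i) (\<beta> s a)"
 let ?b = "\<Sum>i<k. \<Sum>s\<in>UNIV. ?c i s *C \<beta> (- s) (local_unit i)"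
 have "Tr (ev (Tr (x **C a)) i **C local_unit i) = (\<Sum>s\<in>UNIV. Tr (x **C (?c i s *C \<beta> (- s) (local_unit i))))" if "i < k" for i
 proof -
  have "(\<Sum>s\<in>S. f s) **C e = (\<Sum>s\<in>S. f s **C e)" for S and f :: "'t => 'g" and e :: 'a
   by (induction S rule: infinite_finite_induct) (simp_all add: tens_bilinear tens_zero_left)
  moreover have "Tr (\<alpha> s x **C local_unit i) = Tr (x **C \<beta> (- s) (local_unit i))" for s
   using Tr_dg[of s "x **C \<beta> (- s) (local_unit i)"] by (simp add: dg_lemma(2) bb)
  ultimately show ?thesis by (simp add: ev_Tr[OF that] Tr_sum tens_bilinear Tr_scale)
 qed
 then have "lift (ev (Tr (x **C a))) = Tr (x **C ?b)"
  unfolding lift_def tens_sum Tr_sum by (intro sum.cong) auto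
 moreover have "r x ?b v = r x a v"
 proof (rule mod_annihilator[OF _ v], rule ballI)
  fix z assume "z : supp"
  then have "z : orb" by (simp add: cover)
  then obtain t j where z: "j < k" "z = \<beta> t ` (ms ! j)" by (rule orbE)
  have c: "character_ideal z" unfolding z(2) by (rule b_image_character(1)[OF beta ms_char[OF z(1)]])
  have e: "eval_at z (\<beta> (- s) (local_unit i)) = (if i = j then if s = - t then 1 else 0 else 0)" if i: "i < k" for i s
  proof -
   have "eval_at z (\<beta> (- s) (local_unit i)) = eval_at (\<beta> s ` z) (local_unit i)" by (simp add: b_image_character(2)[OF beta c])
   also have "\<beta> s ` z = \<beta> (s + t) ` (ms ! j)" unfolding z(2) by (rule b_image_image[OF beta])
   finally have 1: "eval_at z (\<beta> (- s) (local_unit i)) = eval_at (\<beta> (s + t) ` (ms ! j)) (local_unit i)" .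
   show ?thesis
   proof (cases "\<beta> (s + t) ` (ms ! j) = ms ! i")
    case True
    then have "j = i & s + t = 0" using ms_orbit_iff[OF z(1) i] by simp
    then show ?thesis using 1 True local_unit(1)[OF i] by (simp add: eq_neg_iff_add_eq_0)
   next
    case False
    then have "eval_at (\<beta> (s + t) ` (ms ! j)) (local_unit i) = 0"
    using local_unit(2)[OF i] orb(3)[OF z(1), of "s + t"] eval_at_zero_iff[OF b_image_character(1)[OF beta ms_char[OF z(1)]]] by blast
    moreover have "\<not> (j = i & s + t = 0)" using False ms_orbit_iff[OF z(1) i] by simp
    ultimately show ?thesis using 1 by (auto simp: eq_neg_iff_add_eq_0)
   qed
  qed
  have "eval_at z ?b = (\<Sum>i<k. \<Sum>s\<in>UNIV. ?c i s * eval_at z (\<beta> (- s) (local_unit i)))"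
   by (simp add: cv_linear_sum[OF linear_eval_at[OF c]] eval_at_scale[OF c])
  also have "\<dots> = (\<Sum>i<k. if i = j then ?c i (- t) else 0)"
   by (intro sum.cong refl) (simp add: e if_distrib[of "%y. _ * y"] cong: if_cong)
  also have "\<dots> = eval_at z a" using z by (simp add: b_image_character(2)[OF beta ms_char])
  finally show "eval_at z ?b = eval_at z a" .
 qed
 ultimately show ?thesis by simp
qed

lemma lift_ev:
 assumes t: "t : underlying EE" and v: "v : space V"
 shows "act V (lift (ev t)) v = act V t v"
proof -
 have "linear_on (underlying EE) (%t. act V (lift (ev t)) v - act V t v)"
  by (rule lin_on_arith(2)[OF lin_on_compose[OF clinear_linear_on[OF clinear_comp[OF lift_linear ev_linear]] lift_underlying smodD(3)[OF mV v]] smodD(3)[OF mV v]])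
 then have s: "csubspace {t : underlying EE. act V (lift (ev t)) v - act V t v = 0}" (is "csubspace ?K") by (rule csubspace_kernel[OF _ sEE])
 have "grade EE i \<subseteq> ?K" for i
 proof -
  have "{Tr (x **C f) | x f. x : grade L i} \<subseteq> ?K" using lift_ev_Tr[OF v] Tr_in_EE by auto
  from subset_trans[OF grade_EE_span cv_span_minimal[OF this s]] show ?thesis .
 qed
 note K = this
 obtain u w where uw: "u : grade EE 0" "w : grade EE 1" "t = u + w" by (rule total_cases[OF graded_EE t])
 have "t : ?K" unfolding uw(3) by (rule cv_subspace_add[OF s subsetD[OF K uw(1)] subsetD[OF K uw(2)]])
 then show ?thesis by simp
qed

abbreviation "W \<equiv> pullback lift V"

lemma W_supermodule: "is_supermodule DP W"
 unfolding is_supermodule_def bilinear_on_def pullback_simps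
proof (intro conjI ballI allI)
 show "graded_space (mgrade V)" by (rule smodD(1)[OF mV])
 show "linear_on (underlying DP) (%x. act V (lift x) v)" if "v : space V" for v
  by (rule lin_on_compose[OF clinear_linear_on[OF lift_linear] lift_underlying smodD(3)[OF mV that]])
 show "linear_on (space V) (act V (lift x))" for x by (rule smodD(4)[OF mV lift_underlying])
 show "act V (lift x) v : mgrade V (i + j)" if "x : grade DP i" "v : mgrade V j" for i j x v
  by (rule smodD(5)[OF mV lift_grade[OF that(1)] that(2)])
 show "act V (lift (bracket DP x y)) v = act V (lift x) (act V (lift y) v) - koszul i j *C act V (lift y) (act V (lift x) v)"
  if x: "x : grade DP i" and y: "y : grade DP j" and v: "v : space V" for i j x y v
 proof -
  have "bracket DP x y = ev (br (lift x) (lift y))"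
   unfolding ev_br using ev_lift[of x] ev_lift[of y] grade_direct_powerD(2)[OF x] grade_direct_powerD(2)[OF y] by simp
  moreover have "br (lift x) (lift y) : underlying EE"
   unfolding lift_def br_sum_left unfolding br_sum_right unfolding br_Tr_tens
   by (rule cv_subspace_sum[OF sEE], rule cv_subspace_sum[OF sEE],
    rule cv_subspace_sum[OF sEE], rule Tr_in_EE)
  ultimately have "act V (lift (bracket DP x y)) v = act V (br (lift x) (lift y)) v" using lift_ev[OF _ v] by simp
  then show ?thesis using smodD(6)[OF mV lift_grade[OF x] lift_grade[OF y] v] unfolding bracket_EE by simp
 qed
qed

lemma W_irreducible: "irreducible_supermodule DP W"
 unfolding irreducible_supermodule_def
proof (intro conjI allI impI W_supermodule)
 show "space W ~= {0}" using space_nonzero by simp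
 fix U assume U: "graded_submodule DP W U"
 then have "U \<subseteq> space V" using graded_submodule_iff[OF W_supermodule graded_direct_power[OF gaL]] by simp
 moreover have "act V t u : U" if t: "t : underlying EE" and u: "u : U" for t u
 proof -
  have "ev t : underlying DP" by (rule superalgebra_homD(4)[OF ev_hom graded_EE t])
  then have "act V (lift (ev t)) u : U" using U u unfolding graded_submodule_def by simp
  then show ?thesis using lift_ev[OF t] u \<open>U \<subseteq> space V\<close> by auto
 qed
 ultimately have "graded_submodule EE V U" using U unfolding graded_submodule_def by simp
 then show "U = {0} \<or> U = space W" using V unfolding irreducible_supermodule_def by simp
qed

lemma occ_W:
 assumes j: "j < k" and \<rho>: "is_supermodule L \<rho>" and o: "occ V (ms ! j) \<rho>"
 shows "occurs L \<rho> (pullback (insert_at j) W)"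
proof -
 obtain f u where f: "mhom_on L \<rho> (loc (ms ! j)) f" "u : space \<rho>" "f u ~= 0"
  using o unfolding occ_iff[OF ms_in[OF j] \<rho>] occurs_def by blast
 note f' = mhomD[OF f(1), unfolded loc_simps]
 have "r x (local_unit j) v = r x (idem (ms ! j)) v" if "v : space V" for x v
  using local_function[OF ms_in[OF j] _ that] local_unit[OF j] by (simp add: cover scaleC_one)
 then have "mhom_on L \<rho> (pullback (insert_at j) W) f"
  unfolding mhom_on_def pullback_simps lift_insert[OF j] using f' by auto
 then show ?thesis unfolding occurs_def using f(2,3) by blast
qed

lemma unique_at:
 assumes "j < k" "M : irreps L" "N : irreps L" "occ V (ms ! j) M" "occ V (ms ! j) N"
 shows "module_iso L N M"
 by (rule occurring_unique[OF gaL W_irreducible _ assms(1) irrepsD(1,2)[OF assms(2)] occ_W[OF assms(1) irrepsD(3)[OF assms(2)] assms(4)]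
    irrepsD(1)[OF assms(3)] occ_W[OF assms(1) irrepsD(3)[OF assms(3)] assms(5)]])
  (simp add: fdV)

text \<open>The section \<open>lift\<close> turns \<open>V\<close> into an irreducible module over the direct power, to which the
  uniqueness of iterated products applies.\<close>

lemma classification:
 assumes \<rho>: "!!i. i < k ==> \<rho> i : irreps L" "!!i. i < k ==> occ V (ms ! i) (\<rho> i)"
 shows "module_iso EE (evaluation_module L ms \<rho>) V"
proof -
 have fdW: "finite_dimensional (space W)" by (simp add: fdV)
 have "module_iso DP (iterated_product L \<rho> k) W"
 proof (cases k)
  case 0
  have "act W z v = 0" if "v : space W" for z v
   using that lin_on_0[OF smodD(3)[OF mV] sEE] by (simp add: lift_def 0)
  then show ?thesis using irreducible_trivial_action[OF W_irreducible graded_direct_power[OF gaL]] 0 by simp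
 next
  case (Suc n)
  show ?thesis
   using iterated_product_unique[OF gaL W_irreducible[unfolded Suc] fdW, of \<rho>] \<rho>(1) occ_W[OF _ irrepsD(3)[OF \<rho>(1)] \<rho>(2)] Suc
   by (simp add: less_Suc_eq_le)
 qed
 then have "module_iso EE (evaluation_module L ms \<rho>) (pullback ev W)"
  unfolding evaluation_module_def by (rule pullback_iso[OF _ ev_hom graded_EE])
 moreover have "module_iso EE (pullback ev W) V"
  unfolding module_iso_def by (rule exI[of _ "%v. v"]) (simp add: lin_on_arith(5) lift_ev bij_betw_def)
 ultimately show ?thesis by (rule module_iso_trans)
qed

end

section \<open>The queer Lie superalgebra is perfect\<close>

definition munit :: "'n::finite => 'n => complex ^ 'n ^ 'n" where
 "munit i j = (\<chi> p q. if p = i & q = j then 1 else 0)"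

lemma munit_mult: "munit i j ** munit k l = (if j = k then munit i l else 0)"
proof -
 have "(\<Sum>r\<in>UNIV. munit i j $ p $ r * munit k l $ r $ q) = (\<Sum>r\<in>UNIV. if r = j then (if p = i & j = k & q = l then 1 else 0) else 0)" for p q
  by (rule sum.cong) (auto simp: munit_def)
 then show ?thesis by (simp add: matrix_matrix_mult_def vec_eq_iff munit_def)
qed

text \<open>Traceless matrices are spanned by these, and each of them is a commutator of matrix units with a
  traceless second factor.\<close>

definition sl_gens :: "(complex ^ 'n::finite ^ 'n) set" where
 "sl_gens = {munit i j | i j. i ~= j} \<union> {munit i i - munit j j | i j. True}"

lemma finite_sl_gens: "finite (sl_gens :: (complex ^ 'n::finite ^ 'n) set)"
proof -
 have "sl_gens \<subseteq> (%(i, j). munit i j) ` UNIV \<union> (%(i, j). munit i i - munit j j) ` (UNIV :: ('n \<times> 'n) set)"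
  unfolding sl_gens_def by auto
 then show ?thesis by (rule finite_subset) simp
qed

lemma sl_span:
 assumes b: "trace (b :: complex ^ 'n::finite ^ 'n) = 0"
 shows "b : cspan sl_gens"
proof -
 fix k :: 'n
 have entry: "(c *C m) $ p $ q = c * m $ p $ q" for c and m :: "complex ^ 'n ^ 'n" and p q
  by (simp add: scaleC_vec_def scaleC_complex_def)
 let ?g = "%i j. if i = j then munit i i - munit k k else munit i j"
 have e: "b = (\<Sum>i\<in>UNIV. \<Sum>j\<in>UNIV. b $ i $ j *C ?g i j)"
 proof (simp only: vec_eq_iff, intro allI)
  fix p q
  have "(\<Sum>i\<in>UNIV. \<Sum>j\<in>UNIV. b $ i $ j *C ?g i j) $ p $ q =
    (\<Sum>i\<in>UNIV. \<Sum>j\<in>UNIV. (if j = q then if i = p then b $ p $ q else 0 else 0) - (if j = i then b $ i $ i * munit k k $ p $ q else 0))"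
   unfolding sum_component by (intro sum.cong refl) (auto simp: entry munit_def)
  also have "\<dots> = b $ p $ q - trace b * munit k k $ p $ q"
   by (simp add: sum_subtractf trace_def sum_distrib_right)
  finally show "b $ p $ q = (\<Sum>i\<in>UNIV. \<Sum>j\<in>UNIV. b $ i $ j *C ?g i j) $ p $ q" by (simp add: b)
 qed
 have "?g i j : cspan sl_gens" for i j
  by (rule cv_span_base) (auto simp: sl_gens_def)
 then show ?thesis by (subst e) (intro cv_span_sum cv_span_scale)
qed

lemma sl_gens_commutator:
 assumes "g : sl_gens"
 obtains u v where "trace v = 0" "g = u ** v - v ** u"
proof -
 have tr: "trace (munit i j :: complex ^ 'n ^ 'n) = 0" if "i ~= j" for i j
  using that by (auto simp: trace_def munit_def intro!: sum.neutral)
 consider (1) i j where "i ~= j" "g = munit i j" | (2) i j where "i ~= j" "g = munit i i - munit j j" | (3) "g = 0"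
 proof -
  from assms consider (a) i j where "i ~= j" "g = munit i j" | (b) i j where "g = munit i i - munit j j"
   unfolding sl_gens_def by blast
  then show ?thesis
  proof cases
   case b
   then show ?thesis using that(2)[of i j] that(3) by (cases "i = j") auto
  qed (rule that(1))
 qed
 then show ?thesis
 proof cases
  case 1
  then show ?thesis by (intro that[OF tr, of i j "munit i i"]) (auto simp: munit_mult)
 next
  case 2
  then show ?thesis by (intro that[OF tr, of j i "munit i j"]) (auto simp: munit_mult)
 next
  case 3
  then show ?thesis by (intro that[of 0 0]) (simp_all add: trace_arith)
 qed
qed

lemma trace_sl_gens: "g : sl_gens ==> trace g = 0"
 using sl_gens_commutator trace_commutators(2) by metis

lemma queer_even_odd_span:
 fixes S :: "'n::finite queer set"
 assumes S: "csubspace S"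
 shows "(!!g. g : sl_gens ==> abs_queer (block g 0) : S) ==> grade queer_algebra 0 \<subseteq> S"
  "(!!g. g : sl_gens ==> abs_queer (block 0 g) : S) ==> grade queer_algebra 1 \<subseteq> S"
proof -
 have zero: "abs_queer (block 0 0) = (0 :: 'n queer)" by (simp add: zero_queer_def block_arith)
 note z = cv_subspace_0[OF S, folded zero] and ad = cv_subspace_add[OF S] and sc = cv_subspace_scale[OF S]
 note q = abs_queer_block(2)[symmetric] abs_queer_block'(2)[symmetric]
 {
  assume g: "!!g. g : sl_gens ==> abs_queer (block g 0) : S"
  have "csubspace {a :: complex ^ 'n ^ 'n. abs_queer (block a 0) : S}"
   unfolding cv_subspace_def
  proof (intro conjI ballI allI CollectI; (elim CollectE)?)
   show "abs_queer (block 0 0) : S" by (rule z)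
   fix a c :: "complex ^ 'n ^ 'n" and k
   assume a: "abs_queer (block a 0) : S"
   show "abs_queer (block (k *C a) 0) : S"
    using sc[OF a, of k] abs_queer_block'(2)[of 0 k a] by (simp add: trace_arith complex_vector.scale_zero_right)
   assume c: "abs_queer (block c 0) : S"
   show "abs_queer (block (a + c) 0) : S"
    using ad[OF a c] abs_queer_block(2)[of 0 0 a c] by (simp add: trace_arith)
  qed
  then have e: "cspan sl_gens \<subseteq> {a. abs_queer (block a 0) : S}"
   by (intro cv_span_minimal) (use g in auto)
  have "abs_queer (block a 0) : S" for a :: "complex ^ 'n ^ 'n"
  proof -
   let ?c = "trace a / of_nat CARD('n)"
   have "trace (a - ?c *C mat 1) = 0" by (simp add: trace_sub trace_arith trace_I)
   then have "abs_queer (block (a - ?c *C mat 1) 0) : S" using sl_span e by blast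
   moreover have "abs_queer (block a 0) = abs_queer (block (a - ?c *C mat 1) 0)"
    using abs_queer_block(1)[of 0 0 a "a - ?c *C mat 1"] by (auto simp: trace_arith)
   ultimately show ?thesis by simp
  qed
  then show "grade queer_algebra 0 \<subseteq> S" by (auto simp: queer_grade)
 }
 {
  assume g: "!!g. g : sl_gens ==> abs_queer (block 0 g) : S"
  have "csubspace {a :: complex ^ 'n ^ 'n. trace a = 0 & abs_queer (block 0 a) : S}"
   unfolding cv_subspace_def
  proof (intro conjI ballI allI CollectI; (elim CollectE conjE)?)
   show "abs_queer (block 0 0) : S" by (rule z)
   fix a c :: "complex ^ 'n ^ 'n" and k
   assume a: "trace a = 0" "abs_queer (block 0 a) : S"
   show "abs_queer (block 0 (k *C a)) : S"
    using sc[OF a(2), of k] abs_queer_block'(2)[of a k 0] a(1) by (simp add: complex_vector.scale_zero_right)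
   assume c: "trace c = 0" "abs_queer (block 0 c) : S"
   show "abs_queer (block 0 (a + c)) : S"
    using ad[OF a(2) c(2)] abs_queer_block(2)[of a c 0 0] a(1) c(1) by simp
  qed (simp_all add: trace_arith trace_add)
  then have "cspan sl_gens \<subseteq> {a. trace a = 0 & abs_queer (block 0 a) : S}"
   by (intro cv_span_minimal) (use g trace_sl_gens in auto)
  then show "grade queer_algebra 1 \<subseteq> S" using sl_span by (auto simp: queer_grade)
 }
qed

lemma queer_perfect:
 shows "grade queer_algebra 0 \<subseteq> cspan {bracket queer_algebra x y | x y. x : grade queer_algebra 0 & y : (grade queer_algebra 0 :: 'n::finite queer set)}"
  and "grade queer_algebra 1 \<subseteq> cspan {bracket queer_algebra x y | x y. x : grade queer_algebra 0 & y : (grade queer_algebra 1 :: 'n::finite queer set)}"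
proof -
 have br: "bracket queer_algebra = queer_bracket" by (simp add: queer_algebra_def)
 have in0: "abs_queer (block a 0) : grade queer_algebra 0" for a :: "complex ^ 'n ^ 'n" by (auto simp: queer_grade)
 have in1: "abs_queer (block 0 a) : grade queer_algebra 1" if "trace a = 0" for a :: "complex ^ 'n ^ 'n" using that by (auto simp: queer_grade)
 show "grade queer_algebra 0 \<subseteq> cspan {bracket queer_algebra x y | x y. x : grade queer_algebra 0 & y : (grade queer_algebra 0 :: 'n queer set)}"
 proof (rule queer_even_odd_span(1)[OF complex_vector.subspace_span], rule cv_span_base)
  fix g :: "complex ^ 'n ^ 'n" assume "g : sl_gens"
  then obtain u v where "trace v = 0" "g = u ** v - v ** u" by (rule sl_gens_commutator)
  then have "abs_queer (block g 0) = queer_bracket (abs_queer (block u 0)) (abs_queer (block v 0))"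
   by (simp add: abs_queer_block(4) trace_arith matrix_mult_zero)
  then show "abs_queer (block g 0) : {bracket queer_algebra x y | x y. x : grade queer_algebra 0 & y : grade queer_algebra 0}"
   unfolding br using in0 by blast
 qed
 show "grade queer_algebra 1 \<subseteq> cspan {bracket queer_algebra x y | x y. x : grade queer_algebra 0 & y : (grade queer_algebra 1 :: 'n queer set)}"
 proof (rule queer_even_odd_span(2)[OF complex_vector.subspace_span], rule cv_span_base)
  fix g :: "complex ^ 'n ^ 'n" assume "g : sl_gens"
  then obtain u v where uv: "trace v = 0" "g = u ** v - v ** u" by (rule sl_gens_commutator)
  then have "abs_queer (block 0 g) = queer_bracket (abs_queer (block u 0)) (abs_queer (block 0 v))"
   by (simp add: abs_queer_block(4) trace_arith matrix_mult_zero)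
  then show "abs_queer (block 0 g) : {bracket queer_algebra x y | x y. x : grade queer_algebra 0 & y : grade queer_algebra 1}"
   unfolding br using in0 in1[OF uv(1)] by blast
 qed
qed

lemma queer_finite_dimensional: "finite_dimensional (UNIV :: 'n::finite queer set)"
proof -
 let ?F = "(%g. abs_queer (block g 0)) ` sl_gens \<union> (%g. abs_queer (block 0 g)) ` sl_gens :: 'n queer set"
 have s: "csubspace (cspan ?F)" by simp
 have 0: "grade queer_algebra 0 \<subseteq> cspan ?F" by (rule queer_even_odd_span(1)[OF s]) (auto intro: cv_span_base)
 have 1: "grade queer_algebra 1 \<subseteq> cspan ?F" by (rule queer_even_odd_span(2)[OF s]) (auto intro: cv_span_base)
 have "x : cspan ?F" for x
 proof -
  have "x : underlying queer_algebra" by (simp add: underlying_queer)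
  then obtain u w where uw: "u : grade queer_algebra 0" "w : grade queer_algebra 1" "x = u + w" unfolding total_def by blast
  show ?thesis unfolding uw(3) by (rule cv_subspace_add[OF s subsetD[OF 0 uw(1)] subsetD[OF 1 uw(2)]])
 qed
 moreover have "finite ?F" using finite_sl_gens by blast
 ultimately show ?thesis unfolding finite_dimensional_def by blast
qed

section \<open>The bijection\<close>

definition iso_class :: "'g::complex_vector superalgebra => 'g coord_module => 'g coord_module set" where
 "iso_class G M = {N : irreps G. module_iso G M N}"

lemma iso_class:
 assumes G: "graded_space (grade G)"
 shows "M : irreps G ==> iso_class G M : irrep_classes G" "M : irreps G ==> M : iso_class G M"
  "X : irrep_classes G ==> X ~= {}"
  "X : irrep_classes G ==> M : X ==> M : irreps G & X = iso_class G M"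
proof -
 let ?R = "{(M, N). M : irreps G & N : irreps G & module_iso G M N}"
 have im: "?R `` {M} = iso_class G M" if "M : irreps G" for M using that by (auto simp: iso_class_def)
 show "iso_class G M : irrep_classes G" if M: "M : irreps G"
  using quotientI[OF M, of ?R] unfolding irrep_classes_def im[OF M] .
 show 2: "M : irreps G ==> M : iso_class G M" for M by (simp add: iso_class_def module_iso_refl)
 have 3: "EX N:irreps G. X = iso_class G N" if "X : irrep_classes G"
  using that im unfolding irrep_classes_def by (auto elim!: quotientE)
 show "X : irrep_classes G ==> X ~= {}" using 3 2 by blast
 show "M : irreps G & X = iso_class G M" if X: "X : irrep_classes G" "M : X"
 proof -
  obtain N where N: "N : irreps G" "X = iso_class G N" using 3[OF X(1)] by blast
  then have M: "M : irreps G" "module_iso G N M" using X(2) by (simp_all add: iso_class_def)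
  note sym = module_iso_sym[OF M(2) irrepsD(3)[OF N(1)] G]
  have "module_iso G N P \<longleftrightarrow> module_iso G M P" for P
   using module_iso_trans[OF sym, of P] module_iso_trans[OF M(2), of P] by blast
  then have "iso_class G N = iso_class G M" unfolding iso_class_def by (intro Collect_cong conj_cong refl)
  then show ?thesis using M(1) N(2) by simp
 qed
qed

lemma trivial_class_eq: "trivial_class G = iso_class G trivial_module"
 by (simp add: trivial_class_def iso_class_def)

context equivariant
begin

lemma trivial_class_iff:
 assumes "N : irreps L"
 shows "N : trivial_class L \<longleftrightarrow> (ALL x. ALL v:space N. act N x v = 0)"
proof
 assume "N : trivial_class L"
 then have "module_iso L trivial_module N" by (simp add: trivial_class_def)
 then obtain f where f: "mhom_on L trivial_module N f" "bij_betw f (space (trivial_module :: 'g coord_module)) (space N)"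
  unfolding module_iso_iff by blast
 have f0: "f 0 = 0" by (rule lin_on_0[OF mhomD(1)[OF f(1)] smodD(2)[OF irrepsD(3)[OF trivial_module_irreps[OF gL]]]])
 show "ALL x. ALL v:space N. act N x v = 0"
 proof (intro allI ballI)
  fix x v assume "v : space N"
  then obtain w where w: "w : space (trivial_module :: 'g coord_module)" "v = f w" using f(2) unfolding bij_betw_def by blast
  have "f (act trivial_module x w) = act N x (f w)" by (rule mhomD(3)[OF f(1) _ w(1)]) (simp add: UL)
  then show "act N x v = 0" using f0 w(2) by (simp add: trivial_module_def flip: zero_fun_def)
 qed
next
 assume "ALL x. ALL v:space N. act N x v = 0"
 then have "module_iso L trivial_module N" by (intro irreducible_trivial_action[OF irrepsD(1)[OF assms] gL]) simp
 with assms show "N : trivial_class L" by (simp add: trivial_class_def)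
qed

lemma trivial_class_irreps: "trivial_class L : irrep_classes L"
 unfolding trivial_class_eq by (rule iso_class(1)[OF gL trivial_module_irreps[OF gL]])

lemma equivariant_functionsD:
 assumes "\<Psi> : equivariant_functions L \<alpha> \<beta>"
 shows "m : MaxSpec ==> \<Psi> m : irrep_classes L" "finite (support L \<Psi>)" "\<Psi> : extensional MaxSpec"
  "m : MaxSpec ==> \<Psi> (\<beta> s ` m) = class_action L \<alpha> s (\<Psi> m)"
 using assms unfolding equivariant_functions_def finite_support_functions_def PiE_def by auto

lemma support_invariant:
 assumes \<Psi>: "\<Psi> : equivariant_functions L \<alpha> \<beta>" and m: "m : support L \<Psi>"
 shows "\<beta> s ` m : support L \<Psi>"
proof -
 note D = equivariant_functionsD[OF \<Psi>]
 have mM: "m : MaxSpec" and nt: "\<Psi> m ~= trivial_class L" using m by (simp_all add: support_def)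
 obtain M where M: "M : \<Psi> m" using iso_class(3)[OF gL D(1)[OF mM]] by blast
 note c = iso_class(4)[OF gL D(1)[OF mM] M]
 have "\<Psi> (\<beta> s ` m) ~= trivial_class L"
 proof
  assume t: "\<Psi> (\<beta> s ` m) = trivial_class L"
  let ?N = "pullback (\<alpha> (- s)) M"
  have N: "?N : irreps L" using alpha_irreps c by blast
  have "?N : class_action L \<alpha> s (\<Psi> m)" unfolding class_action_def using N M module_iso_refl by blast
  then have "?N : trivial_class L" using D(4)[OF mM] t by simp
  then have z: "ALL x. ALL v:space ?N. act ?N x v = 0" using trivial_class_iff[OF N] by blast
  have "act M x v = 0" if "v : space M" for x v
   using z[THEN spec, of "\<alpha> s x"] that by (simp add: aa_inv)
  then have "M : trivial_class L" using trivial_class_iff c by blast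
  then have "\<Psi> m = trivial_class L"
   using iso_class(4)[OF gL trivial_class_irreps, THEN conjunct2] c[THEN conjunct2] by metis
  with nt show False by blast
 qed
 then show ?thesis using b_image_MaxSpec[OF beta mM] by (simp add: support_def)
qed

lemma exists_orbit_representatives:
 fixes S :: "'a set set"
 assumes S: "finite S" "!!s m. m : S ==> \<beta> s ` m : S"
 obtains ms where "orbit_representatives \<beta> S ms"
proof -
 define o' where "o' = (%z :: 'a set. range (%s. \<beta> s ` z))"
 define R where "R = (%z. SOME y. y : o' z)"
 have self: "z : o' z" for z
 proof -
  have "z = \<beta> 0 ` z" by (simp add: bb(4))
  then show ?thesis unfolding o'_def by blast
 qed
 have R: "R z : o' z" for z unfolding R_def by (rule someI[of _ z]) (rule self)
 have Rs: "EX s. R z = \<beta> s ` z" for z using R[of z] unfolding o'_def by blast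
 have o_eq: "o' y = o' z" if h: "y : o' z" for y z
 proof -
  obtain s where y: "y = \<beta> s ` z" using h by (auto simp: o'_def)
  have "\<beta> t ` y = \<beta> (t + s) ` z" "\<beta> t ` z = \<beta> (t - s) ` y" for t
   unfolding y b_image_image[OF beta] by simp_all
  then show ?thesis unfolding o'_def by blast
 qed
 obtain ms where ms: "set ms = R ` S" "distinct ms" using finite_distinct_list[of "R ` S"] S(1) by blast
 have "EX! m'. m' : set ms & (EX s. m' = \<beta> s ` m)" if m: "m : S" for m
 proof (rule ex1I[of _ "R m"])
  show "R m : set ms & (EX s. R m = \<beta> s ` m)" unfolding ms(1) using Rs m by blast
  fix m' assume m': "m' : set ms & (EX s. m' = \<beta> s ` m)"
  then obtain w where w: "m' = R w" using ms(1) by blast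
  have "o' m' = o' m" by (rule o_eq) (use m' in \<open>auto simp: o'_def\<close>)
  moreover have "o' m' = o' w" unfolding w by (rule o_eq[OF R])
  ultimately show "m' = R m" unfolding w R_def by simp
 qed
 moreover have "set ms \<subseteq> S"
 proof
  fix y assume "y : set ms"
  then obtain z where z: "z : S" "y = R z" unfolding ms(1) by blast
  obtain s where "R z = \<beta> s ` z" using Rs by blast
  then show "y : S" using S(2)[OF z(1)] z(2) by simp
 qed
 ultimately have "orbit_representatives \<beta> S ms"
  unfolding orbit_representatives_def by (intro conjI ballI ms(2))
 then show ?thesis by (rule that)
qed

lemma representatives_points:
 assumes ms: "orbit_representatives \<beta> S ms" and S: "S \<subseteq> MaxSpec" "!!s m. m : S ==> \<beta> s ` m : S"
 shows "points L \<alpha> \<beta> ms" "points.orb \<beta> ms = S"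
proof -
 have u: "distinct ms" "set ms \<subseteq> S" "!!m. m : S ==> EX! m'. m' : set ms & (EX s. m' = \<beta> s ` m)"
  using ms unfolding orbit_representatives_def by blast+
 show p: "points L \<alpha> \<beta> ms"
 proof unfold_locales
  show "set ms \<subseteq> MaxSpec" using u(2) S(1) by blast
  fix i j s assume i: "i < length ms" and j: "j < length ms" and e: "ms ! i = \<beta> s ` (ms ! j)"
  have "ms ! j = \<beta> 0 ` (ms ! j)" by (simp add: bb(4))
  then have "ms ! j : set ms & (EX s. ms ! j = \<beta> s ` (ms ! j))" using j by (metis nth_mem)
  moreover have "ms ! i : set ms & (EX s. ms ! i = \<beta> s ` (ms ! j))" using i e nth_mem by blast
  moreover have "ms ! j : S" using u(2) j nth_mem by blast
  ultimately have "ms ! i = ms ! j" using u(3) by blast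
  then show "i = j" using u(1) i j nth_eq_iff_index_eq by blast
 qed
 interpret p: points L \<alpha> \<beta> ms by (rule p)
 show "p.orb = S"
 proof
  show "p.orb \<subseteq> S" using u(2) S(2) by (auto simp: p.orb_def)
  show "S \<subseteq> p.orb"
  proof
   fix m assume m: "m : S"
   then obtain m' s where m': "m' : set ms" "m' = \<beta> s ` m" using u(3) by blast
   have "m = \<beta> (- s) ` m'" unfolding m'(2) b_image_image[OF beta] by (simp add: bb(4))
   then show "m : p.orb" using m'(1) by (auto simp: p.orb_def)
  qed
 qed
qed

lemma occ_unique:
 assumes V: "V : irreps EE" and m: "m : MaxSpec" and \<rho>: "\<rho> : irreps L" "\<sigma> : irreps L" and o: "occ V m \<rho>" "occ V m \<sigma>"
 shows "module_iso L \<rho> \<sigma>"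
proof -
 interpret V: equivariant_module L \<alpha> \<beta> V by unfold_locales (rule irrepsD[OF V])+
 show ?thesis
 proof (cases "m : V.supp")
  case False
  have "module_iso L trivial_module \<rho>" "module_iso L trivial_module \<sigma>"
   using V.trivial_not_supp[OF m False irrepsD(1)] \<rho> o by blast+
  then show ?thesis
   using module_iso_trans module_iso_sym[OF _ irrepsD(3)[OF trivial_module_irreps[OF gL]] gL] by blast
 next
  case True
  obtain ms where ms: "orbit_representatives \<beta> V.supp ms"
   by (rule exists_orbit_representatives[OF V.finite_supp V.supp_invariant])
  note P = representatives_points[OF ms V.supp_MaxSpec V.supp_invariant]
  interpret p: points L \<alpha> \<beta> ms by (rule P(1))
  interpret p: module_points L \<alpha> \<beta> V ms by unfold_locales (rule P(2)[symmetric])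
  have "m : p.orb" using True P(2) by simp
  then obtain s j where j: "j < length ms" "m = \<beta> s ` (ms ! j)" by (rule p.orbE)
  have "module_iso L (pullback (\<alpha> s) \<rho>) (pullback (\<alpha> s) \<sigma>)"
   by (rule p.unique_at[OF j(1) alpha_irreps[OF \<rho>(2)] alpha_irreps[OF \<rho>(1)]])
    (use occ_twist[OF _ p.ms_in[OF j(1)]] o j(2) in blast)+
  then have "module_iso L (pullback (\<alpha> (- s)) (pullback (\<alpha> s) \<rho>)) (pullback (\<alpha> (- s)) (pullback (\<alpha> s) \<sigma>))"
   by (rule pullback_iso[OF _ alpha_hom gL])
  then show ?thesis by (simp only: pullback_alpha)
 qed
qed

definition matches :: "('g, 'a) tensor coord_module => ('a set => 'g coord_module set) => bool" where
 "matches V \<Psi> \<longleftrightarrow> (ALL m:MaxSpec. ALL \<rho>:\<Psi> m. occ V m \<rho>)"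

lemma matches_iso: "module_iso EE V W ==> V : irreps EE ==> matches V \<Psi> ==> matches W \<Psi>"
 unfolding matches_def using occ_iso[OF _ smodD(2)[OF irrepsD(3)]] by blast

context
 fixes \<Psi> assumes \<Psi>: "\<Psi> : equivariant_functions L \<alpha> \<beta>"
begin

lemmas \<Psi>D = equivariant_functionsD[OF \<Psi>]

lemma support_MaxSpec: "support L \<Psi> \<subseteq> MaxSpec"
 by (auto simp: support_def)

lemma evaluation_matches:
 assumes ms: "orbit_representatives \<beta> (support L \<Psi>) ms" and \<rho>: "!!i. i < length ms ==> \<rho> i : \<Psi> (ms ! i)"
 shows "evaluation_module L ms \<rho> : irreps EE" "matches (evaluation_module L ms \<rho>) \<Psi>"
proof -
 let ?E = "evaluation_module L ms \<rho>"
 note P = representatives_points[OF ms support_MaxSpec support_invariant[OF \<Psi>]]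
 interpret p: points L \<alpha> \<beta> ms by (rule P(1))
 have r: "\<rho> i : irreps L" if "i < length ms" for i
  using iso_class(4)[OF gL \<Psi>D(1)[OF p.ms_in[OF that]] \<rho>[OF that]] by blast
 show "?E : irreps EE" by (rule p.evaluation_module_irreps[OF r])
 show "matches ?E \<Psi>"
  unfolding matches_def
 proof (intro ballI)
  fix m \<sigma> assume m: "m : MaxSpec" and \<sigma>: "\<sigma> : \<Psi> m"
  note c = iso_class(4)[OF gL \<Psi>D(1)[OF m] \<sigma>]
  note \<sigma>i = c[THEN conjunct1]
  show "occ ?E m \<sigma>"
  proof (cases "m : support L \<Psi>")
   case True
   then have "m : p.orb" using P(2) by simp
   then obtain s j where j: "j < length ms" "m = \<beta> s ` (ms ! j)" by (rule p.orbE)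
   have "\<sigma> : class_action L \<alpha> s (\<Psi> (ms ! j))" using \<sigma> \<Psi>D(4)[OF p.ms_in[OF j(1)]] j(2) by simp
   then obtain M where M: "M : \<Psi> (ms ! j)" "module_iso L (pullback (\<alpha> (- s)) M) \<sigma>" by (auto simp: class_action_def)
   note cM = iso_class(4)[OF gL \<Psi>D(1)[OF p.ms_in[OF j(1)]] M(1)]
   note Mi = cM[THEN conjunct1]
   have "module_iso L M (\<rho> j)" using \<rho>[OF j(1)] cM by (simp add: iso_class_def)
   then have "occ ?E (ms ! j) M" by (rule occ_iso_right[OF _ irrepsD(3)[OF Mi] p.evaluation_module_occ[OF r j(1)]])
   then have "occ ?E m (pullback (\<alpha> (- s)) M)" unfolding j(2) using occ_twist_iff[OF p.ms_in[OF j(1)]] by blast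
   then show ?thesis
    by (rule occ_iso_right[OF module_iso_sym[OF M(2) irrepsD(3)[OF alpha_irreps[OF Mi]] gL] irrepsD(3)[OF \<sigma>i]])
  next
   case False
   then have "\<Psi> m = trivial_class L" using m by (simp add: support_def)
   then have "module_iso L trivial_module \<sigma>" using \<sigma> by (simp add: trivial_class_def)
   then show ?thesis
    by (rule occ_iso_right[OF module_iso_sym[OF _ irrepsD(3)[OF trivial_module_irreps[OF gL]] gL] irrepsD(3)[OF \<sigma>i]
    p.evaluation_module_occ_trivial[OF r]]) (use False P(2) in simp_all)
  qed
 qed
qed

text \<open>Comparison with the trivial class shows that the support of \<open>V\<close> is that of \<open>\<Psi>\<close>, so that
  \<open>classification\<close> applies to any choice of representatives.\<close>

lemma matches_evaluation:
 assumes V: "V : irreps EE" "matches V \<Psi>"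
  and ms: "orbit_representatives \<beta> (support L \<Psi>) ms" and \<rho>: "!!i. i < length ms ==> \<rho> i : \<Psi> (ms ! i)"
 shows "module_iso EE (evaluation_module L ms \<rho>) V"
proof -
 interpret V: equivariant_module L \<alpha> \<beta> V by unfold_locales (rule irrepsD[OF V(1)])+
 have "m : V.supp \<longleftrightarrow> m : support L \<Psi>" if m: "m : MaxSpec" for m
 proof -
  obtain \<sigma> where \<sigma>: "\<sigma> : \<Psi> m" using iso_class(3)[OF gL \<Psi>D(1)[OF m]] by blast
  note c = iso_class(4)[OF gL \<Psi>D(1)[OF m] \<sigma>]
  have o: "occ V m \<sigma>" using V(2) m \<sigma> unfolding matches_def by blast
  show ?thesis
  proof
   assume "m : V.supp"
   then have "\<sigma> ~: trivial_class L"
    using V.not_trivial_supp[OF _ irrepsD(3)[OF c[THEN conjunct1]]] trivial_class_iff[OF c[THEN conjunct1]] o by blast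
   then show "m : support L \<Psi>" using \<sigma> m by (auto simp: support_def)
  next
   assume s: "m : support L \<Psi>"
   show "m : V.supp"
   proof (rule ccontr)
    assume "m ~: V.supp"
    then have "module_iso L trivial_module \<sigma>" using V.trivial_not_supp[OF m _ irrepsD(1)[OF c[THEN conjunct1]]] o by blast
    then have "\<sigma> : trivial_class L" using c by (simp add: trivial_class_def)
    then have "\<Psi> m = trivial_class L"
    using iso_class(4)[OF gL trivial_class_irreps, THEN conjunct2] c[THEN conjunct2] by metis
    with s show False by (simp add: support_def)
   qed
  qed
 qed
 then have supp: "V.supp = support L \<Psi>" using V.supp_MaxSpec support_MaxSpec by blast
 note P = representatives_points[OF ms support_MaxSpec support_invariant[OF \<Psi>]]
 interpret p: points L \<alpha> \<beta> ms by (rule P(1))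
 interpret p: module_points L \<alpha> \<beta> V ms by unfold_locales (simp add: supp P(2))
 show ?thesis
 proof (rule p.classification)
  fix i assume i: "i < length ms"
  show "\<rho> i : irreps L" using iso_class(4)[OF gL \<Psi>D(1)[OF p.ms_in[OF i]] \<rho>[OF i]] by blast
  show "occ V (ms ! i) (\<rho> i)" using V(2) p.ms_in[OF i] \<rho>[OF i] unfolding matches_def by blast
 qed
qed

lemma evaluation_class_iff:
 obtains V where "V : irreps EE" "matches V \<Psi>" "evaluation_class L \<alpha> \<beta> \<Psi> = iso_class EE V"
  "evaluation_class L \<alpha> \<beta> \<Psi> = {N : irreps EE. matches N \<Psi>}"
proof -
 obtain ms where ms: "orbit_representatives \<beta> (support L \<Psi>) ms"
  by (rule exists_orbit_representatives[OF \<Psi>D(2) support_invariant[OF \<Psi>]])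
 have "ALL i. EX r. i < length ms --> r : \<Psi> (ms ! i)"
 proof (intro allI)
  fix i
  have "ms ! i : MaxSpec" if "i < length ms"
   using ms support_MaxSpec nth_mem[OF that] unfolding orbit_representatives_def by blast
  then show "EX r. i < length ms --> r : \<Psi> (ms ! i)" using iso_class(3)[OF gL \<Psi>D(1)] by blast
 qed
 from choice[OF this] obtain \<rho> where \<rho>: "!!i. i < length ms ==> \<rho> i : \<Psi> (ms ! i)" by blast
 let ?E = "evaluation_module L ms \<rho>"
 note E = evaluation_matches[OF ms]
 have Ei: "?E : irreps EE" and Em: "matches ?E \<Psi>" by (rule E, rule \<rho>, assumption)+
 have iso: "module_iso EE ?E N" if "N : irreps EE" "matches N \<Psi>" for N
  by (rule matches_evaluation[OF that ms \<rho>])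
 have m: "matches N \<Psi>" if h: "N : evaluation_class L \<alpha> \<beta> \<Psi>" for N
 proof -
  obtain ms' \<rho>' where h': "orbit_representatives \<beta> (support L \<Psi>) ms'" "ALL i<length ms'. \<rho>' i : \<Psi> (ms' ! i)"
   "module_iso EE (evaluation_module L ms' \<rho>') N"
   using h unfolding evaluation_class_def by blast
  have \<rho>': "\<rho>' i : \<Psi> (ms' ! i)" if "i < length ms'" for i using h'(2) that by blast
  show ?thesis by (rule matches_iso[OF h'(3) evaluation_matches[OF h'(1) \<rho>']])
 qed
 have a: "evaluation_class L \<alpha> \<beta> \<Psi> \<subseteq> {N : irreps EE. matches N \<Psi>}"
 proof (intro subsetI CollectI conjI)
  fix N assume "N : evaluation_class L \<alpha> \<beta> \<Psi>"
  then show "N : irreps EE" "matches N \<Psi>" using m by (simp_all add: evaluation_class_def)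
 qed
 have b: "{N : irreps EE. matches N \<Psi>} \<subseteq> iso_class EE ?E"
  using iso by (intro subsetI) (simp add: iso_class_def)
 have c: "iso_class EE ?E \<subseteq> evaluation_class L \<alpha> \<beta> \<Psi>"
 proof
  fix N assume "N : iso_class EE ?E"
  then have N: "N : irreps EE" "module_iso EE ?E N" by (simp_all add: iso_class_def)
  show "N : evaluation_class L \<alpha> \<beta> \<Psi>"
   unfolding evaluation_class_def
   by (intro CollectI conjI N exI[of _ ms] exI[of _ \<rho>] ms allI impI \<rho>)
 qed
 show ?thesis
 proof (rule that[OF Ei Em])
  show "evaluation_class L \<alpha> \<beta> \<Psi> = iso_class EE ?E" by (rule subset_antisym[OF subset_trans[OF a b] c])
  show "evaluation_class L \<alpha> \<beta> \<Psi> = {N : irreps EE. matches N \<Psi>}" by (rule subset_antisym[OF a subset_trans[OF b c]])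
 qed
qed

end

text \<open>The modules that occur at a given point form one isomorphism class by \<open>occ_exists\<close> and \<open>occ_unique\<close>;
  it is trivial off the support, and \<open>occ_twist\<close> gives equivariance.\<close>

lemma matching_function:
 assumes V: "V : irreps EE"
 obtains \<Psi> where "\<Psi> : equivariant_functions L \<alpha> \<beta>" "matches V \<Psi>"
proof -
 interpret V: equivariant_module L \<alpha> \<beta> V by unfold_locales (rule irrepsD[OF V])+
 define \<Psi> where "\<Psi> = (%m. if m : MaxSpec then {\<rho> : irreps L. occ V m \<rho>} else undefined)"
 have cls: "\<Psi> m : irrep_classes L" if m: "m : MaxSpec" for m
 proof -
  obtain \<rho> where \<rho>: "\<rho> : irreps L" "occ V m \<rho>" by (rule V.occ_exists[OF m])
  have "\<Psi> m = iso_class L \<rho>"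
  proof (rule Set.set_eqI)
   fix \<sigma>
   have "occ V m \<sigma> \<longleftrightarrow> module_iso L \<rho> \<sigma>" if \<sigma>: "\<sigma> : irreps L"
   proof
    show "module_iso L \<rho> \<sigma>" if "occ V m \<sigma>" by (rule occ_unique[OF V m \<rho>(1) \<sigma> \<rho>(2) that])
    show "occ V m \<sigma>" if "module_iso L \<rho> \<sigma>"
    by (rule occ_iso_right[OF module_iso_sym[OF that irrepsD(3)[OF \<rho>(1)] gL] irrepsD(3)[OF \<sigma>] \<rho>(2)])
   qed
   then show "\<sigma> : \<Psi> m \<longleftrightarrow> \<sigma> : iso_class L \<rho>" using m by (auto simp: \<Psi>_def iso_class_def)
  qed
  then show ?thesis using iso_class(1)[OF gL \<rho>(1)] by simp
 qed
 have "support L \<Psi> \<subseteq> V.supp"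
 proof
  fix m assume "m : support L \<Psi>"
  then have m: "m : MaxSpec" "\<Psi> m ~= trivial_class L" by (simp_all add: support_def)
  show "m : V.supp"
  proof (rule ccontr)
   assume "m ~: V.supp"
   then have "\<Psi> m = trivial_class L"
    using m(1) V.trivial_not_supp[OF m(1) _ irrepsD(1)] by (auto simp: \<Psi>_def trivial_class_def)
   with m(2) show False ..
  qed
 qed
 then have "finite (support L \<Psi>)" using V.finite_supp finite_subset by blast
 moreover have "\<Psi> (\<beta> s ` m) = class_action L \<alpha> s (\<Psi> m)" if m: "m : MaxSpec" for s m
 proof (rule Set.set_eqI)
  fix N
  note sm = b_image_MaxSpec[OF beta m, of s]
  show "N : \<Psi> (\<beta> s ` m) \<longleftrightarrow> N : class_action L \<alpha> s (\<Psi> m)"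
  proof
   assume "N : \<Psi> (\<beta> s ` m)"
   then have N: "N : irreps L" "occ V (\<beta> s ` m) N" using sm by (simp_all add: \<Psi>_def)
   have "pullback (\<alpha> s) N : \<Psi> m" using alpha_irreps[OF N(1)] occ_twist[OF N(2) m] m by (simp add: \<Psi>_def)
   moreover have "module_iso L (pullback (\<alpha> (- s)) (pullback (\<alpha> s) N)) N" unfolding pullback_alpha by (rule module_iso_refl)
   ultimately show "N : class_action L \<alpha> s (\<Psi> m)" unfolding class_action_def using N(1) by blast
  next
   assume "N : class_action L \<alpha> s (\<Psi> m)"
   then obtain M where N: "N : irreps L" and M: "M : \<Psi> m" "module_iso L (pullback (\<alpha> (- s)) M) N" by (auto simp: class_action_def)
   have M': "M : irreps L" "occ V m M" using M(1) m by (simp_all add: \<Psi>_def)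
   have "occ V (\<beta> s ` m) (pullback (\<alpha> (- s)) M)" using occ_twist_iff[OF m] M'(2) by blast
   then have "occ V (\<beta> s ` m) N"
    by (rule occ_iso_right[OF module_iso_sym[OF M(2) irrepsD(3)[OF alpha_irreps[OF M'(1)]] gL] irrepsD(3)[OF N]])
   then show "N : \<Psi> (\<beta> s ` m)" using sm N by (simp add: \<Psi>_def)
  qed
 qed
 moreover have "\<Psi> : MaxSpec \<rightarrow>\<^sub>E irrep_classes L" using cls by (intro PiE_I) (simp_all add: \<Psi>_def)
 ultimately have "\<Psi> : equivariant_functions L \<alpha> \<beta>"
  unfolding equivariant_functions_def finite_support_functions_def by blast
 moreover have "matches V \<Psi>" by (simp add: matches_def \<Psi>_def)
 ultimately show ?thesis by (rule that)
qed

theorem evaluation_bijection: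
 "bij_betw (evaluation_class L \<alpha> \<beta>) (equivariant_functions L \<alpha> \<beta>) (irrep_classes EE)"
 unfolding bij_betw_def
proof (intro conjI inj_onI Set.set_eqI iffI)
 fix \<Psi> \<Phi> assume \<Psi>: "\<Psi> : equivariant_functions L \<alpha> \<beta>" and \<Phi>: "\<Phi> : equivariant_functions L \<alpha> \<beta>"
  and eq: "evaluation_class L \<alpha> \<beta> \<Psi> = evaluation_class L \<alpha> \<beta> \<Phi>"
 obtain V where V: "V : irreps EE" "matches V \<Psi>" "evaluation_class L \<alpha> \<beta> \<Psi> = iso_class EE V"
  "evaluation_class L \<alpha> \<beta> \<Psi> = {N : irreps EE. matches N \<Psi>}" by (rule evaluation_class_iff[OF \<Psi>])
 obtain W where W: "W : irreps EE" "matches W \<Phi>" "evaluation_class L \<alpha> \<beta> \<Phi> = iso_class EE W"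
  "evaluation_class L \<alpha> \<beta> \<Phi> = {N : irreps EE. matches N \<Phi>}" by (rule evaluation_class_iff[OF \<Phi>])
 have "V : {N : irreps EE. matches N \<Phi>}" using V(1,2,4) W(4) eq by blast
 then have m: "matches V \<Phi>" by simp
 have "\<Psi> x = \<Phi> x" if x: "x : MaxSpec" for x
 proof -
  note cl = equivariant_functionsD(1)[OF \<Psi> x] equivariant_functionsD(1)[OF \<Phi> x]
  obtain \<rho> \<sigma> where \<rho>: "\<rho> : \<Psi> x" and \<sigma>: "\<sigma> : \<Phi> x" using iso_class(3)[OF gL] cl by blast
  note c = iso_class(4)[OF gL cl(1) \<rho>] iso_class(4)[OF gL cl(2) \<sigma>]
  have "occ V x \<rho>" "occ V x \<sigma>" using V(2) m x \<rho> \<sigma> unfolding matches_def by blast+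
  then have "module_iso L \<rho> \<sigma>" using occ_unique[OF V(1) x] c by blast
  then have "\<sigma> : iso_class L \<rho>" using c(2)[THEN conjunct1] by (simp add: iso_class_def)
  then have "\<sigma> : \<Psi> x" unfolding c(1)[THEN conjunct2, symmetric] .
  from iso_class(4)[OF gL cl(1) this, THEN conjunct2] c(2)[THEN conjunct2] show ?thesis by (rule trans[OF _ sym])
 qed
 then show "\<Psi> = \<Phi>" by (rule extensionalityI[OF equivariant_functionsD(3)[OF \<Psi>] equivariant_functionsD(3)[OF \<Phi>]])
next
 fix X assume "X : evaluation_class L \<alpha> \<beta> ` equivariant_functions L \<alpha> \<beta>"
 then obtain \<Psi> where \<Psi>: "\<Psi> : equivariant_functions L \<alpha> \<beta>" "X = evaluation_class L \<alpha> \<beta> \<Psi>" by blast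
 obtain V where V: "V : irreps EE" "matches V \<Psi>" "evaluation_class L \<alpha> \<beta> \<Psi> = iso_class EE V"
  "evaluation_class L \<alpha> \<beta> \<Psi> = {N : irreps EE. matches N \<Psi>}" by (rule evaluation_class_iff[OF \<Psi>(1)])
 show "X : irrep_classes EE" unfolding \<Psi>(2) V(3) by (rule iso_class(1)[OF graded_EE V(1)])
next
 fix X assume X: "X : irrep_classes EE"
 obtain V where "V : X" using iso_class(3)[OF graded_EE X] by blast
 note c = iso_class(4)[OF graded_EE X this]
 obtain \<Psi> where \<Psi>: "\<Psi> : equivariant_functions L \<alpha> \<beta>" "matches V \<Psi>" by (rule matching_function[OF c[THEN conjunct1]])
 obtain W where W: "W : irreps EE" "matches W \<Psi>" "evaluation_class L \<alpha> \<beta> \<Psi> = iso_class EE W"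
  "evaluation_class L \<alpha> \<beta> \<Psi> = {N : irreps EE. matches N \<Psi>}" by (rule evaluation_class_iff[OF \<Psi>(1)])
 have "V : {N : irreps EE. matches N \<Psi>}" using c[THEN conjunct1] \<Psi>(2) by simp
 then have "V : iso_class EE W" unfolding W(3)[symmetric] W(4) .
 from c[THEN conjunct2] iso_class(4)[OF graded_EE iso_class(1)[OF graded_EE W(1)] this, THEN conjunct2]
 have "X = evaluation_class L \<alpha> \<beta> \<Psi>" unfolding W(3) by (rule trans[OF _ sym])
 then show "X : evaluation_class L \<alpha> \<beta> ` equivariant_functions L \<alpha> \<beta>" using \<Psi>(1) by (rule image_eqI)
qed

end


theorem theorem7p3:
  fixes n :: nat
    and \<alpha> :: "'t::{finite, ab_group_add} \<Rightarrow> 'n::finite queer \<Rightarrow> 'n queer"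
    and \<beta> :: "'t \<Rightarrow> 'a::comm_unital_complex_algebra \<Rightarrow> 'a"
  assumes "n \<ge> 2" and "CARD('n) = n + 1"
    and "finitely_generated_algebra TYPE('a)"
    and "acts_by (superalgebra_automorphism queer_algebra) \<alpha>"
    and "acts_by algebra_automorphism \<beta>"
    and "\<forall>s. \<forall>m \<in> (MaxSpec :: 'a set set). \<beta> s ` m = m \<longrightarrow> s = 0"
  shows "bij_betw (evaluation_class queer_algebra \<alpha> \<beta>)
           (equivariant_functions queer_algebra \<alpha> \<beta>)
           (irrep_classes (equivariant_map_superalgebra queer_algebra \<alpha> \<beta>))"
proof (rule equivariant.evaluation_bijection)
  show "equivariant queer_algebra \<alpha> \<beta>"
  proof
    show "\<And>s m. m \<in> MaxSpec \<Longrightarrow> \<beta> s ` m = m \<Longrightarrow> s = 0" using assms(6) by blast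
  qed (fact lie_superalgebra_queer underlying_queer queer_finite_dimensional queer_perfect assms)+
qed

end
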